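(* Let $I$ be a small category, $X$ an $I^{\mathrm{op}}$-diagram of schemes, $f:U\hookrightarrow X$ an open subdiagram, and $g:V\hookrightarrow U$ an open subdiagram. Let $\mathcal M,\mathcal N\in\mathrm{Mod}(X)$. If both $f$ and $g$ are cartesian, or $\mathcal M$ is equivariant, then the canonical map $$\mathfrak H:\underline\Gamma_{U,V}\underline{\mathrm{Hom}}_{\mathcal O_X}(\mathcal M,\mathcal N)\to\underline{\mathrm{Hom}}_{\mathcal O_X}(\mathcal M,\underline\Gamma_{U,V}\mathcal N)$$ is an isomorphism.
   Context: An $I^{\mathrm{op}}$-diagram of schemes $X$ is a contravariant functor from $I$ to schemes: schemes $X_i$ and morphisms $X_\phi:X_j\to X_i$ for $\phi:i\to j$. An $\mathcal O_X$-module $\mathcal M\in\mathrm{Mod}(X)$ is a family of $\mathcal O_{X_i}$-modules $\mathcal M_i$ with maps $\mathcal M_i\to(X_\phi)_*\mathcal M_j$ for $\phi:i\to j$, compatible with composition (equivalently, a sheaf of modules on the Zariski site of pairs $(i,W)$, $W\subset X_i$ open). $\mathcal M$ is equivariant if all adjoint maps $X_\phi^*\mathcal M_i\to\mathcal M_j$ are isomorphisms. $\underline{\mathrm{Hom}}_{\mathcal O_X}$ is the sheaf Hom on this site. A morphism of diagrams $f:U\to X$ is cartesian if for each $\phi:i\to j$ the square formed by $U_j\to U_i$ and $X_j\to X_i$ is cartesian. An open subdiagram $f:U\hookrightarrow X$ is a morphism of diagrams with every $f_i$ the inclusion of an open subscheme. $\underline\Gamma_{U,V}\mathcal M:=\mathrm{Ker}(u:f_*f^*\mathcal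 M\to f_*g_*g^*f^*\mathcal M)$, $u$ the unit of adjunction, with inclusion $\iota:\underline\Gamma_{U,V}\mathcal M\to f_*f^*\mathcal M$. Let $\mathfrak G:f_*f^*\underline{\mathrm{Hom}}(\mathcal M,\mathcal N)\to\underline{\mathrm{Hom}}(\mathcal M,f_*f^*\mathcal N)$ be the composite of the canonical maps $f_*f^*\underline{\mathrm{Hom}}(\mathcal M,\mathcal N)\to f_*\underline{\mathrm{Hom}}(f^*\mathcal M,f^*\mathcal N)\to\underline{\mathrm{Hom}}(f_*f^*\mathcal M,f_*f^*\mathcal N)\to\underline{\mathrm{Hom}}(\mathcal M,f_*f^*\mathcal N)$, the last induced by the unit $\mathcal M\to f_*f^*\mathcal M$. It is compatible via $u$ with the analogous map for $fg:V\hookrightarrow X$, so there is a unique natural map $\mathfrak H$ with $\iota\mathfrak H=\mathfrak G\iota$. *)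

theory Defs
  imports "HOL-Analysis.Abstract_Topology" "HOL-Algebra.QuotRing" "HOL-Algebra.Module"
    "HOL-Algebra.Free_Abelian_Groups"
begin

section \<open>Small categories\<close>

record ('i, 'f) cat =
  Ob :: "'i set"
  Ar :: "'f set"
  src :: "'f \<Rightarrow> 'i"
  tgt :: "'f \<Rightarrow> 'i"
  cmp :: "'f \<Rightarrow> 'f \<Rightarrow> 'f"
  idt :: "'i \<Rightarrow> 'f"

definition category :: "('i, 'f) cat \<Rightarrow> bool" where
  "category I \<longleftrightarrow>
     (\<forall>\<phi>\<in>Ar I. src I \<phi> \<in> Ob I \<and> tgt I \<phi> \<in> Ob I) \<and>
     (\<forall>i\<in>Ob I. idt I i \<in> Ar I \<and> src I (idt I i) = i \<and> tgt I (idt I i) = i) \<and>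
     (\<forall>\<phi>\<in>Ar I. \<forall>\<psi>\<in>Ar I. tgt I \<phi> = src I \<psi> \<longrightarrow>
        cmp I \<psi> \<phi> \<in> Ar I \<and> src I (cmp I \<psi> \<phi>) = src I \<phi> \<and> tgt I (cmp I \<psi> \<phi>) = tgt I \<psi>) \<and>
     (\<forall>\<phi>\<in>Ar I. cmp I \<phi> (idt I (src I \<phi>)) = \<phi> \<and> cmp I (idt I (tgt I \<phi>)) \<phi> = \<phi>) \<and>
     (\<forall>\<phi>\<in>Ar I. \<forall>\<psi>\<in>Ar I. \<forall>\<chi>\<in>Ar I. tgt I \<phi> = src I \<psi> \<and> tgt I \<psi> = src I \<chi> \<longrightarrow>
        cmp I \<chi> (cmp I \<psi> \<phi>) = cmp I (cmp I \<chi> \<psi>) \<phi>)"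


section \<open>Sheaves and ringed spaces\<close>

definition presheaf_on ::
  "'p topology \<Rightarrow> ('p set \<Rightarrow> 's set) \<Rightarrow> ('p set \<Rightarrow> 'p set \<Rightarrow> 's \<Rightarrow> 's) \<Rightarrow> bool" where
  "presheaf_on T F \<rho> \<longleftrightarrow>
     (\<forall>U V. openin T U \<and> openin T V \<and> V \<subseteq> U \<longrightarrow> \<rho> U V \<in> F U \<rightarrow> F V) \<and>
     (\<forall>U. openin T U \<longrightarrow> (\<forall>s\<in>F U. \<rho> U U s = s)) \<and>
     (\<forall>U V W. openin T U \<and> openin T V \<and> openin T W \<and> W \<subseteq> V \<and> V \<subseteq> U \<longrightarrow>
        (\<forall>s\<in>F U. \<rho> V W (\<rho> U V s) = \<rho> U W s))"

text \<open>The family of opens may be empty, so that \<open>F {}\<close> is a singleton.\<close>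

definition sheaf_on ::
  "'p topology \<Rightarrow> ('p set \<Rightarrow> 's set) \<Rightarrow> ('p set \<Rightarrow> 'p set \<Rightarrow> 's \<Rightarrow> 's) \<Rightarrow> bool" where
  "sheaf_on T F \<rho> \<longleftrightarrow> presheaf_on T F \<rho> \<and>
     (\<forall>\<U> s. (\<forall>V\<in>\<U>. openin T V \<and> s V \<in> F V) \<and>
        (\<forall>V\<in>\<U>. \<forall>W\<in>\<U>. \<rho> V (V \<inter> W) (s V) = \<rho> W (V \<inter> W) (s W)) \<longrightarrow>
        (\<exists>!t. t \<in> F (\<Union>\<U>) \<and> (\<forall>V\<in>\<U>. \<rho> (\<Union>\<U>) V t = s V)))"

record ('p, 'r) ringed_space =
  topol :: "'p topology"
  ring_at :: "'p set \<Rightarrow> 'r ring"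
  rres :: "'p set \<Rightarrow> 'p set \<Rightarrow> 'r \<Rightarrow> 'r"

abbreviation points :: "('p, 'r) ringed_space \<Rightarrow> 'p set" where
  "points X \<equiv> topspace (topol X)"

abbreviation opens :: "('p, 'r) ringed_space \<Rightarrow> 'p set set" where
  "opens X \<equiv> {V. openin (topol X) V}"

definition ringed :: "('p, 'r) ringed_space \<Rightarrow> bool" where
  "ringed X \<longleftrightarrow>
     sheaf_on (topol X) (\<lambda>V. carrier (ring_at X V)) (rres X) \<and>
     (\<forall>V\<in>opens X. cring (ring_at X V)) \<and>
     (\<forall>V\<in>opens X. \<forall>W\<in>opens X. W \<subseteq> V \<longrightarrow> rres X V W \<in> ring_hom (ring_at X V) (ring_at X W))"

definition open_restrict :: "('p, 'r) ringed_space \<Rightarrow> 'p set \<Rightarrow> ('p, 'r) ringed_space" where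
  "open_restrict X W = \<lparr>topol = subtopology (topol X) W, ring_at = ring_at X, rres = rres X\<rparr>"


section \<open>Direct limits over a downward directed family of opens\<close>

text \<open>Used with the open neighbourhoods of a point (stalks) and with the opens containing
  the image of a set (inverse image presheaves).\<close>

definition germ ::
  "('p set \<Rightarrow> 's set) \<Rightarrow> ('p set \<Rightarrow> 'p set \<Rightarrow> 's \<Rightarrow> 's) \<Rightarrow> 'p set set \<Rightarrow> 'p set \<Rightarrow> 's \<Rightarrow> ('p set \<times> 's) set"
  where
  "germ F \<rho> \<F> U s = {(V, t). V \<in> \<F> \<and> t \<in> F V \<and> (\<exists>W\<in>\<F>. W \<subseteq> U \<inter> V \<and> \<rho> U W s = \<rho> V W t)}"

definition lim_map :: "('p set \<Rightarrow> 's \<Rightarrow> 't) \<Rightarrow> ('p set \<times> 's) set \<Rightarrow> 't" where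
  "lim_map h c = the_elem ((\<lambda>(V, s). h V s) ` c)"

abbreviation rgerm ::
  "('p, 'r) ringed_space \<Rightarrow> 'p set set \<Rightarrow> 'p set \<Rightarrow> 'r \<Rightarrow> ('p set \<times> 'r) set" where
  "rgerm X \<equiv> germ (\<lambda>V. carrier (ring_at X V)) (rres X)"

text \<open>The unions below are unions of equal sets.\<close>

definition lim_ring :: "('p, 'r) ringed_space \<Rightarrow> 'p set set \<Rightarrow> ('p set \<times> 'r) set ring" where
  "lim_ring X \<F> =
    \<lparr>carrier = {rgerm X \<F> V r | V r. V \<in> \<F> \<and> r \<in> carrier (ring_at X V)},
     monoid.mult = (\<lambda>a b. \<Union>(V, r)\<in>a. \<Union>(W, s)\<in>b.
        rgerm X \<F> (V \<inter> W) (rres X V (V \<inter> W) r \<otimes>\<^bsub>ring_at X (V \<inter> W)\<^esub> rres X W (V \<inter> W) s)),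
     monoid.one = (\<Union>V\<in>\<F>. rgerm X \<F> V \<one>\<^bsub>ring_at X V\<^esub>),
     ring.zero = (\<Union>V\<in>\<F>. rgerm X \<F> V \<zero>\<^bsub>ring_at X V\<^esub>),
     ring.add = (\<lambda>a b. \<Union>(V, r)\<in>a. \<Union>(W, s)\<in>b.
        rgerm X \<F> (V \<inter> W) (rres X V (V \<inter> W) r \<oplus>\<^bsub>ring_at X (V \<inter> W)\<^esub> rres X W (V \<inter> W) s))\<rparr>"

definition nbhds :: "('p, 'r) ringed_space \<Rightarrow> 'p \<Rightarrow> 'p set set" where
  "nbhds X x = {V \<in> opens X. x \<in> V}"

abbreviation stalk :: "('p, 'r) ringed_space \<Rightarrow> 'p \<Rightarrow> ('p set \<times> 'r) set ring" where
  "stalk X x \<equiv> lim_ring X (nbhds X x)"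


section \<open>Locally ringed spaces\<close>

definition local_ring :: "'r ring \<Rightarrow> bool" where
  "local_ring R \<longleftrightarrow> cring R \<and> (\<exists>!\<mm>. maximalideal \<mm> R)"

definition locally_ringed :: "('p, 'r) ringed_space \<Rightarrow> bool" where
  "locally_ringed X \<longleftrightarrow> ringed X \<and> (\<forall>x\<in>points X. local_ring (stalk X x))"

text \<open>A morphism \<open>X \<rightarrow> Y\<close> is given by a map \<open>pt\<close> of points and ring maps
  \<open>cm V : \<O>\<^sub>Y(V) \<rightarrow> \<O>\<^sub>X(f\<inverse>V)\<close>.\<close>

record ('p, 'q, 'r, 's) mor =
  pt :: "'p \<Rightarrow> 'q"
  cm :: "'q set \<Rightarrow> 's \<Rightarrow> 'r"

definition pre :: "('p, 'r) ringed_space \<Rightarrow> ('p, 'q, 'r, 's) mor \<Rightarrow> 'q set \<Rightarrow> 'p set" where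
  "pre X f V = {x \<in> points X. pt f x \<in> V}"

definition stalk_map ::
  "('p, 'r) ringed_space \<Rightarrow> ('p, 'q, 'r, 's) mor \<Rightarrow> 'p \<Rightarrow> ('q set \<times> 's) set \<Rightarrow> ('p set \<times> 'r) set" where
  "stalk_map X f x = lim_map (\<lambda>V s. rgerm X (nbhds X x) (pre X f V) (cm f V s))"

definition lrs_mor ::
  "('p, 'r) ringed_space \<Rightarrow> ('q, 's) ringed_space \<Rightarrow> ('p, 'q, 'r, 's) mor \<Rightarrow> bool" where
  "lrs_mor X Y f \<longleftrightarrow>
     continuous_map (topol X) (topol Y) (pt f) \<and>
     (\<forall>V\<in>opens Y. cm f V \<in> ring_hom (ring_at Y V) (ring_at X (pre X f V))) \<and>
     (\<forall>V\<in>opens Y. \<forall>W\<in>opens Y. W \<subseteq> V \<longrightarrow>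
        (\<forall>s\<in>carrier (ring_at Y V). cm f W (rres Y V W s) = rres X (pre X f V) (pre X f W) (cm f V s))) \<and>
     (\<forall>x\<in>points X. \<forall>\<mm> \<nn>. maximalideal \<mm> (stalk Y (pt f x)) \<and> maximalideal \<nn> (stalk X x) \<longrightarrow>
        stalk_map X f x ` \<mm> \<subseteq> \<nn>)"

text \<open>Equality of morphisms, ignoring values outside the carriers.\<close>

definition mor_eq ::
  "('p, 'r) ringed_space \<Rightarrow> ('q, 's) ringed_space \<Rightarrow> ('p, 'q, 'r, 's) mor \<Rightarrow> ('p, 'q, 'r, 's) mor \<Rightarrow> bool"
  where
  "mor_eq X Y f g \<longleftrightarrow> (\<forall>x\<in>points X. pt f x = pt g x) \<and>
     (\<forall>V\<in>opens Y. \<forall>s\<in>carrier (ring_at Y V). cm f V s = cm g V s)"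

definition mor_id :: "('p, 'p, 'r, 'r) mor" where
  "mor_id = \<lparr>pt = (\<lambda>x. x), cm = (\<lambda>V r. r)\<rparr>"

text \<open>\<open>mor_comp Y g f\<close> is \<open>X \<rightarrow> Y \<rightarrow> Z\<close>, first \<open>f\<close> and then \<open>g\<close>.\<close>

definition mor_comp ::
  "('q, 's) ringed_space \<Rightarrow> ('q, 'z, 's, 't) mor \<Rightarrow> ('p, 'q, 'r, 's) mor \<Rightarrow> ('p, 'z, 'r, 't) mor" where
  "mor_comp Y g f = \<lparr>pt = (\<lambda>x. pt g (pt f x)), cm = (\<lambda>V t. cm f (pre Y g V) (cm g V t))\<rparr>"

definition lrs_iso :: "('p, 'r) ringed_space \<Rightarrow> ('q, 's) ringed_space \<Rightarrow> bool" where
  "lrs_iso X Y \<longleftrightarrow> (\<exists>f g. lrs_mor X Y f \<and> lrs_mor Y X g \<and>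
     mor_eq X X (mor_comp Y g f) mor_id \<and> mor_eq Y Y (mor_comp X f g) mor_id)"


section \<open>Spectra and schemes\<close>

definition frac :: "'r ring \<Rightarrow> 'r set \<Rightarrow> 'r \<Rightarrow> 'r \<Rightarrow> ('r \<times> 'r) set" where
  "frac R S a s = {(b, t). b \<in> carrier R \<and> t \<in> S \<and>
     (\<exists>u\<in>S. u \<otimes>\<^bsub>R\<^esub> (a \<otimes>\<^bsub>R\<^esub> t) = u \<otimes>\<^bsub>R\<^esub> (b \<otimes>\<^bsub>R\<^esub> s))}"

definition localization :: "'r ring \<Rightarrow> 'r set \<Rightarrow> ('r \<times> 'r) set ring" where
  "localization R S =
    \<lparr>carrier = {frac R S a s | a s. a \<in> carrier R \<and> s \<in> S},
     monoid.mult = (\<lambda>x y. \<Union>(a, s)\<in>x. \<Union>(b, t)\<in>y. frac R S (a \<otimes>\<^bsub>R\<^esub> b) (s \<otimes>\<^bsub>R\<^esub> t)),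
     monoid.one = frac R S \<one>\<^bsub>R\<^esub> \<one>\<^bsub>R\<^esub>,
     ring.zero = frac R S \<zero>\<^bsub>R\<^esub> \<one>\<^bsub>R\<^esub>,
     ring.add = (\<lambda>x y. \<Union>(a, s)\<in>x. \<Union>(b, t)\<in>y.
        frac R S (a \<otimes>\<^bsub>R\<^esub> t \<oplus>\<^bsub>R\<^esub> b \<otimes>\<^bsub>R\<^esub> s) (s \<otimes>\<^bsub>R\<^esub> t))\<rparr>"

definition zariski :: "'r ring \<Rightarrow> 'r set topology" where
  "zariski R = topology_generated_by {{p. primeideal p R \<and> f \<notin> p} | f. f \<in> carrier R}"

definition Spec :: "'r ring \<Rightarrow> ('r set, 'r set \<Rightarrow> ('r \<times> 'r) set) ringed_space" where
  "Spec R = \<lparr>topol = zariski R,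
     ring_at = (\<lambda>U.
       \<lparr>carrier = {s \<in> (\<Pi>\<^sub>E p\<in>U. carrier (localization R (carrier R - p))).
           \<forall>p\<in>U. \<exists>V. openin (zariski R) V \<and> p \<in> V \<and> V \<subseteq> U \<and>
             (\<exists>a\<in>carrier R. \<exists>b\<in>carrier R. \<forall>q\<in>V. b \<notin> q \<and> s q = frac R (carrier R - q) a b)},
        monoid.mult = (\<lambda>s t. \<lambda>p\<in>U. s p \<otimes>\<^bsub>localization R (carrier R - p)\<^esub> t p),
        monoid.one = (\<lambda>p\<in>U. \<one>\<^bsub>localization R (carrier R - p)\<^esub>),
        ring.zero = (\<lambda>p\<in>U. \<zero>\<^bsub>localization R (carrier R - p)\<^esub>),
        ring.add = (\<lambda>s t. \<lambda>p\<in>U. s p \<oplus>\<^bsub>localization R (carrier R - p)\<^esub> t p)\<rparr>),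
     rres = (\<lambda>U V s. restrict s V)\<rparr>"

text \<open>Requiring the coordinate ring to live on the type of sections loses nothing, because it is
  isomorphic to the ring of global sections.\<close>

definition affine_scheme :: "('p, 'r) ringed_space \<Rightarrow> bool" where
  "affine_scheme X \<longleftrightarrow> (\<exists>A :: 'r ring. cring A \<and> lrs_iso X (Spec A))"

definition is_scheme :: "('p, 'r) ringed_space \<Rightarrow> bool" where
  "is_scheme X \<longleftrightarrow> locally_ringed X \<and>
     (\<forall>x\<in>points X. \<exists>U\<in>opens X. x \<in> U \<and> affine_scheme (open_restrict X U))"

text \<open>The square with \<open>p : P \<rightarrow> A\<close>, \<open>q : P \<rightarrow> B\<close>, \<open>f : A \<rightarrow> C\<close>, \<open>g : B \<rightarrow> C\<close> is cartesian in the
  category of schemes. Test schemes range over the types of the given schemes. This is no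
  restriction when \<open>f\<close> is an open immersion, the only case used below: the fibre product is then
  an open subscheme of \<open>B\<close>, which lives on these types.\<close>

definition cartesian_square ::
  "('p, 'r) ringed_space \<Rightarrow> ('p, 'r) ringed_space \<Rightarrow> ('p, 'r) ringed_space \<Rightarrow> ('p, 'r) ringed_space \<Rightarrow>
   ('p, 'p, 'r, 'r) mor \<Rightarrow> ('p, 'p, 'r, 'r) mor \<Rightarrow> ('p, 'p, 'r, 'r) mor \<Rightarrow> ('p, 'p, 'r, 'r) mor \<Rightarrow> bool"
  where
  "cartesian_square P A B C p q f g \<longleftrightarrow>
     mor_eq P C (mor_comp A f p) (mor_comp B g q) \<and>
     (\<forall>T :: ('p, 'r) ringed_space. \<forall>u v.
        is_scheme T \<and> lrs_mor T A u \<and> lrs_mor T B v \<and> mor_eq T C (mor_comp A f u) (mor_comp B g v) \<longrightarrow>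
        (\<exists>w. lrs_mor T P w \<and> mor_eq T A (mor_comp P p w) u \<and> mor_eq T B (mor_comp P q w) v \<and>
           (\<forall>w'. lrs_mor T P w' \<and> mor_eq T A (mor_comp P p w') u \<and> mor_eq T B (mor_comp P q w') v \<longrightarrow>
              mor_eq T P w' w)))"


section \<open>Sheaves of modules on a ringed space\<close>

record ('p, 'r, 'm) smod =
  sec :: "'p set \<Rightarrow> ('r, 'm) module"
  sres :: "'p set \<Rightarrow> 'p set \<Rightarrow> 'm \<Rightarrow> 'm"

definition is_smod :: "('p, 'r) ringed_space \<Rightarrow> ('p, 'r, 'm) smod \<Rightarrow> bool" where
  "is_smod X M \<longleftrightarrow>
     sheaf_on (topol X) (\<lambda>V. carrier (sec M V)) (sres M) \<and>
     (\<forall>V\<in>opens X. module (ring_at X V) (sec M V)) \<and>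
     (\<forall>V\<in>opens X. \<forall>W\<in>opens X. W \<subseteq> V \<longrightarrow>
        (\<forall>s\<in>carrier (sec M V). \<forall>t\<in>carrier (sec M V).
           sres M V W (s \<oplus>\<^bsub>sec M V\<^esub> t) = sres M V W s \<oplus>\<^bsub>sec M W\<^esub> sres M V W t) \<and>
        (\<forall>r\<in>carrier (ring_at X V). \<forall>s\<in>carrier (sec M V).
           sres M V W (r \<odot>\<^bsub>sec M V\<^esub> s) = rres X V W r \<odot>\<^bsub>sec M W\<^esub> sres M V W s))"

definition linear_map :: "'r ring \<Rightarrow> ('r, 'm) module \<Rightarrow> ('r, 'n) module \<Rightarrow> ('m \<Rightarrow> 'n) \<Rightarrow> bool" where
  "linear_map R A B h \<longleftrightarrow> h \<in> carrier A \<rightarrow> carrier B \<and>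
     (\<forall>s\<in>carrier A. \<forall>t\<in>carrier A. h (s \<oplus>\<^bsub>A\<^esub> t) = h s \<oplus>\<^bsub>B\<^esub> h t) \<and>
     (\<forall>r\<in>carrier R. \<forall>s\<in>carrier A. h (r \<odot>\<^bsub>A\<^esub> s) = r \<odot>\<^bsub>B\<^esub> h s)"

definition smod_mor ::
  "('p, 'r) ringed_space \<Rightarrow> ('p, 'r, 'm) smod \<Rightarrow> ('p, 'r, 'n) smod \<Rightarrow> ('p set \<Rightarrow> 'm \<Rightarrow> 'n) \<Rightarrow> bool" where
  "smod_mor X A B h \<longleftrightarrow>
     (\<forall>V\<in>opens X. linear_map (ring_at X V) (sec A V) (sec B V) (h V)) \<and>
     (\<forall>V\<in>opens X. \<forall>W\<in>opens X. W \<subseteq> V \<longrightarrow>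
        (\<forall>s\<in>carrier (sec A V). h W (sres A V W s) = sres B V W (h V s)))"

definition smod_iso ::
  "('p, 'r) ringed_space \<Rightarrow> ('p, 'r, 'm) smod \<Rightarrow> ('p, 'r, 'n) smod \<Rightarrow> ('p set \<Rightarrow> 'm \<Rightarrow> 'n) \<Rightarrow> bool" where
  "smod_iso X A B h \<longleftrightarrow> smod_mor X A B h \<and>
     (\<exists>k. smod_mor X B A k \<and>
        (\<forall>V\<in>opens X. (\<forall>s\<in>carrier (sec A V). k V (h V s) = s) \<and> (\<forall>t\<in>carrier (sec B V). h V (k V t) = t)))"

definition smod_push :: "('p, 'r) ringed_space \<Rightarrow> ('p, 'q, 'r, 'r) mor \<Rightarrow> ('p, 'r, 'm) smod \<Rightarrow> ('q, 'r, 'm) smod"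
  where
  "smod_push X f A =
    \<lparr>sec = (\<lambda>V. (sec A (pre X f V))\<lparr>smult := (\<lambda>r s. cm f V r \<odot>\<^bsub>sec A (pre X f V)\<^esub> s)\<rparr>),
     sres = (\<lambda>V W. sres A (pre X f V) (pre X f W))\<rparr>"


section \<open>Inverse image of a sheaf of modules under an arbitrary morphism\<close>

text \<open>The pullback along \<open>f : X \<rightarrow> Y\<close> of a sheaf \<open>M\<close> of \<open>\<O>\<^sub>Y\<close>-modules is the sheafification of
  \<open>W \<mapsto> \<O>\<^sub>X(W) \<otimes> M'(W)\<close>, where the tensor product is over \<open>\<O>'(W)\<close> and \<open>\<O>'\<close>, \<open>M'\<close> are the
  inverse image presheaves, i.e. \<open>M'(W)\<close> is the direct limit of \<open>M(V)\<close> over the opens \<open>V\<close> of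
  \<open>Y\<close> containing \<open>f(W)\<close>.\<close>

abbreviation mgerm ::
  "('p, 'r, 'm) smod \<Rightarrow> 'p set set \<Rightarrow> 'p set \<Rightarrow> 'm \<Rightarrow> ('p set \<times> 'm) set" where
  "mgerm M \<equiv> germ (\<lambda>V. carrier (sec M V)) (sres M)"

definition lim_module ::
  "('p, 'r) ringed_space \<Rightarrow> ('p, 'r, 'm) smod \<Rightarrow> 'p set set \<Rightarrow> (('p set \<times> 'r) set, ('p set \<times> 'm) set) module"
  where
  "lim_module X M \<F> =
    \<lparr>carrier = {mgerm M \<F> V s | V s. V \<in> \<F> \<and> s \<in> carrier (sec M V)},
     monoid.mult = undefined,
     monoid.one = undefined,
     ring.zero = (\<Union>V\<in>\<F>. mgerm M \<F> V \<zero>\<^bsub>sec M V\<^esub>),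
     ring.add = (\<lambda>a b. \<Union>(V, s)\<in>a. \<Union>(W, t)\<in>b.
        mgerm M \<F> (V \<inter> W) (sres M V (V \<inter> W) s \<oplus>\<^bsub>sec M (V \<inter> W)\<^esub> sres M W (V \<inter> W) t)),
     smult = (\<lambda>a b. \<Union>(V, r)\<in>a. \<Union>(W, t)\<in>b.
        mgerm M \<F> (V \<inter> W) (rres X V (V \<inter> W) r \<odot>\<^bsub>sec M (V \<inter> W)\<^esub> sres M W (V \<inter> W) t))\<rparr>"

text \<open>The tensor product of the \<open>R\<close>-modules \<open>A\<close> and \<open>M\<close>, where the ring \<open>A\<close> is an \<open>R\<close>-algebra
  via \<open>\<theta>\<close>: the quotient of the free abelian group on pairs by the subgroup of relations.\<close>

abbreviation tensor_free :: "'b ring \<Rightarrow> ('c, 'm) module \<Rightarrow> ('b \<times> 'm \<Rightarrow>\<^sub>0 int) monoid" where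
  "tensor_free A M \<equiv> free_Abelian_group (carrier A \<times> carrier M)"

definition tensor_rels ::
  "'c ring \<Rightarrow> 'b ring \<Rightarrow> ('c \<Rightarrow> 'b) \<Rightarrow> ('c, 'm) module \<Rightarrow> ('b \<times> 'm \<Rightarrow>\<^sub>0 int) set" where
  "tensor_rels R A \<theta> M =
     {frag_of (a \<oplus>\<^bsub>A\<^esub> b, s) - frag_of (a, s) - frag_of (b, s) | a b s.
        a \<in> carrier A \<and> b \<in> carrier A \<and> s \<in> carrier M} \<union>
     {frag_of (a, s \<oplus>\<^bsub>M\<^esub> t) - frag_of (a, s) - frag_of (a, t) | a s t.
        a \<in> carrier A \<and> s \<in> carrier M \<and> t \<in> carrier M} \<union>
     {frag_of (a \<otimes>\<^bsub>A\<^esub> \<theta> r, s) - frag_of (a, r \<odot>\<^bsub>M\<^esub> s) | a r s.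
        a \<in> carrier A \<and> r \<in> carrier R \<and> s \<in> carrier M}"

definition tensor_kernel ::
  "'c ring \<Rightarrow> 'b ring \<Rightarrow> ('c \<Rightarrow> 'b) \<Rightarrow> ('c, 'm) module \<Rightarrow> ('b \<times> 'm \<Rightarrow>\<^sub>0 int) set" where
  "tensor_kernel R A \<theta> M = generate (tensor_free A M) (tensor_rels R A \<theta> M)"

definition tensor ::
  "'c ring \<Rightarrow> 'b ring \<Rightarrow> ('c \<Rightarrow> 'b) \<Rightarrow> ('c, 'm) module \<Rightarrow> ('b, ('b \<times> 'm \<Rightarrow>\<^sub>0 int) set) module" where
  "tensor R A \<theta> M =
    \<lparr>carrier = rcosets\<^bsub>tensor_free A M\<^esub> (tensor_kernel R A \<theta> M),
     monoid.mult = undefined,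
     monoid.one = undefined,
     ring.zero = tensor_kernel R A \<theta> M,
     ring.add = (\<lambda>C D. C <#>\<^bsub>tensor_free A M\<^esub> D),
     smult = (\<lambda>b C. \<Union>c\<in>C. tensor_kernel R A \<theta> M
        #>\<^bsub>tensor_free A M\<^esub> frag_extend (\<lambda>(a, s). frag_of (b \<otimes>\<^bsub>A\<^esub> a, s)) c)\<rparr>"

definition pure_tensor ::
  "'c ring \<Rightarrow> 'b ring \<Rightarrow> ('c \<Rightarrow> 'b) \<Rightarrow> ('c, 'm) module \<Rightarrow> 'b \<Rightarrow> 'm \<Rightarrow> ('b \<times> 'm \<Rightarrow>\<^sub>0 int) set" where
  "pure_tensor R A \<theta> M a s = tensor_kernel R A \<theta> M #>\<^bsub>tensor_free A M\<^esub> frag_of (a, s)"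

definition opens_over ::
  "('p, 'r) ringed_space \<Rightarrow> ('q, 's) ringed_space \<Rightarrow> ('p, 'q, 'r, 's) mor \<Rightarrow> 'p set \<Rightarrow> 'q set set" where
  "opens_over X Y f W = {V \<in> opens Y. pt f ` W \<subseteq> V}"

definition inv_ring_map ::
  "('p, 'r) ringed_space \<Rightarrow> ('p, 'q, 'r, 's) mor \<Rightarrow> 'p set \<Rightarrow> ('q set \<times> 's) set \<Rightarrow> 'r" where
  "inv_ring_map X f W = lim_map (\<lambda>V s. rres X (pre X f V) W (cm f V s))"

type_synonym ('q, 'r, 'm) tens = "('r \<times> ('q set \<times> 'm) set \<Rightarrow>\<^sub>0 int) set"

definition pre_pullback ::
  "('p, 'r) ringed_space \<Rightarrow> ('q, 's) ringed_space \<Rightarrow> ('p, 'q, 'r, 's) mor \<Rightarrow> ('q, 's, 'm) smod \<Rightarrow>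
   ('p, 'r, ('q, 'r, 'm) tens) smod" where
  "pre_pullback X Y f M =
    (let R = (\<lambda>W. lim_ring Y (opens_over X Y f W));
         L = (\<lambda>W. lim_module Y M (opens_over X Y f W));
         \<theta> = inv_ring_map X f
     in \<lparr>sec = (\<lambda>W. tensor (R W) (ring_at X W) (\<theta> W) (L W)),
         sres = (\<lambda>W W' C. \<Union>c\<in>C. tensor_kernel (R W') (ring_at X W') (\<theta> W') (L W')
            #>\<^bsub>tensor_free (ring_at X W') (L W')\<^esub>
            frag_extend (\<lambda>(a, l). frag_of (rres X W W' a, lim_map (mgerm M (opens_over X Y f W')) l)) c)\<rparr>)"

definition sheafify ::
  "('p, 'r) ringed_space \<Rightarrow> ('p, 'r, 'm) smod \<Rightarrow> ('p, 'r, 'p \<Rightarrow> ('p set \<times> 'm) set) smod" where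
  "sheafify X P =
    (let St = (\<lambda>x. lim_module X P (nbhds X x))
     in \<lparr>sec = (\<lambda>W.
          \<lparr>carrier = {\<sigma> \<in> (\<Pi>\<^sub>E x\<in>W. carrier (St x)).
              \<forall>x\<in>W. \<exists>W'\<in>opens X. x \<in> W' \<and> W' \<subseteq> W \<and>
                (\<exists>s\<in>carrier (sec P W'). \<forall>y\<in>W'. \<sigma> y = mgerm P (nbhds X y) W' s)},
           monoid.mult = undefined,
           monoid.one = undefined,
           ring.zero = (\<lambda>x\<in>W. \<zero>\<^bsub>St x\<^esub>),
           ring.add = (\<lambda>\<sigma> \<tau>. \<lambda>x\<in>W. \<sigma> x \<oplus>\<^bsub>St x\<^esub> \<tau> x),
           smult = (\<lambda>r \<sigma>. \<lambda>x\<in>W. rgerm X (nbhds X x) W r \<odot>\<^bsub>St x\<^esub> \<sigma> x)\<rparr>),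
         sres = (\<lambda>W W' \<sigma>. restrict \<sigma> W')\<rparr>)"

definition pullback ::
  "('p, 'r) ringed_space \<Rightarrow> ('q, 's) ringed_space \<Rightarrow> ('p, 'q, 'r, 's) mor \<Rightarrow> ('q, 's, 'm) smod \<Rightarrow>
   ('p, 'r, 'p \<Rightarrow> ('p set \<times> ('q, 'r, 'm) tens) set) smod" where
  "pullback X Y f M = sheafify X (pre_pullback X Y f M)"

text \<open>The unit \<open>M \<rightarrow> f\<^sub>* f\<^sup>* M\<close>, \<open>s \<mapsto> 1 \<otimes> s\<close>, at an open \<open>V\<close> of \<open>Y\<close>.\<close>

definition pullback_unit ::
  "('p, 'r) ringed_space \<Rightarrow> ('q, 's) ringed_space \<Rightarrow> ('p, 'q, 'r, 's) mor \<Rightarrow> ('q, 's, 'm) smod \<Rightarrow>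
   'q set \<Rightarrow> 'm \<Rightarrow> 'p \<Rightarrow> ('p set \<times> ('q, 'r, 'm) tens) set" where
  "pullback_unit X Y f M V s = (let W = pre X f V; \<F> = opens_over X Y f W in
     (\<lambda>x\<in>W. mgerm (pre_pullback X Y f M) (nbhds X x) W
       (pure_tensor (lim_ring Y \<F>) (ring_at X W) (inv_ring_map X f W) (lim_module Y M \<F>)
          \<one>\<^bsub>ring_at X W\<^esub> (mgerm M \<F> V s))))"

text \<open>\<open>h : f\<^sup>* M \<rightarrow> N\<close> is the map adjoint to \<open>\<alpha> : M \<rightarrow> f\<^sub>* N\<close>.\<close>

definition adjoint_map ::
  "('p, 'r) ringed_space \<Rightarrow> ('q, 's) ringed_space \<Rightarrow> ('p, 'q, 'r, 's) mor \<Rightarrow> ('q, 's, 'm) smod \<Rightarrow>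
   ('p, 'r, 'n) smod \<Rightarrow> ('q set \<Rightarrow> 'm \<Rightarrow> 'n) \<Rightarrow>
   ('p set \<Rightarrow> ('p \<Rightarrow> ('p set \<times> ('q, 'r, 'm) tens) set) \<Rightarrow> 'n) \<Rightarrow> bool" where
  "adjoint_map X Y f M N \<alpha> h \<longleftrightarrow> smod_mor X (pullback X Y f M) N h \<and>
     (\<forall>V\<in>opens Y. \<forall>s\<in>carrier (sec M V). h (pre X f V) (pullback_unit X Y f M V s) = \<alpha> V s)"


section \<open>Diagrams of schemes and their modules\<close>

text \<open>All schemes of a diagram share the types of points and sections. As these types are
  arbitrary, every small diagram of schemes is isomorphic to one of this form.
  For \<open>\<phi> : i \<rightarrow> j\<close>, \<open>tr X \<phi>\<close> is the morphism from \<open>sp X j\<close> to \<open>sp X i\<close>.\<close>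

record ('i, 'f, 'p, 'r) diagram =
  sp :: "'i \<Rightarrow> ('p, 'r) ringed_space"
  tr :: "'f \<Rightarrow> ('p, 'p, 'r, 'r) mor"

definition scheme_diagram :: "('i, 'f) cat \<Rightarrow> ('i, 'f, 'p, 'r) diagram \<Rightarrow> bool" where
  "scheme_diagram I X \<longleftrightarrow>
     (\<forall>i\<in>Ob I. is_scheme (sp X i)) \<and>
     (\<forall>\<phi>\<in>Ar I. lrs_mor (sp X (tgt I \<phi>)) (sp X (src I \<phi>)) (tr X \<phi>)) \<and>
     (\<forall>i\<in>Ob I. mor_eq (sp X i) (sp X i) (tr X (idt I i)) mor_id) \<and>
     (\<forall>\<phi>\<in>Ar I. \<forall>\<psi>\<in>Ar I. tgt I \<phi> = src I \<psi> \<longrightarrow>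
        mor_eq (sp X (tgt I \<psi>)) (sp X (src I \<phi>))
          (tr X (cmp I \<psi> \<phi>)) (mor_comp (sp X (tgt I \<phi>)) (tr X \<phi>) (tr X \<psi>)))"

definition diagram_mor ::
  "('i, 'f) cat \<Rightarrow> ('i, 'f, 'p, 'r) diagram \<Rightarrow> ('i, 'f, 'p, 'r) diagram \<Rightarrow> ('i \<Rightarrow> ('p, 'p, 'r, 'r) mor) \<Rightarrow> bool"
  where
  "diagram_mor I U X f \<longleftrightarrow>
     (\<forall>i\<in>Ob I. lrs_mor (sp U i) (sp X i) (f i)) \<and>
     (\<forall>\<phi>\<in>Ar I. mor_eq (sp U (tgt I \<phi>)) (sp X (src I \<phi>))
        (mor_comp (sp U (src I \<phi>)) (f (src I \<phi>)) (tr U \<phi>))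
        (mor_comp (sp X (tgt I \<phi>)) (tr X \<phi>) (f (tgt I \<phi>))))"

definition cartesian_mor ::
  "('i, 'f) cat \<Rightarrow> ('i, 'f, 'p, 'r) diagram \<Rightarrow> ('i, 'f, 'p, 'r) diagram \<Rightarrow> ('i \<Rightarrow> ('p, 'p, 'r, 'r) mor) \<Rightarrow> bool"
  where
  "cartesian_mor I U X f \<longleftrightarrow> (\<forall>\<phi>\<in>Ar I.
     cartesian_square (sp U (tgt I \<phi>)) (sp U (src I \<phi>)) (sp X (tgt I \<phi>)) (sp X (src I \<phi>))
       (tr U \<phi>) (f (tgt I \<phi>)) (f (src I \<phi>)) (tr X \<phi>))"

definition incl ::
  "('i, 'f, 'p, 'r) diagram \<Rightarrow> ('i, 'f, 'p, 'r) diagram \<Rightarrow> 'i \<Rightarrow> ('p, 'p, 'r, 'r) mor" where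
  "incl U X i = \<lparr>pt = (\<lambda>x. x), cm = (\<lambda>V. rres (sp X i) V (points (sp U i) \<inter> V))\<rparr>"

definition open_subdiagram ::
  "('i, 'f) cat \<Rightarrow> ('i, 'f, 'p, 'r) diagram \<Rightarrow> ('i, 'f, 'p, 'r) diagram \<Rightarrow> bool" where
  "open_subdiagram I U X \<longleftrightarrow> scheme_diagram I U \<and> scheme_diagram I X \<and>
     (\<forall>i\<in>Ob I. openin (topol (sp X i)) (points (sp U i)) \<and>
        sp U i = open_restrict (sp X i) (points (sp U i))) \<and>
     diagram_mor I U X (incl U X)"

text \<open>For \<open>\<phi> : i \<rightarrow> j\<close>, \<open>trn M \<phi>\<close> is the map from the sheaf \<open>fib M i\<close> to the direct image of
  the sheaf \<open>fib M j\<close> under \<open>tr X \<phi>\<close>.\<close>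

record ('i, 'f, 'p, 'r, 'm) dmod =
  fib :: "'i \<Rightarrow> ('p, 'r, 'm) smod"
  trn :: "'f \<Rightarrow> 'p set \<Rightarrow> 'm \<Rightarrow> 'm"

abbreviation dsec :: "('i, 'f, 'p, 'r, 'm) dmod \<Rightarrow> 'i \<Rightarrow> 'p set \<Rightarrow> ('r, 'm) module" where
  "dsec M i \<equiv> sec (fib M i)"

definition Modules :: "('i, 'f) cat \<Rightarrow> ('i, 'f, 'p, 'r) diagram \<Rightarrow> ('i, 'f, 'p, 'r, 'm) dmod set" where
  "Modules I X = {M.
     (\<forall>i\<in>Ob I. is_smod (sp X i) (fib M i)) \<and>
     (\<forall>\<phi>\<in>Ar I. smod_mor (sp X (src I \<phi>)) (fib M (src I \<phi>))
        (smod_push (sp X (tgt I \<phi>)) (tr X \<phi>) (fib M (tgt I \<phi>))) (trn M \<phi>)) \<and>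
     (\<forall>i\<in>Ob I. \<forall>V\<in>opens (sp X i). \<forall>s\<in>carrier (dsec M i V). trn M (idt I i) V s = s) \<and>
     (\<forall>\<phi>\<in>Ar I. \<forall>\<psi>\<in>Ar I. tgt I \<phi> = src I \<psi> \<longrightarrow>
        (\<forall>V\<in>opens (sp X (src I \<phi>)). \<forall>s\<in>carrier (dsec M (src I \<phi>) V).
           trn M (cmp I \<psi> \<phi>) V s = trn M \<psi> (pre (sp X (tgt I \<phi>)) (tr X \<phi>) V) (trn M \<phi> V s)))}"

definition equivariant :: "('i, 'f) cat \<Rightarrow> ('i, 'f, 'p, 'r) diagram \<Rightarrow> ('i, 'f, 'p, 'r, 'm) dmod \<Rightarrow> bool" where
  "equivariant I X M \<longleftrightarrow> (\<forall>\<phi>\<in>Ar I.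
     let Xi = sp X (src I \<phi>); Xj = sp X (tgt I \<phi>); Mi = fib M (src I \<phi>); Mj = fib M (tgt I \<phi>)
     in \<exists>h. adjoint_map Xj Xi (tr X \<phi>) Mi Mj (trn M \<phi>) h \<and> smod_iso Xj (pullback Xj Xi (tr X \<phi>) Mi) Mj h)"

text \<open>Morphisms in \<open>Modules I X\<close>, normalized to be extensional so that equality is meaningful.\<close>

definition dmap ::
  "('i, 'f) cat \<Rightarrow> ('i, 'f, 'p, 'r) diagram \<Rightarrow> ('i, 'f, 'p, 'r, 'm) dmod \<Rightarrow>
   ('i \<Rightarrow> 'p set \<Rightarrow> 'm \<Rightarrow> 'n) \<Rightarrow> 'i \<Rightarrow> 'p set \<Rightarrow> 'm \<Rightarrow> 'n" where
  "dmap I X A h = (\<lambda>i\<in>Ob I. \<lambda>V\<in>opens (sp X i). \<lambda>s\<in>carrier (dsec A i V). h i V s)"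

definition Mod_hom ::
  "('i, 'f) cat \<Rightarrow> ('i, 'f, 'p, 'r) diagram \<Rightarrow> ('i, 'f, 'p, 'r, 'm) dmod \<Rightarrow> ('i, 'f, 'p, 'r, 'n) dmod \<Rightarrow>
   ('i \<Rightarrow> 'p set \<Rightarrow> 'm \<Rightarrow> 'n) set" where
  "Mod_hom I X A B = {h. h = dmap I X A h \<and>
     (\<forall>i\<in>Ob I. smod_mor (sp X i) (fib A i) (fib B i) (h i)) \<and>
     (\<forall>\<phi>\<in>Ar I. \<forall>V\<in>opens (sp X (src I \<phi>)). \<forall>s\<in>carrier (dsec A (src I \<phi>) V).
        h (tgt I \<phi>) (pre (sp X (tgt I \<phi>)) (tr X \<phi>) V) (trn A \<phi> V s) = trn B \<phi> V (h (src I \<phi>) V s))}"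

definition Mod_comp ::
  "('i, 'f) cat \<Rightarrow> ('i, 'f, 'p, 'r) diagram \<Rightarrow> ('i, 'f, 'p, 'r, 'm) dmod \<Rightarrow>
   ('i \<Rightarrow> 'p set \<Rightarrow> 'n \<Rightarrow> 'k) \<Rightarrow> ('i \<Rightarrow> 'p set \<Rightarrow> 'm \<Rightarrow> 'n) \<Rightarrow> 'i \<Rightarrow> 'p set \<Rightarrow> 'm \<Rightarrow> 'k" where
  "Mod_comp I X A k h = dmap I X A (\<lambda>i V s. k i V (h i V s))"

definition Mod_id ::
  "('i, 'f) cat \<Rightarrow> ('i, 'f, 'p, 'r) diagram \<Rightarrow> ('i, 'f, 'p, 'r, 'm) dmod \<Rightarrow> 'i \<Rightarrow> 'p set \<Rightarrow> 'm \<Rightarrow> 'm" where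
  "Mod_id I X A = dmap I X A (\<lambda>i V s. s)"

definition Mod_iso ::
  "('i, 'f) cat \<Rightarrow> ('i, 'f, 'p, 'r) diagram \<Rightarrow> ('i, 'f, 'p, 'r, 'm) dmod \<Rightarrow> ('i, 'f, 'p, 'r, 'n) dmod \<Rightarrow>
   ('i \<Rightarrow> 'p set \<Rightarrow> 'm \<Rightarrow> 'n) \<Rightarrow> bool" where
  "Mod_iso I X A B h \<longleftrightarrow> h \<in> Mod_hom I X A B \<and>
     (\<exists>k\<in>Mod_hom I X B A. Mod_comp I X A k h = Mod_id I X A \<and> Mod_comp I X B h k = Mod_id I X B)"


section \<open>Direct image, restriction and kernels\<close>

definition push ::
  "('i, 'f) cat \<Rightarrow> ('i, 'f, 'p, 'r) diagram \<Rightarrow> ('i \<Rightarrow> ('p, 'p, 'r, 'r) mor) \<Rightarrow>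
   ('i, 'f, 'p, 'r, 'm) dmod \<Rightarrow> ('i, 'f, 'p, 'r, 'm) dmod" where
  "push I U f A =
    \<lparr>fib = (\<lambda>i. smod_push (sp U i) (f i) (fib A i)),
     trn = (\<lambda>\<phi> V. trn A \<phi> (pre (sp U (src I \<phi>)) (f (src I \<phi>)) V))\<rparr>"

definition push_map ::
  "('i, 'f) cat \<Rightarrow> ('i, 'f, 'p, 'r) diagram \<Rightarrow> ('i, 'f, 'p, 'r) diagram \<Rightarrow> ('i \<Rightarrow> ('p, 'p, 'r, 'r) mor) \<Rightarrow>
   ('i, 'f, 'p, 'r, 'm) dmod \<Rightarrow> ('i \<Rightarrow> 'p set \<Rightarrow> 'm \<Rightarrow> 'n) \<Rightarrow> 'i \<Rightarrow> 'p set \<Rightarrow> 'm \<Rightarrow> 'n" where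
  "push_map I U X f A h = dmap I X (push I U f A) (\<lambda>i V. h i (pre (sp U i) (f i) V))"

text \<open>\<open>f\<^sup>*\<close> for an open subdiagram \<open>f : U \<rightarrow> X\<close>. The sheaves are restricted to the opens of \<open>U\<close>, so
  they are given by the same functions; only the transition maps must be corrected, since the
  preimage under \<open>tr U \<phi>\<close> is smaller than the one under \<open>tr X \<phi>\<close>.\<close>

definition restr ::
  "('i, 'f) cat \<Rightarrow> ('i, 'f, 'p, 'r) diagram \<Rightarrow> ('i, 'f, 'p, 'r) diagram \<Rightarrow>
   ('i, 'f, 'p, 'r, 'm) dmod \<Rightarrow> ('i, 'f, 'p, 'r, 'm) dmod" where
  "restr I U X M =
    \<lparr>fib = fib M,
     trn = (\<lambda>\<phi> V s. sres (fib M (tgt I \<phi>))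
        (pre (sp X (tgt I \<phi>)) (tr X \<phi>) V) (pre (sp U (tgt I \<phi>)) (tr U \<phi>) V) (trn M \<phi> V s))\<rparr>"

definition adj_unit ::
  "('i, 'f) cat \<Rightarrow> ('i, 'f, 'p, 'r) diagram \<Rightarrow> ('i, 'f, 'p, 'r) diagram \<Rightarrow>
   ('i, 'f, 'p, 'r, 'm) dmod \<Rightarrow> 'i \<Rightarrow> 'p set \<Rightarrow> 'm \<Rightarrow> 'm" where
  "adj_unit I U X M = dmap I X M (\<lambda>i V. sres (fib M i) V (pre (sp U i) (incl U X i) V))"

definition ker ::
  "('i, 'f, 'p, 'r, 'm) dmod \<Rightarrow> ('i, 'f, 'p, 'r, 'n) dmod \<Rightarrow> ('i \<Rightarrow> 'p set \<Rightarrow> 'm \<Rightarrow> 'n) \<Rightarrow>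
   ('i, 'f, 'p, 'r, 'm) dmod" where
  "ker A B h =
    \<lparr>fib = (\<lambda>i. \<lparr>sec = (\<lambda>V. (dsec A i V)\<lparr>carrier := {s \<in> carrier (dsec A i V). h i V s = \<zero>\<^bsub>dsec B i V\<^esub>}\<rparr>),
                 sres = sres (fib A i)\<rparr>),
     trn = trn A\<rparr>"

definition push_restr ::
  "('i, 'f) cat \<Rightarrow> ('i, 'f, 'p, 'r) diagram \<Rightarrow> ('i, 'f, 'p, 'r) diagram \<Rightarrow>
   ('i, 'f, 'p, 'r, 'm) dmod \<Rightarrow> ('i, 'f, 'p, 'r, 'm) dmod" where
  "push_restr I U X M = push I U (incl U X) (restr I U X M)"

definition Gamma ::
  "('i, 'f) cat \<Rightarrow> ('i, 'f, 'p, 'r) diagram \<Rightarrow> ('i, 'f, 'p, 'r) diagram \<Rightarrow> ('i, 'f, 'p, 'r) diagram \<Rightarrow>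
   ('i, 'f, 'p, 'r, 'm) dmod \<Rightarrow> ('i, 'f, 'p, 'r, 'm) dmod" where
  "Gamma I X U V M =
     ker (push_restr I U X M) (push I U (incl U X) (push_restr I V U (restr I U X M)))
       (push_map I U X (incl U X) (restr I U X M) (adj_unit I V U (restr I U X M)))"

definition iota ::
  "('i, 'f) cat \<Rightarrow> ('i, 'f, 'p, 'r) diagram \<Rightarrow> ('i, 'f, 'p, 'r) diagram \<Rightarrow> ('i, 'f, 'p, 'r) diagram \<Rightarrow>
   ('i, 'f, 'p, 'r, 'm) dmod \<Rightarrow> 'i \<Rightarrow> 'p set \<Rightarrow> 'm \<Rightarrow> 'm" where
  "iota I X U V M = dmap I X (Gamma I X U V M) (\<lambda>i W s. s)"


section \<open>The sheaf Hom\<close>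

definition out :: "('i, 'f) cat \<Rightarrow> 'i \<Rightarrow> 'f set" where
  "out I i = {\<phi> \<in> Ar I. src I \<phi> = i}"

definition below :: "('i, 'f) cat \<Rightarrow> ('i, 'f, 'p, 'r) diagram \<Rightarrow> 'f \<Rightarrow> 'p set \<Rightarrow> 'p set set" where
  "below I X \<phi> W = {W' \<in> opens (sp X (tgt I \<phi>)). W' \<subseteq> pre (sp X (tgt I \<phi>)) (tr X \<phi>) W}"

text \<open>For \<open>\<psi> : j \<rightarrow> k\<close>, an open \<open>W\<close> of \<open>sp X j\<close> and an open \<open>W'\<close> of \<open>sp X k\<close> lying in its
  preimage, the restriction \<open>M(j, W) \<rightarrow> M(k, W')\<close> on the Zariski site of \<open>X\<close>.\<close>

definition site_res ::
  "('i, 'f) cat \<Rightarrow> ('i, 'f, 'p, 'r) diagram \<Rightarrow> ('i, 'f, 'p, 'r, 'm) dmod \<Rightarrow>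
   'f \<Rightarrow> 'p set \<Rightarrow> 'p set \<Rightarrow> 'm \<Rightarrow> 'm" where
  "site_res I X M \<psi> W W' s =
     sres (fib M (tgt I \<psi>)) (pre (sp X (tgt I \<psi>)) (tr X \<psi>) W) W' (trn M \<psi> W s)"

text \<open>A section of the sheaf Hom over \<open>(i, W)\<close> is a morphism between the restrictions of \<open>M\<close> and
  \<open>N\<close> to the slice of the Zariski site over \<open>(i, W)\<close>. An object of this slice is a pair \<open>(\<phi>, W')\<close>
  with \<open>\<phi> : i \<rightarrow> j\<close> and \<open>W'\<close> an open of \<open>sp X j\<close> contained in the preimage of \<open>W\<close>.\<close>

definition hom_sections ::
  "('i, 'f) cat \<Rightarrow> ('i, 'f, 'p, 'r) diagram \<Rightarrow> ('i, 'f, 'p, 'r, 'm) dmod \<Rightarrow> ('i, 'f, 'p, 'r, 'n) dmod \<Rightarrow>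
   'i \<Rightarrow> 'p set \<Rightarrow> ('f \<Rightarrow> 'p set \<Rightarrow> 'm \<Rightarrow> 'n) set" where
  "hom_sections I X M N i W =
    {\<eta> \<in> (\<Pi>\<^sub>E \<phi>\<in>out I i. \<Pi>\<^sub>E W'\<in>below I X \<phi> W.
          {h \<in> carrier (dsec M (tgt I \<phi>) W') \<rightarrow>\<^sub>E carrier (dsec N (tgt I \<phi>) W').
             linear_map (ring_at (sp X (tgt I \<phi>)) W') (dsec M (tgt I \<phi>) W') (dsec N (tgt I \<phi>) W') h}).
       \<forall>\<phi>\<in>out I i. \<forall>W'\<in>below I X \<phi> W. \<forall>\<psi>\<in>out I (tgt I \<phi>). \<forall>W''\<in>below I X \<psi> W'.
         \<forall>s\<in>carrier (dsec M (tgt I \<phi>) W').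
           \<eta> (cmp I \<psi> \<phi>) W'' (site_res I X M \<psi> W' W'' s) = site_res I X N \<psi> W' W'' (\<eta> \<phi> W' s)}"

definition sheaf_Hom ::
  "('i, 'f) cat \<Rightarrow> ('i, 'f, 'p, 'r) diagram \<Rightarrow> ('i, 'f, 'p, 'r, 'm) dmod \<Rightarrow> ('i, 'f, 'p, 'r, 'n) dmod \<Rightarrow>
   ('i, 'f, 'p, 'r, 'f \<Rightarrow> 'p set \<Rightarrow> 'm \<Rightarrow> 'n) dmod" where
  "sheaf_Hom I X M N =
    \<lparr>fib = (\<lambda>i.
      \<lparr>sec = (\<lambda>W.
        \<lparr>carrier = hom_sections I X M N i W,
         monoid.mult = undefined,
         monoid.one = undefined,
         ring.zero = (\<lambda>\<phi>\<in>out I i. \<lambda>W'\<in>below I X \<phi> W. \<lambda>s\<in>carrier (dsec M (tgt I \<phi>) W').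
            \<zero>\<^bsub>dsec N (tgt I \<phi>) W'\<^esub>),
         ring.add = (\<lambda>\<eta> \<theta>. \<lambda>\<phi>\<in>out I i. \<lambda>W'\<in>below I X \<phi> W. \<lambda>s\<in>carrier (dsec M (tgt I \<phi>) W').
            \<eta> \<phi> W' s \<oplus>\<^bsub>dsec N (tgt I \<phi>) W'\<^esub> \<theta> \<phi> W' s),
         smult = (\<lambda>r \<eta>. \<lambda>\<phi>\<in>out I i. \<lambda>W'\<in>below I X \<phi> W. \<lambda>s\<in>carrier (dsec M (tgt I \<phi>) W').
            rres (sp X (tgt I \<phi>)) (pre (sp X (tgt I \<phi>)) (tr X \<phi>) W) W' (cm (tr X \<phi>) W r)
              \<odot>\<^bsub>dsec N (tgt I \<phi>) W'\<^esub> \<eta> \<phi> W' s)\<rparr>),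
       sres = (\<lambda>V W \<eta>. \<lambda>\<phi>\<in>out I i. \<lambda>W'\<in>below I X \<phi> W. \<eta> \<phi> W')\<rparr>),
     trn = (\<lambda>\<phi> W \<eta>. \<lambda>\<psi>\<in>out I (tgt I \<phi>).
        \<lambda>W'\<in>below I X \<psi> (pre (sp X (tgt I \<phi>)) (tr X \<phi>) W). \<eta> (cmp I \<psi> \<phi>) W')\<rparr>"

text \<open>The maps \<open>Hom(M', N) \<rightarrow> Hom(M, N)\<close> and \<open>Hom(M, N) \<rightarrow> Hom(M, N')\<close> induced by
  \<open>a : M \<rightarrow> M'\<close> and \<open>b : N \<rightarrow> N'\<close>.\<close>

definition Hom_pre ::
  "('i, 'f) cat \<Rightarrow> ('i, 'f, 'p, 'r) diagram \<Rightarrow> ('i, 'f, 'p, 'r, 'm) dmod \<Rightarrow> ('i, 'f, 'p, 'r, 'k) dmod \<Rightarrow>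
   ('i, 'f, 'p, 'r, 'n) dmod \<Rightarrow> ('i \<Rightarrow> 'p set \<Rightarrow> 'm \<Rightarrow> 'k) \<Rightarrow>
   'i \<Rightarrow> 'p set \<Rightarrow> ('f \<Rightarrow> 'p set \<Rightarrow> 'k \<Rightarrow> 'n) \<Rightarrow> 'f \<Rightarrow> 'p set \<Rightarrow> 'm \<Rightarrow> 'n" where
  "Hom_pre I X M M' N a = dmap I X (sheaf_Hom I X M' N) (\<lambda>i W \<eta>.
     \<lambda>\<phi>\<in>out I i. \<lambda>W'\<in>below I X \<phi> W. \<lambda>s\<in>carrier (dsec M (tgt I \<phi>) W'). \<eta> \<phi> W' (a (tgt I \<phi>) W' s))"

definition Hom_post ::
  "('i, 'f) cat \<Rightarrow> ('i, 'f, 'p, 'r) diagram \<Rightarrow> ('i, 'f, 'p, 'r, 'm) dmod \<Rightarrow> ('i, 'f, 'p, 'r, 'n) dmod \<Rightarrow>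
   ('i \<Rightarrow> 'p set \<Rightarrow> 'n \<Rightarrow> 'k) \<Rightarrow>
   'i \<Rightarrow> 'p set \<Rightarrow> ('f \<Rightarrow> 'p set \<Rightarrow> 'm \<Rightarrow> 'n) \<Rightarrow> 'f \<Rightarrow> 'p set \<Rightarrow> 'm \<Rightarrow> 'k" where
  "Hom_post I X M N b = dmap I X (sheaf_Hom I X M N) (\<lambda>i W \<eta>.
     \<lambda>\<phi>\<in>out I i. \<lambda>W'\<in>below I X \<phi> W. \<lambda>s\<in>carrier (dsec M (tgt I \<phi>) W'). b (tgt I \<phi>) W' (\<eta> \<phi> W' s))"


section \<open>The canonical maps\<close>

text \<open>\<open>f\<^sup>* Hom(M, N) \<rightarrow> Hom(f\<^sup>* M, f\<^sup>* N)\<close> for an open subdiagram.\<close>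

definition restr_Hom ::
  "('i, 'f) cat \<Rightarrow> ('i, 'f, 'p, 'r) diagram \<Rightarrow> ('i, 'f, 'p, 'r) diagram \<Rightarrow>
   ('i, 'f, 'p, 'r, 'm) dmod \<Rightarrow> ('i, 'f, 'p, 'r, 'n) dmod \<Rightarrow>
   'i \<Rightarrow> 'p set \<Rightarrow> ('f \<Rightarrow> 'p set \<Rightarrow> 'm \<Rightarrow> 'n) \<Rightarrow> 'f \<Rightarrow> 'p set \<Rightarrow> 'm \<Rightarrow> 'n" where
  "restr_Hom I U X M N = dmap I U (restr I U X (sheaf_Hom I X M N)) (\<lambda>i W \<eta>.
     \<lambda>\<phi>\<in>out I i. \<lambda>W'\<in>below I U \<phi> W. \<eta> \<phi> W')"

text \<open>\<open>f\<^sub>* Hom(A, B) \<rightarrow> Hom(f\<^sub>* A, f\<^sub>* B)\<close>.\<close>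

definition push_Hom ::
  "('i, 'f) cat \<Rightarrow> ('i, 'f, 'p, 'r) diagram \<Rightarrow> ('i, 'f, 'p, 'r) diagram \<Rightarrow> ('i \<Rightarrow> ('p, 'p, 'r, 'r) mor) \<Rightarrow>
   ('i, 'f, 'p, 'r, 'm) dmod \<Rightarrow> ('i, 'f, 'p, 'r, 'n) dmod \<Rightarrow>
   'i \<Rightarrow> 'p set \<Rightarrow> ('f \<Rightarrow> 'p set \<Rightarrow> 'm \<Rightarrow> 'n) \<Rightarrow> 'f \<Rightarrow> 'p set \<Rightarrow> 'm \<Rightarrow> 'n" where
  "push_Hom I U X f A B = dmap I X (push I U f (sheaf_Hom I U A B)) (\<lambda>i W \<eta>.
     \<lambda>\<phi>\<in>out I i. \<lambda>W'\<in>below I X \<phi> W. \<eta> \<phi> (pre (sp U (tgt I \<phi>)) (f (tgt I \<phi>)) W'))"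

definition frakG ::
  "('i, 'f) cat \<Rightarrow> ('i, 'f, 'p, 'r) diagram \<Rightarrow> ('i, 'f, 'p, 'r) diagram \<Rightarrow>
   ('i, 'f, 'p, 'r, 'm) dmod \<Rightarrow> ('i, 'f, 'p, 'r, 'n) dmod \<Rightarrow>
   'i \<Rightarrow> 'p set \<Rightarrow> ('f \<Rightarrow> 'p set \<Rightarrow> 'm \<Rightarrow> 'n) \<Rightarrow> 'f \<Rightarrow> 'p set \<Rightarrow> 'm \<Rightarrow> 'n" where
  "frakG I X U M N =
     (let f = incl U X; D = push_restr I U X (sheaf_Hom I X M N) in
      Mod_comp I X D (Hom_pre I X M (push_restr I U X M) (push_restr I U X N) (adj_unit I U X M))
        (Mod_comp I X D (push_Hom I U X f (restr I U X M) (restr I U X N))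
           (push_map I U X f (restr I U X (sheaf_Hom I X M N)) (restr_Hom I U X M N))))"

text \<open>The equation is \<open>\<iota> \<HH> = \<GG> \<iota>\<close>, where the first \<open>\<iota>\<close> is applied to the target of Hom.\<close>

definition frakH ::
  "('i, 'f) cat \<Rightarrow> ('i, 'f, 'p, 'r) diagram \<Rightarrow> ('i, 'f, 'p, 'r) diagram \<Rightarrow> ('i, 'f, 'p, 'r) diagram \<Rightarrow>
   ('i, 'f, 'p, 'r, 'm) dmod \<Rightarrow> ('i, 'f, 'p, 'r, 'n) dmod \<Rightarrow>
   'i \<Rightarrow> 'p set \<Rightarrow> ('f \<Rightarrow> 'p set \<Rightarrow> 'm \<Rightarrow> 'n) \<Rightarrow> 'f \<Rightarrow> 'p set \<Rightarrow> 'm \<Rightarrow> 'n" where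
  "frakH I X U V M N =
     (let S = Gamma I X U V (sheaf_Hom I X M N); T = sheaf_Hom I X M (Gamma I X U V N) in
      THE H. H \<in> Mod_hom I X S T \<and>
        Mod_comp I X S (Hom_post I X M (Gamma I X U V N) (iota I X U V N)) H =
        Mod_comp I X S (frakG I X U M N) (iota I X U V (sheaf_Hom I X M N)))"

end

theory Submission
  imports Defs "HOL-Algebra.Weak_Morphisms"
begin

text \<open>
  Write \<open>P\<^sub>i \<supseteq> Q\<^sub>i\<close> for the open subsets \<open>U\<^sub>i \<supseteq> V\<^sub>i\<close> of \<open>X\<^sub>i\<close>. A section of the source over \<open>(i, W)\<close> is a
  compatible family \<open>\<eta>\<close> of maps \<open>M \<rightarrow> N\<close> over the opens \<open>(\<phi>, W')\<close> lying above \<open>P\<^sub>i \<inter> W\<close>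
  that vanishes above \<open>Q\<^sub>i \<inter> W\<close>, and the canonical map sends \<open>\<eta>\<close> to the family
  \<open>s \<mapsto> \<eta> (s|P\<^sub>j \<inter> W')\<close>; it suffices that this is a bijection over each \<open>(i, W)\<close>.

  If \<open>f\<close> and \<open>g\<close> are cartesian, then \<open>P\<^sub>j\<close> contains the preimage of \<open>P\<^sub>i\<close>, and likewise for \<open>Q\<close>, and
  restriction to the opens above \<open>P\<^sub>i \<inter> W\<close> is an inverse. The containment of points is obtained by
  testing the cartesian square with the spectrum of the residue field of a point.

  If \<open>M\<close> is equivariant, a family over \<open>(i, W)\<close> amounts to its component at the identity of \<open>i\<close>, a
  map of sheaves on \<open>W \<subseteq> X\<^sub>i\<close>, because \<open>M\<^sub>j\<close> is the pullback of \<open>M\<^sub>i\<close>; on identity components the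
  canonical map is visibly bijective. Uniqueness holds since \<open>M\<^sub>j\<close> is locally generated by pulled
  back sections, and existence since linear combinations of these, paired with their prescribed images,
  form the graph of a map.
\<close>

section \<open>Ringed spaces and sheaves of modules\<close>

text \<open>The inclusion \<open>iota\<close> changes no element, so the equation defining
  \<open>frakH\<close> determines it at once as the explicit map \<open>Hx\<close>. The obstacle to
  inverting \<open>Hx\<close> is that \<open>P j\<close> may be smaller than the preimage of
  \<open>P i\<close>: a section of the source also has components over opens above
  \<open>P i \<inter> W\<close> that are not contained in \<open>P j\<close>, and \<open>Hx\<close>
  discards them. For cartesian morphisms there are no such opens; for equivariant \<open>M\<close>
  the components are determined by the one at the identity. Test schemes in
  \<open>cartesian_square\<close> live on the types of the diagram, so the residue field must be
  embedded in \<open>'r\<close>. Fractions bound a stalk by \<open>'r \<times> 'r\<close>, which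
  suffices when \<open>'r\<close> is infinite; when it is finite, all germs at a point are
  represented on one neighbourhood. In the equivariant case maps are extended through their graphs.
  The pairs are defined without mentioning the tensor product, so they move along a further arrow
  without any comparison of iterated pullbacks; the tensor product enters through local generation
  and single-valuedness.\<close>

lemma ringed_cring: "ringed X \<Longrightarrow> openin (topol X) V \<Longrightarrow> cring (ring_at X V)"
  by (simp add: ringed_def)

lemma ringed_hom:
  "ringed X \<Longrightarrow> openin (topol X) V \<Longrightarrow> openin (topol X) W \<Longrightarrow> W \<subseteq> V \<Longrightarrow>
   rres X V W \<in> ring_hom (ring_at X V) (ring_at X W)"
  by (simp add: ringed_def)

lemma ringed_presheaf: "ringed X \<Longrightarrow> presheaf_on (topol X) (\<lambda>V. carrier (ring_at X V)) (rres X)"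
  by (simp add: ringed_def sheaf_on_def)

lemma presheaf_closed:
  "presheaf_on T F \<rho> \<Longrightarrow> openin T V \<Longrightarrow> openin T W \<Longrightarrow> W \<subseteq> V \<Longrightarrow> s \<in> F V \<Longrightarrow> \<rho> V W s \<in> F W"
  by (simp add: presheaf_on_def Pi_iff)

lemma presheaf_id: "presheaf_on T F \<rho> \<Longrightarrow> openin T V \<Longrightarrow> s \<in> F V \<Longrightarrow> \<rho> V V s = s"
  by (simp add: presheaf_on_def Pi_iff)

lemma presheaf_comp:
  "presheaf_on T F \<rho> \<Longrightarrow> openin T V \<Longrightarrow> openin T W \<Longrightarrow> openin T W' \<Longrightarrow> W' \<subseteq> W \<Longrightarrow> W \<subseteq> V \<Longrightarrow>
   s \<in> F V \<Longrightarrow> \<rho> W W' (\<rho> V W s) = \<rho> V W' s"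
  by (simp add: presheaf_on_def Pi_iff)

lemma rres_closed:
  "ringed X \<Longrightarrow> openin (topol X) V \<Longrightarrow> openin (topol X) W \<Longrightarrow> W \<subseteq> V \<Longrightarrow> r \<in> carrier (ring_at X V) \<Longrightarrow>
   rres X V W r \<in> carrier (ring_at X W)"
  by (rule presheaf_closed [OF ringed_presheaf])

lemma rres_id: "ringed X \<Longrightarrow> openin (topol X) V \<Longrightarrow> r \<in> carrier (ring_at X V) \<Longrightarrow> rres X V V r = r"
  by (rule presheaf_id [OF ringed_presheaf])

lemma rres_comp:
  "ringed X \<Longrightarrow> openin (topol X) V \<Longrightarrow> openin (topol X) W \<Longrightarrow> openin (topol X) W' \<Longrightarrow> W' \<subseteq> W \<Longrightarrow> W \<subseteq> V \<Longrightarrow>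
   r \<in> carrier (ring_at X V) \<Longrightarrow> rres X W W' (rres X V W r) = rres X V W' r"
  by (rule presheaf_comp [OF ringed_presheaf])

lemma smod_presheaf: "is_smod X M \<Longrightarrow> presheaf_on (topol X) (\<lambda>V. carrier (sec M V)) (sres M)"
  by (simp add: is_smod_def sheaf_on_def)

lemma smod_module: "is_smod X M \<Longrightarrow> openin (topol X) V \<Longrightarrow> module (ring_at X V) (sec M V)"
  by (simp add: is_smod_def)

lemma smod_group: "is_smod X M \<Longrightarrow> openin (topol X) V \<Longrightarrow> abelian_group (sec M V)"
  using smod_module module.axioms by blast

lemma sres_closed:
  "is_smod X M \<Longrightarrow> openin (topol X) V \<Longrightarrow> openin (topol X) W \<Longrightarrow> W \<subseteq> V \<Longrightarrow> s \<in> carrier (sec M V) \<Longrightarrow>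
   sres M V W s \<in> carrier (sec M W)"
  by (rule presheaf_closed [OF smod_presheaf])

lemma sres_id: "is_smod X M \<Longrightarrow> openin (topol X) V \<Longrightarrow> s \<in> carrier (sec M V) \<Longrightarrow> sres M V V s = s"
  by (rule presheaf_id [OF smod_presheaf])

lemma sres_comp:
  "is_smod X M \<Longrightarrow> openin (topol X) V \<Longrightarrow> openin (topol X) W \<Longrightarrow> openin (topol X) W' \<Longrightarrow> W' \<subseteq> W \<Longrightarrow> W \<subseteq> V \<Longrightarrow>
   s \<in> carrier (sec M V) \<Longrightarrow> sres M W W' (sres M V W s) = sres M V W' s"
  by (rule presheaf_comp [OF smod_presheaf])

lemma sres_add:
  "is_smod X M \<Longrightarrow> openin (topol X) V \<Longrightarrow> openin (topol X) W \<Longrightarrow> W \<subseteq> V \<Longrightarrow>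
   s \<in> carrier (sec M V) \<Longrightarrow> t \<in> carrier (sec M V) \<Longrightarrow>
   sres M V W (s \<oplus>\<^bsub>sec M V\<^esub> t) = sres M V W s \<oplus>\<^bsub>sec M W\<^esub> sres M V W t"
  by (simp add: is_smod_def)

lemma sres_smult:
  "is_smod X M \<Longrightarrow> openin (topol X) V \<Longrightarrow> openin (topol X) W \<Longrightarrow> W \<subseteq> V \<Longrightarrow>
   r \<in> carrier (ring_at X V) \<Longrightarrow> s \<in> carrier (sec M V) \<Longrightarrow>
   sres M V W (r \<odot>\<^bsub>sec M V\<^esub> s) = rres X V W r \<odot>\<^bsub>sec M W\<^esub> sres M V W s"
  by (simp add: is_smod_def)

section \<open>Additive maps and linear maps\<close>

lemma additive_zero:
  assumes "abelian_group A" "abelian_group B" "h \<in> carrier A \<rightarrow> carrier B"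
    and "\<And>s t. s \<in> carrier A \<Longrightarrow> t \<in> carrier A \<Longrightarrow> h (s \<oplus>\<^bsub>A\<^esub> t) = h s \<oplus>\<^bsub>B\<^esub> h t"
  shows "h \<zero>\<^bsub>A\<^esub> = \<zero>\<^bsub>B\<^esub>"
proof -
  interpret A: abelian_group A by fact
  interpret B: abelian_group B by fact
  have "h \<zero>\<^bsub>A\<^esub> \<oplus>\<^bsub>B\<^esub> h \<zero>\<^bsub>A\<^esub> = h \<zero>\<^bsub>A\<^esub>" "h \<zero>\<^bsub>A\<^esub> \<in> carrier B"
    using assms(3) assms(4)[of "\<zero>\<^bsub>A\<^esub>" "\<zero>\<^bsub>A\<^esub>"] by auto
  then show ?thesis
    using B.add.l_cancel_one' by force
qed

lemma additive_minus:
  assumes "abelian_group A" "abelian_group B" "h \<in> carrier A \<rightarrow> carrier B"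
    and "\<And>s t. s \<in> carrier A \<Longrightarrow> t \<in> carrier A \<Longrightarrow> h (s \<oplus>\<^bsub>A\<^esub> t) = h s \<oplus>\<^bsub>B\<^esub> h t"
    and "s \<in> carrier A" "t \<in> carrier A"
  shows "h (s \<ominus>\<^bsub>A\<^esub> t) = h s \<ominus>\<^bsub>B\<^esub> h t"
proof -
  interpret A: abelian_group A by fact
  interpret B: abelian_group B by fact
  have c: "h (\<ominus>\<^bsub>A\<^esub> t) \<in> carrier B" "h t \<in> carrier B" "h s \<in> carrier B"
    using assms(3,5,6) by auto
  have "h (\<ominus>\<^bsub>A\<^esub> t) \<oplus>\<^bsub>B\<^esub> h t = \<zero>\<^bsub>B\<^esub>"
    using assms(4)[of "\<ominus>\<^bsub>A\<^esub> t" t] additive_zero[OF assms(1-4)] assms(6) by (simp add: A.l_neg)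
  then have "h (\<ominus>\<^bsub>A\<^esub> t) = \<ominus>\<^bsub>B\<^esub> h t"
    using c B.minus_equality by force
  then show ?thesis
    using assms(4)[of s "\<ominus>\<^bsub>A\<^esub> t"] assms(5,6) by (simp add: A.minus_eq B.minus_eq)
qed

lemma linear_map_closed: "linear_map R A B h \<Longrightarrow> s \<in> carrier A \<Longrightarrow> h s \<in> carrier B"
  unfolding linear_map_def by auto

lemma linear_map_add:
  "linear_map R A B h \<Longrightarrow> s \<in> carrier A \<Longrightarrow> t \<in> carrier A \<Longrightarrow> h (s \<oplus>\<^bsub>A\<^esub> t) = h s \<oplus>\<^bsub>B\<^esub> h t"
  unfolding linear_map_def by auto

lemma linear_map_smult:
  "linear_map R A B h \<Longrightarrow> r \<in> carrier R \<Longrightarrow> s \<in> carrier A \<Longrightarrow> h (r \<odot>\<^bsub>A\<^esub> s) = r \<odot>\<^bsub>B\<^esub> h s"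
  unfolding linear_map_def by auto

lemma linear_mapI:
  assumes "\<And>s. s \<in> carrier A \<Longrightarrow> h s \<in> carrier B"
    and "\<And>s t. s \<in> carrier A \<Longrightarrow> t \<in> carrier A \<Longrightarrow> h (s \<oplus>\<^bsub>A\<^esub> t) = h s \<oplus>\<^bsub>B\<^esub> h t"
    and "\<And>r s. r \<in> carrier R \<Longrightarrow> s \<in> carrier A \<Longrightarrow> h (r \<odot>\<^bsub>A\<^esub> s) = r \<odot>\<^bsub>B\<^esub> h s"
  shows "linear_map R A B h"
  using assms unfolding linear_map_def by auto

lemma linear_map_zero:
  assumes "linear_map R A B h" "abelian_group A" "abelian_group B"
  shows "h \<zero>\<^bsub>A\<^esub> = \<zero>\<^bsub>B\<^esub>"
  by (rule additive_zero) (use assms in \<open>auto simp: linear_map_def\<close>)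

lemma linear_map_minus:
  assumes "linear_map R A B h" "abelian_group A" "abelian_group B" "s \<in> carrier A" "t \<in> carrier A"
  shows "h (s \<ominus>\<^bsub>A\<^esub> t) = h s \<ominus>\<^bsub>B\<^esub> h t"
  by (rule additive_minus) (use assms in \<open>auto simp: linear_map_def\<close>)

lemma sres_zero:
  "is_smod X M \<Longrightarrow> openin (topol X) V \<Longrightarrow> openin (topol X) W \<Longrightarrow> W \<subseteq> V \<Longrightarrow>
   sres M V W \<zero>\<^bsub>sec M V\<^esub> = \<zero>\<^bsub>sec M W\<^esub>"
  by (rule additive_zero) (auto simp: smod_group sres_add sres_closed)

lemma sres_minus:
  "is_smod X M \<Longrightarrow> openin (topol X) V \<Longrightarrow> openin (topol X) W \<Longrightarrow> W \<subseteq> V \<Longrightarrow>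
   s \<in> carrier (sec M V) \<Longrightarrow> t \<in> carrier (sec M V) \<Longrightarrow>
   sres M V W (s \<ominus>\<^bsub>sec M V\<^esub> t) = sres M V W s \<ominus>\<^bsub>sec M W\<^esub> sres M V W t"
  by (rule additive_minus) (auto simp: smod_group sres_add sres_closed)

section \<open>Separation and glueing for sheaves\<close>

lemma sheaf_unique_glueing:
  assumes "sheaf_on T F \<rho>" "\<forall>V\<in>\<U>. openin T V \<and> s V \<in> F V"
    and "\<forall>V\<in>\<U>. \<forall>W\<in>\<U>. \<rho> V (V \<inter> W) (s V) = \<rho> W (V \<inter> W) (s W)"
  shows "\<exists>!t. t \<in> F (\<Union>\<U>) \<and> (\<forall>V\<in>\<U>. \<rho> (\<Union>\<U>) V t = s V)"
  using assms(1)[unfolded sheaf_on_def, THEN conjunct2, THEN spec, THEN spec, THEN mp, of \<U> s] assms(2,3)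
  by simp

text \<open>Both sections glue the restrictions of \<open>s\<close> to the opens on which the two
  agree, and these opens cover \<open>V\<close>; so the uniqueness half of the sheaf axiom
  identifies them.\<close>

lemma sheaf_separated:
  assumes sh: "sheaf_on T F \<rho>" and V: "openin T V" and s: "s \<in> F V" and t: "t \<in> F V"
    and loc: "\<And>x. x \<in> V \<Longrightarrow> \<exists>W. openin T W \<and> x \<in> W \<and> W \<subseteq> V \<and> \<rho> V W s = \<rho> V W t"
  shows "s = t"
proof -
  note psh = sh[unfolded sheaf_on_def, THEN conjunct1]
  define \<U> where "\<U> = {W. openin T W \<and> W \<subseteq> V \<and> \<rho> V W s = \<rho> V W t}"
  have un: "\<Union>\<U> = V"
    using loc unfolding \<U>_def by blast
  have sub: "openin T W \<and> W \<subseteq> V" if "W \<in> \<U>" for W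
    using that by (auto simp: \<U>_def)
  have 1: "\<forall>W\<in>\<U>. openin T W \<and> \<rho> V W s \<in> F W"
    using sub V s presheaf_closed[OF psh] by blast
  have 2: "\<rho> W (W \<inter> W') (\<rho> V W s) = \<rho> W' (W \<inter> W') (\<rho> V W' s)" if "W \<in> \<U>" "W' \<in> \<U>" for W W'
    using sub[OF that(1)] sub[OF that(2)] V s by (simp add: presheaf_comp[OF psh] openin_Int)
  have ex: "\<exists>!r. r \<in> F (\<Union>\<U>) \<and> (\<forall>W\<in>\<U>. \<rho> (\<Union>\<U>) W r = \<rho> V W s)"
    by (rule sheaf_unique_glueing[OF sh 1]) (use 2 in blast)
  have "\<forall>W\<in>\<U>. \<rho> V W t = \<rho> V W s"
    by (simp add: \<U>_def)
  with ex show ?thesis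
    unfolding un using s t by (metis (no_types, lifting))
qed

lemma smod_separated:
  assumes "is_smod X M" "openin (topol X) V" "s \<in> carrier (sec M V)" "t \<in> carrier (sec M V)"
    and "\<And>x. x \<in> V \<Longrightarrow> \<exists>W. openin (topol X) W \<and> x \<in> W \<and> W \<subseteq> V \<and> sres M V W s = sres M V W t"
  shows "s = t"
  by (rule sheaf_separated[of "topol X" "\<lambda>V. carrier (sec M V)" "sres M"])
    (use assms in \<open>simp_all add: is_smod_def\<close>)

lemma sheaf_glue:
  assumes sh: "sheaf_on T F \<rho>" and "\<And>V. V \<in> \<U> \<Longrightarrow> openin T V \<and> s V \<in> F V"
    and "\<And>V W. V \<in> \<U> \<Longrightarrow> W \<in> \<U> \<Longrightarrow> \<rho> V (V \<inter> W) (s V) = \<rho> W (V \<inter> W) (s W)"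
  obtains t where "t \<in> F (\<Union>\<U>)" "\<And>V. V \<in> \<U> \<Longrightarrow> \<rho> (\<Union>\<U>) V t = s V"
proof -
  have "\<exists>!t. t \<in> F (\<Union>\<U>) \<and> (\<forall>V\<in>\<U>. \<rho> (\<Union>\<U>) V t = s V)"
    by (rule sheaf_unique_glueing[OF sh]) (use assms(2,3) in auto)
  then show thesis
    using that by blast
qed

text \<open>Glueing for sections that are specified by a property rather than by a cover. The cover
  consists of all opens carrying a section with the property, and uniqueness on overlaps makes the
  chosen sections agree. It serves both the sheaf condition for \<open>Gamma\<close> and the
  extension of maps out of an equivariant module.\<close>

lemma smod_glue_rel:
  assumes M: "is_smod X M" and V: "openin (topol X) V"
    and loc: "\<And>x. x \<in> V \<Longrightarrow> \<exists>W n. openin (topol X) W \<and> x \<in> W \<and> W \<subseteq> V \<and> n \<in> carrier (sec M W) \<and> R W n"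
    and res: "\<And>W W' n. openin (topol X) W \<Longrightarrow> W \<subseteq> V \<Longrightarrow> n \<in> carrier (sec M W) \<Longrightarrow> R W n \<Longrightarrow>
       openin (topol X) W' \<Longrightarrow> W' \<subseteq> W \<Longrightarrow> R W' (sres M W W' n)"
    and uniq: "\<And>W n n'. openin (topol X) W \<Longrightarrow> W \<subseteq> V \<Longrightarrow> n \<in> carrier (sec M W) \<Longrightarrow>
       n' \<in> carrier (sec M W) \<Longrightarrow> R W n \<Longrightarrow> R W n' \<Longrightarrow> n = n'"
  obtains t where "t \<in> carrier (sec M V)"
    "\<And>x. x \<in> V \<Longrightarrow> \<exists>W. openin (topol X) W \<and> x \<in> W \<and> W \<subseteq> V \<and> R W (sres M V W t)"
proof -
  define \<U> where "\<U> = {W. openin (topol X) W \<and> W \<subseteq> V \<and> (\<exists>n\<in>carrier (sec M W). R W n)}"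
  define s where "s W = (SOME n. n \<in> carrier (sec M W) \<and> R W n)" for W
  have s: "openin (topol X) W \<and> W \<subseteq> V \<and> s W \<in> carrier (sec M W) \<and> R W (s W)" if "W \<in> \<U>" for W
  proof -
    have "\<exists>n. n \<in> carrier (sec M W) \<and> R W n"
      using that by (auto simp: \<U>_def)
    from someI_ex[OF this] that show ?thesis
      by (simp add: \<U>_def s_def)
  qed
  have un: "\<Union>\<U> = V"
  proof
    show "V \<subseteq> \<Union>\<U>"
      using loc by (fastforce simp: \<U>_def)
  qed (auto simp: \<U>_def)
  have sh: "sheaf_on (topol X) (\<lambda>V. carrier (sec M V)) (sres M)"
    using M by (simp add: is_smod_def)
  have agree: "sres M W (W \<inter> W') (s W) = sres M W' (W \<inter> W') (s W')" if "W \<in> \<U>" "W' \<in> \<U>" for W W'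
    by (rule uniq[of "W \<inter> W'"])
      (use s[OF that(1)] s[OF that(2)] M res in \<open>auto simp: openin_Int sres_closed\<close>)
  obtain t where t: "t \<in> carrier (sec M V)" "\<And>W. W \<in> \<U> \<Longrightarrow> sres M V W t = s W"
    using sheaf_glue[OF sh, of \<U> s] s agree unfolding un by metis
  show thesis
  proof (rule that[OF t(1)])
    fix x assume "x \<in> V"
    then obtain W where "W \<in> \<U>" "x \<in> W" using un by blast
    then show "\<exists>W. openin (topol X) W \<and> x \<in> W \<and> W \<subseteq> V \<and> R W (sres M V W t)"
      using s t(2) by metis
  qed
qed

section \<open>Preimages and comorphisms of morphisms of locally ringed spaces\<close>

lemma openin_pre: "continuous_map (topol X) (topol Y) (pt f) \<Longrightarrow> openin (topol Y) V \<Longrightarrow> openin (topol X) (pre X f V)"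
  unfolding pre_def by (rule openin_continuous_map_preimage)

lemma lrs_mor_openin_pre: "lrs_mor X Y f \<Longrightarrow> openin (topol Y) V \<Longrightarrow> openin (topol X) (pre X f V)"
  by (rule openin_pre) (simp_all only: lrs_mor_def)

lemma lrs_mor_cm_hom:
  "lrs_mor X Y f \<Longrightarrow> openin (topol Y) V \<Longrightarrow> cm f V \<in> ring_hom (ring_at Y V) (ring_at X (pre X f V))"
  by (simp add: lrs_mor_def)

lemma lrs_mor_cm_closed:
  "lrs_mor X Y f \<Longrightarrow> openin (topol Y) V \<Longrightarrow> r \<in> carrier (ring_at Y V) \<Longrightarrow> cm f V r \<in> carrier (ring_at X (pre X f V))"
  using lrs_mor_cm_hom ring_hom_closed by fast

lemma lrs_mor_cm_rres:
  "lrs_mor X Y f \<Longrightarrow> openin (topol Y) V \<Longrightarrow> openin (topol Y) W \<Longrightarrow> W \<subseteq> V \<Longrightarrow> r \<in> carrier (ring_at Y V) \<Longrightarrow>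
   cm f W (rres Y V W r) = rres X (pre X f V) (pre X f W) (cm f V r)"
  by (simp add: lrs_mor_def)

lemma pre_mono: "V \<subseteq> W \<Longrightarrow> pre X f V \<subseteq> pre X f W"
  unfolding pre_def by auto

lemma scheme_ringed: "is_scheme X \<Longrightarrow> ringed X"
  by (simp add: is_scheme_def locally_ringed_def)

section \<open>The Zariski site of a diagram\<close>

locale scheme_dia =
  fixes I :: "('i, 'f) cat" and X :: "('i, 'f, 'p, 'r) diagram"
  assumes cat: "category I" and dia: "scheme_diagram I X"
begin

abbreviation op :: "'i \<Rightarrow> 'p set \<Rightarrow> bool" where
  "op i \<equiv> openin (topol (sp X i))"

definition pb :: "'f \<Rightarrow> 'p set \<Rightarrow> 'p set" where
  "pb \<phi> W = pre (sp X (tgt I \<phi>)) (tr X \<phi>) W"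

text \<open>The analogue of \<open>site_res\<close> for the structure sheaves: this is how a scalar
  on \<open>(i, W)\<close> acts on a component of a section of the sheaf Hom.\<close>

definition rsr :: "'f \<Rightarrow> 'p set \<Rightarrow> 'p set \<Rightarrow> 'r \<Rightarrow> 'r" where
  "rsr \<phi> W W' r = rres (sp X (tgt I \<phi>)) (pb \<phi> W) W' (cm (tr X \<phi>) W r)"

lemma out_iff: "\<phi> \<in> out I i \<longleftrightarrow> \<phi> \<in> Ar I \<and> src I \<phi> = i"
  by (auto simp: out_def)

lemma out_Ob: "\<phi> \<in> out I i \<Longrightarrow> i \<in> Ob I"
  using cat by (auto simp: category_def out_iff)

lemma src_Ob: "\<phi> \<in> Ar I \<Longrightarrow> src I \<phi> \<in> Ob I" and tgt_Ob: "\<phi> \<in> Ar I \<Longrightarrow> tgt I \<phi> \<in> Ob I"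
  using cat by (auto simp: category_def)

lemma out_tgt: "\<phi> \<in> out I i \<Longrightarrow> tgt I \<phi> \<in> Ob I"
  by (simp add: out_iff tgt_Ob)

lemma idt_out: "i \<in> Ob I \<Longrightarrow> idt I i \<in> out I i" and tgt_idt: "i \<in> Ob I \<Longrightarrow> tgt I (idt I i) = i"
  using cat by (auto simp: category_def out_iff)

lemma cmp_out: "\<phi> \<in> out I i \<Longrightarrow> \<psi> \<in> out I (tgt I \<phi>) \<Longrightarrow> cmp I \<psi> \<phi> \<in> out I i"
  and tgt_cmp: "\<phi> \<in> out I i \<Longrightarrow> \<psi> \<in> out I (tgt I \<phi>) \<Longrightarrow> tgt I (cmp I \<psi> \<phi>) = tgt I \<psi>"
  using cat by (auto simp: category_def out_iff)

lemma cmp_idt: "\<phi> \<in> out I i \<Longrightarrow> cmp I \<phi> (idt I i) = \<phi>"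
  and idt_cmp: "\<phi> \<in> out I i \<Longrightarrow> cmp I (idt I (tgt I \<phi>)) \<phi> = \<phi>"
  using cat by (auto simp: category_def out_iff)

lemma cmp_assoc:
  "\<phi> \<in> out I i \<Longrightarrow> \<psi> \<in> out I (tgt I \<phi>) \<Longrightarrow> \<chi> \<in> out I (tgt I \<psi>) \<Longrightarrow>
   cmp I \<chi> (cmp I \<psi> \<phi>) = cmp I (cmp I \<chi> \<psi>) \<phi>"
  using cat by (simp add: category_def out_iff)

lemma sp_scheme: "i \<in> Ob I \<Longrightarrow> is_scheme (sp X i)"
  using dia by (simp add: scheme_diagram_def)

lemma sp_ringed: "i \<in> Ob I \<Longrightarrow> ringed (sp X i)"
  by (simp add: scheme_ringed sp_scheme)

lemma tr_lrs: "\<phi> \<in> out I i \<Longrightarrow> lrs_mor (sp X (tgt I \<phi>)) (sp X i) (tr X \<phi>)"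
  using dia by (auto simp: scheme_diagram_def out_iff)

lemma pb_op: "\<phi> \<in> out I i \<Longrightarrow> op i W \<Longrightarrow> op (tgt I \<phi>) (pb \<phi> W)"
  unfolding pb_def by (rule lrs_mor_openin_pre[OF tr_lrs])

lemma cm_closed:
  "\<phi> \<in> out I i \<Longrightarrow> op i W \<Longrightarrow> r \<in> carrier (ring_at (sp X i) W) \<Longrightarrow>
   cm (tr X \<phi>) W r \<in> carrier (ring_at (sp X (tgt I \<phi>)) (pb \<phi> W))"
  unfolding pb_def by (rule lrs_mor_cm_closed[OF tr_lrs])

lemma cm_hom:
  "\<phi> \<in> out I i \<Longrightarrow> op i W \<Longrightarrow>
   cm (tr X \<phi>) W \<in> ring_hom (ring_at (sp X i) W) (ring_at (sp X (tgt I \<phi>)) (pb \<phi> W))"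
  unfolding pb_def by (rule lrs_mor_cm_hom[OF tr_lrs])

lemma cm_rres:
  "\<phi> \<in> out I i \<Longrightarrow> op i V \<Longrightarrow> op i W \<Longrightarrow> W \<subseteq> V \<Longrightarrow> r \<in> carrier (ring_at (sp X i) V) \<Longrightarrow>
   cm (tr X \<phi>) W (rres (sp X i) V W r) = rres (sp X (tgt I \<phi>)) (pb \<phi> V) (pb \<phi> W) (cm (tr X \<phi>) V r)"
  unfolding pb_def by (rule lrs_mor_cm_rres[OF tr_lrs])

lemma tr_idt: "i \<in> Ob I \<Longrightarrow> mor_eq (sp X i) (sp X i) (tr X (idt I i)) mor_id"
  using dia by (simp add: scheme_diagram_def)

lemma tr_cmp:
  "\<phi> \<in> out I i \<Longrightarrow> \<psi> \<in> out I (tgt I \<phi>) \<Longrightarrow>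
   mor_eq (sp X (tgt I \<psi>)) (sp X i) (tr X (cmp I \<psi> \<phi>)) (mor_comp (sp X (tgt I \<phi>)) (tr X \<phi>) (tr X \<psi>))"
  using dia unfolding scheme_diagram_def out_iff by metis

lemma op_points: "op i W \<Longrightarrow> W \<subseteq> points (sp X i)"
  by (rule openin_subset)

lemma pb_idt: assumes "i \<in> Ob I" "op i W" shows "pb (idt I i) W = W"
  using tr_idt[OF assms(1)] op_points[OF assms(2)] assms(1)
  by (auto simp: mor_eq_def mor_id_def pb_def pre_def tgt_idt)

lemma tr_points: "\<phi> \<in> out I i \<Longrightarrow> x \<in> points (sp X (tgt I \<phi>)) \<Longrightarrow> pt (tr X \<phi>) x \<in> points (sp X i)"
  using tr_lrs unfolding lrs_mor_def continuous_map_def by blast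

lemma pb_cmp:
  assumes "\<phi> \<in> out I i" "\<psi> \<in> out I (tgt I \<phi>)"
  shows "pb (cmp I \<psi> \<phi>) W = pb \<psi> (pb \<phi> W)"
  using tr_cmp[OF assms] tr_points[OF assms(2)] assms
  by (auto simp: mor_eq_def mor_comp_def pb_def pre_def tgt_cmp)

lemma pb_Int: "pb \<phi> (A \<inter> B) = pb \<phi> A \<inter> pb \<phi> B"
  by (auto simp: pb_def pre_def)

lemma pb_mono: "A \<subseteq> B \<Longrightarrow> pb \<phi> A \<subseteq> pb \<phi> B"
  by (auto simp: pb_def pre_def)

lemma below_iff: "W' \<in> below I X \<phi> W \<longleftrightarrow> op (tgt I \<phi>) W' \<and> W' \<subseteq> pb \<phi> W"
  by (auto simp: below_def pb_def)

lemma below_op: "W' \<in> below I X \<phi> W \<Longrightarrow> op (tgt I \<phi>) W'"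
  and below_sub: "W' \<in> below I X \<phi> W \<Longrightarrow> W' \<subseteq> pb \<phi> W"
  by (auto simp: below_iff)

lemma below_mono: "W \<subseteq> W1 \<Longrightarrow> W' \<in> below I X \<phi> W \<Longrightarrow> W' \<in> below I X \<phi> W1"
  using pb_mono unfolding below_iff by blast

lemma below_cmp:
  assumes "\<phi> \<in> out I i" "\<psi> \<in> out I (tgt I \<phi>)" "W' \<in> below I X \<phi> W" "W'' \<in> below I X \<psi> W'"
  shows "W'' \<in> below I X (cmp I \<psi> \<phi>) W"
  using assms(3,4) pb_mono[of W' "pb \<phi> W" \<psi>] unfolding below_iff
  by (auto simp: tgt_cmp[OF assms(1,2)] pb_cmp[OF assms(1,2)])

lemma below_idt: "i \<in> Ob I \<Longrightarrow> op i W \<Longrightarrow> W' \<in> below I X (idt I i) W \<longleftrightarrow> op i W' \<and> W' \<subseteq> W"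
  by (simp add: below_iff pb_idt tgt_idt)

lemma below_sub_trans: "W' \<in> below I X \<phi> W \<Longrightarrow> op (tgt I \<phi>) W'' \<Longrightarrow> W'' \<subseteq> W' \<Longrightarrow> W'' \<in> below I X \<phi> W"
  unfolding below_iff by blast

lemma site_res_alt:
  "site_res I X N \<psi> W W' s = sres (fib N (tgt I \<psi>)) (pb \<psi> W) W' (trn N \<psi> W s)"
  by (simp add: site_res_def pb_def)

lemma rsr_hom:
  assumes "\<phi> \<in> out I i" "op i W" "W' \<in> below I X \<phi> W"
  shows "rsr \<phi> W W' \<in> ring_hom (ring_at (sp X i) W) (ring_at (sp X (tgt I \<phi>)) W')"
proof -
  have "(rres (sp X (tgt I \<phi>)) (pb \<phi> W) W') \<circ> (cm (tr X \<phi>) W)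
      \<in> ring_hom (ring_at (sp X i) W) (ring_at (sp X (tgt I \<phi>)) W')"
    by (rule ring_hom_trans[OF cm_hom ringed_hom])
      (use assms in \<open>auto simp: below_iff pb_op sp_ringed out_tgt\<close>)
  then show ?thesis by (simp add: o_def rsr_def[abs_def])
qed

lemma rsr_closed:
  "\<phi> \<in> out I i \<Longrightarrow> op i W \<Longrightarrow> W' \<in> below I X \<phi> W \<Longrightarrow> r \<in> carrier (ring_at (sp X i) W) \<Longrightarrow>
   rsr \<phi> W W' r \<in> carrier (ring_at (sp X (tgt I \<phi>)) W')"
  using rsr_hom ring_hom_closed by fast

text \<open>Functoriality of the structure sheaf on the site. Naturality of \<open>cm\<close> moves
  the intermediate restriction past \<open>tr X \<psi>\<close>, and the rest is transitivity of
  restriction. The laws \<open>rsr_rres\<close> and \<open>rres_rsr\<close> are the cases in which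
  one of the two arrows is an identity.\<close>

lemma rsr_cmp:
  assumes \<phi>: "\<phi> \<in> out I i" and \<psi>: "\<psi> \<in> out I (tgt I \<phi>)" and W: "op i W"
    and W': "W' \<in> below I X \<phi> W" and W'': "W'' \<in> below I X \<psi> W'" and r: "r \<in> carrier (ring_at (sp X i) W)"
  shows "rsr \<psi> W' W'' (rsr \<phi> W W' r) = rsr (cmp I \<psi> \<phi>) W W'' r"
proof -
  let ?Xj = "sp X (tgt I \<phi>)" and ?Xk = "sp X (tgt I \<psi>)"
  have cmr: "cm (tr X \<phi>) W r \<in> carrier (ring_at ?Xj (pb \<phi> W))"
    by (rule cm_closed[OF \<phi> W r])
  have "cm (tr X \<psi>) W' (rres ?Xj (pb \<phi> W) W' (cm (tr X \<phi>) W r)) =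
      rres ?Xk (pb \<psi> (pb \<phi> W)) (pb \<psi> W') (cm (tr X \<psi>) (pb \<phi> W) (cm (tr X \<phi>) W r))"
    by (rule cm_rres[OF \<psi>]) (use W' \<phi> W cmr in \<open>auto simp: below_iff pb_op\<close>)
  moreover have "rres ?Xk (pb \<psi> W') W''
      (rres ?Xk (pb \<psi> (pb \<phi> W)) (pb \<psi> W') (cm (tr X \<psi>) (pb \<phi> W) (cm (tr X \<phi>) W r))) =
      rres ?Xk (pb \<psi> (pb \<phi> W)) W'' (cm (tr X \<psi>) (pb \<phi> W) (cm (tr X \<phi>) W r))"
    by (rule rres_comp)
      (use W' W'' \<phi> \<psi> W cmr in \<open>auto simp: below_iff pb_op sp_ringed out_tgt cm_closed
        intro: pb_mono[THEN subsetD]\<close>)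
  moreover have "cm (tr X (cmp I \<psi> \<phi>)) W r = cm (tr X \<psi>) (pb \<phi> W) (cm (tr X \<phi>) W r)"
    using tr_cmp[OF \<phi> \<psi>] W r by (simp add: mor_eq_def mor_comp_def pb_def)
  ultimately show ?thesis
    by (simp add: rsr_def tgt_cmp[OF \<phi> \<psi>] pb_cmp[OF \<phi> \<psi>])
qed

lemma rsr_idt:
  assumes "i \<in> Ob I" "op i W" "r \<in> carrier (ring_at (sp X i) W)"
  shows "rsr (idt I i) W W' r = rres (sp X i) W W' r"
  using tr_idt[OF assms(1)] assms by (simp add: rsr_def tgt_idt pb_idt mor_eq_def mor_id_def)

lemma rsr_rres:
  assumes "\<phi> \<in> out I i" "op i W" "op i W1" "W1 \<subseteq> W" "W' \<in> below I X \<phi> W1" "r \<in> carrier (ring_at (sp X i) W)"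
  shows "rsr \<phi> W1 W' (rres (sp X i) W W1 r) = rsr \<phi> W W' r"
proof -
  have i: "i \<in> Ob I" using assms(1) src_Ob by (auto simp: out_iff)
  show ?thesis
    using rsr_cmp[OF idt_out[OF i], of \<phi> W W1 W' r] assms i
    by (simp add: tgt_idt below_idt rsr_idt cmp_idt)
qed

lemma rres_rsr:
  assumes "\<phi> \<in> out I i" "op i W" "W' \<in> below I X \<phi> W" "op (tgt I \<phi>) W''" "W'' \<subseteq> W'"
    "r \<in> carrier (ring_at (sp X i) W)"
  shows "rres (sp X (tgt I \<phi>)) W' W'' (rsr \<phi> W W' r) = rsr \<phi> W W'' r"
  using rsr_cmp[OF assms(1) idt_out, of W W' W'' r] assms out_tgt[OF assms(1)] rsr_closed[OF assms(1-3,6)]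
  by (simp add: below_idt below_op rsr_idt idt_cmp)

end

section \<open>Restriction maps of a module on the Zariski site\<close>

locale dia_module = scheme_dia I X
  for I :: "('i, 'f) cat" and X :: "('i, 'f, 'p, 'r) diagram" +
  fixes M :: "('i, 'f, 'p, 'r, 'm) dmod"
  assumes mod: "M \<in> Modules I X"
begin

abbreviation sr :: "'f \<Rightarrow> 'p set \<Rightarrow> 'p set \<Rightarrow> 'm \<Rightarrow> 'm" where
  "sr \<equiv> site_res I X M"

lemma fib_smod: "i \<in> Ob I \<Longrightarrow> is_smod (sp X i) (fib M i)"
  using mod by (simp add: Modules_def)

lemma trn_mor:
  "\<phi> \<in> out I i \<Longrightarrow> smod_mor (sp X i) (fib M i) (smod_push (sp X (tgt I \<phi>)) (tr X \<phi>) (fib M (tgt I \<phi>))) (trn M \<phi>)"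
  using mod by (auto simp: Modules_def out_iff)

lemma trn_closed:
  "\<phi> \<in> out I i \<Longrightarrow> op i W \<Longrightarrow> s \<in> carrier (dsec M i W) \<Longrightarrow> trn M \<phi> W s \<in> carrier (dsec M (tgt I \<phi>) (pb \<phi> W))"
  using trn_mor[of \<phi> i] by (auto simp: smod_mor_def linear_map_def smod_push_def pb_def)

lemma trn_add:
  "\<phi> \<in> out I i \<Longrightarrow> op i W \<Longrightarrow> s \<in> carrier (dsec M i W) \<Longrightarrow> t \<in> carrier (dsec M i W) \<Longrightarrow>
   trn M \<phi> W (s \<oplus>\<^bsub>dsec M i W\<^esub> t) = trn M \<phi> W s \<oplus>\<^bsub>dsec M (tgt I \<phi>) (pb \<phi> W)\<^esub> trn M \<phi> W t"
  using trn_mor[of \<phi> i] by (auto simp: smod_mor_def linear_map_def smod_push_def pb_def)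

lemma trn_smult:
  "\<phi> \<in> out I i \<Longrightarrow> op i W \<Longrightarrow> r \<in> carrier (ring_at (sp X i) W) \<Longrightarrow> s \<in> carrier (dsec M i W) \<Longrightarrow>
   trn M \<phi> W (r \<odot>\<^bsub>dsec M i W\<^esub> s) = cm (tr X \<phi>) W r \<odot>\<^bsub>dsec M (tgt I \<phi>) (pb \<phi> W)\<^esub> trn M \<phi> W s"
  using trn_mor[of \<phi> i] by (auto simp: smod_mor_def linear_map_def smod_push_def pb_def)

lemma trn_sres:
  "\<phi> \<in> out I i \<Longrightarrow> op i V \<Longrightarrow> op i W \<Longrightarrow> W \<subseteq> V \<Longrightarrow> s \<in> carrier (dsec M i V) \<Longrightarrow>
   trn M \<phi> W (sres (fib M i) V W s) = sres (fib M (tgt I \<phi>)) (pb \<phi> V) (pb \<phi> W) (trn M \<phi> V s)"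
  using trn_mor[of \<phi> i] by (auto simp: smod_mor_def linear_map_def smod_push_def pb_def)

lemma trn_idt: "i \<in> Ob I \<Longrightarrow> op i W \<Longrightarrow> s \<in> carrier (dsec M i W) \<Longrightarrow> trn M (idt I i) W s = s"
  using mod by (simp add: Modules_def)

lemma trn_cmp:
  "\<phi> \<in> out I i \<Longrightarrow> \<psi> \<in> out I (tgt I \<phi>) \<Longrightarrow> op i W \<Longrightarrow> s \<in> carrier (dsec M i W) \<Longrightarrow>
   trn M (cmp I \<psi> \<phi>) W s = trn M \<psi> (pb \<phi> W) (trn M \<phi> W s)"
  using mod unfolding pb_def by (auto simp: Modules_def out_iff)

lemma sr_closed:
  "\<phi> \<in> out I i \<Longrightarrow> op i W \<Longrightarrow> W' \<in> below I X \<phi> W \<Longrightarrow> s \<in> carrier (dsec M i W) \<Longrightarrow>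
   sr \<phi> W W' s \<in> carrier (dsec M (tgt I \<phi>) W')"
  unfolding site_res_alt
  by (rule sres_closed[OF fib_smod]) (auto simp: out_tgt pb_op below_iff trn_closed)

text \<open>As for \<open>rsr_cmp\<close>, with \<open>trn_sres\<close> in place of naturality of
  \<open>cm\<close>. Ordinary restriction is restriction along an identity arrow, so the mixed laws
  \<open>sr_sres\<close> and \<open>sres_sr\<close> are special cases.\<close>

lemma sr_cmp:
  assumes \<phi>: "\<phi> \<in> out I i" and \<psi>: "\<psi> \<in> out I (tgt I \<phi>)" and W: "op i W"
    and W': "W' \<in> below I X \<phi> W" and W'': "W'' \<in> below I X \<psi> W'" and s: "s \<in> carrier (dsec M i W)"
  shows "sr \<psi> W' W'' (sr \<phi> W W' s) = sr (cmp I \<psi> \<phi>) W W'' s"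
proof -
  let ?Mj = "fib M (tgt I \<phi>)" and ?Mk = "fib M (tgt I \<psi>)"
  have t: "trn M \<phi> W s \<in> carrier (sec ?Mj (pb \<phi> W))"
    by (rule trn_closed[OF \<phi> W s])
  have "trn M \<psi> W' (sres ?Mj (pb \<phi> W) W' (trn M \<phi> W s)) =
      sres ?Mk (pb \<psi> (pb \<phi> W)) (pb \<psi> W') (trn M \<psi> (pb \<phi> W) (trn M \<phi> W s))"
    by (rule trn_sres[OF \<psi>]) (use W' \<phi> W t in \<open>auto simp: below_iff pb_op\<close>)
  moreover have "sres ?Mk (pb \<psi> W') W''
      (sres ?Mk (pb \<psi> (pb \<phi> W)) (pb \<psi> W') (trn M \<psi> (pb \<phi> W) (trn M \<phi> W s))) =
      sres ?Mk (pb \<psi> (pb \<phi> W)) W'' (trn M \<psi> (pb \<phi> W) (trn M \<phi> W s))"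
    by (rule sres_comp[OF fib_smod])
      (use W' W'' \<phi> \<psi> W t in \<open>auto simp: below_iff pb_op out_tgt trn_closed intro: pb_mono[THEN subsetD]\<close>)
  ultimately show ?thesis
    by (simp add: site_res_alt tgt_cmp[OF \<phi> \<psi>] pb_cmp[OF \<phi> \<psi>] trn_cmp[OF \<phi> \<psi> W s])
qed

lemma sr_idt:
  "i \<in> Ob I \<Longrightarrow> op i W \<Longrightarrow> s \<in> carrier (dsec M i W) \<Longrightarrow> sr (idt I i) W W' s = sres (fib M i) W W' s"
  by (simp add: site_res_alt tgt_idt pb_idt trn_idt)

lemma sr_sres:
  assumes "\<phi> \<in> out I i" "op i W" "op i W1" "W1 \<subseteq> W" "W' \<in> below I X \<phi> W1" "s \<in> carrier (dsec M i W)"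
  shows "sr \<phi> W1 W' (sres (fib M i) W W1 s) = sr \<phi> W W' s"
proof -
  have i: "i \<in> Ob I" using assms(1) src_Ob by (auto simp: out_iff)
  show ?thesis
    using sr_cmp[OF idt_out[OF i], of \<phi> W W1 W' s] assms i
    by (simp add: tgt_idt below_idt sr_idt cmp_idt)
qed

lemma sres_sr:
  assumes "\<phi> \<in> out I i" "op i W" "W' \<in> below I X \<phi> W" "op (tgt I \<phi>) W''" "W'' \<subseteq> W'" "s \<in> carrier (dsec M i W)"
  shows "sres (fib M (tgt I \<phi>)) W' W'' (sr \<phi> W W' s) = sr \<phi> W W'' s"
  using sr_cmp[OF assms(1) idt_out, of W W' W'' s] assms out_tgt[OF assms(1)] sr_closed[OF assms(1-3,6)]
  by (simp add: below_idt below_op sr_idt idt_cmp)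

lemma sr_add:
  assumes "\<phi> \<in> out I i" "op i W" "W' \<in> below I X \<phi> W" "s \<in> carrier (dsec M i W)" "t \<in> carrier (dsec M i W)"
  shows "sr \<phi> W W' (s \<oplus>\<^bsub>dsec M i W\<^esub> t) = sr \<phi> W W' s \<oplus>\<^bsub>dsec M (tgt I \<phi>) W'\<^esub> sr \<phi> W W' t"
  unfolding site_res_alt
  using sres_add[OF fib_smod[OF out_tgt[OF assms(1)]] pb_op[OF assms(1,2)]] assms
  by (simp add: trn_add trn_closed below_iff)

lemma sr_smult:
  assumes "\<phi> \<in> out I i" "op i W" "W' \<in> below I X \<phi> W" "r \<in> carrier (ring_at (sp X i) W)" "s \<in> carrier (dsec M i W)"
  shows "sr \<phi> W W' (r \<odot>\<^bsub>dsec M i W\<^esub> s) = rsr \<phi> W W' r \<odot>\<^bsub>dsec M (tgt I \<phi>) W'\<^esub> sr \<phi> W W' s"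
  unfolding site_res_alt rsr_def
  using sres_smult[OF fib_smod[OF out_tgt[OF assms(1)]] pb_op[OF assms(1,2)]] assms
    cm_closed[OF assms(1)]
  by (simp add: trn_smult trn_closed below_iff)

lemma sec_module: "i \<in> Ob I \<Longrightarrow> op i W \<Longrightarrow> module (ring_at (sp X i) W) (dsec M i W)"
  by (rule smod_module[OF fib_smod])

lemma sec_group: "i \<in> Ob I \<Longrightarrow> op i W \<Longrightarrow> abelian_group (dsec M i W)"
  by (rule smod_group[OF fib_smod])

lemma sr_linear_zero:
  assumes "\<phi> \<in> out I i" "op i W" "W' \<in> below I X \<phi> W"
  shows "sr \<phi> W W' \<zero>\<^bsub>dsec M i W\<^esub> = \<zero>\<^bsub>dsec M (tgt I \<phi>) W'\<^esub>"
proof (rule additive_zero)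
  show "abelian_group (dsec M i W)"
    using assms by (auto simp: out_iff intro!: sec_group src_Ob)
  show "abelian_group (dsec M (tgt I \<phi>) W')"
    using assms by (auto simp: out_tgt below_op intro!: sec_group)
qed (use assms in \<open>auto simp: sr_add sr_closed\<close>)

lemma sr_minus:
  assumes "\<phi> \<in> out I i" "op i W" "W' \<in> below I X \<phi> W" "s \<in> carrier (dsec M i W)" "t \<in> carrier (dsec M i W)"
  shows "sr \<phi> W W' (s \<ominus>\<^bsub>dsec M i W\<^esub> t) = sr \<phi> W W' s \<ominus>\<^bsub>dsec M (tgt I \<phi>) W'\<^esub> sr \<phi> W W' t"
proof (rule additive_minus)
  show "abelian_group (dsec M i W)"
    using assms by (auto simp: out_iff intro!: sec_group src_Ob)
  show "abelian_group (dsec M (tgt I \<phi>) W')"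
    using assms by (auto simp: out_tgt below_op intro!: sec_group)
qed (use assms in \<open>auto simp: sr_add sr_closed\<close>)

end

section \<open>Germs\<close>

text \<open>Operations in \<open>lim_ring\<close>, \<open>lim_module\<close> and
  \<open>localization\<close> are unions over all representatives. They are evaluated by showing
  that every pair of representatives contributes the same set.\<close>

lemma Union_pairs_const:
  assumes "a \<noteq> {}" "b \<noteq> {}" "\<And>V r W s. (V, r) \<in> a \<Longrightarrow> (W, s) \<in> b \<Longrightarrow> g V r W s = c"
  shows "(\<Union>(V, r)\<in>a. \<Union>(W, s)\<in>b. g V r W s) = c"
proof -
  have in': "(\<Union>(W, s)\<in>b. g V r W s) = c" if "(V, r) \<in> a" for V r
  proof -
    have "(\<Union>(W, s)\<in>b. g V r W s) = (\<Union>p\<in>b. c)"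
      by (rule SUP_cong) (auto simp: assms(3)[OF that])
    then show ?thesis by (simp add: assms(2))
  qed
  have "(\<Union>(V, r)\<in>a. \<Union>(W, s)\<in>b. g V r W s) = (\<Union>p\<in>a. c)"
    by (rule SUP_cong[OF refl]) (clarify, rule in')
  then show ?thesis by (simp add: assms(1))
qed

text \<open>Stability under binary intersections provides the directedness, and it holds both for
  the neighbourhoods of a point and for the opens containing the image of a set.\<close>

locale direct_sys =
  fixes T :: "'p topology" and F :: "'p set \<Rightarrow> 's set" and \<rho> :: "'p set \<Rightarrow> 'p set \<Rightarrow> 's \<Rightarrow> 's"
    and \<F> :: "'p set set"
  assumes psh: "presheaf_on T F \<rho>"
    and op: "\<And>V. V \<in> \<F> \<Longrightarrow> openin T V"
    and Int: "\<And>V W. V \<in> \<F> \<Longrightarrow> W \<in> \<F> \<Longrightarrow> V \<inter> W \<in> \<F>"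
begin

abbreviation gm :: "'p set \<Rightarrow> 's \<Rightarrow> ('p set \<times> 's) set" where
  "gm \<equiv> germ F \<rho> \<F>"

lemma res_closed: "U \<in> \<F> \<Longrightarrow> V \<in> \<F> \<Longrightarrow> V \<subseteq> U \<Longrightarrow> s \<in> F U \<Longrightarrow> \<rho> U V s \<in> F V"
  by (rule presheaf_closed[OF psh op op])

lemma res_comp:
  "U \<in> \<F> \<Longrightarrow> V \<in> \<F> \<Longrightarrow> W \<in> \<F> \<Longrightarrow> W \<subseteq> V \<Longrightarrow> V \<subseteq> U \<Longrightarrow> s \<in> F U \<Longrightarrow> \<rho> V W (\<rho> U V s) = \<rho> U W s"
  by (rule presheaf_comp[OF psh op op op])

lemma res_id: "U \<in> \<F> \<Longrightarrow> s \<in> F U \<Longrightarrow> \<rho> U U s = s"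
  by (rule presheaf_id[OF psh op])

lemma gm_self: "U \<in> \<F> \<Longrightarrow> s \<in> F U \<Longrightarrow> (U, s) \<in> gm U s"
  unfolding germ_def by blast

text \<open>Transitivity of agreeing on a smaller open: the two witnesses \<open>W\<close> and
  \<open>W'\<close> are intersected. The inclusion is one half of an equality whose hypotheses are
  symmetric.\<close>

lemma gm_sub:
  assumes U: "U \<in> \<F>" "s \<in> F U" and V: "V \<in> \<F>" "t \<in> F V"
    and W: "W \<in> \<F>" "W \<subseteq> U" "W \<subseteq> V" and eq: "\<rho> U W s = \<rho> V W t"
  shows "gm U s \<subseteq> gm V t"
proof
  fix p assume "p \<in> gm U s"
  then obtain V' t' W' where p: "p = (V', t')" "V' \<in> \<F>" "t' \<in> F V'" and W': "W' \<in> \<F>" "W' \<subseteq> U" "W' \<subseteq> V'"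
    and eq': "\<rho> U W' s = \<rho> V' W' t'"
    unfolding germ_def by auto
  let ?W = "W \<inter> W'"
  have W'': "?W \<in> \<F>" using W W' Int by blast
  have "\<rho> V ?W t = \<rho> W ?W (\<rho> U W s)"
    unfolding eq using res_comp[OF V(1) W(1) W''] W V by auto
  also have "\<dots> = \<rho> W' ?W (\<rho> U W' s)"
    using res_comp[OF U(1) W(1) W''] res_comp[OF U(1) W'(1) W''] W W' U by auto
  also have "\<dots> = \<rho> V' ?W t'"
    unfolding eq' using res_comp[OF p(2) W'(1) W''] W' p by auto
  finally have "\<rho> V ?W t = \<rho> V' ?W t'" .
  moreover have "?W \<subseteq> V \<inter> V'"
    using W W' by auto
  ultimately have "\<exists>W\<in>\<F>. W \<subseteq> V \<inter> V' \<and> \<rho> V W t = \<rho> V' W t'"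
    using W'' by (intro bexI[of _ ?W] conjI)
  then show "p \<in> gm V t"
    by (simp only: germ_def p(1) mem_Collect_eq prod.case p(2,3) simp_thms)
qed

lemma gm_eqI:
  assumes "U \<in> \<F>" "s \<in> F U" "V \<in> \<F>" "t \<in> F V" "W \<in> \<F>" "W \<subseteq> U" "W \<subseteq> V" "\<rho> U W s = \<rho> V W t"
  shows "gm U s = gm V t"
  by (rule subset_antisym[OF gm_sub[OF assms] gm_sub[OF assms(3,4,1,2,5,7,6) assms(8)[symmetric]]])

lemma gm_memD:
  assumes "(V, t) \<in> gm U s"
  obtains W where "V \<in> \<F>" "t \<in> F V" "W \<in> \<F>" "W \<subseteq> U" "W \<subseteq> V" "\<rho> U W s = \<rho> V W t"
proof -
  from assms have "V \<in> \<F> \<and> t \<in> F V \<and> (\<exists>W\<in>\<F>. W \<subseteq> U \<inter> V \<and> \<rho> U W s = \<rho> V W t)"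
    by (simp add: germ_def)
  then show thesis
    by (elim conjE bexE) (rule that, simp_all)
qed

lemma gm_eqD:
  assumes "U \<in> \<F>" "s \<in> F U" "V \<in> \<F>" "t \<in> F V" "gm U s = gm V t"
  obtains W where "W \<in> \<F>" "W \<subseteq> U" "W \<subseteq> V" "\<rho> U W s = \<rho> V W t"
proof -
  have "(V, t) \<in> gm U s"
    using gm_self[OF assms(3,4)] assms(5) by simp
  then show thesis
    by (rule gm_memD) (rule that)
qed

lemma gm_res: "U \<in> \<F> \<Longrightarrow> s \<in> F U \<Longrightarrow> V \<in> \<F> \<Longrightarrow> V \<subseteq> U \<Longrightarrow> gm V (\<rho> U V s) = gm U s"
  by (rule gm_eqI[of _ _ _ _ V]) (auto simp: res_closed res_id)

text \<open>\<open>lim_map\<close> takes the only element of an image, so it is meaningful when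
  \<open>h\<close> is constant on the germ. Two representatives agree on a smaller open, hence
  invariance of \<open>h\<close> under restriction gives this.\<close>

lemma lim_map_gm:
  assumes "U \<in> \<F>" "s \<in> F U"
    and "\<And>V W t. V \<in> \<F> \<Longrightarrow> W \<in> \<F> \<Longrightarrow> W \<subseteq> V \<Longrightarrow> t \<in> F V \<Longrightarrow> h W (\<rho> V W t) = h V t"
  shows "lim_map h (gm U s) = h U s"
proof -
  have "h V t = h U s" if "(V, t) \<in> gm U s" for V t
  proof -
    from that obtain W where W: "V \<in> \<F>" "t \<in> F V" "W \<in> \<F>" "W \<subseteq> U" "W \<subseteq> V" "\<rho> U W s = \<rho> V W t"
      by (rule gm_memD)
    have "h V t = h W (\<rho> V W t)"
      by (rule assms(3)[symmetric]) (use W in simp_all)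
    also have "\<dots> = h U s"
      unfolding W(6)[symmetric] by (rule assms(3)) (use W assms in simp_all)
    finally show ?thesis .
  qed
  then have "(\<lambda>(V, t). h V t) ` gm U s \<subseteq> {h U s}"
    by (simp add: image_subset_iff split_paired_all)
  moreover have "(\<lambda>(V, t). h V t) ` gm U s \<noteq> {}"
    using gm_self[OF assms(1,2)] by blast
  ultimately have "(\<lambda>(V, t). h V t) ` gm U s = {h U s}"
    by (simp add: subset_singleton_iff)
  then show ?thesis
    by (simp add: lim_map_def)
qed

end

text \<open>Three presheaves are allowed so that one argument covers addition and multiplication of
  germs of a ring, addition in a module, and scalar multiplication.\<close>

lemma lim_op:
  assumes dF: "direct_sys T F \<rho> \<F>" and dG: "direct_sys T G \<sigma> \<F>" and dH: "direct_sys T H \<tau> \<F>"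
    and cl: "\<And>V s t. V \<in> \<F> \<Longrightarrow> s \<in> F V \<Longrightarrow> t \<in> G V \<Longrightarrow> opr V s t \<in> H V"
    and nat: "\<And>V W s t. V \<in> \<F> \<Longrightarrow> W \<in> \<F> \<Longrightarrow> W \<subseteq> V \<Longrightarrow> s \<in> F V \<Longrightarrow> t \<in> G V \<Longrightarrow>
       \<tau> V W (opr V s t) = opr W (\<rho> V W s) (\<sigma> V W t)"
    and U: "U \<in> \<F>" "s \<in> F U" and V: "V \<in> \<F>" "t \<in> G V"
  shows "(\<Union>(U', s')\<in>germ F \<rho> \<F> U s. \<Union>(V', t')\<in>germ G \<sigma> \<F> V t.
      germ H \<tau> \<F> (U' \<inter> V') (opr (U' \<inter> V') (\<rho> U' (U' \<inter> V') s') (\<sigma> V' (U' \<inter> V') t'))) =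
    germ H \<tau> \<F> (U \<inter> V) (opr (U \<inter> V) (\<rho> U (U \<inter> V) s) (\<sigma> V (U \<inter> V) t))"
proof (rule Union_pairs_const)
  interpret F: direct_sys T F \<rho> \<F> by fact
  interpret G: direct_sys T G \<sigma> \<F> by fact
  interpret H: direct_sys T H \<tau> \<F> by fact
  show "F.gm U s \<noteq> {}" "G.gm V t \<noteq> {}"
    using F.gm_self[OF U] G.gm_self[OF V] by auto
  fix U' s' V' t'
  assume 1: "(U', s') \<in> F.gm U s" and 2: "(V', t') \<in> G.gm V t"
  from 1 obtain A where A: "U' \<in> \<F>" "s' \<in> F U'" "A \<in> \<F>" "A \<subseteq> U" "A \<subseteq> U'" "\<rho> U A s = \<rho> U' A s'"
    by (rule F.gm_memD)
  from 2 obtain B where B: "V' \<in> \<F>" "t' \<in> G V'" "B \<in> \<F>" "B \<subseteq> V" "B \<subseteq> V'" "\<sigma> V B t = \<sigma> V' B t'"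
    by (rule G.gm_memD)
  \<comment> \<open>Both changes of representative take place on \<open>?W\<close>, and naturality
    of the operation brings its two values there.\<close>
  let ?W = "A \<inter> B" and ?UV = "U \<inter> V" and ?UV' = "U' \<inter> V'"
  have W: "?W \<in> \<F>" and UV: "?UV \<in> \<F>" and UV': "?UV' \<in> \<F>"
    using A B U V F.Int by auto
  have a: "\<rho> ?UV ?W (\<rho> U ?UV s) = \<rho> U ?W s" "\<rho> ?UV' ?W (\<rho> U' ?UV' s') = \<rho> U' ?W s'"
    using A B U V by (auto intro!: F.res_comp W UV UV')
  have a': "\<rho> U ?W s = \<rho> U' ?W s'"
  proof -
    have "\<rho> U ?W s = \<rho> A ?W (\<rho> U A s)"
      by (rule F.res_comp[symmetric]) (use U A W in simp_all)
    also have "\<dots> = \<rho> U' ?W s'"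
      unfolding A(6) by (rule F.res_comp) (use U A W in simp_all)
    finally show ?thesis .
  qed
  have b: "\<sigma> ?UV ?W (\<sigma> V ?UV t) = \<sigma> V ?W t" "\<sigma> ?UV' ?W (\<sigma> V' ?UV' t') = \<sigma> V' ?W t'"
    using A B U V by (auto intro!: G.res_comp W UV UV')
  have b': "\<sigma> V ?W t = \<sigma> V' ?W t'"
  proof -
    have "\<sigma> V ?W t = \<sigma> B ?W (\<sigma> V B t)"
      by (rule G.res_comp[symmetric]) (use V B W in simp_all)
    also have "\<dots> = \<sigma> V' ?W t'"
      unfolding B(6) by (rule G.res_comp) (use V B W in simp_all)
    finally show ?thesis .
  qed
  have cF: "\<rho> U ?UV s \<in> F ?UV" "\<rho> U' ?UV' s' \<in> F ?UV'"
    using A U UV UV' by (auto intro!: F.res_closed)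
  have cG: "\<sigma> V ?UV t \<in> G ?UV" "\<sigma> V' ?UV' t' \<in> G ?UV'"
    using B V UV UV' by (auto intro!: G.res_closed)
  show "H.gm ?UV' (opr ?UV' (\<rho> U' ?UV' s') (\<sigma> V' ?UV' t')) = H.gm ?UV (opr ?UV (\<rho> U ?UV s) (\<sigma> V ?UV t))"
  proof (rule H.gm_eqI[OF UV' cl[OF UV' cF(2) cG(2)] UV cl[OF UV cF(1) cG(1)] W])
    show "\<tau> ?UV' ?W (opr ?UV' (\<rho> U' ?UV' s') (\<sigma> V' ?UV' t')) = \<tau> ?UV ?W (opr ?UV (\<rho> U ?UV s) (\<sigma> V ?UV t))"
    proof -
      have "?W \<subseteq> ?UV'" "?W \<subseteq> ?UV" using A B by auto
      with nat[OF UV' W _ cF(2) cG(2)] nat[OF UV W _ cF(1) cG(1)] show ?thesis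
        by (simp add: a a' b b')
    qed
  qed (use A B in auto)
qed

lemma lim_op_same:
  assumes dF: "direct_sys T F \<rho> \<F>" and dG: "direct_sys T G \<sigma> \<F>" and dH: "direct_sys T H \<tau> \<F>"
    and cl: "\<And>V s t. V \<in> \<F> \<Longrightarrow> s \<in> F V \<Longrightarrow> t \<in> G V \<Longrightarrow> opr V s t \<in> H V"
    and nat: "\<And>V W s t. V \<in> \<F> \<Longrightarrow> W \<in> \<F> \<Longrightarrow> W \<subseteq> V \<Longrightarrow> s \<in> F V \<Longrightarrow> t \<in> G V \<Longrightarrow>
       \<tau> V W (opr V s t) = opr W (\<rho> V W s) (\<sigma> V W t)"
    and U: "U \<in> \<F>" "s \<in> F U" "t \<in> G U"
  shows "(\<Union>(U', s')\<in>germ F \<rho> \<F> U s. \<Union>(V', t')\<in>germ G \<sigma> \<F> U t.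
      germ H \<tau> \<F> (U' \<inter> V') (opr (U' \<inter> V') (\<rho> U' (U' \<inter> V') s') (\<sigma> V' (U' \<inter> V') t'))) =
    germ H \<tau> \<F> U (opr U s t)"
  using lim_op[OF dF dG dH cl nat U(1,2) U(1,3)] direct_sys.res_id[OF dF U(1,2)] direct_sys.res_id[OF dG U(1,3)]
  by simp

section \<open>Operations on germs that are represented over a common open\<close>

lemma direct_sys_ring:
  assumes "ringed X" "\<And>V. V \<in> \<F> \<Longrightarrow> openin (topol X) V" "\<And>V W. V \<in> \<F> \<Longrightarrow> W \<in> \<F> \<Longrightarrow> V \<inter> W \<in> \<F>"
  shows "direct_sys (topol X) (\<lambda>V. carrier (ring_at X V)) (rres X) \<F>"
  using assms ringed_presheaf by (intro direct_sys.intro) auto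

lemma direct_sys_smod:
  assumes "is_smod X M" "\<And>V. V \<in> \<F> \<Longrightarrow> openin (topol X) V" "\<And>V W. V \<in> \<F> \<Longrightarrow> W \<in> \<F> \<Longrightarrow> V \<inter> W \<in> \<F>"
  shows "direct_sys (topol X) (\<lambda>V. carrier (sec M V)) (sres M) \<F>"
  using assms smod_presheaf by (intro direct_sys.intro) auto

lemma lim_ring_add:
  assumes X: "ringed X" and F: "\<And>V. V \<in> \<F> \<Longrightarrow> openin (topol X) V" "\<And>V W. V \<in> \<F> \<Longrightarrow> W \<in> \<F> \<Longrightarrow> V \<inter> W \<in> \<F>"
    and U: "U \<in> \<F>" "r \<in> carrier (ring_at X U)" "s \<in> carrier (ring_at X U)"
  shows "rgerm X \<F> U r \<oplus>\<^bsub>lim_ring X \<F>\<^esub> rgerm X \<F> U s = rgerm X \<F> U (r \<oplus>\<^bsub>ring_at X U\<^esub> s)"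
  unfolding lim_ring_def
  by (simp, rule lim_op_same[OF direct_sys_ring[OF X F] direct_sys_ring[OF X F] direct_sys_ring[OF X F]])
    (use X F U in \<open>auto intro!: ring.ring_simprules(1) cring.axioms(1) ringed_cring ring_hom_add[OF ringed_hom]\<close>)

lemma lim_ring_mult:
  assumes X: "ringed X" and F: "\<And>V. V \<in> \<F> \<Longrightarrow> openin (topol X) V" "\<And>V W. V \<in> \<F> \<Longrightarrow> W \<in> \<F> \<Longrightarrow> V \<inter> W \<in> \<F>"
    and U: "U \<in> \<F>" "r \<in> carrier (ring_at X U)" "s \<in> carrier (ring_at X U)"
  shows "rgerm X \<F> U r \<otimes>\<^bsub>lim_ring X \<F>\<^esub> rgerm X \<F> U s = rgerm X \<F> U (r \<otimes>\<^bsub>ring_at X U\<^esub> s)"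
  unfolding lim_ring_def
  by (simp, rule lim_op_same[OF direct_sys_ring[OF X F] direct_sys_ring[OF X F] direct_sys_ring[OF X F]])
    (use X F U in \<open>auto intro!: ring.ring_simprules(5) cring.axioms(1) ringed_cring ring_hom_mult[OF ringed_hom]\<close>)

lemma lim_ring_one:
  assumes X: "ringed X" and F: "\<And>V. V \<in> \<F> \<Longrightarrow> openin (topol X) V" "\<And>V W. V \<in> \<F> \<Longrightarrow> W \<in> \<F> \<Longrightarrow> V \<inter> W \<in> \<F>"
    and U: "U \<in> \<F>"
  shows "\<one>\<^bsub>lim_ring X \<F>\<^esub> = rgerm X \<F> U \<one>\<^bsub>ring_at X U\<^esub>"
proof -
  interpret direct_sys "topol X" "\<lambda>V. carrier (ring_at X V)" "rres X" \<F>
    by (rule direct_sys_ring[OF X F])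
  have ring: "ring (ring_at X V)" if "V \<in> \<F>" for V
    by (rule cring.axioms(1)[OF ringed_cring[OF X F(1)[OF that]]])
  have mem: "\<one>\<^bsub>ring_at X V\<^esub> \<in> carrier (ring_at X V)" if "V \<in> \<F>" for V
    by (rule ring.ring_simprules(6)[OF ring[OF that]])
  have res: "rres X V W \<one>\<^bsub>ring_at X V\<^esub> = \<one>\<^bsub>ring_at X W\<^esub>" if "V \<in> \<F>" "W \<in> \<F>" "W \<subseteq> V" for V W
    by (rule ring_hom_one[OF ringed_hom[OF X F(1)[OF that(1)] F(1)[OF that(2)] that(3)]])
  have "gm V \<one>\<^bsub>ring_at X V\<^esub> = gm U \<one>\<^bsub>ring_at X U\<^esub>" if V: "V \<in> \<F>" for V
  proof (rule gm_eqI[OF V mem[OF V] U mem[OF U] Int[OF V U]])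
    show "rres X V (V \<inter> U) \<one>\<^bsub>ring_at X V\<^esub> = rres X U (V \<inter> U) \<one>\<^bsub>ring_at X U\<^esub>"
      by (simp only: res[OF V Int[OF V U] Int_lower1] res[OF U Int[OF V U] Int_lower2])
  qed (rule Int_lower1 Int_lower2)+
  then have "(\<Union>V\<in>\<F>. gm V \<one>\<^bsub>ring_at X V\<^esub>) = gm U \<one>\<^bsub>ring_at X U\<^esub>"
    by (intro SUP_eq_const) (use U in blast)+
  then show ?thesis
    by (simp add: lim_ring_def)
qed

lemma lim_module_add:
  assumes M: "is_smod X M" and F: "\<And>V. V \<in> \<F> \<Longrightarrow> openin (topol X) V" "\<And>V W. V \<in> \<F> \<Longrightarrow> W \<in> \<F> \<Longrightarrow> V \<inter> W \<in> \<F>"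
    and U: "U \<in> \<F>" "s \<in> carrier (sec M U)" "t \<in> carrier (sec M U)"
  shows "mgerm M \<F> U s \<oplus>\<^bsub>lim_module X M \<F>\<^esub> mgerm M \<F> U t = mgerm M \<F> U (s \<oplus>\<^bsub>sec M U\<^esub> t)"
  unfolding lim_module_def
  by (simp, rule lim_op_same[OF direct_sys_smod[OF M F] direct_sys_smod[OF M F] direct_sys_smod[OF M F]])
    (use M F U in \<open>auto intro!: sres_add abelian_monoid.a_closed abelian_group.axioms(1) smod_group\<close>)

lemma lim_module_smult:
  assumes X: "ringed X" and M: "is_smod X M"
    and F: "\<And>V. V \<in> \<F> \<Longrightarrow> openin (topol X) V" "\<And>V W. V \<in> \<F> \<Longrightarrow> W \<in> \<F> \<Longrightarrow> V \<inter> W \<in> \<F>"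
    and U: "U \<in> \<F>" "r \<in> carrier (ring_at X U)" "t \<in> carrier (sec M U)"
  shows "rgerm X \<F> U r \<odot>\<^bsub>lim_module X M \<F>\<^esub> mgerm M \<F> U t = mgerm M \<F> U (r \<odot>\<^bsub>sec M U\<^esub> t)"
  unfolding lim_module_def
  by (simp, rule lim_op_same[OF direct_sys_ring[OF X F] direct_sys_smod[OF M F] direct_sys_smod[OF M F]])
    (use M F U in \<open>auto intro!: sres_smult module.smult_closed smod_module\<close>)

section \<open>Morphisms of modules on a diagram\<close>

context scheme_dia
begin

lemma dmap_app: "i \<in> Ob I \<Longrightarrow> op i W \<Longrightarrow> s \<in> carrier (dsec A i W) \<Longrightarrow> dmap I X A h i W s = h i W s"
  by (simp add: dmap_def)

lemma dmap_eqI: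
  assumes "\<And>i W s. i \<in> Ob I \<Longrightarrow> op i W \<Longrightarrow> s \<in> carrier (dsec A i W) \<Longrightarrow> h i W s = h' i W s"
  shows "dmap I X A h = dmap I X A h'"
  unfolding dmap_def by (intro restrict_ext) (use assms in simp)

lemma dmap_idem: "dmap I X A (dmap I X A h) = dmap I X A h"
  by (rule dmap_eqI) (simp add: dmap_app)

lemma Mod_homI:
  assumes "h = dmap I X A h"
    and "\<And>i W s. i \<in> Ob I \<Longrightarrow> op i W \<Longrightarrow> s \<in> carrier (dsec A i W) \<Longrightarrow> h i W s \<in> carrier (dsec B i W)"
    and "\<And>i W s t. i \<in> Ob I \<Longrightarrow> op i W \<Longrightarrow> s \<in> carrier (dsec A i W) \<Longrightarrow> t \<in> carrier (dsec A i W) \<Longrightarrow>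
       h i W (s \<oplus>\<^bsub>dsec A i W\<^esub> t) = h i W s \<oplus>\<^bsub>dsec B i W\<^esub> h i W t"
    and "\<And>i W r s. i \<in> Ob I \<Longrightarrow> op i W \<Longrightarrow> r \<in> carrier (ring_at (sp X i) W) \<Longrightarrow> s \<in> carrier (dsec A i W) \<Longrightarrow>
       h i W (r \<odot>\<^bsub>dsec A i W\<^esub> s) = r \<odot>\<^bsub>dsec B i W\<^esub> h i W s"
    and "\<And>i W W' s. i \<in> Ob I \<Longrightarrow> op i W \<Longrightarrow> op i W' \<Longrightarrow> W' \<subseteq> W \<Longrightarrow> s \<in> carrier (dsec A i W) \<Longrightarrow>
       h i W' (sres (fib A i) W W' s) = sres (fib B i) W W' (h i W s)"
    and "\<And>i \<phi> W s. \<phi> \<in> out I i \<Longrightarrow> op i W \<Longrightarrow> s \<in> carrier (dsec A i W) \<Longrightarrow>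
       h (tgt I \<phi>) (pb \<phi> W) (trn A \<phi> W s) = trn B \<phi> W (h i W s)"
  shows "h \<in> Mod_hom I X A B"
proof -
  have "smod_mor (sp X i) (fib A i) (fib B i) (h i)" if "i \<in> Ob I" for i
    unfolding smod_mor_def by (intro conjI ballI impI linear_mapI) (simp_all add: assms(2-5) that)
  moreover have "h (tgt I \<phi>) (pre (sp X (tgt I \<phi>)) (tr X \<phi>) W) (trn A \<phi> W s) = trn B \<phi> W (h (src I \<phi>) W s)"
    if "\<phi> \<in> Ar I" "op (src I \<phi>) W" "s \<in> carrier (dsec A (src I \<phi>) W)" for \<phi> W s
    using assms(6)[of \<phi> "src I \<phi>" W s] that by (simp add: out_iff pb_def)
  ultimately show ?thesis
    unfolding Mod_hom_def using assms(1) by (intro CollectI conjI ballI) simp_all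
qed

lemma Mod_homD:
  assumes "h \<in> Mod_hom I X A B"
  shows "h = dmap I X A h"
    and "\<And>i W s. i \<in> Ob I \<Longrightarrow> op i W \<Longrightarrow> s \<in> carrier (dsec A i W) \<Longrightarrow> h i W s \<in> carrier (dsec B i W)"
    and "\<And>i W s t. i \<in> Ob I \<Longrightarrow> op i W \<Longrightarrow> s \<in> carrier (dsec A i W) \<Longrightarrow> t \<in> carrier (dsec A i W) \<Longrightarrow>
       h i W (s \<oplus>\<^bsub>dsec A i W\<^esub> t) = h i W s \<oplus>\<^bsub>dsec B i W\<^esub> h i W t"
    and "\<And>i W r s. i \<in> Ob I \<Longrightarrow> op i W \<Longrightarrow> r \<in> carrier (ring_at (sp X i) W) \<Longrightarrow> s \<in> carrier (dsec A i W) \<Longrightarrow>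
       h i W (r \<odot>\<^bsub>dsec A i W\<^esub> s) = r \<odot>\<^bsub>dsec B i W\<^esub> h i W s"
    and "\<And>i W W' s. i \<in> Ob I \<Longrightarrow> op i W \<Longrightarrow> op i W' \<Longrightarrow> W' \<subseteq> W \<Longrightarrow> s \<in> carrier (dsec A i W) \<Longrightarrow>
       h i W' (sres (fib A i) W W' s) = sres (fib B i) W W' (h i W s)"
    and "\<And>i \<phi> W s. \<phi> \<in> out I i \<Longrightarrow> op i W \<Longrightarrow> s \<in> carrier (dsec A i W) \<Longrightarrow>
       h (tgt I \<phi>) (pb \<phi> W) (trn A \<phi> W s) = trn B \<phi> W (h i W s)"
proof -
  show "h = dmap I X A h" using assms unfolding Mod_hom_def by (elim CollectE conjE)
  have m: "smod_mor (sp X i) (fib A i) (fib B i) (h i)" if "i \<in> Ob I" for i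
    using assms that unfolding Mod_hom_def by simp
  note l = m[unfolded smod_mor_def, THEN conjunct1, rule_format, simplified]
  show "h i W s \<in> carrier (dsec B i W)" if "i \<in> Ob I" "op i W" "s \<in> carrier (dsec A i W)" for i W s
    using linear_map_closed[OF l] that by simp
  show "h i W (s \<oplus>\<^bsub>dsec A i W\<^esub> t) = h i W s \<oplus>\<^bsub>dsec B i W\<^esub> h i W t"
    if "i \<in> Ob I" "op i W" "s \<in> carrier (dsec A i W)" "t \<in> carrier (dsec A i W)" for i W s t
    using linear_map_add[OF l] that by simp
  show "h i W (r \<odot>\<^bsub>dsec A i W\<^esub> s) = r \<odot>\<^bsub>dsec B i W\<^esub> h i W s"
    if "i \<in> Ob I" "op i W" "r \<in> carrier (ring_at (sp X i) W)" "s \<in> carrier (dsec A i W)" for i W r s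
    using linear_map_smult[OF l] that by simp
  show "h i W' (sres (fib A i) W W' s) = sres (fib B i) W W' (h i W s)"
    if "i \<in> Ob I" "op i W" "op i W'" "W' \<subseteq> W" "s \<in> carrier (dsec A i W)" for i W W' s
    using m[OF that(1)] that unfolding smod_mor_def by simp
  show "h (tgt I \<phi>) (pb \<phi> W) (trn A \<phi> W s) = trn B \<phi> W (h i W s)"
    if "\<phi> \<in> out I i" "op i W" "s \<in> carrier (dsec A i W)" for i \<phi> W s
    using assms that unfolding Mod_hom_def by (auto simp: out_iff pb_def)
qed

text \<open>The inverse is taken pointwise, and a bijection reflects every law that it preserves.
  Closure of the source under its operations is assumed law by law, so that the source does not
  first have to be shown to be an object of \<open>Modules\<close>.\<close>

lemma bij_Mod_iso:
  assumes h: "h \<in> Mod_hom I X A B"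
    and bij: "\<And>i W. i \<in> Ob I \<Longrightarrow> op i W \<Longrightarrow> bij_betw (h i W) (carrier (dsec A i W)) (carrier (dsec B i W))"
    and add: "\<And>i W s t. i \<in> Ob I \<Longrightarrow> op i W \<Longrightarrow> s \<in> carrier (dsec A i W) \<Longrightarrow> t \<in> carrier (dsec A i W) \<Longrightarrow>
       s \<oplus>\<^bsub>dsec A i W\<^esub> t \<in> carrier (dsec A i W)"
    and smult: "\<And>i W r s. i \<in> Ob I \<Longrightarrow> op i W \<Longrightarrow> r \<in> carrier (ring_at (sp X i) W) \<Longrightarrow> s \<in> carrier (dsec A i W) \<Longrightarrow>
       r \<odot>\<^bsub>dsec A i W\<^esub> s \<in> carrier (dsec A i W)"
    and res: "\<And>i W W' s. i \<in> Ob I \<Longrightarrow> op i W \<Longrightarrow> op i W' \<Longrightarrow> W' \<subseteq> W \<Longrightarrow> s \<in> carrier (dsec A i W) \<Longrightarrow>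
       sres (fib A i) W W' s \<in> carrier (dsec A i W')"
    and trn: "\<And>i \<phi> W s. \<phi> \<in> out I i \<Longrightarrow> op i W \<Longrightarrow> s \<in> carrier (dsec A i W) \<Longrightarrow>
       trn A \<phi> W s \<in> carrier (dsec A (tgt I \<phi>) (pb \<phi> W))"
  shows "Mod_iso I X A B h"
proof -
  note hD = Mod_homD[OF h]
  define k where "k = dmap I X B (\<lambda>i W. inv_into (carrier (dsec A i W)) (h i W))"
  have k: "k i W t = inv_into (carrier (dsec A i W)) (h i W) t"
    if "i \<in> Ob I" "op i W" "t \<in> carrier (dsec B i W)" for i W t
    using that by (simp add: k_def dmap_app)
  have kc: "k i W t \<in> carrier (dsec A i W)" and hk: "h i W (k i W t) = t"
    if "i \<in> Ob I" "op i W" "t \<in> carrier (dsec B i W)" for i W t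
    using bij[OF that(1,2)] that
    by (simp_all add: k bij_betw_def inv_into_into f_inv_into_f)
  have kh: "k i W (h i W s) = s" if "i \<in> Ob I" "op i W" "s \<in> carrier (dsec A i W)" for i W s
    using bij[OF that(1,2)] that by (simp add: k hD(2) bij_betw_def)
  have kI: "k i W t = s" if "i \<in> Ob I" "op i W" "s \<in> carrier (dsec A i W)" "h i W s = t" for i W s t
    using kh[OF that(1-3)] that(4) by simp
  have "k \<in> Mod_hom I X B A"
  proof (rule Mod_homI)
    show "k = dmap I X B k" by (simp add: k_def dmap_idem)
  next
    fix i W s t assume "i \<in> Ob I" "op i W" "s \<in> carrier (dsec B i W)" "t \<in> carrier (dsec B i W)"
    then show "k i W (s \<oplus>\<^bsub>dsec B i W\<^esub> t) = k i W s \<oplus>\<^bsub>dsec A i W\<^esub> k i W t"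
      by (intro kI add) (simp_all add: hD(3) kc hk)
  next
    fix i W r s assume "i \<in> Ob I" "op i W" "r \<in> carrier (ring_at (sp X i) W)" "s \<in> carrier (dsec B i W)"
    then show "k i W (r \<odot>\<^bsub>dsec B i W\<^esub> s) = r \<odot>\<^bsub>dsec A i W\<^esub> k i W s"
      by (intro kI smult) (simp_all add: hD(4) kc hk)
  next
    fix i W W' s assume "i \<in> Ob I" "op i W" "op i W'" "W' \<subseteq> W" "s \<in> carrier (dsec B i W)"
    then show "k i W' (sres (fib B i) W W' s) = sres (fib A i) W W' (k i W s)"
      by (intro kI res) (simp_all add: hD(5) kc hk)
  next
    fix i \<phi> W s assume a: "\<phi> \<in> out I i" "op i W" "s \<in> carrier (dsec B i W)"
    have i: "i \<in> Ob I" by (rule out_Ob[OF a(1)])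
    show "k (tgt I \<phi>) (pb \<phi> W) (trn B \<phi> W s) = trn A \<phi> W (k i W s)"
      by (intro kI trn[OF a(1,2)] out_tgt[OF a(1)] pb_op[OF a(1,2)]) (use a in \<open>simp_all add: i kc hk hD(6)\<close>)
  qed (rule kc)
  moreover have "Mod_comp I X A k h = Mod_id I X A" "Mod_comp I X B h k = Mod_id I X B"
    unfolding Mod_comp_def Mod_id_def by (rule dmap_eqI, simp add: kh hk)+
  ultimately show ?thesis
    unfolding Mod_iso_def using h by blast
qed

section \<open>Sections of the sheaf Hom\<close>

text \<open>Normal form of a section of the sheaf Hom: values outside the index sets and the
  carriers are made undefined. All operations of \<open>sheaf_Hom\<close> are brought to this form,
  so that equality becomes equality of the values that matter.\<close>

definition hom_of ::
  "('i, 'f, 'p, 'r, 'm) dmod \<Rightarrow> 'i \<Rightarrow> 'p set \<Rightarrow> ('f \<Rightarrow> 'p set \<Rightarrow> 'm \<Rightarrow> 'n) \<Rightarrow> 'f \<Rightarrow> 'p set \<Rightarrow> 'm \<Rightarrow> 'n" where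
  "hom_of M i W h = (\<lambda>\<phi>\<in>out I i. \<lambda>W'\<in>below I X \<phi> W. \<lambda>s\<in>carrier (dsec M (tgt I \<phi>) W'). h \<phi> W' s)"

lemma hom_of_app:
  "\<phi> \<in> out I i \<Longrightarrow> W' \<in> below I X \<phi> W \<Longrightarrow> s \<in> carrier (dsec M (tgt I \<phi>) W') \<Longrightarrow> hom_of M i W h \<phi> W' s = h \<phi> W' s"
  by (simp add: hom_of_def)

lemma hom_of_cong:
  assumes "\<And>\<phi> W' s. \<phi> \<in> out I i \<Longrightarrow> W' \<in> below I X \<phi> W \<Longrightarrow> s \<in> carrier (dsec M (tgt I \<phi>) W') \<Longrightarrow> h \<phi> W' s = h' \<phi> W' s"
  shows "hom_of M i W h = hom_of M i W h'"
  unfolding hom_of_def by (intro restrict_ext) (simp add: assms)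

lemma hom_sectionsD:
  assumes "\<eta> \<in> hom_sections I X M N i W"
  shows "\<eta> = hom_of M i W \<eta>"
    and "\<And>\<phi> W'. \<phi> \<in> out I i \<Longrightarrow> W' \<in> below I X \<phi> W \<Longrightarrow>
       linear_map (ring_at (sp X (tgt I \<phi>)) W') (dsec M (tgt I \<phi>) W') (dsec N (tgt I \<phi>) W') (\<eta> \<phi> W')"
    and "\<And>\<phi> W' \<psi> W'' s. \<phi> \<in> out I i \<Longrightarrow> W' \<in> below I X \<phi> W \<Longrightarrow> \<psi> \<in> out I (tgt I \<phi>) \<Longrightarrow> W'' \<in> below I X \<psi> W' \<Longrightarrow>
       s \<in> carrier (dsec M (tgt I \<phi>) W') \<Longrightarrow>
       \<eta> (cmp I \<psi> \<phi>) W'' (site_res I X M \<psi> W' W'' s) = site_res I X N \<psi> W' W'' (\<eta> \<phi> W' s)"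
proof -
  have e: "\<eta> \<in> (\<Pi>\<^sub>E \<phi>\<in>out I i. \<Pi>\<^sub>E W'\<in>below I X \<phi> W.
          {h \<in> carrier (dsec M (tgt I \<phi>) W') \<rightarrow>\<^sub>E carrier (dsec N (tgt I \<phi>) W').
             linear_map (ring_at (sp X (tgt I \<phi>)) W') (dsec M (tgt I \<phi>) W') (dsec N (tgt I \<phi>) W') h})"
    and c: "\<forall>\<phi>\<in>out I i. \<forall>W'\<in>below I X \<phi> W. \<forall>\<psi>\<in>out I (tgt I \<phi>). \<forall>W''\<in>below I X \<psi> W'.
         \<forall>s\<in>carrier (dsec M (tgt I \<phi>) W').
           \<eta> (cmp I \<psi> \<phi>) W'' (site_res I X M \<psi> W' W'' s) = site_res I X N \<psi> W' W'' (\<eta> \<phi> W' s)"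
    using assms unfolding hom_sections_def mem_Collect_eq by (rule conjunct1, rule conjunct2)
  note e1 = PiE_mem[OF e]
  show "\<eta> = hom_of M i W \<eta>"
    unfolding hom_of_def
  proof (intro ext)
    fix \<phi> W' s
    show "\<eta> \<phi> W' s = (\<lambda>\<phi>\<in>out I i. \<lambda>W'\<in>below I X \<phi> W. \<lambda>s\<in>carrier (dsec M (tgt I \<phi>) W'). \<eta> \<phi> W' s) \<phi> W' s"
    proof (cases "\<phi> \<in> out I i")
      case True
      note e2 = PiE_mem[OF e1[OF True]]
      show ?thesis
      proof (cases "W' \<in> below I X \<phi> W")
        case True
        then show ?thesis
          using e2[OF True] \<open>\<phi> \<in> out I i\<close> by (auto simp: PiE_def extensional_def)
      next
        case False
        then show ?thesis
          using PiE_arb[OF e1[OF True] False] True by simp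
      qed
    next
      case False
      then show ?thesis
        using PiE_arb[OF e False] by simp
    qed
  qed
  show "linear_map (ring_at (sp X (tgt I \<phi>)) W') (dsec M (tgt I \<phi>) W') (dsec N (tgt I \<phi>) W') (\<eta> \<phi> W')"
    if "\<phi> \<in> out I i" "W' \<in> below I X \<phi> W" for \<phi> W'
    using PiE_mem[OF e1[OF that(1)] that(2)] by simp
  show "\<eta> (cmp I \<psi> \<phi>) W'' (site_res I X M \<psi> W' W'' s) = site_res I X N \<psi> W' W'' (\<eta> \<phi> W' s)"
    if "\<phi> \<in> out I i" "W' \<in> below I X \<phi> W" "\<psi> \<in> out I (tgt I \<phi>)" "W'' \<in> below I X \<psi> W'"
      "s \<in> carrier (dsec M (tgt I \<phi>) W')" for \<phi> W' \<psi> W'' s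
    using c that by blast
qed

text \<open>Closure of the carriers is assumed rather than derived from membership in
  \<open>Modules\<close>, because the rule is also applied to \<open>restr\<close> and
  \<open>push_restr\<close>, for which only these closure facts are established.\<close>

lemma hom_sectionsI:
  assumes lin: "\<And>\<phi> W'. \<phi> \<in> out I i \<Longrightarrow> W' \<in> below I X \<phi> W \<Longrightarrow>
       linear_map (ring_at (sp X (tgt I \<phi>)) W') (dsec M (tgt I \<phi>) W') (dsec N (tgt I \<phi>) W') (h \<phi> W')"
    and add: "\<And>\<phi> W' s t. \<phi> \<in> out I i \<Longrightarrow> W' \<in> below I X \<phi> W \<Longrightarrow> s \<in> carrier (dsec M (tgt I \<phi>) W') \<Longrightarrow>
       t \<in> carrier (dsec M (tgt I \<phi>) W') \<Longrightarrow> s \<oplus>\<^bsub>dsec M (tgt I \<phi>) W'\<^esub> t \<in> carrier (dsec M (tgt I \<phi>) W')"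
    and smult: "\<And>\<phi> W' r t. \<phi> \<in> out I i \<Longrightarrow> W' \<in> below I X \<phi> W \<Longrightarrow> r \<in> carrier (ring_at (sp X (tgt I \<phi>)) W') \<Longrightarrow>
       t \<in> carrier (dsec M (tgt I \<phi>) W') \<Longrightarrow> r \<odot>\<^bsub>dsec M (tgt I \<phi>) W'\<^esub> t \<in> carrier (dsec M (tgt I \<phi>) W')"
    and cl: "\<And>\<phi> W' \<psi> W'' s. \<phi> \<in> out I i \<Longrightarrow> W' \<in> below I X \<phi> W \<Longrightarrow> \<psi> \<in> out I (tgt I \<phi>) \<Longrightarrow> W'' \<in> below I X \<psi> W' \<Longrightarrow>
       s \<in> carrier (dsec M (tgt I \<phi>) W') \<Longrightarrow> site_res I X M \<psi> W' W'' s \<in> carrier (dsec M (tgt I \<psi>) W'')"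
    and cmp: "\<And>\<phi> W' \<psi> W'' s. \<phi> \<in> out I i \<Longrightarrow> W' \<in> below I X \<phi> W \<Longrightarrow> \<psi> \<in> out I (tgt I \<phi>) \<Longrightarrow> W'' \<in> below I X \<psi> W' \<Longrightarrow>
       s \<in> carrier (dsec M (tgt I \<phi>) W') \<Longrightarrow>
       h (cmp I \<psi> \<phi>) W'' (site_res I X M \<psi> W' W'' s) = site_res I X N \<psi> W' W'' (h \<phi> W' s)"
  shows "hom_of M i W h \<in> hom_sections I X M N i W"
proof -
  have "(\<lambda>s\<in>carrier (dsec M (tgt I \<phi>) W'). h \<phi> W' s) \<in> {h \<in> carrier (dsec M (tgt I \<phi>) W') \<rightarrow>\<^sub>E carrier (dsec N (tgt I \<phi>) W').
             linear_map (ring_at (sp X (tgt I \<phi>)) W') (dsec M (tgt I \<phi>) W') (dsec N (tgt I \<phi>) W') h}"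
    if "\<phi> \<in> out I i" "W' \<in> below I X \<phi> W" for \<phi> W'
    using lin[OF that] add[OF that] smult[OF that] by (auto simp: linear_map_def)
  then have "hom_of M i W h \<in> (\<Pi>\<^sub>E \<phi>\<in>out I i. \<Pi>\<^sub>E W'\<in>below I X \<phi> W.
          {h \<in> carrier (dsec M (tgt I \<phi>) W') \<rightarrow>\<^sub>E carrier (dsec N (tgt I \<phi>) W').
             linear_map (ring_at (sp X (tgt I \<phi>)) W') (dsec M (tgt I \<phi>) W') (dsec N (tgt I \<phi>) W') h})"
    unfolding hom_of_def by (intro restrict_PiE_iff[THEN iffD2] ballI)
  moreover have "hom_of M i W h (cmp I \<psi> \<phi>) W'' (site_res I X M \<psi> W' W'' s) = site_res I X N \<psi> W' W'' (hom_of M i W h \<phi> W' s)"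
    if a: "\<phi> \<in> out I i" "W' \<in> below I X \<phi> W" "\<psi> \<in> out I (tgt I \<phi>)" "W'' \<in> below I X \<psi> W'"
      "s \<in> carrier (dsec M (tgt I \<phi>) W')" for \<phi> W' \<psi> W'' s
    using cmp[OF a] cl[OF a] cmp_out[OF a(1,3)] below_cmp[OF a(1,3,2,4)] a tgt_cmp[OF a(1,3)] by (simp add: hom_of_app)
  ultimately show ?thesis
    unfolding hom_sections_def by blast
qed

lemma hom_sections_eqI:
  assumes "\<eta> \<in> hom_sections I X M N i W" "\<theta> \<in> hom_sections I X M N i W"
    and "\<And>\<phi> W' s. \<phi> \<in> out I i \<Longrightarrow> W' \<in> below I X \<phi> W \<Longrightarrow> s \<in> carrier (dsec M (tgt I \<phi>) W') \<Longrightarrow> \<eta> \<phi> W' s = \<theta> \<phi> W' s"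
  shows "\<eta> = \<theta>"
proof -
  have "\<eta> = hom_of M i W \<eta>" by (rule hom_sectionsD(1)[OF assms(1)])
  also have "\<dots> = hom_of M i W \<theta>" by (rule hom_of_cong) (rule assms(3))
  also have "\<dots> = \<theta>" by (rule hom_sectionsD(1)[OF assms(2), symmetric])
  finally show ?thesis .
qed

lemma hom_closed:
  "\<eta> \<in> hom_sections I X M N i W \<Longrightarrow> \<phi> \<in> out I i \<Longrightarrow> W' \<in> below I X \<phi> W \<Longrightarrow> s \<in> carrier (dsec M (tgt I \<phi>) W') \<Longrightarrow>
   \<eta> \<phi> W' s \<in> carrier (dsec N (tgt I \<phi>) W')"
  by (rule linear_map_closed[OF hom_sectionsD(2)])

lemma sheaf_Hom_simps:
  "carrier (dsec (sheaf_Hom I X M N) i W) = hom_sections I X M N i W"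
  "\<zero>\<^bsub>dsec (sheaf_Hom I X M N) i W\<^esub> = hom_of M i W (\<lambda>\<phi> W' s. \<zero>\<^bsub>dsec N (tgt I \<phi>) W'\<^esub>)"
  "\<eta> \<oplus>\<^bsub>dsec (sheaf_Hom I X M N) i W\<^esub> \<theta> = hom_of M i W (\<lambda>\<phi> W' s. \<eta> \<phi> W' s \<oplus>\<^bsub>dsec N (tgt I \<phi>) W'\<^esub> \<theta> \<phi> W' s)"
  "r \<odot>\<^bsub>dsec (sheaf_Hom I X M N) i W\<^esub> \<eta> = hom_of M i W (\<lambda>\<phi> W' s. rsr \<phi> W W' r \<odot>\<^bsub>dsec N (tgt I \<phi>) W'\<^esub> \<eta> \<phi> W' s)"
  "sres (fib (sheaf_Hom I X M N) i) W W1 \<eta> = (\<lambda>\<phi>\<in>out I i. \<lambda>W'\<in>below I X \<phi> W1. \<eta> \<phi> W')"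
  "trn (sheaf_Hom I X M N) \<phi> W \<eta> = (\<lambda>\<psi>\<in>out I (tgt I \<phi>). \<lambda>W'\<in>below I X \<psi> (pb \<phi> W). \<eta> (cmp I \<psi> \<phi>) W')"
  by (simp_all add: sheaf_Hom_def hom_of_def rsr_def pb_def)

lemma hom_undefined:
  assumes "\<eta> \<in> hom_sections I X M N i W" "\<phi> \<in> out I i" "W' \<in> below I X \<phi> W" "s \<notin> carrier (dsec M (tgt I \<phi>) W')"
  shows "\<eta> \<phi> W' s = undefined"
proof -
  have "\<eta> \<phi> W' s = hom_of M i W \<eta> \<phi> W' s"
    by (rule hom_sectionsD(1)[OF assms(1), THEN fun_cong, THEN fun_cong, THEN fun_cong])
  also have "\<dots> = undefined"
    using assms(2-4) by (simp add: hom_of_def)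
  finally show ?thesis .
qed

text \<open>Restricting a Hom section cuts down the index sets only. The arguments need no cut,
  since a section is already undefined off the carriers.\<close>

lemma hom_restrict:
  assumes "\<eta> \<in> hom_sections I X M N i W" "W1 \<subseteq> W"
  shows "(\<lambda>\<phi>\<in>out I i. \<lambda>W'\<in>below I X \<phi> W1. \<eta> \<phi> W') = hom_of M i W1 \<eta>"
  unfolding hom_of_def
proof (intro restrict_ext ext)
  fix \<phi> W' s assume "\<phi> \<in> out I i" "W' \<in> below I X \<phi> W1"
  then show "\<eta> \<phi> W' s = (\<lambda>s\<in>carrier (dsec M (tgt I \<phi>) W'). \<eta> \<phi> W' s) s"
    using hom_undefined[OF assms(1), of \<phi> W' s] below_mono[OF assms(2), of W' \<phi>] by (simp add: restrict_def)
qed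

lemma below_trn: "\<phi> \<in> out I i \<Longrightarrow> \<psi> \<in> out I (tgt I \<phi>) \<Longrightarrow> W' \<in> below I X \<psi> (pb \<phi> W) \<Longrightarrow> W' \<in> below I X (cmp I \<psi> \<phi>) W"
  by (simp add: below_iff tgt_cmp pb_cmp)

lemma hom_trn:
  assumes "\<eta> \<in> hom_sections I X M N i W" "\<phi> \<in> out I i"
  shows "(\<lambda>\<psi>\<in>out I (tgt I \<phi>). \<lambda>W'\<in>below I X \<psi> (pb \<phi> W). \<eta> (cmp I \<psi> \<phi>) W') = hom_of M (tgt I \<phi>) (pb \<phi> W) (\<lambda>\<psi>. \<eta> (cmp I \<psi> \<phi>))"
  unfolding hom_of_def
proof (intro restrict_ext ext)
  fix \<psi> W' s assume "\<psi> \<in> out I (tgt I \<phi>)" "W' \<in> below I X \<psi> (pb \<phi> W)"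
  then show "\<eta> (cmp I \<psi> \<phi>) W' s = (\<lambda>s\<in>carrier (dsec M (tgt I \<psi>) W'). \<eta> (cmp I \<psi> \<phi>) W' s) s"
    using hom_undefined[OF assms(1) cmp_out[OF assms(2)], of \<psi> W' s] below_trn[OF assms(2)]
    by (simp add: restrict_def tgt_cmp[OF assms(2)])
qed

end

context dia_module
begin

lemma sec_add_closed:
  "i \<in> Ob I \<Longrightarrow> op i W \<Longrightarrow> s \<in> carrier (dsec M i W) \<Longrightarrow> t \<in> carrier (dsec M i W) \<Longrightarrow> s \<oplus>\<^bsub>dsec M i W\<^esub> t \<in> carrier (dsec M i W)"
  by (rule abelian_monoid.a_closed[OF abelian_group.axioms(1)[OF sec_group]])

lemma sec_zero_closed: "i \<in> Ob I \<Longrightarrow> op i W \<Longrightarrow> \<zero>\<^bsub>dsec M i W\<^esub> \<in> carrier (dsec M i W)"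
  by (rule abelian_monoid.zero_closed[OF abelian_group.axioms(1)[OF sec_group]])

lemma sec_smult_closed:
  "i \<in> Ob I \<Longrightarrow> op i W \<Longrightarrow> r \<in> carrier (ring_at (sp X i) W) \<Longrightarrow> t \<in> carrier (dsec M i W) \<Longrightarrow> r \<odot>\<^bsub>dsec M i W\<^esub> t \<in> carrier (dsec M i W)"
  by (rule module.smult_closed[OF sec_module])

lemma hom_sectionsI':
  assumes lin: "\<And>\<phi> W'. \<phi> \<in> out I i \<Longrightarrow> W' \<in> below I X \<phi> W \<Longrightarrow>
       linear_map (ring_at (sp X (tgt I \<phi>)) W') (dsec M (tgt I \<phi>) W') (dsec N (tgt I \<phi>) W') (h \<phi> W')"
    and cmp: "\<And>\<phi> W' \<psi> W'' s. \<phi> \<in> out I i \<Longrightarrow> W' \<in> below I X \<phi> W \<Longrightarrow> \<psi> \<in> out I (tgt I \<phi>) \<Longrightarrow> W'' \<in> below I X \<psi> W' \<Longrightarrow>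
       s \<in> carrier (dsec M (tgt I \<phi>) W') \<Longrightarrow>
       h (cmp I \<psi> \<phi>) W'' (site_res I X M \<psi> W' W'' s) = site_res I X N \<psi> W' W'' (h \<phi> W' s)"
  shows "hom_of M i W h \<in> hom_sections I X M N i W"
  by (rule hom_sectionsI[OF lin _ _ _ cmp])
    (simp_all add: sec_add_closed sec_smult_closed out_tgt below_op sr_closed)

end

section \<open>Restrictions, sums, multiples and transition maps of Hom sections\<close>

locale hom_modules = M: dia_module I X M + N: dia_module I X N
  for I :: "('i, 'f) cat" and X :: "('i, 'f, 'p, 'r) diagram"
    and M :: "('i, 'f, 'p, 'r, 'm) dmod" and N :: "('i, 'f, 'p, 'r, 'n) dmod"
begin

text \<open>This is the compatibility condition of a Hom section at the identity arrow of the target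
  of \<open>\<phi>\<close>.\<close>

lemma hom_sres:
  assumes \<eta>: "\<eta> \<in> hom_sections I X M N i W" and \<phi>: "\<phi> \<in> out I i" and W': "W' \<in> below I X \<phi> W"
    and W'': "M.op (tgt I \<phi>) W''" "W'' \<subseteq> W'" and s: "s \<in> carrier (dsec M (tgt I \<phi>) W')"
  shows "\<eta> \<phi> W'' (sres (fib M (tgt I \<phi>)) W' W'' s) = sres (fib N (tgt I \<phi>)) W' W'' (\<eta> \<phi> W' s)"
proof -
  have j: "tgt I \<phi> \<in> Ob I" by (rule M.out_tgt[OF \<phi>])
  have oW': "M.op (tgt I \<phi>) W'" by (rule M.below_op[OF W'])
  have "W'' \<in> below I X (idt I (tgt I \<phi>)) W'"
    using W'' by (simp add: M.below_idt[OF j oW'])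
  from M.hom_sectionsD(3)[OF \<eta> \<phi> W' M.idt_out[OF j] this s] show ?thesis
    by (simp add: M.idt_cmp[OF \<phi>] M.sr_idt[OF j oW' s] N.sr_idt[OF j oW' M.hom_closed[OF \<eta> \<phi> W' s]])
qed

lemma hom_restrict_mem:
  assumes \<eta>: "\<eta> \<in> hom_sections I X M N i W" and W1: "W1 \<subseteq> W"
  shows "M.hom_of M i W1 \<eta> \<in> hom_sections I X M N i W1"
  by (rule M.hom_sectionsI')
    (use M.hom_sectionsD(2,3)[OF \<eta>] M.below_mono[OF W1] in blast)+

lemma hom_add_mem:
  assumes \<eta>: "\<eta> \<in> hom_sections I X M N i W" and \<theta>: "\<theta> \<in> hom_sections I X M N i W"
  shows "M.hom_of M i W (\<lambda>\<phi> W' s. \<eta> \<phi> W' s \<oplus>\<^bsub>dsec N (tgt I \<phi>) W'\<^esub> \<theta> \<phi> W' s) \<in> hom_sections I X M N i W"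
proof (rule M.hom_sectionsI')
  fix \<phi> W' assume a: "\<phi> \<in> out I i" "W' \<in> below I X \<phi> W"
  note l = M.hom_sectionsD(2)[OF \<eta> a] M.hom_sectionsD(2)[OF \<theta> a]
  interpret N: module "ring_at (sp X (tgt I \<phi>)) W'" "dsec N (tgt I \<phi>) W'"
    by (rule N.sec_module[OF M.out_tgt[OF a(1)] M.below_op[OF a(2)]])
  show "linear_map (ring_at (sp X (tgt I \<phi>)) W') (dsec M (tgt I \<phi>) W') (dsec N (tgt I \<phi>) W')
      (\<lambda>s. \<eta> \<phi> W' s \<oplus>\<^bsub>dsec N (tgt I \<phi>) W'\<^esub> \<theta> \<phi> W' s)"
    by (rule linear_mapI)
      (simp_all add: linear_map_closed[OF l(1)] linear_map_closed[OF l(2)] linear_map_add[OF l(1)] linear_map_add[OF l(2)]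
        linear_map_smult[OF l(1)] linear_map_smult[OF l(2)] N.smult_r_distr N.M.a_ac)
next
  fix \<phi> W' \<psi> W'' s
  assume a: "\<phi> \<in> out I i" "W' \<in> below I X \<phi> W" "\<psi> \<in> out I (tgt I \<phi>)" "W'' \<in> below I X \<psi> W'" "s \<in> carrier (dsec M (tgt I \<phi>) W')"
  show "\<eta> (cmp I \<psi> \<phi>) W'' (M.sr \<psi> W' W'' s) \<oplus>\<^bsub>dsec N (tgt I (cmp I \<psi> \<phi>)) W''\<^esub> \<theta> (cmp I \<psi> \<phi>) W'' (M.sr \<psi> W' W'' s)
      = N.sr \<psi> W' W'' (\<eta> \<phi> W' s \<oplus>\<^bsub>dsec N (tgt I \<phi>) W'\<^esub> \<theta> \<phi> W' s)"
    by (simp add: M.hom_sectionsD(3)[OF \<eta> a] M.hom_sectionsD(3)[OF \<theta> a] M.tgt_cmp[OF a(1,3)]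
        N.sr_add[OF a(3) M.below_op[OF a(2)] a(4) M.hom_closed[OF \<eta> a(1,2,5)] M.hom_closed[OF \<theta> a(1,2,5)]])
qed

text \<open>A multiple of a linear map is linear because the rings of sections are commutative, and
  it is compatible along \<open>\<psi>\<close> because scalars restrict functorially by
  \<open>rsr_cmp\<close>.\<close>

lemma hom_smult_mem:
  assumes \<eta>: "\<eta> \<in> hom_sections I X M N i W" and W: "M.op i W" and r: "r \<in> carrier (ring_at (sp X i) W)"
  shows "M.hom_of M i W (\<lambda>\<phi> W' s. M.rsr \<phi> W W' r \<odot>\<^bsub>dsec N (tgt I \<phi>) W'\<^esub> \<eta> \<phi> W' s) \<in> hom_sections I X M N i W"
proof (rule M.hom_sectionsI')
  fix \<phi> W' assume a: "\<phi> \<in> out I i" "W' \<in> below I X \<phi> W"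
  note l = M.hom_sectionsD(2)[OF \<eta> a]
  interpret N: module "ring_at (sp X (tgt I \<phi>)) W'" "dsec N (tgt I \<phi>) W'"
    by (rule N.sec_module[OF M.out_tgt[OF a(1)] M.below_op[OF a(2)]])
  note r' = M.rsr_closed[OF a(1) W a(2) r]
  show "linear_map (ring_at (sp X (tgt I \<phi>)) W') (dsec M (tgt I \<phi>) W') (dsec N (tgt I \<phi>) W')
      (\<lambda>s. M.rsr \<phi> W W' r \<odot>\<^bsub>dsec N (tgt I \<phi>) W'\<^esub> \<eta> \<phi> W' s)"
  proof (rule linear_mapI)
    fix q s assume q: "q \<in> carrier (ring_at (sp X (tgt I \<phi>)) W')" and s: "s \<in> carrier (dsec M (tgt I \<phi>) W')"
    have e: "\<eta> \<phi> W' s \<in> carrier (dsec N (tgt I \<phi>) W')" by (rule linear_map_closed[OF l s])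
    have "M.rsr \<phi> W W' r \<odot>\<^bsub>dsec N (tgt I \<phi>) W'\<^esub> (q \<odot>\<^bsub>dsec N (tgt I \<phi>) W'\<^esub> \<eta> \<phi> W' s) =
        (M.rsr \<phi> W W' r \<otimes>\<^bsub>ring_at (sp X (tgt I \<phi>)) W'\<^esub> q) \<odot>\<^bsub>dsec N (tgt I \<phi>) W'\<^esub> \<eta> \<phi> W' s"
      by (rule N.smult_assoc1[OF r' q e, symmetric])
    also have "\<dots> = q \<odot>\<^bsub>dsec N (tgt I \<phi>) W'\<^esub> (M.rsr \<phi> W W' r \<odot>\<^bsub>dsec N (tgt I \<phi>) W'\<^esub> \<eta> \<phi> W' s)"
      unfolding N.R.m_comm[OF r' q] by (rule N.smult_assoc1[OF q r' e])
    finally show "M.rsr \<phi> W W' r \<odot>\<^bsub>dsec N (tgt I \<phi>) W'\<^esub> \<eta> \<phi> W' (q \<odot>\<^bsub>dsec M (tgt I \<phi>) W'\<^esub> s) =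
        q \<odot>\<^bsub>dsec N (tgt I \<phi>) W'\<^esub> (M.rsr \<phi> W W' r \<odot>\<^bsub>dsec N (tgt I \<phi>) W'\<^esub> \<eta> \<phi> W' s)"
      by (simp only: linear_map_smult[OF l q s])
  qed (simp_all add: linear_map_closed[OF l] linear_map_add[OF l] N.smult_r_distr r')
next
  fix \<phi> W' \<psi> W'' s
  assume a: "\<phi> \<in> out I i" "W' \<in> below I X \<phi> W" "\<psi> \<in> out I (tgt I \<phi>)" "W'' \<in> below I X \<psi> W'" "s \<in> carrier (dsec M (tgt I \<phi>) W')"
  show "M.rsr (cmp I \<psi> \<phi>) W W'' r \<odot>\<^bsub>dsec N (tgt I (cmp I \<psi> \<phi>)) W''\<^esub> \<eta> (cmp I \<psi> \<phi>) W'' (M.sr \<psi> W' W'' s)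
      = N.sr \<psi> W' W'' (M.rsr \<phi> W W' r \<odot>\<^bsub>dsec N (tgt I \<phi>) W'\<^esub> \<eta> \<phi> W' s)"
    by (simp add: M.hom_sectionsD(3)[OF \<eta> a] M.tgt_cmp[OF a(1,3)] M.rsr_cmp[OF a(1,3) W a(2,4) r]
        N.sr_smult[OF a(3) M.below_op[OF a(2)] a(4) M.rsr_closed[OF a(1) W a(2) r] M.hom_closed[OF \<eta> a(1,2,5)]])
qed

text \<open>Associativity turns the compatibility condition over the target of \<open>\<phi>\<close>
  into that of \<open>\<eta>\<close> at the composites with \<open>\<phi>\<close>.\<close>

lemma hom_trn_mem:
  assumes \<eta>: "\<eta> \<in> hom_sections I X M N i W" and \<phi>: "\<phi> \<in> out I i"
  shows "M.hom_of M (tgt I \<phi>) (M.pb \<phi> W) (\<lambda>\<psi>. \<eta> (cmp I \<psi> \<phi>)) \<in> hom_sections I X M N (tgt I \<phi>) (M.pb \<phi> W)"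
proof -
  have b: "W' \<in> below I X (cmp I \<psi> \<phi>) W" if "\<psi> \<in> out I (tgt I \<phi>)" "W' \<in> below I X \<psi> (M.pb \<phi> W)" for \<psi> W'
    using that by (simp add: M.below_iff M.tgt_cmp[OF \<phi>] M.pb_cmp[OF \<phi>])
  show ?thesis
  proof (rule M.hom_sectionsI')
    fix \<psi> W' assume a: "\<psi> \<in> out I (tgt I \<phi>)" "W' \<in> below I X \<psi> (M.pb \<phi> W)"
    show "linear_map (ring_at (sp X (tgt I \<psi>)) W') (dsec M (tgt I \<psi>) W') (dsec N (tgt I \<psi>) W') (\<eta> (cmp I \<psi> \<phi>) W')"
      using M.hom_sectionsD(2)[OF \<eta> M.cmp_out[OF \<phi> a(1)] b[OF a]] by (simp add: M.tgt_cmp[OF \<phi> a(1)])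
  next
    fix \<psi> W' \<chi> W'' s
    assume a: "\<psi> \<in> out I (tgt I \<phi>)" "W' \<in> below I X \<psi> (M.pb \<phi> W)" "\<chi> \<in> out I (tgt I \<psi>)" "W'' \<in> below I X \<chi> W'"
      "s \<in> carrier (dsec M (tgt I \<psi>) W')"
    show "\<eta> (cmp I (cmp I \<chi> \<psi>) \<phi>) W'' (M.sr \<chi> W' W'' s) = N.sr \<chi> W' W'' (\<eta> (cmp I \<psi> \<phi>) W' s)"
      using M.hom_sectionsD(3)[OF \<eta> M.cmp_out[OF \<phi> a(1)] b[OF a(1,2)], of \<chi> W'' s] a
      by (simp add: M.tgt_cmp[OF \<phi> a(1)] M.cmp_assoc[OF \<phi> a(1,3)])
  qed
qed

end

section \<open>Open subdiagrams\<close>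

locale open_sub = scheme_dia I X
  for I :: "('i, 'f) cat" and X :: "('i, 'f, 'p, 'r) diagram" +
  fixes U :: "('i, 'f, 'p, 'r) diagram"
  assumes sub: "open_subdiagram I U X"
begin

abbreviation P :: "'i \<Rightarrow> 'p set" where "P i \<equiv> points (sp U i)"

sublocale sub: scheme_dia I U
  by unfold_locales (use cat sub in \<open>simp_all add: open_subdiagram_def\<close>)

lemma P_op: "i \<in> Ob I \<Longrightarrow> op i (P i)"
  using sub by (simp add: open_subdiagram_def)

lemma sp_sub: "i \<in> Ob I \<Longrightarrow> sp U i = open_restrict (sp X i) (P i)"
  using sub unfolding open_subdiagram_def by blast

lemma sub_topol: "i \<in> Ob I \<Longrightarrow> topol (sp U i) = subtopology (topol (sp X i)) (P i)"
  and sub_ring: "i \<in> Ob I \<Longrightarrow> ring_at (sp U i) = ring_at (sp X i)"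
  and sub_rres: "i \<in> Ob I \<Longrightarrow> rres (sp U i) = rres (sp X i)"
proof -
  assume i: "i \<in> Ob I"
  \<comment> \<open>The right-hand side of \<open>sp_sub\<close> contains \<open>sp U i\<close>
    again through \<open>P i\<close>, so its fields are extracted by congruence.\<close>
  have "topol (sp U i) = topol (open_restrict (sp X i) (P i))" "ring_at (sp U i) = ring_at (open_restrict (sp X i) (P i))"
    "rres (sp U i) = rres (open_restrict (sp X i) (P i))"
    by (rule arg_cong[OF sp_sub[OF i]])+
  then show "topol (sp U i) = subtopology (topol (sp X i)) (P i)" "ring_at (sp U i) = ring_at (sp X i)" "rres (sp U i) = rres (sp X i)"
    by (simp_all only: open_restrict_def ringed_space.simps)
qed

lemma sub_open: "i \<in> Ob I \<Longrightarrow> openin (topol (sp U i)) W \<longleftrightarrow> op i W \<and> W \<subseteq> P i"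
proof -
  assume i: "i \<in> Ob I"
  have "openin (topol (sp U i)) W \<longleftrightarrow> openin (subtopology (topol (sp X i)) (P i)) W"
    by (rule arg_cong[OF sub_topol[OF i], of "\<lambda>T. openin T W"])
  then show ?thesis
    using openin_open_subtopology[OF P_op[OF i], of W] by simp
qed

lemma pre_incl: "pre (sp U i) (incl U X i) W = P i \<inter> W"
  by (auto simp: pre_def incl_def)

lemma tr_sub:
  assumes "\<phi> \<in> out I i" "x \<in> P (tgt I \<phi>)"
  shows "pt (tr U \<phi>) x = pt (tr X \<phi>) x"
proof -
  have "mor_eq (sp U (tgt I \<phi>)) (sp X (src I \<phi>)) (mor_comp (sp U (src I \<phi>)) (incl U X (src I \<phi>)) (tr U \<phi>))
        (mor_comp (sp X (tgt I \<phi>)) (tr X \<phi>) (incl U X (tgt I \<phi>)))"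
    using sub assms(1) unfolding open_subdiagram_def diagram_mor_def out_iff by blast
  then show ?thesis
    using assms(2) by (simp add: mor_eq_def mor_comp_def incl_def)
qed

lemma P_sub: "i \<in> Ob I \<Longrightarrow> P i \<subseteq> points (sp X i)"
  by (rule op_points[OF P_op])

lemma pre_tr: "\<phi> \<in> out I i \<Longrightarrow> pre (sp U (tgt I \<phi>)) (tr U \<phi>) W = P (tgt I \<phi>) \<inter> pb \<phi> W"
  using tr_sub[of \<phi> i] P_sub[OF out_tgt[of \<phi> i]] by (auto simp: pre_def pb_def)

text \<open>The transition map of \<open>U\<close> is the restriction of that of \<open>X\<close>
  and has values in \<open>P i\<close>. The opposite containment fails in general; it is what a
  cartesian morphism supplies in \<open>cartesian_pb\<close>.\<close>

lemma P_pb: assumes "\<phi> \<in> out I i" shows "P (tgt I \<phi>) \<subseteq> pb \<phi> (P i)"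
  using sub.tr_points[OF assms] tr_sub[OF assms] P_sub[OF out_tgt[OF assms]] by (auto simp: pb_def pre_def)

lemma below_sub_iff: "\<phi> \<in> out I i \<Longrightarrow> W' \<in> below I U \<phi> W \<longleftrightarrow> op (tgt I \<phi>) W' \<and> W' \<subseteq> P (tgt I \<phi>) \<and> W' \<subseteq> pb \<phi> W"
  by (simp add: below_def pre_tr sub_open out_tgt)

lemma below_P: "\<phi> \<in> out I i \<Longrightarrow> W' \<in> below I X \<phi> W \<Longrightarrow> P (tgt I \<phi>) \<inter> W' \<in> below I X \<phi> (P i \<inter> W)"
  using P_pb[of \<phi> i] P_op[OF out_tgt[of \<phi> i]] by (auto simp: below_iff pb_Int)

lemma push_restr_simps:
  "carrier (dsec (push_restr I U X A) i W) = carrier (dsec A i (P i \<inter> W))"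
  "\<zero>\<^bsub>dsec (push_restr I U X A) i W\<^esub> = \<zero>\<^bsub>dsec A i (P i \<inter> W)\<^esub>"
  "s \<oplus>\<^bsub>dsec (push_restr I U X A) i W\<^esub> t = s \<oplus>\<^bsub>dsec A i (P i \<inter> W)\<^esub> t"
  "r \<odot>\<^bsub>dsec (push_restr I U X A) i W\<^esub> s = rres (sp X i) W (P i \<inter> W) r \<odot>\<^bsub>dsec A i (P i \<inter> W)\<^esub> s"
  "sres (fib (push_restr I U X A) i) W W' s = sres (fib A i) (P i \<inter> W) (P i \<inter> W') s"
  by (simp_all add: push_restr_def push_def smod_push_def restr_def pre_incl incl_def[of U X i, THEN arg_cong[of _ _ cm]])

lemma push_restr_trn:
  assumes "\<phi> \<in> out I i"
  shows "trn (push_restr I U X A) \<phi> W s =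
    sres (fib A (tgt I \<phi>)) (pb \<phi> (P i \<inter> W)) (P (tgt I \<phi>) \<inter> pb \<phi> W) (trn A \<phi> (P i \<inter> W) s)"
proof -
  have "P (tgt I \<phi>) \<inter> pb \<phi> (P i \<inter> W) = P (tgt I \<phi>) \<inter> pb \<phi> W"
    using P_pb[OF assms] by (auto simp: pb_Int)
  then show ?thesis
    using assms by (simp add: push_restr_def push_def restr_def pre_incl pre_tr[OF assms] out_iff pb_def)
qed

text \<open>The correction that \<open>restr\<close> makes to a transition map is a restriction to
  the open subscheme at the target, and it is absorbed by the further restriction to an open lying
  inside that subscheme.\<close>

lemma site_res_restr:
  assumes A: "A \<in> Modules I X" and \<psi>: "\<psi> \<in> out I j" and W: "op j W" and W': "W' \<in> below I U \<psi> W"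
    and s: "s \<in> carrier (dsec A j W)"
  shows "site_res I U (restr I U X A) \<psi> W W' s = site_res I X A \<psi> W W' s"
proof -
  interpret A: dia_module I X A by unfold_locales (rule A)
  have k: "tgt I \<psi> \<in> Ob I" by (rule out_tgt[OF \<psi>])
  have "sres (fib A (tgt I \<psi>)) (P (tgt I \<psi>) \<inter> pb \<psi> W) W' (sres (fib A (tgt I \<psi>)) (pb \<psi> W) (P (tgt I \<psi>) \<inter> pb \<psi> W) (trn A \<psi> W s))
      = sres (fib A (tgt I \<psi>)) (pb \<psi> W) W' (trn A \<psi> W s)"
    by (rule sres_comp[OF A.fib_smod[OF k]])
      (use W' in \<open>simp_all add: below_sub_iff[OF \<psi>] pb_op[OF \<psi> W] P_op[OF k] openin_Int A.trn_closed[OF \<psi> W s]\<close>)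
  then show ?thesis
    by (simp add: site_res_def restr_def pre_tr[OF \<psi>] pb_def)
qed

lemma site_res_push_restr:
  assumes A: "A \<in> Modules I X" and \<psi>: "\<psi> \<in> out I j" and W: "op j W" and W': "W' \<in> below I X \<psi> W"
    and s: "s \<in> carrier (dsec A j (P j \<inter> W))"
  shows "site_res I X (push_restr I U X A) \<psi> W W' s = site_res I X A \<psi> (P j \<inter> W) (P (tgt I \<psi>) \<inter> W') s"
proof -
  interpret A: dia_module I X A by unfold_locales (rule A)
  have k: "tgt I \<psi> \<in> Ob I" by (rule out_tgt[OF \<psi>])
  have PW: "op j (P j \<inter> W)" by (rule openin_Int[OF P_op[OF out_Ob[OF \<psi>]] W])
  have "sres (fib A (tgt I \<psi>)) (P (tgt I \<psi>) \<inter> pb \<psi> W) (P (tgt I \<psi>) \<inter> W')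
      (sres (fib A (tgt I \<psi>)) (pb \<psi> (P j \<inter> W)) (P (tgt I \<psi>) \<inter> pb \<psi> W) (trn A \<psi> (P j \<inter> W) s))
      = sres (fib A (tgt I \<psi>)) (pb \<psi> (P j \<inter> W)) (P (tgt I \<psi>) \<inter> W') (trn A \<psi> (P j \<inter> W) s)"
  proof (rule sres_comp[OF A.fib_smod[OF k]])
    show "P (tgt I \<psi>) \<inter> pb \<psi> W \<subseteq> pb \<psi> (P j \<inter> W)"
      using P_pb[OF \<psi>] by (auto simp: pb_Int)
    show "P (tgt I \<psi>) \<inter> W' \<subseteq> P (tgt I \<psi>) \<inter> pb \<psi> W"
      using below_sub[OF W'] by blast
  qed (simp_all add: pb_op[OF \<psi> PW] pb_op[OF \<psi> W] P_op[OF k] openin_Int A.trn_closed[OF \<psi> PW s] below_op[OF W'])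
  then show ?thesis
    by (simp add: site_res_alt push_restr_trn[OF \<psi>] push_restr_simps)
qed

end

section \<open>Pairs of open subdiagrams and the modules \<open>Gamma\<close>\<close>

locale two_open = open_sub I X U + VU: open_sub I U V
  for I :: "('i, 'f) cat" and X :: "('i, 'f, 'p, 'r) diagram" and U V :: "('i, 'f, 'p, 'r) diagram"
begin

abbreviation Q :: "'i \<Rightarrow> 'p set" where "Q i \<equiv> points (sp V i)"

abbreviation \<Gamma> where "\<Gamma> \<equiv> Gamma I X U V"

lemma Q_op: "i \<in> Ob I \<Longrightarrow> op i (Q i)" and Q_P: "i \<in> Ob I \<Longrightarrow> Q i \<subseteq> P i"
  using VU.P_op[of i] by (simp_all add: sub_open)

lemma Q_pb: "\<phi> \<in> out I i \<Longrightarrow> Q (tgt I \<phi>) \<subseteq> pb \<phi> (Q i)"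
  using VU.P_pb[of \<phi> i] by (simp add: sub.pb_def pre_tr)

lemma Gamma_carrier:
  assumes i: "i \<in> Ob I" and W: "op i W"
  shows "carrier (dsec (\<Gamma> A) i W) = {s \<in> carrier (dsec A i (P i \<inter> W)).
     sres (fib A i) (P i \<inter> W) (Q i \<inter> (P i \<inter> W)) s = \<zero>\<^bsub>dsec A i (Q i \<inter> (P i \<inter> W))\<^esub>}"
proof -
  let ?A = "restr I U X A"
  let ?u = "push_map I U X (incl U X) ?A (adj_unit I V U ?A)"
  have c: "carrier (dsec (push I U (incl U X) ?A) i W) = carrier (dsec A i (P i \<inter> W))"
    using push_restr_simps(1)[of A i W] by (simp add: push_restr_def)
  have u: "?u i W s = sres (fib A i) (P i \<inter> W) (Q i \<inter> (P i \<inter> W)) s" if s: "s \<in> carrier (dsec A i (P i \<inter> W))" for s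
  proof -
    have "?u i W s = adj_unit I V U ?A i (P i \<inter> W) s"
      unfolding push_map_def by (simp add: dmap_app[OF i W] c s pre_incl)
    also have "\<dots> = sres (fib A i) (P i \<inter> W) (Q i \<inter> (P i \<inter> W)) s"
    proof -
      have "openin (topol (sp U i)) (P i \<inter> W)"
        using W P_op[OF i] by (simp add: sub_open[OF i] openin_Int)
      then show ?thesis
        unfolding adj_unit_def by (simp add: sub.dmap_app[OF i] s restr_def VU.pre_incl)
    qed
    finally show ?thesis .
  qed
  have z: "\<zero>\<^bsub>dsec (push I U (incl U X) (push_restr I V U ?A)) i W\<^esub> = \<zero>\<^bsub>dsec A i (Q i \<inter> (P i \<inter> W))\<^esub>"
    by (simp add: push_def smod_push_def pre_incl VU.push_restr_simps) (simp add: restr_def)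
  have "carrier (dsec (\<Gamma> A) i W) = {s \<in> carrier (dsec A i (P i \<inter> W)). ?u i W s = \<zero>\<^bsub>dsec A i (Q i \<inter> (P i \<inter> W))\<^esub>}"
    unfolding Gamma_def ker_def by (simp add: z push_restr_simps)
  then show ?thesis
    using u by auto
qed

lemma Gamma_simps:
  "\<zero>\<^bsub>dsec (\<Gamma> A) i W\<^esub> = \<zero>\<^bsub>dsec A i (P i \<inter> W)\<^esub>"
  "s \<oplus>\<^bsub>dsec (\<Gamma> A) i W\<^esub> t = s \<oplus>\<^bsub>dsec A i (P i \<inter> W)\<^esub> t"
  "r \<odot>\<^bsub>dsec (\<Gamma> A) i W\<^esub> s = rres (sp X i) W (P i \<inter> W) r \<odot>\<^bsub>dsec A i (P i \<inter> W)\<^esub> s"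
  "sres (fib (\<Gamma> A) i) W W' s = sres (fib A i) (P i \<inter> W) (P i \<inter> W') s"
  "site_res I X (\<Gamma> A) = site_res I X (push_restr I U X A)"
  "trn (\<Gamma> A) = trn (push_restr I U X A)"
  by (simp_all add: Gamma_def ker_def push_restr_simps site_res_def[abs_def])

text \<open>Sections of the target of the canonical map are morphisms into
  \<open>\<Gamma> N\<close>, and the equivariant case compares such morphisms locally, so
  \<open>\<Gamma> N\<close> has to be a sheaf. A section of \<open>\<Gamma> A\<close> over
  \<open>W\<close> is a section of \<open>A\<close> over \<open>P i \<inter> W\<close>; each law is
  therefore a law of \<open>A\<close> on traces, together with the check that vanishing on
  \<open>Q i\<close> survives.\<close>

lemma Gamma_Modules:
  assumes A: "A \<in> Modules I X"
  shows "\<Gamma> A \<in> Modules I X"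
proof -
  interpret A: dia_module I X A by unfold_locales (rule A)
  have PW: "op i (P i \<inter> W)" and QW: "op i (Q i \<inter> (P i \<inter> W))" if "i \<in> Ob I" "op i W" for i W
    using that P_op Q_op by (simp_all add: openin_Int)
  have car: "s \<in> carrier (dsec (\<Gamma> A) i W) \<longleftrightarrow> s \<in> carrier (dsec A i (P i \<inter> W)) \<and>
     sres (fib A i) (P i \<inter> W) (Q i \<inter> (P i \<inter> W)) s = \<zero>\<^bsub>dsec A i (Q i \<inter> (P i \<inter> W))\<^esub>" if "i \<in> Ob I" "op i W" for i W s
    by (simp add: Gamma_carrier[OF that])
  have res_cl: "sres (fib A i) (P i \<inter> W) (P i \<inter> W') s \<in> carrier (dsec (\<Gamma> A) i W')"
    if i: "i \<in> Ob I" and W: "op i W" and W': "op i W'" and s: "W' \<subseteq> W" "s \<in> carrier (dsec (\<Gamma> A) i W)" for i W W' s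
  proof -
    have s1: "s \<in> carrier (dsec A i (P i \<inter> W))" and s2: "sres (fib A i) (P i \<inter> W) (Q i \<inter> (P i \<inter> W)) s = \<zero>\<^bsub>dsec A i (Q i \<inter> (P i \<inter> W))\<^esub>"
      using s(2) car[OF i W] by auto
    note f = A.fib_smod[OF i]
    have PP: "P i \<inter> W' \<subseteq> P i \<inter> W" and QQ: "Q i \<inter> (P i \<inter> W') \<subseteq> Q i \<inter> (P i \<inter> W)" using s(1) by auto
    have "sres (fib A i) (P i \<inter> W') (Q i \<inter> (P i \<inter> W')) (sres (fib A i) (P i \<inter> W) (P i \<inter> W') s)
        = sres (fib A i) (P i \<inter> W) (Q i \<inter> (P i \<inter> W')) s"
      by (rule sres_comp[OF f PW[OF i W] PW[OF i W'] QW[OF i W'] Int_lower2 PP s1])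
    also have "\<dots> = sres (fib A i) (Q i \<inter> (P i \<inter> W)) (Q i \<inter> (P i \<inter> W')) (sres (fib A i) (P i \<inter> W) (Q i \<inter> (P i \<inter> W)) s)"
      by (rule sres_comp[OF f PW[OF i W] QW[OF i W] QW[OF i W'] QQ Int_lower2 s1, symmetric])
    also have "\<dots> = \<zero>\<^bsub>dsec A i (Q i \<inter> (P i \<inter> W'))\<^esub>"
      unfolding s2 by (rule sres_zero[OF f QW[OF i W] QW[OF i W'] QQ])
    finally show ?thesis
      using sres_closed[OF f PW[OF i W] PW[OF i W'] PP s1] by (simp add: car[OF i W'])
  qed
  have smod: "is_smod (sp X i) (fib (\<Gamma> A) i)" if i: "i \<in> Ob I" for i
    unfolding is_smod_def
  proof (intro conjI ballI impI)
    note f = A.fib_smod[OF i]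
    let ?F = "\<lambda>W. carrier (dsec (\<Gamma> A) i W)"
    have F: "s \<in> carrier (dsec A i (P i \<inter> W))" if "op i W" "s \<in> ?F W" for s W
      using that car[OF i] by simp
    have psh: "presheaf_on (topol (sp X i)) ?F (sres (fib (\<Gamma> A) i))"
      unfolding presheaf_on_def
    proof (intro conjI allI impI ballI Pi_I)
      fix W W' s assume "op i W \<and> op i W' \<and> W' \<subseteq> W" "s \<in> ?F W"
      then show "sres (fib (\<Gamma> A) i) W W' s \<in> ?F W'"
        using res_cl[OF i] by (simp add: Gamma_simps)
    next
      fix W s assume "op i W" "s \<in> ?F W"
      then show "sres (fib (\<Gamma> A) i) W W s = s"
        using sres_id[OF f PW[OF i] F] by (simp add: Gamma_simps)
    next
      fix W1 W2 W3 s assume a: "op i W1 \<and> op i W2 \<and> op i W3 \<and> W3 \<subseteq> W2 \<and> W2 \<subseteq> W1" "s \<in> ?F W1"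
      then have "sres (fib A i) (P i \<inter> W2) (P i \<inter> W3) (sres (fib A i) (P i \<inter> W1) (P i \<inter> W2) s) = sres (fib A i) (P i \<inter> W1) (P i \<inter> W3) s"
        by (intro sres_comp[OF f] PW[OF i] F Int_mono subset_refl) simp_all
      then show "sres (fib (\<Gamma> A) i) W2 W3 (sres (fib (\<Gamma> A) i) W1 W2 s) = sres (fib (\<Gamma> A) i) W1 W3 s"
        by (simp add: Gamma_simps)
    qed
    show "sheaf_on (topol (sp X i)) ?F (sres (fib (\<Gamma> A) i))"
      unfolding sheaf_on_def
    proof (intro conjI psh allI impI)
      fix \<U> s
      assume a: "(\<forall>W\<in>\<U>. op i W \<and> s W \<in> ?F W) \<and>
        (\<forall>W\<in>\<U>. \<forall>W'\<in>\<U>. sres (fib (\<Gamma> A) i) W (W \<inter> W') (s W) = sres (fib (\<Gamma> A) i) W' (W \<inter> W') (s W'))"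
      then have oW: "\<And>W. W \<in> \<U> \<Longrightarrow> op i W" and sW: "\<And>W. W \<in> \<U> \<Longrightarrow> s W \<in> ?F W"
        by simp_all
      have comp: "sres (fib A i) (P i \<inter> W) (P i \<inter> (W \<inter> W')) (s W) = sres (fib A i) (P i \<inter> W') (P i \<inter> (W \<inter> W')) (s W')"
        if "W \<in> \<U>" "W' \<in> \<U>" for W W'
        using a[THEN conjunct2, THEN bspec, THEN bspec, OF that] by (simp only: Gamma_simps)
      have oU: "op i (\<Union>\<U>)" using oW by blast
      have sA: "s W \<in> carrier (dsec A i (P i \<inter> W))" if "W \<in> \<U>" for W
        by (rule F[OF oW[OF that] sW[OF that]])
      have agree: "sres (fib A i) (P i \<inter> W) Z (s W) = sres (fib A i) (P i \<inter> W') Z (s W')"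
        if W: "W \<in> \<U>" and W': "W' \<in> \<U>" and Z: "op i Z" "Z \<subseteq> P i \<inter> W" "Z \<subseteq> P i \<inter> W'" for W W' Z
      proof -
        have oWW: "op i (P i \<inter> (W \<inter> W'))" by (rule PW[OF i openin_Int[OF oW[OF W] oW[OF W']]])
        have ZZ: "Z \<subseteq> P i \<inter> (W \<inter> W')" "P i \<inter> (W \<inter> W') \<subseteq> P i \<inter> W" "P i \<inter> (W \<inter> W') \<subseteq> P i \<inter> W'" using Z by auto
        show ?thesis
          using sres_comp[OF f PW[OF i oW[OF W]] oWW Z(1) ZZ(1,2) sA[OF W]]
            sres_comp[OF f PW[OF i oW[OF W']] oWW Z(1) ZZ(1,3) sA[OF W']] comp[OF W W'] by simp
      qed
      \<comment> \<open>Distinct members of the cover can have the same trace on \<open>P i\<close>,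
        so the data to be glued are not a function of the trace. They are presented as a relation on
        opens of \<open>P i\<close>, which \<open>agree\<close> shows to be single-valued.\<close>
      define R where "R Z n \<longleftrightarrow> (\<exists>W\<in>\<U>. Z \<subseteq> P i \<inter> W \<and> n = sres (fib A i) (P i \<inter> W) Z (s W))" for Z n
      obtain t where t: "t \<in> carrier (dsec A i (P i \<inter> \<Union>\<U>))"
        and tR: "\<And>x. x \<in> P i \<inter> \<Union>\<U> \<Longrightarrow> \<exists>Z. op i Z \<and> x \<in> Z \<and> Z \<subseteq> P i \<inter> \<Union>\<U> \<and> R Z (sres (fib A i) (P i \<inter> \<Union>\<U>) Z t)"
      proof (rule smod_glue_rel[OF f PW[OF i oU], of R])
        fix x assume "x \<in> P i \<inter> \<Union>\<U>"
        then obtain W where W: "W \<in> \<U>" "x \<in> P i \<inter> W" by blast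
        have "R (P i \<inter> W) (s W)"
          unfolding R_def using W(1) sres_id[OF f PW[OF i oW[OF W(1)]] sA[OF W(1)]] by (intro bexI[of _ W]) simp_all
        then show "\<exists>Z n. op i Z \<and> x \<in> Z \<and> Z \<subseteq> P i \<inter> \<Union>\<U> \<and> n \<in> carrier (dsec A i Z) \<and> R Z n"
          using W PW[OF i oW[OF W(1)]] sA[OF W(1)] by (intro exI[of _ "P i \<inter> W"] exI[of _ "s W"]) auto
      next
        fix Z Z' n assume Z: "op i Z" "op i Z'" "Z' \<subseteq> Z" and "R Z n"
        then obtain W where W: "W \<in> \<U>" "Z \<subseteq> P i \<inter> W" "n = sres (fib A i) (P i \<inter> W) Z (s W)"
          unfolding R_def by blast
        then show "R Z' (sres (fib A i) Z Z' n)"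
          unfolding R_def using Z sres_comp[OF f PW[OF i oW[OF W(1)]] Z(1,2,3) W(2) sA[OF W(1)]] by (intro bexI[of _ W]) auto
      next
        fix Z n n' assume "op i Z" "R Z n" "R Z n'"
        then show "n = n'"
          unfolding R_def using agree by blast
      qed (rule that)
      \<comment> \<open>The glued section is known on small pieces only. On each of them it is the
        restriction of some \<open>s W'\<close>, which \<open>agree\<close> compares with
        \<open>s W\<close>.\<close>
      have tW: "sres (fib A i) (P i \<inter> \<Union>\<U>) (P i \<inter> W) t = s W" if W: "W \<in> \<U>" for W
      proof (rule smod_separated[OF f PW[OF i oW[OF W]] _ sA[OF W]])
        have sub: "P i \<inter> W \<subseteq> P i \<inter> \<Union>\<U>" using W by blast
        show "sres (fib A i) (P i \<inter> \<Union>\<U>) (P i \<inter> W) t \<in> carrier (dsec A i (P i \<inter> W))"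
          by (rule sres_closed[OF f PW[OF i oU] PW[OF i oW[OF W]] sub t])
        fix x assume x: "x \<in> P i \<inter> W"
        then obtain Z W' where Z: "op i Z" "x \<in> Z" "Z \<subseteq> P i \<inter> \<Union>\<U>" and W': "W' \<in> \<U>" "Z \<subseteq> P i \<inter> W'"
          and e: "sres (fib A i) (P i \<inter> \<Union>\<U>) Z t = sres (fib A i) (P i \<inter> W') Z (s W')"
          using tR[of x] sub unfolding R_def by blast
        let ?Z = "Z \<inter> (P i \<inter> W)"
        have oZ: "op i ?Z" by (rule openin_Int[OF Z(1) PW[OF i oW[OF W]]])
        have "sres (fib A i) (P i \<inter> W) ?Z (sres (fib A i) (P i \<inter> \<Union>\<U>) (P i \<inter> W) t) = sres (fib A i) Z ?Z (sres (fib A i) (P i \<inter> \<Union>\<U>) Z t)"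
          by (simp only: sres_comp[OF f PW[OF i oU] PW[OF i oW[OF W]] oZ Int_lower2 sub t] sres_comp[OF f PW[OF i oU] Z(1) oZ Int_lower1 Z(3) t])
        also have "\<dots> = sres (fib A i) (P i \<inter> W') ?Z (s W')"
          unfolding e by (rule sres_comp[OF f PW[OF i oW[OF W'(1)]] Z(1) oZ Int_lower1 W'(2) sA[OF W'(1)]])
        also have "\<dots> = sres (fib A i) (P i \<inter> W) ?Z (s W)"
          by (rule agree[OF W'(1) W oZ]) (use W'(2) in auto)
        finally show "\<exists>Z. op i Z \<and> x \<in> Z \<and> Z \<subseteq> P i \<inter> W \<and>
            sres (fib A i) (P i \<inter> W) Z (sres (fib A i) (P i \<inter> \<Union>\<U>) (P i \<inter> W) t) = sres (fib A i) (P i \<inter> W) Z (s W)"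
          using oZ x Z(2) by (intro exI[of _ ?Z]) auto
      qed
      \<comment> \<open>Vanishing on \<open>Q i\<close> is checked over each member of the cover,
        where \<open>t\<close> restricts to \<open>s W\<close>.\<close>
      have tQ: "sres (fib A i) (P i \<inter> \<Union>\<U>) (Q i \<inter> (P i \<inter> \<Union>\<U>)) t = \<zero>\<^bsub>dsec A i (Q i \<inter> (P i \<inter> \<Union>\<U>))\<^esub>"
      proof (rule smod_separated[OF f QW[OF i oU]])
        show "sres (fib A i) (P i \<inter> \<Union>\<U>) (Q i \<inter> (P i \<inter> \<Union>\<U>)) t \<in> carrier (dsec A i (Q i \<inter> (P i \<inter> \<Union>\<U>)))"
          by (rule sres_closed[OF f PW[OF i oU] QW[OF i oU] Int_lower2 t])
        show "\<zero>\<^bsub>dsec A i (Q i \<inter> (P i \<inter> \<Union>\<U>))\<^esub> \<in> carrier (dsec A i (Q i \<inter> (P i \<inter> \<Union>\<U>)))"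
          by (rule A.sec_zero_closed[OF i QW[OF i oU]])
        fix x assume x: "x \<in> Q i \<inter> (P i \<inter> \<Union>\<U>)"
        then obtain W where W: "W \<in> \<U>" "x \<in> W" by blast
        let ?Z = "Q i \<inter> (P i \<inter> W)"
        have sub: "P i \<inter> W \<subseteq> P i \<inter> \<Union>\<U>" "?Z \<subseteq> Q i \<inter> (P i \<inter> \<Union>\<U>)" using W by auto
        have "sres (fib A i) (Q i \<inter> (P i \<inter> \<Union>\<U>)) ?Z (sres (fib A i) (P i \<inter> \<Union>\<U>) (Q i \<inter> (P i \<inter> \<Union>\<U>)) t)
            = sres (fib A i) (P i \<inter> W) ?Z (sres (fib A i) (P i \<inter> \<Union>\<U>) (P i \<inter> W) t)"
          by (simp only: sres_comp[OF f PW[OF i oU] QW[OF i oU] QW[OF i oW[OF W(1)]] sub(2) Int_lower2 t]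
              sres_comp[OF f PW[OF i oU] PW[OF i oW[OF W(1)]] QW[OF i oW[OF W(1)]] Int_lower2 sub(1) t])
        also have "\<dots> = \<zero>\<^bsub>dsec A i ?Z\<^esub>"
          unfolding tW[OF W(1)] using sW[OF W(1)] car[OF i oW[OF W(1)]] by simp
        also have "\<dots> = sres (fib A i) (Q i \<inter> (P i \<inter> \<Union>\<U>)) ?Z \<zero>\<^bsub>dsec A i (Q i \<inter> (P i \<inter> \<Union>\<U>))\<^esub>"
          by (rule sres_zero[OF f QW[OF i oU] QW[OF i oW[OF W(1)]] sub(2), symmetric])
        finally show "\<exists>Z. op i Z \<and> x \<in> Z \<and> Z \<subseteq> Q i \<inter> (P i \<inter> \<Union>\<U>) \<and>
            sres (fib A i) (Q i \<inter> (P i \<inter> \<Union>\<U>)) Z (sres (fib A i) (P i \<inter> \<Union>\<U>) (Q i \<inter> (P i \<inter> \<Union>\<U>)) t) =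
            sres (fib A i) (Q i \<inter> (P i \<inter> \<Union>\<U>)) Z \<zero>\<^bsub>dsec A i (Q i \<inter> (P i \<inter> \<Union>\<U>))\<^esub>"
          using QW[OF i oW[OF W(1)]] x W sub(2) by (intro exI[of _ ?Z]) auto
      qed
      show "\<exists>!t. t \<in> ?F (\<Union>\<U>) \<and> (\<forall>W\<in>\<U>. sres (fib (\<Gamma> A) i) (\<Union>\<U>) W t = s W)"
      proof (rule ex1I[of _ t])
        show "t \<in> ?F (\<Union>\<U>) \<and> (\<forall>W\<in>\<U>. sres (fib (\<Gamma> A) i) (\<Union>\<U>) W t = s W)"
          using t tQ tW by (simp add: car[OF i oU] Gamma_simps)
        fix t' assume "t' \<in> ?F (\<Union>\<U>) \<and> (\<forall>W\<in>\<U>. sres (fib (\<Gamma> A) i) (\<Union>\<U>) W t' = s W)"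
        then have t': "t' \<in> carrier (dsec A i (P i \<inter> \<Union>\<U>))" "\<And>W. W \<in> \<U> \<Longrightarrow> sres (fib A i) (P i \<inter> \<Union>\<U>) (P i \<inter> W) t' = s W"
          using F[OF oU] by (simp_all add: Gamma_simps)
        show "t' = t"
        proof (rule smod_separated[OF f PW[OF i oU] t'(1) t])
          fix x assume "x \<in> P i \<inter> \<Union>\<U>"
          then obtain W where W: "W \<in> \<U>" "x \<in> P i \<inter> W" by blast
          then show "\<exists>W. op i W \<and> x \<in> W \<and> W \<subseteq> P i \<inter> \<Union>\<U> \<and> sres (fib A i) (P i \<inter> \<Union>\<U>) W t' = sres (fib A i) (P i \<inter> \<Union>\<U>) W t"
            using PW[OF i oW[OF W(1)]] t'(2)[OF W(1)] tW[OF W(1)] by (intro exI[of _ "P i \<inter> W"]) auto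
        qed
      qed
    qed
    show "module (ring_at (sp X i) W) (dsec (\<Gamma> A) i W)" if "W \<in> opens (sp X i)" for W
    proof -
      have W: "op i W" using that by simp
      interpret R: cring "ring_at (sp X i) W" by (rule ringed_cring[OF sp_ringed[OF i] W])
      interpret M: module "ring_at (sp X i) (P i \<inter> W)" "dsec A i (P i \<inter> W)" by (rule A.sec_module[OF i PW[OF i W]])
      note hom = ringed_hom[OF sp_ringed[OF i] W PW[OF i W] Int_lower2]
      note rc = ring_hom_closed[OF hom]
      note qz = sres_zero[OF f PW[OF i W] QW[OF i W] Int_lower2]
      interpret Z: module "ring_at (sp X i) (Q i \<inter> (P i \<inter> W))" "dsec A i (Q i \<inter> (P i \<inter> W))" by (rule A.sec_module[OF i QW[OF i W]])
      note rq = rres_closed[OF sp_ringed[OF i] PW[OF i W] QW[OF i W] Int_lower2]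
      have ag: "abelian_group (dsec (\<Gamma> A) i W)"
      proof (rule abelian_groupI)
        fix s assume s: "s \<in> carrier (dsec (\<Gamma> A) i W)"
        then have "\<ominus>\<^bsub>dsec A i (P i \<inter> W)\<^esub> s \<in> carrier (dsec (\<Gamma> A) i W)"
        proof -
          have s': "s \<in> carrier (dsec A i (P i \<inter> W))" and z: "sres (fib A i) (P i \<inter> W) (Q i \<inter> (P i \<inter> W)) s = \<zero>\<^bsub>dsec A i (Q i \<inter> (P i \<inter> W))\<^esub>"
            using s car[OF i W] by auto
          have "sres (fib A i) (P i \<inter> W) (Q i \<inter> (P i \<inter> W)) (\<zero>\<^bsub>dsec A i (P i \<inter> W)\<^esub> \<ominus>\<^bsub>dsec A i (P i \<inter> W)\<^esub> s) = \<zero>\<^bsub>dsec A i (Q i \<inter> (P i \<inter> W))\<^esub>"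
            by (simp add: sres_minus[OF f PW[OF i W] QW[OF i W] Int_lower2] s' z qz Z.minus_eq Z.r_neg)
          then show ?thesis
            using s' by (simp add: car[OF i W] M.minus_eq)
        qed
        then show "\<exists>t\<in>carrier (dsec (\<Gamma> A) i W). t \<oplus>\<^bsub>dsec (\<Gamma> A) i W\<^esub> s = \<zero>\<^bsub>dsec (\<Gamma> A) i W\<^esub>"
          using s by (intro bexI[of _ "\<ominus>\<^bsub>dsec A i (P i \<inter> W)\<^esub> s"]) (simp_all add: Gamma_simps car[OF i W] M.l_neg)
      qed (simp_all add: Gamma_simps car[OF i W] sres_add[OF f PW[OF i W] QW[OF i W] Int_lower2] qz M.a_ac)
      show ?thesis
        by (rule moduleI[OF R.cring_axioms ag])
          (simp_all add: Gamma_simps car[OF i W] rc sres_smult[OF f PW[OF i W] QW[OF i W] Int_lower2] rq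
            ring_hom_add[OF hom] ring_hom_mult[OF hom] ring_hom_one[OF hom] M.smult_l_distr M.smult_r_distr M.smult_assoc1)
    qed
    fix W W' assume a: "W \<in> opens (sp X i)" "W' \<in> opens (sp X i)" "W' \<subseteq> W"
    then have W: "op i W" and W': "op i W'" and sub: "P i \<inter> W' \<subseteq> P i \<inter> W" by auto
    show "sres (fib (\<Gamma> A) i) W W' (s \<oplus>\<^bsub>dsec (\<Gamma> A) i W\<^esub> t) = sres (fib (\<Gamma> A) i) W W' s \<oplus>\<^bsub>dsec (\<Gamma> A) i W'\<^esub> sres (fib (\<Gamma> A) i) W W' t"
      if "s \<in> carrier (dsec (\<Gamma> A) i W)" "t \<in> carrier (dsec (\<Gamma> A) i W)" for s t
      using that by (simp add: Gamma_simps car[OF i W] sres_add[OF f PW[OF i W] PW[OF i W'] sub])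
    show "sres (fib (\<Gamma> A) i) W W' (r \<odot>\<^bsub>dsec (\<Gamma> A) i W\<^esub> s) = rres (sp X i) W W' r \<odot>\<^bsub>dsec (\<Gamma> A) i W'\<^esub> sres (fib (\<Gamma> A) i) W W' s"
      if "r \<in> carrier (ring_at (sp X i) W)" "s \<in> carrier (dsec (\<Gamma> A) i W)" for r s
    proof -
      have "rres (sp X i) (P i \<inter> W) (P i \<inter> W') (rres (sp X i) W (P i \<inter> W) r) = rres (sp X i) W' (P i \<inter> W') (rres (sp X i) W W' r)"
        by (simp only: rres_comp[OF sp_ringed[OF i] W PW[OF i W] PW[OF i W'] sub Int_lower2 that(1)]
            rres_comp[OF sp_ringed[OF i] W W' PW[OF i W'] Int_lower2 a(3) that(1)])
      then show ?thesis
        using that by (simp add: Gamma_simps car[OF i W] sres_smult[OF f PW[OF i W] PW[OF i W'] sub]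
            rres_closed[OF sp_ringed[OF i] W PW[OF i W] Int_lower2])
    qed
  qed
  \<comment> \<open>The transition map of \<open>\<Gamma> A\<close> is a restriction map of
    \<open>A\<close> on the site, between traces. All its laws thus reduce to \<open>sr_cmp\<close>,
    \<open>sr_sres\<close> and \<open>sres_sr\<close>.\<close>
  have trn: "trn (\<Gamma> A) \<phi> W s = site_res I X A \<phi> (P i \<inter> W) (P (tgt I \<phi>) \<inter> pb \<phi> W) s" if "\<phi> \<in> out I i" for \<phi> i W s
    by (simp add: Gamma_simps push_restr_trn[OF that] site_res_alt)
  have bel: "P (tgt I \<phi>) \<inter> pb \<phi> W \<in> below I X \<phi> (P i \<inter> W)" "Q (tgt I \<phi>) \<inter> (P (tgt I \<phi>) \<inter> pb \<phi> W) \<in> below I X \<phi> (Q i \<inter> (P i \<inter> W))"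
    if "\<phi> \<in> out I i" "op i W" for \<phi> i W
    using PW[OF out_tgt[OF that(1)] pb_op[OF that]] QW[OF out_tgt[OF that(1)] pb_op[OF that]] P_pb[OF that(1)] Q_pb[OF that(1)]
    by (auto simp: below_iff pb_Int)
  have mor: "smod_mor (sp X i) (fib (\<Gamma> A) i) (smod_push (sp X (tgt I \<phi>)) (tr X \<phi>) (fib (\<Gamma> A) (tgt I \<phi>))) (trn (\<Gamma> A) \<phi>)"
    if \<phi>: "\<phi> \<in> out I i" for \<phi> i
    unfolding smod_mor_def
  proof (intro conjI ballI impI)
    have i: "i \<in> Ob I" and j: "tgt I \<phi> \<in> Ob I" using \<phi> by (simp_all add: out_Ob out_tgt)
    have pbe: "pre (sp X (tgt I \<phi>)) (tr X \<phi>) W = pb \<phi> W" for W by (simp add: pb_def)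
    fix W assume "W \<in> opens (sp X i)"
    then have W: "op i W" by simp
    note b = bel[OF \<phi> W]
    note oP = PW[OF i W]
    note ojP = PW[OF j pb_op[OF \<phi> W]]
    note ojQ = QW[OF j pb_op[OF \<phi> W]]
    have bQ: "Q (tgt I \<phi>) \<inter> (P (tgt I \<phi>) \<inter> pb \<phi> W) \<in> below I X \<phi> (P i \<inter> W)"
      by (rule below_mono[OF _ b(2)]) blast
    show "linear_map (ring_at (sp X i) W) (dsec (\<Gamma> A) i W) (sec (smod_push (sp X (tgt I \<phi>)) (tr X \<phi>) (fib (\<Gamma> A) (tgt I \<phi>))) W) (trn (\<Gamma> A) \<phi> W)"
    proof (rule linear_mapI)
      fix s assume "s \<in> carrier (dsec (\<Gamma> A) i W)"
      then have s: "s \<in> carrier (dsec A i (P i \<inter> W))" and z: "sres (fib A i) (P i \<inter> W) (Q i \<inter> (P i \<inter> W)) s = \<zero>\<^bsub>dsec A i (Q i \<inter> (P i \<inter> W))\<^esub>"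
        using car[OF i W] by auto
      \<comment> \<open>The part of \<open>Q\<close> at the target lies over \<open>Q i\<close>, so
        the restriction to it factors through the restriction of \<open>s\<close> to
        \<open>Q i\<close>, which is zero.\<close>
      have "sres (fib A (tgt I \<phi>)) (P (tgt I \<phi>) \<inter> pb \<phi> W) (Q (tgt I \<phi>) \<inter> (P (tgt I \<phi>) \<inter> pb \<phi> W)) (A.sr \<phi> (P i \<inter> W) (P (tgt I \<phi>) \<inter> pb \<phi> W) s)
          = A.sr \<phi> (P i \<inter> W) (Q (tgt I \<phi>) \<inter> (P (tgt I \<phi>) \<inter> pb \<phi> W)) s"
        by (rule A.sres_sr[OF \<phi> oP b(1) ojQ Int_lower2 s])
      also have "\<dots> = A.sr \<phi> (Q i \<inter> (P i \<inter> W)) (Q (tgt I \<phi>) \<inter> (P (tgt I \<phi>) \<inter> pb \<phi> W)) (sres (fib A i) (P i \<inter> W) (Q i \<inter> (P i \<inter> W)) s)"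
        by (rule A.sr_sres[OF \<phi> oP QW[OF i W] Int_lower2 b(2) s, symmetric])
      also have "\<dots> = \<zero>\<^bsub>dsec A (tgt I \<phi>) (Q (tgt I \<phi>) \<inter> (P (tgt I \<phi>) \<inter> pb \<phi> W))\<^esub>"
        unfolding z by (rule A.sr_linear_zero[OF \<phi> QW[OF i W] b(2)])
      finally show "trn (\<Gamma> A) \<phi> W s \<in> carrier (sec (smod_push (sp X (tgt I \<phi>)) (tr X \<phi>) (fib (\<Gamma> A) (tgt I \<phi>))) W)"
        using A.sr_closed[OF \<phi> oP b(1) s] by (simp add: smod_push_def pbe car[OF j pb_op[OF \<phi> W]] trn[OF \<phi>])
    next
      fix s t assume "s \<in> carrier (dsec (\<Gamma> A) i W)" "t \<in> carrier (dsec (\<Gamma> A) i W)"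
      then show "trn (\<Gamma> A) \<phi> W (s \<oplus>\<^bsub>dsec (\<Gamma> A) i W\<^esub> t) = trn (\<Gamma> A) \<phi> W s \<oplus>\<^bsub>sec (smod_push (sp X (tgt I \<phi>)) (tr X \<phi>) (fib (\<Gamma> A) (tgt I \<phi>))) W\<^esub> trn (\<Gamma> A) \<phi> W t"
        by (simp add: smod_push_def pbe car[OF i W] trn[OF \<phi>] Gamma_simps(1-4) A.sr_add[OF \<phi> oP b(1)])
    next
      fix r s assume r: "r \<in> carrier (ring_at (sp X i) W)" and s: "s \<in> carrier (dsec (\<Gamma> A) i W)"
      have r1: "rres (sp X i) W (P i \<inter> W) r \<in> carrier (ring_at (sp X i) (P i \<inter> W))"
        by (rule rres_closed[OF sp_ringed[OF i] W oP Int_lower2 r])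
      have "rsr \<phi> (P i \<inter> W) (P (tgt I \<phi>) \<inter> pb \<phi> W) (rres (sp X i) W (P i \<inter> W) r) = rres (sp X (tgt I \<phi>)) (pb \<phi> W) (P (tgt I \<phi>) \<inter> pb \<phi> W) (cm (tr X \<phi>) W r)"
        unfolding rsr_rres[OF \<phi> W oP Int_lower2 b(1) r] by (simp add: rsr_def)
      then show "trn (\<Gamma> A) \<phi> W (r \<odot>\<^bsub>dsec (\<Gamma> A) i W\<^esub> s) = r \<odot>\<^bsub>sec (smod_push (sp X (tgt I \<phi>)) (tr X \<phi>) (fib (\<Gamma> A) (tgt I \<phi>))) W\<^esub> trn (\<Gamma> A) \<phi> W s"
        using s by (simp add: smod_push_def pbe car[OF i W] trn[OF \<phi>] Gamma_simps(1-4) A.sr_smult[OF \<phi> oP b(1) r1])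
    qed
    fix W' s assume "W' \<in> opens (sp X i)" and sub: "W' \<subseteq> W" and "s \<in> carrier (dsec (\<Gamma> A) i W)"
    then have W': "op i W'" and s: "s \<in> carrier (dsec A i (P i \<inter> W))" by (simp_all add: car[OF i W])
    have PP: "P i \<inter> W' \<subseteq> P i \<inter> W" using sub by blast
    have "A.sr \<phi> (P i \<inter> W') (P (tgt I \<phi>) \<inter> pb \<phi> W') (sres (fib A i) (P i \<inter> W) (P i \<inter> W') s) = A.sr \<phi> (P i \<inter> W) (P (tgt I \<phi>) \<inter> pb \<phi> W') s"
      by (rule A.sr_sres[OF \<phi> oP PW[OF i W'] PP bel(1)[OF \<phi> W'] s])
    also have "\<dots> = sres (fib A (tgt I \<phi>)) (P (tgt I \<phi>) \<inter> pb \<phi> W) (P (tgt I \<phi>) \<inter> pb \<phi> W') (A.sr \<phi> (P i \<inter> W) (P (tgt I \<phi>) \<inter> pb \<phi> W) s)"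
      by (rule A.sres_sr[OF \<phi> oP b(1) PW[OF j pb_op[OF \<phi> W']] _ s, symmetric]) (use pb_mono[OF sub] in blast)
    finally show "trn (\<Gamma> A) \<phi> W' (sres (fib (\<Gamma> A) i) W W' s) = sres (smod_push (sp X (tgt I \<phi>)) (tr X \<phi>) (fib (\<Gamma> A) (tgt I \<phi>))) W W' (trn (\<Gamma> A) \<phi> W s)"
      by (simp add: smod_push_def pbe trn[OF \<phi>] Gamma_simps(1-4))
  qed
  have idt: "trn (\<Gamma> A) (idt I i) W s = s" if i: "i \<in> Ob I" and W: "op i W" and s: "s \<in> carrier (dsec (\<Gamma> A) i W)" for i W s
    using s sres_id[OF A.fib_smod[OF i] PW[OF i W]]
    by (simp add: trn[OF idt_out[OF i]] tgt_idt[OF i] pb_idt[OF i W] car[OF i W] A.sr_idt[OF i PW[OF i W]])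
  have cmp: "trn (\<Gamma> A) (cmp I \<psi> \<phi>) W s = trn (\<Gamma> A) \<psi> (pb \<phi> W) (trn (\<Gamma> A) \<phi> W s)"
    if \<phi>: "\<phi> \<in> out I i" and \<psi>: "\<psi> \<in> out I (tgt I \<phi>)" and W: "op i W" and s: "s \<in> carrier (dsec (\<Gamma> A) i W)" for i \<phi> \<psi> W s
  proof -
    have s': "s \<in> carrier (dsec A i (P i \<inter> W))" using s car[OF out_Ob[OF \<phi>] W] by simp
    show ?thesis
      using A.sr_cmp[OF \<phi> \<psi> PW[OF out_Ob[OF \<phi>] W] bel(1)[OF \<phi> W] bel(1)[OF \<psi> pb_op[OF \<phi> W]] s']
      by (simp add: trn[OF cmp_out[OF \<phi> \<psi>]] trn[OF \<phi>] trn[OF \<psi>] tgt_cmp[OF \<phi> \<psi>] pb_cmp[OF \<phi> \<psi>])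
  qed
  show ?thesis
    unfolding Modules_def
  proof (intro CollectI conjI ballI impI)
    fix \<phi> assume \<phi>: "\<phi> \<in> Ar I"
    then show "smod_mor (sp X (src I \<phi>)) (fib (\<Gamma> A) (src I \<phi>)) (smod_push (sp X (tgt I \<phi>)) (tr X \<phi>) (fib (\<Gamma> A) (tgt I \<phi>))) (trn (\<Gamma> A) \<phi>)"
      by (intro mor) (simp add: out_iff)
    fix \<psi> W s assume "\<psi> \<in> Ar I" "tgt I \<phi> = src I \<psi>" "W \<in> opens (sp X (src I \<phi>))" "s \<in> carrier (dsec (\<Gamma> A) (src I \<phi>) W)"
    then show "trn (\<Gamma> A) (cmp I \<psi> \<phi>) W s = trn (\<Gamma> A) \<psi> (pre (sp X (tgt I \<phi>)) (tr X \<phi>) W) (trn (\<Gamma> A) \<phi> W s)"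
      using cmp[of \<phi> "src I \<phi>" \<psi> W s] \<phi> by (simp add: out_iff pb_def)
  qed (simp_all add: smod idt)
qed

end

section \<open>Cosets in free abelian groups\<close>

lemma r_coset_free: "K #>\<^bsub>free_Abelian_group S\<^esub> c = (\<lambda>k. k + c) ` K"
  by (auto simp: r_coset_def)

text \<open>\<open>frag_extend u\<close> is additive, so it carries all that the generators generate
  into \<open>K'\<close> once it does so for the generators. This is how maps on formal sums are
  seen to respect the tensor relations.\<close>

lemma generate_free_hom:
  assumes H: "H \<subseteq> carrier (free_Abelian_group S)" and K: "subgroup K' (free_Abelian_group S')"
    and u: "\<And>x. x \<in> H \<Longrightarrow> frag_extend u x \<in> K'" and x: "x \<in> generate (free_Abelian_group S) H"
  shows "frag_extend u x \<in> K'"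
  using x
proof (induction rule: generate.induct)
  case one
  then show ?case
    using subgroup.one_closed[OF K] by simp
next
  case (incl h)
  then show ?case by (rule u)
next
  case (inv h)
  have "inv\<^bsub>free_Abelian_group S\<^esub> h = - h"
    by (rule inv_free_Abelian_group) (use H inv in \<open>simp add: subset_iff\<close>)
  moreover have "inv\<^bsub>free_Abelian_group S'\<^esub> (frag_extend u h) = - frag_extend u h"
    by (rule inv_free_Abelian_group) (use subgroup.subset[OF K] u[OF inv] in \<open>simp add: subset_iff\<close>)
  ultimately show ?case
    using subgroup.m_inv_closed[OF K u[OF inv]] by (simp add: frag_extend_minus)
next
  case (eng h1 h2)
  then show ?case
    using subgroup.m_closed[OF K, of "frag_extend u h1" "frag_extend u h2"] by (simp add: frag_extend_add)
qed

text \<open>Scalar multiplication in \<open>tensor\<close> and restriction in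
  \<open>pre_pullback\<close> are written as unions over the members of a coset. As
  \<open>frag_extend u\<close> maps \<open>K\<close> into \<open>K'\<close>, all members contribute
  the same coset.\<close>

lemma coset_image:
  assumes K: "0 \<in> K" and K': "subgroup K' (free_Abelian_group S')"
    and u: "\<And>k. k \<in> K \<Longrightarrow> frag_extend u k \<in> K'"
  shows "(\<Union>c'\<in>K #>\<^bsub>free_Abelian_group S\<^esub> c. K' #>\<^bsub>free_Abelian_group S'\<^esub> frag_extend u c') =
    K' #>\<^bsub>free_Abelian_group S'\<^esub> frag_extend u c"
proof -
  have "K' #>\<^bsub>free_Abelian_group S'\<^esub> frag_extend u (k + c) = K' #>\<^bsub>free_Abelian_group S'\<^esub> frag_extend u c"
    if k: "k \<in> K" for k
  proof -
    have "(\<lambda>j. j + frag_extend u k) ` K' = K'"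
    proof
      show "(\<lambda>j. j + frag_extend u k) ` K' \<subseteq> K'"
        using subgroup.m_closed[OF K' _ u[OF k]] by (simp add: image_subset_iff)
      have "inv\<^bsub>free_Abelian_group S'\<^esub> (frag_extend u k) = - frag_extend u k"
        by (rule inv_free_Abelian_group) (use subgroup.subset[OF K'] u[OF k] in \<open>simp add: subset_iff\<close>)
      then have "j - frag_extend u k \<in> K'" if "j \<in> K'" for j
        using subgroup.m_closed[OF K' that subgroup.m_inv_closed[OF K' u[OF k]]] by simp
      then show "K' \<subseteq> (\<lambda>j. j + frag_extend u k) ` K'"
        by (intro subsetI image_eqI[of _ _ "_ - frag_extend u k"]) simp_all
    qed
    then have "(\<lambda>j. j + frag_extend u c) ` K' = (\<lambda>j. j + frag_extend u c) ` (\<lambda>j. j + frag_extend u k) ` K'"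
      by simp
    then show ?thesis
      by (simp add: r_coset_free frag_extend_add image_image add.assoc)
  qed
  moreover have "K #>\<^bsub>free_Abelian_group S\<^esub> c = (\<lambda>k. k + c) ` K"
    by (rule r_coset_free)
  ultimately show ?thesis
    using K by (intro SUP_eq_const) (auto simp del: UN_simps)
qed

lemma coset_add_free:
  assumes "subgroup K (free_Abelian_group S)"
  shows "(K #>\<^bsub>free_Abelian_group S\<^esub> c) <#>\<^bsub>free_Abelian_group S\<^esub> (K #>\<^bsub>free_Abelian_group S\<^esub> d) =
    K #>\<^bsub>free_Abelian_group S\<^esub> (c + d)"
proof
  have "\<exists>m\<in>K. k + c + (l + d) = m + (c + d)" if "k \<in> K" "l \<in> K" for k l
    using subgroup.m_closed[OF assms that] by (intro bexI[of _ "k + l"]) (simp_all add: algebra_simps)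
  then show "(K #>\<^bsub>free_Abelian_group S\<^esub> c) <#>\<^bsub>free_Abelian_group S\<^esub> (K #>\<^bsub>free_Abelian_group S\<^esub> d)
      \<subseteq> K #>\<^bsub>free_Abelian_group S\<^esub> (c + d)"
    by (auto simp: r_coset_free set_mult_def)
  have "0 \<in> K"
    using subgroup.one_closed[OF assms] by simp
  then show "K #>\<^bsub>free_Abelian_group S\<^esub> (c + d)
      \<subseteq> (K #>\<^bsub>free_Abelian_group S\<^esub> c) <#>\<^bsub>free_Abelian_group S\<^esub> (K #>\<^bsub>free_Abelian_group S\<^esub> d)"
    by (force simp: r_coset_free set_mult_def algebra_simps)
qed

lemma frag_extend_carrier:
  assumes "c \<in> carrier (free_Abelian_group S)" "\<And>x. x \<in> S \<Longrightarrow> u x \<in> S'"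
  shows "frag_extend (\<lambda>x. frag_of (u x)) c \<in> carrier (free_Abelian_group S')"
  using keys_frag_extend[of "\<lambda>x. frag_of (u x)" c] assms by (auto simp: keys_frag_of)

lemma frag_extend_frag_of:
  "frag_extend g (frag_extend (\<lambda>x. frag_of (u x)) c) = frag_extend (\<lambda>x. g (u x)) c"
  using subset_UNIV by (induction c rule: frag_induction) (auto simp: frag_extend_diff)

lemma frag_extend_cong:
  assumes "c \<in> carrier (free_Abelian_group S)" "\<And>x. x \<in> S \<Longrightarrow> u x = v x"
  shows "frag_extend u c = frag_extend v c"
  by (rule frag_extend_eq) (use assms in auto)

lemma frag_extend_ident:
  assumes "c \<in> carrier (free_Abelian_group S)" "\<And>x. x \<in> S \<Longrightarrow> u x = x"
  shows "frag_extend (\<lambda>x. frag_of (u x)) c = c"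
  using frag_extend_cong[OF assms(1), of "\<lambda>x. frag_of (u x)" frag_of] assms(2) frag_expansion[of c] by simp

text \<open>The kernel of \<open>E\<close> is a subgroup, hence contains everything generated by the
  relations. Here the values lie in the additive group of a module, in contrast to
  \<open>generate_free_hom\<close>.\<close>

lemma hom_generate_zero:
  assumes H: "H \<subseteq> carrier (free_Abelian_group S)" and N: "abelian_group N"
    and E: "E \<in> hom (free_Abelian_group S) (add_monoid N)"
    and z: "\<And>x. x \<in> H \<Longrightarrow> E x = \<zero>\<^bsub>N\<^esub>" and x: "x \<in> generate (free_Abelian_group S) H"
  shows "E x = \<zero>\<^bsub>N\<^esub>"
proof -
  interpret N: abelian_group N by fact
  interpret E: group_hom "free_Abelian_group S" "add_monoid N" E
    using E N.a_group by (simp add: group_hom_def group_hom_axioms_def)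
  have "generate (free_Abelian_group S) H \<subseteq> kernel (free_Abelian_group S) (add_monoid N) E"
  proof (rule group.generate_subgroup_incl)
    show "group (free_Abelian_group S)" by simp
    show "H \<subseteq> kernel (free_Abelian_group S) (add_monoid N) E"
      using H z by (simp add: kernel_def subset_iff del: carrier_free_Abelian_group_iff)
  qed (rule E.subgroup_kernel)
  then show ?thesis
    using x by (auto simp: kernel_def)
qed

section \<open>The pullback of a sheaf of modules\<close>

locale pullback_data =
  fixes X :: "('p, 'r) ringed_space" and Y :: "('q, 's) ringed_space" and f :: "('p, 'q, 'r, 's) mor"
    and A :: "('q, 's, 'm) smod"
  assumes rX: "ringed X" and rY: "ringed Y" and f: "lrs_mor X Y f" and A: "is_smod Y A"
begin

definition FF :: "'p set \<Rightarrow> 'q set set" where "FF W = opens_over X Y f W"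

definition R where "R W = lim_ring Y (FF W)"

definition L where "L W = lim_module Y A (FF W)"

definition \<theta> where "\<theta> W = inv_ring_map X f W"

definition S where "S W = carrier (ring_at X W) \<times> carrier (L W)"

abbreviation G where "G W \<equiv> free_Abelian_group (S W)"

definition K where "K W = tensor_kernel (R W) (ring_at X W) (\<theta> W) (L W)"

definition P where "P = pre_pullback X Y f A"

definition resl :: "'p set \<Rightarrow> ('q set \<times> 'm) set \<Rightarrow> ('q set \<times> 'm) set" where
  "resl W' = lim_map (mgerm A (FF W'))"

text \<open>Restriction of the tensor presheaf lifted to formal sums; \<open>sm\<close> does the
  same for multiplication by a scalar, and \<open>CC\<close> passes to the tensor product.
  Computations with unions of cosets are thereby reduced to maps of free groups.\<close>

definition rr where
  "rr W W' = frag_extend (\<lambda>x. frag_of (case x of (a, l) \<Rightarrow> (rres X W W' a, resl W' l)))"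

definition sm where
  "sm W b = frag_extend (\<lambda>x. frag_of (case x of (a, s) \<Rightarrow> (b \<otimes>\<^bsub>ring_at X W\<^esub> a, s)))"

definition CC where "CC W c = K W #>\<^bsub>G W\<^esub> c"

definition lg :: "'p set \<Rightarrow> 'q set \<Rightarrow> 'm \<Rightarrow> ('q set \<times> 'm) set" where "lg W = mgerm A (FF W)"

definition rg :: "'p set \<Rightarrow> 'q set \<Rightarrow> 's \<Rightarrow> ('q set \<times> 's) set" where "rg W = rgerm Y (FF W)"

lemma FF_open: "V \<in> FF W \<Longrightarrow> openin (topol Y) V"
  by (simp add: FF_def opens_over_def)

lemma FF_Int: "V \<in> FF W \<Longrightarrow> V' \<in> FF W \<Longrightarrow> V \<inter> V' \<in> FF W"
  by (auto simp: FF_def opens_over_def)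

lemma FF_mono: "W' \<subseteq> W \<Longrightarrow> V \<in> FF W \<Longrightarrow> V \<in> FF W'"
  by (auto simp: FF_def opens_over_def)

lemma FF_iff: "openin (topol X) W \<Longrightarrow> V \<in> FF W \<longleftrightarrow> openin (topol Y) V \<and> W \<subseteq> pre X f V"
  using openin_subset by (fastforce simp: FF_def opens_over_def pre_def)

lemma dsr: "direct_sys (topol Y) (\<lambda>V. carrier (ring_at Y V)) (rres Y) (FF W)"
  by (rule direct_sys_ring[OF rY FF_open FF_Int])

lemma dsm: "direct_sys (topol Y) (\<lambda>V. carrier (sec A V)) (sres A) (FF W)"
  by (rule direct_sys_smod[OF A FF_open FF_Int])

lemma L_carrier: "l \<in> carrier (L W) \<longleftrightarrow> (\<exists>V s. V \<in> FF W \<and> s \<in> carrier (sec A V) \<and> l = lg W V s)"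
  by (auto simp: L_def lim_module_def lg_def)

lemma R_carrier: "r \<in> carrier (R W) \<longleftrightarrow> (\<exists>V s. V \<in> FF W \<and> s \<in> carrier (ring_at Y V) \<and> r = rg W V s)"
  by (auto simp: R_def lim_ring_def rg_def)

lemma lg_closed: "V \<in> FF W \<Longrightarrow> s \<in> carrier (sec A V) \<Longrightarrow> lg W V s \<in> carrier (L W)"
  by (auto simp: L_carrier)

lemma lg_res: "V \<in> FF W \<Longrightarrow> V' \<in> FF W \<Longrightarrow> V' \<subseteq> V \<Longrightarrow> s \<in> carrier (sec A V) \<Longrightarrow> lg W V' (sres A V V' s) = lg W V s"
  unfolding lg_def by (rule direct_sys.gm_res[OF dsm])

lemma rg_res: "V \<in> FF W \<Longrightarrow> V' \<in> FF W \<Longrightarrow> V' \<subseteq> V \<Longrightarrow> s \<in> carrier (ring_at Y V) \<Longrightarrow> rg W V' (rres Y V V' s) = rg W V s"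
  unfolding rg_def by (rule direct_sys.gm_res[OF dsr])

lemma L_common:
  assumes "l \<in> carrier (L W)" "l' \<in> carrier (L W)"
  obtains V s s' where "V \<in> FF W" "s \<in> carrier (sec A V)" "s' \<in> carrier (sec A V)" "l = lg W V s" "l' = lg W V s'"
proof -
  obtain V s where 1: "V \<in> FF W" "s \<in> carrier (sec A V)" "l = lg W V s"
    using assms(1) L_carrier by blast
  obtain V' s' where 2: "V' \<in> FF W" "s' \<in> carrier (sec A V')" "l' = lg W V' s'"
    using assms(2) L_carrier by blast
  note VV = FF_Int[OF 1(1) 2(1)]
  show thesis
    by (rule that[OF VV, of "sres A V (V \<inter> V') s" "sres A V' (V \<inter> V') s'"])
      (simp_all add: 1 2 VV lg_res sres_closed[OF A] FF_open[OF VV] FF_open[OF 1(1)] FF_open[OF 2(1)])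
qed

lemma RL_common:
  assumes "r \<in> carrier (R W)" "l' \<in> carrier (L W)"
  obtains V s s' where "V \<in> FF W" "s \<in> carrier (ring_at Y V)" "s' \<in> carrier (sec A V)" "r = rg W V s" "l' = lg W V s'"
proof -
  obtain V s where 1: "V \<in> FF W" "s \<in> carrier (ring_at Y V)" "r = rg W V s"
    using assms(1) R_carrier by blast
  obtain V' s' where 2: "V' \<in> FF W" "s' \<in> carrier (sec A V')" "l' = lg W V' s'"
    using assms(2) L_carrier by blast
  note VV = FF_Int[OF 1(1) 2(1)]
  show thesis
    by (rule that[OF VV, of "rres Y V (V \<inter> V') s" "sres A V' (V \<inter> V') s'"])
      (simp_all add: 1 2 VV lg_res rg_res sres_closed[OF A] rres_closed[OF rY] FF_open[OF VV] FF_open[OF 1(1)] FF_open[OF 2(1)])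
qed

lemma L_add:
  "V \<in> FF W \<Longrightarrow> s \<in> carrier (sec A V) \<Longrightarrow> t \<in> carrier (sec A V) \<Longrightarrow>
   lg W V s \<oplus>\<^bsub>L W\<^esub> lg W V t = lg W V (s \<oplus>\<^bsub>sec A V\<^esub> t)"
  unfolding L_def lg_def by (rule lim_module_add[OF A FF_open FF_Int])

lemma L_smult:
  "V \<in> FF W \<Longrightarrow> r \<in> carrier (ring_at Y V) \<Longrightarrow> t \<in> carrier (sec A V) \<Longrightarrow>
   rg W V r \<odot>\<^bsub>L W\<^esub> lg W V t = lg W V (r \<odot>\<^bsub>sec A V\<^esub> t)"
  unfolding L_def lg_def rg_def by (rule lim_module_smult[OF rY A FF_open FF_Int])

lemma A_add_closed:
  "openin (topol Y) V \<Longrightarrow> s \<in> carrier (sec A V) \<Longrightarrow> t \<in> carrier (sec A V) \<Longrightarrow> s \<oplus>\<^bsub>sec A V\<^esub> t \<in> carrier (sec A V)"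
  by (rule abelian_monoid.a_closed[OF abelian_group.axioms(1)[OF smod_group[OF A]]])

lemma A_smult_closed:
  "openin (topol Y) V \<Longrightarrow> r \<in> carrier (ring_at Y V) \<Longrightarrow> t \<in> carrier (sec A V) \<Longrightarrow> r \<odot>\<^bsub>sec A V\<^esub> t \<in> carrier (sec A V)"
  by (rule module.smult_closed[OF smod_module[OF A]])

lemma L_add_closed: "l \<in> carrier (L W) \<Longrightarrow> l' \<in> carrier (L W) \<Longrightarrow> l \<oplus>\<^bsub>L W\<^esub> l' \<in> carrier (L W)"
  by (erule (1) L_common) (simp add: L_add lg_closed A_add_closed FF_open)

lemma L_smult_closed: "r \<in> carrier (R W) \<Longrightarrow> l \<in> carrier (L W) \<Longrightarrow> r \<odot>\<^bsub>L W\<^esub> l \<in> carrier (L W)"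
  by (erule (1) RL_common) (simp add: L_smult lg_closed A_smult_closed FF_open)

lemma \<theta>_rg:
  assumes W: "openin (topol X) W" and V: "V \<in> FF W" and r: "r \<in> carrier (ring_at Y V)"
  shows "\<theta> W (rg W V r) = rres X (pre X f V) W (cm f V r)"
  unfolding \<theta>_def inv_ring_map_def rg_def
proof (rule direct_sys.lim_map_gm[OF dsr V r])
  fix V1 V2 t assume 1: "V1 \<in> FF W" and 2: "V2 \<in> FF W" and s: "V2 \<subseteq> V1" and t: "t \<in> carrier (ring_at Y V1)"
  have "rres X (pre X f V2) W (rres X (pre X f V1) (pre X f V2) (cm f V1 t)) = rres X (pre X f V1) W (cm f V1 t)"
    by (rule rres_comp[OF rX])
      (use 1 2 s t W in \<open>simp_all add: FF_iff lrs_mor_openin_pre[OF f] lrs_mor_cm_closed[OF f] pre_mono\<close>)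
  then show "rres X (pre X f V2) W (cm f V2 (rres Y V1 V2 t)) = rres X (pre X f V1) W (cm f V1 t)"
    by (simp add: lrs_mor_cm_rres[OF f] s t FF_open[OF 1] FF_open[OF 2])
qed

lemma \<theta>_closed:
  assumes W: "openin (topol X) W" and r: "r \<in> carrier (R W)"
  shows "\<theta> W r \<in> carrier (ring_at X W)"
proof -
  obtain V s where 1: "V \<in> FF W" "s \<in> carrier (ring_at Y V)" "r = rg W V s"
    using r R_carrier by blast
  show ?thesis
    unfolding 1(3) \<theta>_rg[OF W 1(1,2)]
    by (rule rres_closed[OF rX]) (use 1 W in \<open>simp_all add: FF_iff lrs_mor_openin_pre[OF f] lrs_mor_cm_closed[OF f]\<close>)
qed

lemma resl_lg:
  assumes "W' \<subseteq> W" "V \<in> FF W" "s \<in> carrier (sec A V)"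
  shows "resl W' (lg W V s) = lg W' V s"
  unfolding resl_def lg_def
  by (rule direct_sys.lim_map_gm[OF dsm assms(2,3)])
    (use assms(1) FF_mono[OF assms(1)] in \<open>simp add: direct_sys.gm_res[OF dsm]\<close>)

lemma resl_closed: "W' \<subseteq> W \<Longrightarrow> l \<in> carrier (L W) \<Longrightarrow> resl W' l \<in> carrier (L W')"
  unfolding L_carrier[of l W] by (elim exE conjE) (simp add: resl_lg lg_closed FF_mono)

lemma resl_id: "l \<in> carrier (L W) \<Longrightarrow> resl W l = l"
  unfolding L_carrier by (elim exE conjE) (simp add: resl_lg)

lemma resl_comp: "W'' \<subseteq> W' \<Longrightarrow> W' \<subseteq> W \<Longrightarrow> l \<in> carrier (L W) \<Longrightarrow> resl W'' (resl W' l) = resl W'' l"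
  unfolding L_carrier by (elim exE conjE) (simp add: resl_lg FF_mono order_trans[of W'' W' W])

lemma resl_add:
  assumes "W' \<subseteq> W" "l \<in> carrier (L W)" "l' \<in> carrier (L W)"
  shows "resl W' (l \<oplus>\<^bsub>L W\<^esub> l') = resl W' l \<oplus>\<^bsub>L W'\<^esub> resl W' l'"
  using assms(2,3)
  by (rule L_common) (simp add: L_add resl_lg assms(1) FF_mono[OF assms(1)] A_add_closed FF_open)

lemma resl_smult:
  assumes "W' \<subseteq> W" "V \<in> FF W" "r \<in> carrier (ring_at Y V)" "s \<in> carrier (sec A V)"
  shows "resl W' (rg W V r \<odot>\<^bsub>L W\<^esub> lg W V s) = rg W' V r \<odot>\<^bsub>L W'\<^esub> lg W' V s"
  using assms by (simp add: L_smult resl_lg FF_mono[OF assms(1)] A_smult_closed FF_open)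

lemma ring_X: "openin (topol X) W \<Longrightarrow> cring (ring_at X W)"
  by (rule ringed_cring[OF rX])

lemma X_mult_closed:
  "openin (topol X) W \<Longrightarrow> a \<in> carrier (ring_at X W) \<Longrightarrow> b \<in> carrier (ring_at X W) \<Longrightarrow>
   a \<otimes>\<^bsub>ring_at X W\<^esub> b \<in> carrier (ring_at X W)"
  by (rule ring.ring_simprules(5)[OF cring.axioms(1)[OF ring_X]])

lemma X_add_closed:
  "openin (topol X) W \<Longrightarrow> a \<in> carrier (ring_at X W) \<Longrightarrow> b \<in> carrier (ring_at X W) \<Longrightarrow>
   a \<oplus>\<^bsub>ring_at X W\<^esub> b \<in> carrier (ring_at X W)"
  by (rule ring.ring_simprules(1)[OF cring.axioms(1)[OF ring_X]])

lemma X_one_closed: "openin (topol X) W \<Longrightarrow> \<one>\<^bsub>ring_at X W\<^esub> \<in> carrier (ring_at X W)"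
  by (rule ring.ring_simprules(6)[OF cring.axioms(1)[OF ring_X]])

section \<open>The tensor relations and the operations on formal sums\<close>

definition rels where "rels W = tensor_rels (R W) (ring_at X W) (\<theta> W) (L W)"

lemma K_generate: "K W = generate (G W) (rels W)"
  by (simp add: K_def tensor_kernel_def S_def rels_def)

lemma keys_diff_subset: "Poly_Mapping.keys x \<subseteq> T \<Longrightarrow> Poly_Mapping.keys y \<subseteq> T \<Longrightarrow> Poly_Mapping.keys (x - y) \<subseteq> T"
  for x y :: "'x \<Rightarrow>\<^sub>0 int"
  by (rule order_trans[OF keys_diff Un_least])

lemma rels_cases:
  assumes "x \<in> rels W"
  obtains a b s where "x = frag_of (a \<oplus>\<^bsub>ring_at X W\<^esub> b, s) - frag_of (a, s) - frag_of (b, s)"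
      "a \<in> carrier (ring_at X W)" "b \<in> carrier (ring_at X W)" "s \<in> carrier (L W)"
    | a s t where "x = frag_of (a, s \<oplus>\<^bsub>L W\<^esub> t) - frag_of (a, s) - frag_of (a, t)"
      "a \<in> carrier (ring_at X W)" "s \<in> carrier (L W)" "t \<in> carrier (L W)"
    | a r s where "x = frag_of (a \<otimes>\<^bsub>ring_at X W\<^esub> \<theta> W r, s) - frag_of (a, r \<odot>\<^bsub>L W\<^esub> s)"
      "a \<in> carrier (ring_at X W)" "r \<in> carrier (R W)" "s \<in> carrier (L W)"
  using assms unfolding rels_def tensor_rels_def
proof (elim UnE CollectE exE conjE)
  fix a b s assume "x = frag_of (a \<oplus>\<^bsub>ring_at X W\<^esub> b, s) - frag_of (a, s) - frag_of (b, s)"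
    "a \<in> carrier (ring_at X W)" "b \<in> carrier (ring_at X W)" "s \<in> carrier (L W)"
  then show thesis by (rule that(1))
next
  fix a s t assume "x = frag_of (a, s \<oplus>\<^bsub>L W\<^esub> t) - frag_of (a, s) - frag_of (a, t)"
    "a \<in> carrier (ring_at X W)" "s \<in> carrier (L W)" "t \<in> carrier (L W)"
  then show thesis by (rule that(2))
next
  fix a r s assume "x = frag_of (a \<otimes>\<^bsub>ring_at X W\<^esub> \<theta> W r, s) - frag_of (a, r \<odot>\<^bsub>L W\<^esub> s)"
    "a \<in> carrier (ring_at X W)" "r \<in> carrier (R W)" "s \<in> carrier (L W)"
  then show thesis by (rule that(3))
qed

lemma rels_carrier: assumes W: "openin (topol X) W" shows "rels W \<subseteq> carrier (G W)"
proof
  fix x assume "x \<in> rels W"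
  then show "x \<in> carrier (G W)"
    by (cases rule: rels_cases)
      (simp_all add: keys_diff_subset keys_frag_of S_def X_add_closed X_mult_closed L_add_closed L_smult_closed \<theta>_closed W)
qed

lemma K_subgroup: "openin (topol X) W \<Longrightarrow> subgroup (K W) (G W)"
  unfolding K_generate by (rule group.generate_is_subgroup) (simp_all only: group_free_Abelian_group rels_carrier)

lemma zero_K: "openin (topol X) W \<Longrightarrow> 0 \<in> K W"
  using subgroup.one_closed[OF K_subgroup] by simp

lemma rels_K: "x \<in> rels W \<Longrightarrow> x \<in> K W"
  unfolding K_generate by (rule generate.incl)

text \<open>Each of the three kinds of relation is mapped to a relation of the same kind. The
  balancing relation takes an extra argument: its scalar is a germ, for which a representative is
  chosen, and the image of that representative under \<open>\<theta>\<close> is compatible with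
  restriction.\<close>

lemma rr_rels:
  assumes W: "openin (topol X) W" and W': "openin (topol X) W'" and sub: "W' \<subseteq> W" and x: "x \<in> rels W"
  shows "rr W W' x \<in> rels W'"
  using x
proof (cases rule: rels_cases)
  case (1 a b s)
  have "rr W W' x = frag_of (rres X W W' a \<oplus>\<^bsub>ring_at X W'\<^esub> rres X W W' b, resl W' s)
      - frag_of (rres X W W' a, resl W' s) - frag_of (rres X W W' b, resl W' s)"
    unfolding rr_def 1(1) by (simp add: frag_extend_diff ring_hom_add[OF ringed_hom[OF rX W W' sub]] 1)
  moreover have "rres X W W' a \<in> carrier (ring_at X W')" "rres X W W' b \<in> carrier (ring_at X W')" "resl W' s \<in> carrier (L W')"
    using 1 by (simp_all add: rres_closed[OF rX W W' sub] resl_closed[OF sub])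
  ultimately show ?thesis
    unfolding rels_def tensor_rels_def by blast
next
  case (2 a s t)
  have "rr W W' x = frag_of (rres X W W' a, resl W' s \<oplus>\<^bsub>L W'\<^esub> resl W' t)
      - frag_of (rres X W W' a, resl W' s) - frag_of (rres X W W' a, resl W' t)"
    unfolding rr_def 2(1) by (simp add: frag_extend_diff resl_add sub 2)
  moreover have "rres X W W' a \<in> carrier (ring_at X W')" "resl W' t \<in> carrier (L W')" "resl W' s \<in> carrier (L W')"
    using 2 by (simp_all add: rres_closed[OF rX W W' sub] resl_closed[OF sub])
  ultimately show ?thesis
    unfolding rels_def tensor_rels_def by blast
next
  case (3 a r s)
  obtain V r0 s0 where V: "V \<in> FF W" "r0 \<in> carrier (ring_at Y V)" "s0 \<in> carrier (sec A V)"
      "r = rg W V r0" "s = lg W V s0"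
    using RL_common[OF 3(3,4)] by blast
  have V': "V \<in> FF W'"
    by (rule FF_mono[OF sub V(1)])
  have th: "rres X W W' (\<theta> W r) = \<theta> W' (rg W' V r0)"
    unfolding V(4) \<theta>_rg[OF W V(1,2)] \<theta>_rg[OF W' V' V(2)]
    by (rule rres_comp[OF rX])
      (use V sub W W' in \<open>simp_all add: FF_iff lrs_mor_openin_pre[OF f] lrs_mor_cm_closed[OF f]\<close>)
  have "rr W W' x = frag_of (rres X W W' a \<otimes>\<^bsub>ring_at X W'\<^esub> \<theta> W' (rg W' V r0), resl W' s)
      - frag_of (rres X W W' a, rg W' V r0 \<odot>\<^bsub>L W'\<^esub> resl W' s)"
    unfolding rr_def 3(1)
    by (simp add: frag_extend_diff ring_hom_mult[OF ringed_hom[OF rX W W' sub]] \<theta>_closed[OF W] th 3)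
      (simp add: V resl_smult[OF sub] resl_lg[OF sub])
  moreover have "rres X W W' a \<in> carrier (ring_at X W')" "resl W' s \<in> carrier (L W')" "rg W' V r0 \<in> carrier (R W')"
    using 3 V V' by (auto simp add: rres_closed[OF rX W W' sub] resl_closed[OF sub] R_carrier)
  ultimately show ?thesis
    unfolding rels_def tensor_rels_def by blast
qed

text \<open>Multiplication acts on the ring factor alone. Additivity in that factor is preserved by
  distributivity, and the balancing relation by associativity.\<close>

lemma sm_rels:
  assumes W: "openin (topol X) W" and b: "b \<in> carrier (ring_at X W)" and x: "x \<in> rels W"
  shows "sm W b x \<in> rels W"
proof -
  interpret cring "ring_at X W" by (rule ring_X[OF W])
  show ?thesis
    using x
  proof (cases rule: rels_cases)
    case (1 a c s)
    have "sm W b x = frag_of (b \<otimes>\<^bsub>ring_at X W\<^esub> a \<oplus>\<^bsub>ring_at X W\<^esub> b \<otimes>\<^bsub>ring_at X W\<^esub> c, s)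
        - frag_of (b \<otimes>\<^bsub>ring_at X W\<^esub> a, s) - frag_of (b \<otimes>\<^bsub>ring_at X W\<^esub> c, s)"
      unfolding sm_def 1(1) by (simp add: frag_extend_diff 1 b r_distr)
    moreover have "b \<otimes>\<^bsub>ring_at X W\<^esub> a \<in> carrier (ring_at X W)" "b \<otimes>\<^bsub>ring_at X W\<^esub> c \<in> carrier (ring_at X W)"
      using 1 b by simp_all
    ultimately show ?thesis
      using 1(4) unfolding rels_def tensor_rels_def by blast
  next
    case (2 a s t)
    have "sm W b x = frag_of (b \<otimes>\<^bsub>ring_at X W\<^esub> a, s \<oplus>\<^bsub>L W\<^esub> t)
        - frag_of (b \<otimes>\<^bsub>ring_at X W\<^esub> a, s) - frag_of (b \<otimes>\<^bsub>ring_at X W\<^esub> a, t)"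
      unfolding sm_def 2(1) by (simp add: frag_extend_diff)
    moreover have "b \<otimes>\<^bsub>ring_at X W\<^esub> a \<in> carrier (ring_at X W)"
      using 2 b by simp
    ultimately show ?thesis
      using 2(3,4) unfolding rels_def tensor_rels_def by blast
  next
    case (3 a r s)
    have "sm W b x = frag_of ((b \<otimes>\<^bsub>ring_at X W\<^esub> a) \<otimes>\<^bsub>ring_at X W\<^esub> \<theta> W r, s)
        - frag_of (b \<otimes>\<^bsub>ring_at X W\<^esub> a, r \<odot>\<^bsub>L W\<^esub> s)"
      unfolding sm_def 3(1) by (simp add: frag_extend_diff 3 b m_assoc \<theta>_closed[OF W])
    moreover have "b \<otimes>\<^bsub>ring_at X W\<^esub> a \<in> carrier (ring_at X W)"
      using 3 b by simp
    ultimately show ?thesis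
      using 3(3,4) unfolding rels_def tensor_rels_def by blast
  qed
qed

lemma rr_K:
  assumes "openin (topol X) W" "openin (topol X) W'" "W' \<subseteq> W" "x \<in> K W"
  shows "rr W W' x \<in> K W'"
  unfolding rr_def
  by (rule generate_free_hom[OF rels_carrier[OF assms(1)] K_subgroup[OF assms(2)]])
    (use rr_rels[OF assms(1-3)] rels_K assms(4) in \<open>simp_all add: rr_def K_generate\<close>)

lemma sm_K:
  assumes "openin (topol X) W" "b \<in> carrier (ring_at X W)" "x \<in> K W"
  shows "sm W b x \<in> K W"
  unfolding sm_def
  by (rule generate_free_hom[OF rels_carrier[OF assms(1)] K_subgroup[OF assms(1)]])
    (use sm_rels[OF assms(1,2)] rels_K assms(3) in \<open>simp_all add: sm_def K_generate\<close>)

lemma rr_carrier: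
  assumes "openin (topol X) W" "openin (topol X) W'" "W' \<subseteq> W" "c \<in> carrier (G W)"
  shows "rr W W' c \<in> carrier (G W')"
  unfolding rr_def
  by (rule frag_extend_carrier[OF assms(4)])
    (auto simp: S_def rres_closed[OF rX assms(1-3)] resl_closed[OF assms(3)])

lemma sm_carrier:
  assumes "openin (topol X) W" "b \<in> carrier (ring_at X W)" "c \<in> carrier (G W)"
  shows "sm W b c \<in> carrier (G W)"
  unfolding sm_def
  by (rule frag_extend_carrier[OF assms(3)]) (auto simp: S_def X_mult_closed assms)

lemma rr_id: "openin (topol X) W \<Longrightarrow> c \<in> carrier (G W) \<Longrightarrow> rr W W c = c"
  unfolding rr_def by (rule frag_extend_ident) (auto simp: S_def rres_id[OF rX] resl_id)

lemma rr_comp: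
  assumes "openin (topol X) W" "openin (topol X) W'" "openin (topol X) W''" "W'' \<subseteq> W'" "W' \<subseteq> W" "c \<in> carrier (G W)"
  shows "rr W' W'' (rr W W' c) = rr W W'' c"
  unfolding rr_def frag_extend_frag_of
  by (rule frag_extend_cong[OF assms(6)])
    (auto simp: S_def rres_comp[OF rX assms(1-5)] resl_comp[OF assms(4,5)])

lemma rr_sm:
  assumes "openin (topol X) W" "openin (topol X) W'" "W' \<subseteq> W" "b \<in> carrier (ring_at X W)" "c \<in> carrier (G W)"
  shows "rr W W' (sm W b c) = sm W' (rres X W W' b) (rr W W' c)"
  unfolding rr_def sm_def frag_extend_frag_of
  by (rule frag_extend_cong[OF assms(5)])
    (auto simp: S_def ring_hom_mult[OF ringed_hom[OF rX assms(1-3)]] assms(4))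

lemma rr_add: "rr W W' (c + d) = rr W W' c + rr W W' d"
  by (simp add: rr_def frag_extend_add)

lemma P_carrier: "carrier (sec P W) = CC W ` carrier (G W)"
  by (auto simp: P_def pre_pullback_def Let_def tensor_def RCOSETS_def CC_def K_def R_def L_def \<theta>_def S_def FF_def)

lemma P_add:
  assumes "openin (topol X) W"
  shows "CC W c \<oplus>\<^bsub>sec P W\<^esub> CC W d = CC W (c + d)"
proof -
  have "CC W c \<oplus>\<^bsub>sec P W\<^esub> CC W d = CC W c <#>\<^bsub>G W\<^esub> CC W d"
    by (simp add: P_def pre_pullback_def Let_def tensor_def S_def L_def FF_def)
  then show ?thesis
    by (simp add: CC_def coset_add_free[OF K_subgroup[OF assms]])
qed

lemma P_smult:
  assumes "openin (topol X) W" "b \<in> carrier (ring_at X W)"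
  shows "b \<odot>\<^bsub>sec P W\<^esub> CC W c = CC W (sm W b c)"
proof -
  have "b \<odot>\<^bsub>sec P W\<^esub> CC W c = (\<Union>c'\<in>CC W c. CC W (sm W b c'))"
    by (simp add: P_def pre_pullback_def Let_def tensor_def CC_def K_def R_def L_def \<theta>_def S_def FF_def sm_def
        case_prod_unfold)
  also have "\<dots> = CC W (sm W b c)"
    unfolding CC_def sm_def
    by (rule coset_image[OF zero_K[OF assms(1)] K_subgroup[OF assms(1)]])
      (use sm_K[OF assms] in \<open>simp add: sm_def\<close>)
  finally show ?thesis .
qed

lemma P_res:
  assumes "openin (topol X) W" "openin (topol X) W'" "W' \<subseteq> W"
  shows "sres P W W' (CC W c) = CC W' (rr W W' c)"
proof -
  have "sres P W W' (CC W c) = (\<Union>c'\<in>CC W c. CC W' (rr W W' c'))"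
    by (simp add: P_def pre_pullback_def Let_def tensor_def CC_def K_def R_def L_def \<theta>_def S_def FF_def rr_def resl_def
        case_prod_unfold)
  also have "\<dots> = CC W' (rr W W' c)"
    unfolding CC_def rr_def
    by (rule coset_image[OF zero_K[OF assms(1)] K_subgroup[OF assms(2)]])
      (use rr_K[OF assms] in \<open>simp add: rr_def\<close>)
  finally show ?thesis .
qed

text \<open>The presheaf laws hold already for formal sums. They are what \<open>direct_sys\<close>
  asks for in order to form germs of the tensor presheaf.\<close>

lemma P_presheaf: "presheaf_on (topol X) (\<lambda>W. carrier (sec P W)) (sres P)"
  unfolding presheaf_on_def
proof (intro conjI allI impI ballI Pi_I)
  fix W W' C assume "openin (topol X) W \<and> openin (topol X) W' \<and> W' \<subseteq> W" "C \<in> carrier (sec P W)"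
  then show "sres P W W' C \<in> carrier (sec P W')"
    by (elim conjE) (auto simp only: P_carrier P_res rr_carrier image_iff)
next
  fix W C assume "openin (topol X) W" "C \<in> carrier (sec P W)"
  then show "sres P W W C = C"
    by (auto simp only: P_carrier P_res rr_id image_iff subset_refl)
next
  fix U V W C assume "openin (topol X) U \<and> openin (topol X) V \<and> openin (topol X) W \<and> W \<subseteq> V \<and> V \<subseteq> U"
    "C \<in> carrier (sec P U)"
  then show "sres P V W (sres P U V C) = sres P U W C"
    by (elim conjE) (auto simp only: P_carrier P_res rr_comp rr_carrier image_iff order_trans)
qed

end

lemmas free_group_induct = free_Abelian_group_induct [consumes 1, case_names zero diff gen]

lemma (in abelian_group) add_minus_minus:
  assumes "x \<in> carrier G" "y \<in> carrier G"
  shows "x \<oplus> y \<ominus> x \<ominus> y = \<zero>"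
proof -
  have "x \<oplus> y \<ominus> x \<ominus> y = (x \<oplus> y) \<oplus> (\<ominus> x \<oplus> \<ominus> y)"
    using assms by (simp add: minus_eq a_assoc)
  also have "\<dots> = (x \<oplus> y) \<oplus> \<ominus> (x \<oplus> y)"
    using assms by (simp only: minus_add)
  also have "\<dots> = \<zero>"
    using assms by (simp add: r_neg)
  finally show ?thesis .
qed

section \<open>Germs and sections of the pullback sheaf\<close>

context pullback_data
begin

lemma nbhds_open: "V \<in> nbhds X y \<Longrightarrow> openin (topol X) V"
  by (simp add: nbhds_def)

lemma nbhds_Int: "V \<in> nbhds X y \<Longrightarrow> W \<in> nbhds X y \<Longrightarrow> V \<inter> W \<in> nbhds X y"
  by (auto simp: nbhds_def)

lemma nbhdsI: "openin (topol X) V \<Longrightarrow> y \<in> V \<Longrightarrow> V \<in> nbhds X y"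
  by (simp add: nbhds_def)

lemma dsP: "direct_sys (topol X) (\<lambda>W. carrier (sec P W)) (sres P) (nbhds X y)"
  by (intro direct_sys.intro P_presheaf nbhds_open nbhds_Int)

lemma dsX: "direct_sys (topol X) (\<lambda>W. carrier (ring_at X W)) (rres X) (nbhds X y)"
  by (rule direct_sys_ring[OF rX nbhds_open nbhds_Int])

definition st :: "'p \<Rightarrow> 'p set \<Rightarrow> _" where "st y W c = mgerm P (nbhds X y) W (CC W c)"

abbreviation Sh where "Sh \<equiv> pullback X Y f A"

text \<open>The section of the pullback given by a formal sum. Every section has this shape locally,
  and later arguments see the pullback through such sections.\<close>

definition sg where "sg W c = (\<lambda>y\<in>W. st y W c)"

lemma CC_P: "c \<in> carrier (G W) \<Longrightarrow> CC W c \<in> carrier (sec P W)"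
  by (simp add: P_carrier)

lemma st_add:
  assumes W: "W \<in> nbhds X y" and c: "c \<in> carrier (G W)" and d: "d \<in> carrier (G W)"
  shows "st y W c \<oplus>\<^bsub>lim_module X P (nbhds X y)\<^esub> st y W d = st y W (c + d)"
proof -
  have "st y W c \<oplus>\<^bsub>lim_module X P (nbhds X y)\<^esub> st y W d = mgerm P (nbhds X y) W (CC W c \<oplus>\<^bsub>sec P W\<^esub> CC W d)"
    unfolding lim_module_def st_def ring_record_simps
  proof (rule lim_op_same[OF dsP dsP dsP _ _ W CC_P[OF c] CC_P[OF d]])
    fix V s t assume "V \<in> nbhds X y" "s \<in> carrier (sec P V)" "t \<in> carrier (sec P V)"
    moreover from this obtain c d where "s = CC V c" "t = CC V d" "c \<in> carrier (G V)" "d \<in> carrier (G V)"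
      by (auto simp only: P_carrier)
    moreover have "c + d \<in> carrier (G V)"
      using \<open>c \<in> carrier (G V)\<close> \<open>d \<in> carrier (G V)\<close> keys_add[of c d] by auto
    ultimately show "s \<oplus>\<^bsub>sec P V\<^esub> t \<in> carrier (sec P V)"
      using nbhds_open by (simp only: P_add CC_P)
  next
    fix V W s t assume "V \<in> nbhds X y" "W \<in> nbhds X y" "W \<subseteq> V" "s \<in> carrier (sec P V)" "t \<in> carrier (sec P V)"
    moreover from this obtain c d where "s = CC V c" "t = CC V d" "c \<in> carrier (G V)" "d \<in> carrier (G V)"
      by (auto simp only: P_carrier)
    ultimately show "sres P V W (s \<oplus>\<^bsub>sec P V\<^esub> t) = sres P V W s \<oplus>\<^bsub>sec P W\<^esub> sres P V W t"
      using nbhds_open by (simp only: P_add P_res rr_add)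
  qed
  then show ?thesis
    by (simp only: P_add[OF nbhds_open[OF W]] st_def)
qed

lemma st_smult:
  assumes W: "W \<in> nbhds X y" and b: "b \<in> carrier (ring_at X W)" and c: "c \<in> carrier (G W)"
  shows "rgerm X (nbhds X y) W b \<odot>\<^bsub>lim_module X P (nbhds X y)\<^esub> st y W c = st y W (sm W b c)"
proof -
  have "rgerm X (nbhds X y) W b \<odot>\<^bsub>lim_module X P (nbhds X y)\<^esub> st y W c
      = mgerm P (nbhds X y) W (b \<odot>\<^bsub>sec P W\<^esub> CC W c)"
    unfolding lim_module_def st_def module.simps
  proof (rule lim_op_same[OF dsX dsP dsP _ _ W b CC_P[OF c]])
    fix V s t assume "V \<in> nbhds X y" "s \<in> carrier (ring_at X V)" "t \<in> carrier (sec P V)"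
    moreover from this obtain c where "t = CC V c" "c \<in> carrier (G V)"
      by (auto simp only: P_carrier)
    ultimately show "s \<odot>\<^bsub>sec P V\<^esub> t \<in> carrier (sec P V)"
      using nbhds_open by (simp only: P_smult CC_P sm_carrier)
  next
    fix V W s t assume "V \<in> nbhds X y" "W \<in> nbhds X y" "W \<subseteq> V" "s \<in> carrier (ring_at X V)" "t \<in> carrier (sec P V)"
    moreover from this obtain c where "t = CC V c" "c \<in> carrier (G V)"
      by (auto simp only: P_carrier)
    ultimately show "sres P V W (s \<odot>\<^bsub>sec P V\<^esub> t) = rres X V W s \<odot>\<^bsub>sec P W\<^esub> sres P V W t"
      using nbhds_open rX by (simp only: P_smult P_res rr_sm rres_closed)
  qed
  then show ?thesis
    by (simp only: P_smult[OF nbhds_open[OF W] b] st_def)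
qed

lemma st_res:
  assumes "openin (topol X) W" "openin (topol X) W'" "W' \<subseteq> W" "y \<in> W'" "c \<in> carrier (G W)"
  shows "st y W' (rr W W' c) = st y W c"
  unfolding st_def P_res[OF assms(1-3), symmetric]
  by (rule direct_sys.gm_res[OF dsP]) (use assms in \<open>auto simp only: nbhds_def CC_P mem_Collect_eq\<close>)

lemma Sh_carrier:
  "carrier (sec Sh W) = {\<sigma> \<in> (\<Pi>\<^sub>E x\<in>W. carrier (lim_module X P (nbhds X x))).
     \<forall>x\<in>W. \<exists>W'\<in>opens X. x \<in> W' \<and> W' \<subseteq> W \<and>
       (\<exists>s\<in>carrier (sec P W'). \<forall>y\<in>W'. \<sigma> y = mgerm P (nbhds X y) W' s)}"
  by (simp add: pullback_def sheafify_def Let_def P_def)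

lemma sg_Sh:
  assumes W: "openin (topol X) W" and c: "c \<in> carrier (G W)"
  shows "sg W c \<in> carrier (sec Sh W)"
proof -
  have "st y W c \<in> carrier (lim_module X P (nbhds X y))" if "y \<in> W" for y
    using CC_P[OF c] nbhdsI[OF W that] unfolding lim_module_def st_def by auto
  moreover have "\<exists>W'\<in>opens X. x \<in> W' \<and> W' \<subseteq> W \<and>
       (\<exists>s\<in>carrier (sec P W'). \<forall>y\<in>W'. sg W c y = mgerm P (nbhds X y) W' s)" if "x \<in> W" for x
    using that W CC_P[OF c] by (intro bexI[of _ W] conjI bexI[of _ "CC W c"] ballI) (simp_all add: sg_def st_def)
  ultimately show ?thesis
    unfolding Sh_carrier by (simp add: sg_def)
qed

text \<open>The definition of \<open>sheafify\<close> asks for local representation by sections of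
  the presheaf, and these are cosets of formal sums.\<close>

lemma sg_local:
  assumes "\<sigma> \<in> carrier (sec Sh W)" "x \<in> W"
  obtains W' c where "openin (topol X) W'" "x \<in> W'" "W' \<subseteq> W" "c \<in> carrier (G W')" "sres Sh W W' \<sigma> = sg W' c"
proof -
  obtain W' s where W': "openin (topol X) W'" "x \<in> W'" "W' \<subseteq> W" and s: "s \<in> carrier (sec P W')"
    and e: "\<forall>y\<in>W'. \<sigma> y = mgerm P (nbhds X y) W' s"
    using assms unfolding Sh_carrier by blast
  obtain c where c: "c \<in> carrier (G W')" "s = CC W' c"
    using s by (auto simp only: P_carrier)
  have "sres Sh W W' \<sigma> = restrict \<sigma> W'"
    by (simp add: pullback_def sheafify_def Let_def)
  also have "\<dots> = sg W' c"
    unfolding sg_def st_def by (rule restrict_ext) (use e c in simp)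
  finally show thesis
    using that W' c by blast
qed

lemma sg_res:
  assumes "openin (topol X) W" "openin (topol X) W'" "W' \<subseteq> W" "c \<in> carrier (G W)"
  shows "sres Sh W W' (sg W c) = sg W' (rr W W' c)"
proof -
  have "sres Sh W W' (sg W c) = restrict (sg W c) W'"
    by (simp add: pullback_def sheafify_def Let_def)
  also have "\<dots> = sg W' (rr W W' c)"
    unfolding sg_def by (rule ext) (use assms(3) st_res[OF assms(1-3) _ assms(4)] in \<open>auto simp: restrict_def\<close>)
  finally show ?thesis .
qed

lemma sg_add:
  assumes "openin (topol X) W" "c \<in> carrier (G W)" "d \<in> carrier (G W)"
  shows "sg W c \<oplus>\<^bsub>sec Sh W\<^esub> sg W d = sg W (c + d)"
proof -
  have "sg W c \<oplus>\<^bsub>sec Sh W\<^esub> sg W d = (\<lambda>y\<in>W. sg W c y \<oplus>\<^bsub>lim_module X P (nbhds X y)\<^esub> sg W d y)"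
    by (simp add: pullback_def sheafify_def Let_def P_def)
  also have "\<dots> = sg W (c + d)"
    by (simp only: sg_def, rule restrict_ext) (simp add: st_add nbhdsI assms del: carrier_free_Abelian_group_iff)
  finally show ?thesis .
qed

lemma sg_smult:
  assumes "openin (topol X) W" "b \<in> carrier (ring_at X W)" "c \<in> carrier (G W)"
  shows "b \<odot>\<^bsub>sec Sh W\<^esub> sg W c = sg W (sm W b c)"
proof -
  have "b \<odot>\<^bsub>sec Sh W\<^esub> sg W c = (\<lambda>y\<in>W. rgerm X (nbhds X y) W b \<odot>\<^bsub>lim_module X P (nbhds X y)\<^esub> sg W c y)"
    by (simp add: pullback_def sheafify_def Let_def P_def)
  also have "\<dots> = sg W (sm W b c)"
    by (simp only: sg_def, rule restrict_ext) (simp add: st_smult nbhdsI assms del: carrier_free_Abelian_group_iff)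
  finally show ?thesis .
qed

text \<open>Equal germs at \<open>x\<close> agree on a neighbourhood, and equality of the two cosets
  there means that the restricted formal sum is a consequence of the tensor relations.
  Single-valuedness of the graph rests on this.\<close>

lemma sg_eqD:
  assumes W: "openin (topol X) W" and c: "c \<in> carrier (G W)" and eq: "sg W c = sg W 0" and x: "x \<in> W"
  obtains W' where "openin (topol X) W'" "x \<in> W'" "W' \<subseteq> W" "rr W W' c \<in> K W'"
proof -
  have z: "0 \<in> carrier (G W)" by simp
  have "st x W c = st x W 0"
    using fun_cong[OF eq, of x] x by (simp add: sg_def)
  then have "mgerm P (nbhds X x) W (CC W c) = mgerm P (nbhds X x) W (CC W 0)"
    by (simp only: st_def)
  then obtain W' where W': "W' \<in> nbhds X x" "W' \<subseteq> W" "W' \<subseteq> W" "sres P W W' (CC W c) = sres P W W' (CC W 0)"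
    by (rule direct_sys.gm_eqD[OF dsP nbhdsI[OF W x] CC_P[OF c] nbhdsI[OF W x] CC_P[OF z]])
  note op = nbhds_open[OF W'(1)]
  have "CC W' (rr W W' c) = CC W' 0"
    using W'(4) unfolding P_res[OF W op W'(2)] by (simp add: rr_def)
  moreover have "rr W W' c \<in> CC W' (rr W W' c)"
    using zero_K[OF op] unfolding CC_def r_coset_free by force
  ultimately have "rr W W' c \<in> K W'"
    by (simp add: CC_def r_coset_free)
  then show thesis
    using that W' op by (simp add: nbhds_def)
qed

lemma unit_sg:
  "pullback_unit X Y f A V s = sg (pre X f V) (frag_of (\<one>\<^bsub>ring_at X (pre X f V)\<^esub>, lg (pre X f V) V s))"
  by (simp add: pullback_unit_def Let_def sg_def st_def P_def CC_def pure_tensor_def K_def R_def L_def S_def \<theta>_def lg_def FF_def)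

lemma FF_pre: "openin (topol Y) V \<Longrightarrow> V \<in> FF (pre X f V)"
  using FF_iff[OF lrs_mor_openin_pre[OF f]] by simp

lemma unit_carrier:
  assumes "openin (topol Y) V" "s \<in> carrier (sec A V)"
  shows "frag_of (\<one>\<^bsub>ring_at X (pre X f V)\<^esub>, lg (pre X f V) V s) \<in> carrier (G (pre X f V))"
  using lg_closed[OF FF_pre[OF assms(1)] assms(2)] X_one_closed[OF lrs_mor_openin_pre[OF f assms(1)]]
  by (simp add: S_def keys_frag_of)

text \<open>The pure tensors are multiples of restricted values of the unit. As the values of an
  adjoint map on the unit are prescribed, this fixes it on all formal sums.\<close>

lemma sg_gen:
  assumes W: "openin (topol X) W" and V: "V \<in> FF W" and s: "s \<in> carrier (sec A V)" and a: "a \<in> carrier (ring_at X W)"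
  shows "a \<odot>\<^bsub>sec Sh W\<^esub> sres Sh (pre X f V) W (pullback_unit X Y f A V s) = sg W (frag_of (a, lg W V s))"
proof -
  have oV: "openin (topol Y) V" and sub: "W \<subseteq> pre X f V"
    using V FF_iff[OF W] by auto
  note oP = lrs_mor_openin_pre[OF f oV]
  interpret cring "ring_at X W" by (rule ring_X[OF W])
  have one: "rres X (pre X f V) W \<one>\<^bsub>ring_at X (pre X f V)\<^esub> = \<one>\<^bsub>ring_at X W\<^esub>"
    by (rule ring_hom_one[OF ringed_hom[OF rX oP W sub]])
  have "a \<odot>\<^bsub>sec Sh W\<^esub> sres Sh (pre X f V) W (pullback_unit X Y f A V s)
      = sg W (sm W a (rr (pre X f V) W (frag_of (\<one>\<^bsub>ring_at X (pre X f V)\<^esub>, lg (pre X f V) V s))))"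
    unfolding unit_sg
    by (simp only: sg_res[OF oP W sub unit_carrier[OF oV s]] sg_smult[OF W a rr_carrier[OF oP W sub unit_carrier[OF oV s]]])
  also have "\<dots> = sg W (frag_of (a, lg W V s))"
    by (simp add: rr_def sm_def one a resl_lg[OF sub FF_pre[OF oV] s])
  finally show ?thesis .
qed

end

text \<open>If \<open>\<alpha>\<close> exhibits \<open>M\<close> as a pullback of \<open>A\<close>, these pairs form locally the graph of the map adjoint to \<open>e\<close>.\<close>

inductive_set graph_pairs ::
  "('p, 'r) ringed_space \<Rightarrow> ('q, 's) ringed_space \<Rightarrow> ('p, 'q, 'r, 's) mor \<Rightarrow> ('q, 's, 'm) smod \<Rightarrow>
   ('p, 'r, 'k) smod \<Rightarrow> ('p, 'r, 'n) smod \<Rightarrow> ('q set \<Rightarrow> 'm \<Rightarrow> 'k) \<Rightarrow> ('q set \<Rightarrow> 'm \<Rightarrow> 'n) \<Rightarrow> 'q set \<Rightarrow>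
   'p set \<Rightarrow> ('k \<times> 'n) set"
  for X Y f A M N \<alpha> e W0 W where
    gen: "openin (topol Y) V \<Longrightarrow> V \<subseteq> W0 \<Longrightarrow> W \<subseteq> pre X f V \<Longrightarrow> s \<in> carrier (sec A V) \<Longrightarrow> a \<in> carrier (ring_at X W) \<Longrightarrow>
      (a \<odot>\<^bsub>sec M W\<^esub> sres M (pre X f V) W (\<alpha> V s), a \<odot>\<^bsub>sec N W\<^esub> sres N (pre X f V) W (e V s))
        \<in> graph_pairs X Y f A M N \<alpha> e W0 W"
  | zero: "(\<zero>\<^bsub>sec M W\<^esub>, \<zero>\<^bsub>sec N W\<^esub>) \<in> graph_pairs X Y f A M N \<alpha> e W0 W"
  | diff: "(m, n) \<in> graph_pairs X Y f A M N \<alpha> e W0 W \<Longrightarrow> (m', n') \<in> graph_pairs X Y f A M N \<alpha> e W0 W \<Longrightarrow>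
      (m \<ominus>\<^bsub>sec M W\<^esub> m', n \<ominus>\<^bsub>sec N W\<^esub> n') \<in> graph_pairs X Y f A M N \<alpha> e W0 W"

text \<open>The setting for the universal property of the pullback in graph form. \<open>e\<close>
  stands for a morphism from \<open>A\<close> to the direct image of \<open>N\<close> that is
  controlled only on the opens inside \<open>W0\<close>, and \<open>h\<close> is the isomorphism
  from the pullback of \<open>A\<close> to \<open>M\<close>.\<close>

locale pullback_ext = pullback_data X Y f A
  for X :: "('p, 'r) ringed_space" and Y :: "('q, 's) ringed_space" and f :: "('p, 'q, 'r, 's) mor"
    and A :: "('q, 's, 'm) smod" +
  fixes M :: "('p, 'r, 'k) smod" and N :: "('p, 'r, 'n) smod" and \<alpha> :: "'q set \<Rightarrow> 'm \<Rightarrow> 'k" and e :: "'q set \<Rightarrow> 'm \<Rightarrow> 'n"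
    and W0 :: "'q set" and h :: "'p set \<Rightarrow> ('p \<Rightarrow> ('p set \<times> ('q, 'r, 'm) tens) set) \<Rightarrow> 'k"
  assumes M: "is_smod X M" and N: "is_smod X N" and W0: "openin (topol Y) W0"
    and h: "adjoint_map X Y f A M \<alpha> h" "smod_iso X (pullback X Y f A) M h"
    and e_closed: "\<And>V s. openin (topol Y) V \<Longrightarrow> V \<subseteq> W0 \<Longrightarrow> s \<in> carrier (sec A V) \<Longrightarrow> e V s \<in> carrier (sec N (pre X f V))"
    and e_add: "\<And>V s t. openin (topol Y) V \<Longrightarrow> V \<subseteq> W0 \<Longrightarrow> s \<in> carrier (sec A V) \<Longrightarrow> t \<in> carrier (sec A V) \<Longrightarrow>
        e V (s \<oplus>\<^bsub>sec A V\<^esub> t) = e V s \<oplus>\<^bsub>sec N (pre X f V)\<^esub> e V t"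
    and e_smult: "\<And>V r s. openin (topol Y) V \<Longrightarrow> V \<subseteq> W0 \<Longrightarrow> r \<in> carrier (ring_at Y V) \<Longrightarrow> s \<in> carrier (sec A V) \<Longrightarrow>
        e V (r \<odot>\<^bsub>sec A V\<^esub> s) = cm f V r \<odot>\<^bsub>sec N (pre X f V)\<^esub> e V s"
    and e_res: "\<And>V V' s. openin (topol Y) V \<Longrightarrow> V \<subseteq> W0 \<Longrightarrow> openin (topol Y) V' \<Longrightarrow> V' \<subseteq> V \<Longrightarrow> s \<in> carrier (sec A V) \<Longrightarrow>
        e V' (sres A V V' s) = sres N (pre X f V) (pre X f V') (e V s)"
begin

abbreviation Q where "Q \<equiv> graph_pairs X Y f A M N \<alpha> e W0"

text \<open>A germ may be represented over an open that is not contained in \<open>W0\<close>, where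
  nothing is known about \<open>e\<close>; hence the representative is first cut down to
  \<open>V \<inter> W0\<close>.\<close>

definition ev :: "'p set \<Rightarrow> ('q set \<times> 'm) set \<Rightarrow> 'n" where
  "ev W = lim_map (\<lambda>V s. sres N (pre X f (V \<inter> W0)) W (e (V \<inter> W0) (sres A V (V \<inter> W0) s)))"

lemma W0_FF: "openin (topol X) W \<Longrightarrow> W \<subseteq> pre X f W0 \<Longrightarrow> W0 \<in> FF W"
  using FF_iff W0 by simp

lemma ev_lg_gen:
  assumes W: "openin (topol X) W" and sub: "W \<subseteq> pre X f W0" and V: "V \<in> FF W" and s: "s \<in> carrier (sec A V)"
  shows "ev W (lg W V s) = sres N (pre X f (V \<inter> W0)) W (e (V \<inter> W0) (sres A V (V \<inter> W0) s))"
  unfolding ev_def lg_def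
proof (rule direct_sys.lim_map_gm[OF dsm V s])
  fix V1 V2 t assume 1: "V1 \<in> FF W" and 2: "V2 \<in> FF W" and s: "V2 \<subseteq> V1" and t: "t \<in> carrier (sec A V1)"
  have oV1: "openin (topol Y) V1" "openin (topol Y) (V1 \<inter> W0)" and oV2: "openin (topol Y) V2" "openin (topol Y) (V2 \<inter> W0)"
    using FF_open[OF 1] FF_open[OF 2] W0 by auto
  have sub12: "V2 \<inter> W0 \<subseteq> V1 \<inter> W0" using s by auto
  have t1: "sres A V1 (V1 \<inter> W0) t \<in> carrier (sec A (V1 \<inter> W0))"
    by (rule sres_closed[OF A oV1 Int_lower1 t])
  have "sres A V2 (V2 \<inter> W0) (sres A V1 V2 t) = sres A (V1 \<inter> W0) (V2 \<inter> W0) (sres A V1 (V1 \<inter> W0) t)"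
    by (simp only: sres_comp[OF A oV1(1) oV1(2) oV2(2) sub12 Int_lower1 t] sres_comp[OF A oV1(1) oV2(1) oV2(2) Int_lower1 s t])
  then have "e (V2 \<inter> W0) (sres A V2 (V2 \<inter> W0) (sres A V1 V2 t))
      = sres N (pre X f (V1 \<inter> W0)) (pre X f (V2 \<inter> W0)) (e (V1 \<inter> W0) (sres A V1 (V1 \<inter> W0) t))"
    by (simp add: e_res[OF oV1(2) Int_lower2 oV2(2) sub12 t1])
  moreover have "sres N (pre X f (V2 \<inter> W0)) W
      (sres N (pre X f (V1 \<inter> W0)) (pre X f (V2 \<inter> W0)) (e (V1 \<inter> W0) (sres A V1 (V1 \<inter> W0) t)))
    = sres N (pre X f (V1 \<inter> W0)) W (e (V1 \<inter> W0) (sres A V1 (V1 \<inter> W0) t))"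
  proof (rule sres_comp[OF N])
    show "W \<subseteq> pre X f (V2 \<inter> W0)"
      using 2 FF_iff[OF W] sub by (auto simp: pre_def)
  qed (use W oV1 oV2 sub12 in \<open>simp_all add: lrs_mor_openin_pre[OF f] pre_mono e_closed t1\<close>)
  ultimately show "sres N (pre X f (V2 \<inter> W0)) W (e (V2 \<inter> W0) (sres A V2 (V2 \<inter> W0) (sres A V1 V2 t)))
    = sres N (pre X f (V1 \<inter> W0)) W (e (V1 \<inter> W0) (sres A V1 (V1 \<inter> W0) t))"
    by simp
qed

lemma ev_lg:
  assumes W: "openin (topol X) W" and sub: "W \<subseteq> pre X f W0" and V: "V \<in> FF W" "V \<subseteq> W0" and s: "s \<in> carrier (sec A V)"
  shows "ev W (lg W V s) = sres N (pre X f V) W (e V s)"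
proof -
  have "V \<inter> W0 = V" using V by auto
  then show ?thesis
    using ev_lg_gen[OF W sub V(1) s] sres_id[OF A FF_open[OF V(1)] s] by simp
qed

lemma lg_small:
  assumes W: "openin (topol X) W" and sub: "W \<subseteq> pre X f W0" and l: "l \<in> carrier (L W)"
  obtains V s where "V \<in> FF W" "V \<subseteq> W0" "s \<in> carrier (sec A V)" "l = lg W V s"
proof -
  obtain V s where V: "V \<in> FF W" "s \<in> carrier (sec A V)" "l = lg W V s"
    using l L_carrier by blast
  note VW = FF_Int[OF V(1) W0_FF[OF W sub]]
  show thesis
    by (rule that[OF VW Int_lower2, of "sres A V (V \<inter> W0) s"])
      (simp_all add: V lg_res VW sres_closed[OF A FF_open[OF V(1)] FF_open[OF VW]])
qed

lemma ev_closed: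
  assumes W: "openin (topol X) W" and sub: "W \<subseteq> pre X f W0" and l: "l \<in> carrier (L W)"
  shows "ev W l \<in> carrier (sec N W)"
proof -
  obtain V s where V: "V \<in> FF W" "V \<subseteq> W0" "s \<in> carrier (sec A V)" "l = lg W V s"
    by (rule lg_small[OF W sub l])
  note oV = FF_open[OF V(1)]
  show ?thesis
    unfolding V(4) ev_lg[OF W sub V(1-3)]
    by (rule sres_closed[OF N]) (use V oV W in \<open>simp_all add: FF_iff e_closed lrs_mor_openin_pre[OF f]\<close>)
qed

lemma ev_add:
  assumes W: "openin (topol X) W" and sub: "W \<subseteq> pre X f W0" and l: "l \<in> carrier (L W)" "l' \<in> carrier (L W)"
  shows "ev W (l \<oplus>\<^bsub>L W\<^esub> l') = ev W l \<oplus>\<^bsub>sec N W\<^esub> ev W l'"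
proof -
  obtain V1 s1 where V1: "V1 \<in> FF W" "V1 \<subseteq> W0" "s1 \<in> carrier (sec A V1)" "l = lg W V1 s1"
    by (rule lg_small[OF W sub l(1)])
  obtain V2 s2 where V2: "V2 \<in> FF W" "V2 \<subseteq> W0" "s2 \<in> carrier (sec A V2)" "l' = lg W V2 s2"
    by (rule lg_small[OF W sub l(2)])
  define V where "V = V1 \<inter> V2"
  define s where "s = sres A V1 V s1"
  define t where "t = sres A V2 V s2"
  have V: "V \<in> FF W" "V \<subseteq> W0" "V \<subseteq> V1" "V \<subseteq> V2"
    using FF_Int[OF V1(1) V2(1)] V1 by (auto simp: V_def)
  note oV = FF_open[OF V(1)]
  have s: "s \<in> carrier (sec A V)" "l = lg W V s" and t: "t \<in> carrier (sec A V)" "l' = lg W V t"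
    unfolding s_def t_def
    by (simp_all add: V1 V2 V lg_res sres_closed[OF A FF_open[OF V1(1)] oV] sres_closed[OF A FF_open[OF V2(1)] oV])
  have "W \<subseteq> pre X f V" using V(1) FF_iff[OF W] by simp
  then show ?thesis
    unfolding s t L_add[OF V(1) s(1) t(1)]
    by (simp add: ev_lg[OF W sub V(1,2)] s t A_add_closed[OF oV] e_add[OF oV V(2)]
        sres_add[OF N lrs_mor_openin_pre[OF f oV] W] e_closed[OF oV V(2)])
qed

lemma ev_smult:
  assumes W: "openin (topol X) W" and sub: "W \<subseteq> pre X f W0" and r: "r \<in> carrier (R W)" and l: "l \<in> carrier (L W)"
  shows "ev W (r \<odot>\<^bsub>L W\<^esub> l) = \<theta> W r \<odot>\<^bsub>sec N W\<^esub> ev W l"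
proof -
  obtain V1 r1 where V1: "V1 \<in> FF W" "r1 \<in> carrier (ring_at Y V1)" "r = rg W V1 r1"
    using r R_carrier by blast
  obtain V2 s2 where V2: "V2 \<in> FF W" "V2 \<subseteq> W0" "s2 \<in> carrier (sec A V2)" "l = lg W V2 s2"
    by (rule lg_small[OF W sub l])
  define V where "V = V1 \<inter> V2"
  define s where "s = rres Y V1 V r1"
  define t where "t = sres A V2 V s2"
  have V: "V \<in> FF W" "V \<subseteq> W0" "V \<subseteq> V1" "V \<subseteq> V2"
    using FF_Int[OF V1(1) V2(1)] V2 by (auto simp: V_def)
  note oV = FF_open[OF V(1)]
  have s: "s \<in> carrier (ring_at Y V)" "r = rg W V s" and t: "t \<in> carrier (sec A V)" "l = lg W V t"
    unfolding s_def t_def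
    by (simp_all add: V1 V2 V lg_res rg_res rres_closed[OF rY FF_open[OF V1(1)] oV] sres_closed[OF A FF_open[OF V2(1)] oV])
  have "W \<subseteq> pre X f V" using V(1) FF_iff[OF W] by simp
  then show ?thesis
    unfolding s t L_smult[OF V(1) s(1) t(1)]
    by (simp add: ev_lg[OF W sub V(1,2)] s t A_smult_closed[OF oV] e_smult[OF oV V(2)] \<theta>_rg[OF W V(1)]
        sres_smult[OF N lrs_mor_openin_pre[OF f oV] W] lrs_mor_cm_closed[OF f oV] e_closed[OF oV V(2)])
qed

lemma ev_resl:
  assumes W: "openin (topol X) W" and sub: "W \<subseteq> pre X f W0" and W': "openin (topol X) W'" "W' \<subseteq> W" and l: "l \<in> carrier (L W)"
  shows "ev W' (resl W' l) = sres N W W' (ev W l)"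
proof -
  obtain V s where V: "V \<in> FF W" "V \<subseteq> W0" "s \<in> carrier (sec A V)" "l = lg W V s"
    by (rule lg_small[OF W sub l])
  note oV = FF_open[OF V(1)]
  have WV: "W \<subseteq> pre X f V" using V(1) FF_iff[OF W] by simp
  have sub': "W' \<subseteq> pre X f W0" using W' sub by simp
  show ?thesis
    unfolding V(4) resl_lg[OF W'(2) V(1,3)]
    by (simp add: ev_lg[OF W sub V(1,2)] ev_lg[OF W'(1) sub' FF_mono[OF W'(2) V(1)] V(2)] V W W' WV
        sres_comp[OF N lrs_mor_openin_pre[OF f oV]] e_closed[OF oV V(2)])
qed

lemma N_module: "openin (topol X) W \<Longrightarrow> module (ring_at X W) (sec N W)"
  by (rule smod_module[OF N])

lemma M_group: "openin (topol X) W \<Longrightarrow> abelian_group (sec M W)"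
  by (rule smod_group[OF M])

lemma N_group: "openin (topol X) W \<Longrightarrow> abelian_group (sec N W)"
  by (rule smod_group[OF N])

text \<open>The additive map that the prescribed images induce on formal sums. It comes from the
  universal property of the free abelian group and is picked by \<open>SOME\<close>, since
  \<open>frag_extend\<close> takes values in free groups only.\<close>

definition E :: "'p set \<Rightarrow> _ \<Rightarrow> 'n" where
  "E W = (SOME g. g \<in> hom (G W) (add_monoid (sec N W)) \<and> (\<forall>(a, l)\<in>S W. g (frag_of (a, l)) = a \<odot>\<^bsub>sec N W\<^esub> ev W l))"

lemma E:
  assumes W: "openin (topol X) W" and sub: "W \<subseteq> pre X f W0"
  shows "E W \<in> hom (G W) (add_monoid (sec N W))"
    and "\<And>a l. a \<in> carrier (ring_at X W) \<Longrightarrow> l \<in> carrier (L W) \<Longrightarrow> E W (frag_of (a, l)) = a \<odot>\<^bsub>sec N W\<^esub> ev W l"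
proof -
  interpret N: module "ring_at X W" "sec N W" by (rule N_module[OF W])
    have "(\<lambda>(a, l). a \<odot>\<^bsub>sec N W\<^esub> ev W l) ` S W \<subseteq> carrier (add_monoid (sec N W))"
    by (auto simp: S_def ev_closed[OF W sub])
  then obtain g where "g \<in> hom (G W) (add_monoid (sec N W))"
      "\<And>x. x \<in> S W \<Longrightarrow> g (frag_of x) = (case x of (a, l) \<Rightarrow> a \<odot>\<^bsub>sec N W\<^esub> ev W l)"
    by (rule comm_group.free_Abelian_group_universal[OF N.a_comm_group]) blast
  then have "\<exists>g. g \<in> hom (G W) (add_monoid (sec N W)) \<and> (\<forall>(a, l)\<in>S W. g (frag_of (a, l)) = a \<odot>\<^bsub>sec N W\<^esub> ev W l)"
    by auto
  from someI_ex[OF this] show "E W \<in> hom (G W) (add_monoid (sec N W))"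
    "\<And>a l. a \<in> carrier (ring_at X W) \<Longrightarrow> l \<in> carrier (L W) \<Longrightarrow> E W (frag_of (a, l)) = a \<odot>\<^bsub>sec N W\<^esub> ev W l"
    unfolding E_def[symmetric] by (auto simp: S_def)
qed

text \<open>Induction on formal sums proceeds by differences, and so does the definition of
  \<open>graph_pairs\<close>; homomorphisms are therefore used in this form.\<close>

lemma hom_free_diff:
  assumes "abelian_group B" "g \<in> hom (free_Abelian_group T) (add_monoid B)"
    and "c \<in> carrier (free_Abelian_group T)" "d \<in> carrier (free_Abelian_group T)"
  shows "g (c - d) = g c \<ominus>\<^bsub>B\<^esub> g d"
proof -
  interpret B: abelian_group B by fact
  have cd: "c - d \<in> carrier (free_Abelian_group T)"
    using assms(3,4) keys_diff[of c d] by auto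
  have "g (c - d + d) = g (c - d) \<oplus>\<^bsub>B\<^esub> g d"
    using hom_mult[OF assms(2) cd assms(4)] by simp
  moreover have "g c \<in> carrier B" "g d \<in> carrier B" "g (c - d) \<in> carrier B"
    using hom_in_carrier[OF assms(2)] assms(3,4) cd by auto
  ultimately show ?thesis
    by (simp add: B.minus_eq B.a_assoc B.r_neg)
qed

lemma E_zero: 
  assumes W: "openin (topol X) W" and sub: "W \<subseteq> pre X f W0"
  shows "E W 0 = \<zero>\<^bsub>sec N W\<^esub>"
proof -
  interpret N: abelian_group "sec N W" by (rule N_group[OF W])
  have "E W (0 - 0) = E W 0 \<ominus>\<^bsub>sec N W\<^esub> E W 0"
    by (rule hom_free_diff[OF N_group[OF W] E(1)[OF W sub]]) simp_all
  moreover have "E W 0 \<in> carrier (sec N W)"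
    using hom_in_carrier[OF E(1)[OF W sub], of 0] by simp
  ultimately show ?thesis
    by (simp add: N.minus_eq N.r_neg)
qed

text \<open>The three kinds of relation correspond to additivity in the scalar, additivity of
  \<open>ev\<close>, and \<open>ev_smult\<close>.\<close>

lemma E_rels:
  assumes W: "openin (topol X) W" and sub: "W \<subseteq> pre X f W0" and x: "x \<in> rels W"
  shows "E W x = \<zero>\<^bsub>sec N W\<^esub>"
proof -
  interpret N: module "ring_at X W" "sec N W" by (rule N_module[OF W])
  note hd = hom_free_diff[OF N.abelian_group_axioms E(1)[OF W sub]]
  note ev = ev_closed[OF W sub]
  show ?thesis
    using x
  proof (cases rule: rels_cases)
    case (1 a b s)
    have "E W x = (E W (frag_of (a \<oplus>\<^bsub>ring_at X W\<^esub> b, s)) \<ominus>\<^bsub>sec N W\<^esub> E W (frag_of (a, s))) \<ominus>\<^bsub>sec N W\<^esub> E W (frag_of (b, s))"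
      unfolding 1(1) by (simp add: hd keys_diff_subset keys_frag_of S_def 1)
    then show ?thesis
      by (simp add: E(2)[OF W sub] 1 N.smult_l_distr ev N.add_minus_minus)
  next
    case (2 a s t)
    have "E W x = (E W (frag_of (a, s \<oplus>\<^bsub>L W\<^esub> t)) \<ominus>\<^bsub>sec N W\<^esub> E W (frag_of (a, s))) \<ominus>\<^bsub>sec N W\<^esub> E W (frag_of (a, t))"
      unfolding 2(1) by (simp add: hd keys_diff_subset keys_frag_of S_def L_add_closed 2)
    then show ?thesis
      by (simp add: E(2)[OF W sub] 2 N.smult_r_distr ev L_add_closed ev_add[OF W sub] N.add_minus_minus)
  next
    case (3 a r s)
    have "E W x = E W (frag_of (a \<otimes>\<^bsub>ring_at X W\<^esub> \<theta> W r, s)) \<ominus>\<^bsub>sec N W\<^esub> E W (frag_of (a, r \<odot>\<^bsub>L W\<^esub> s))"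
      unfolding 3(1) by (simp add: hd keys_frag_of S_def L_smult_closed \<theta>_closed[OF W] 3)
    then show ?thesis
      by (simp add: E(2)[OF W sub] 3 N.smult_assoc1 ev L_smult_closed ev_smult[OF W sub] \<theta>_closed[OF W] N.minus_eq N.r_neg)
  qed
qed

lemma E_K:
  assumes W: "openin (topol X) W" and sub: "W \<subseteq> pre X f W0" and x: "x \<in> K W"
  shows "E W x = \<zero>\<^bsub>sec N W\<^esub>"
  by (rule hom_generate_zero[OF rels_carrier[OF W] N_group[OF W] E(1)[OF W sub] E_rels[OF W sub]])
    (use x in \<open>simp_all add: K_generate\<close>)

text \<open>Both sides are additive in \<open>c\<close>, and on a generator the claim is naturality
  of \<open>ev\<close> under restriction.\<close>

lemma E_rr:
  assumes W: "openin (topol X) W" and sub: "W \<subseteq> pre X f W0" and W': "openin (topol X) W'" "W' \<subseteq> W"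
    and c: "c \<in> carrier (G W)"
  shows "E W' (rr W W' c) = sres N W W' (E W c)"
proof -
  have sub': "W' \<subseteq> pre X f W0" using W' sub by simp
  have "Poly_Mapping.keys c \<subseteq> S W" using c by simp
  then show ?thesis
  proof (induction c rule: free_group_induct)
    case zero
    then show ?case
      using E_zero[OF W sub] E_zero[OF W'(1) sub'] sres_zero[OF N W W'] by (simp add: rr_def)
  next
    case (diff x y)
    then have x: "x \<in> carrier (G W)" and y: "y \<in> carrier (G W)" by simp_all
    have "rr W W' (x - y) = rr W W' x - rr W W' y"
      by (simp add: rr_def frag_extend_diff)
    moreover have "E W x \<in> carrier (sec N W)" "E W y \<in> carrier (sec N W)"
      using hom_in_carrier[OF E(1)[OF W sub]] x y by auto
    ultimately show ?case
      by (simp add: hom_free_diff[OF N_group[OF W] E(1)[OF W sub] x y] sres_minus[OF N W W']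
          hom_free_diff[OF N_group[OF W'(1)] E(1)[OF W'(1) sub'] rr_carrier[OF W W' x] rr_carrier[OF W W' y]] diff.IH
          del: carrier_free_Abelian_group_iff)
  next
    case (gen p)
    then obtain a l where p: "p = (a, l)" "a \<in> carrier (ring_at X W)" "l \<in> carrier (L W)"
      by (auto simp: S_def)
    then show ?case
      by (simp add: rr_def E(2)[OF W sub] E(2)[OF W'(1) sub'] rres_closed[OF rX W W'] resl_closed[OF W'(2)]
          sres_smult[OF N W W'] ev_closed[OF W sub] ev_resl[OF W sub W'])
  qed
qed

lemma h_linear: "openin (topol X) W \<Longrightarrow> linear_map (ring_at X W) (sec Sh W) (sec M W) (h W)"
  using h(1) by (simp add: adjoint_map_def smod_mor_def)

lemma h_res:
  "openin (topol X) W \<Longrightarrow> openin (topol X) W' \<Longrightarrow> W' \<subseteq> W \<Longrightarrow> \<sigma> \<in> carrier (sec Sh W) \<Longrightarrow>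
   h W' (sres Sh W W' \<sigma>) = sres M W W' (h W \<sigma>)"
  using h(1) by (simp add: adjoint_map_def smod_mor_def)

lemma h_inj:
  assumes "openin (topol X) W" "\<sigma> \<in> carrier (sec Sh W)" "\<tau> \<in> carrier (sec Sh W)" "h W \<sigma> = h W \<tau>"
  shows "\<sigma> = \<tau>"
proof -
  obtain k where "\<forall>V\<in>opens X. \<forall>s\<in>carrier (sec Sh V). k V (h V s) = s"
    using h(2) unfolding smod_iso_def by blast
  then show ?thesis
    using assms by (metis mem_Collect_eq)
qed

lemma h_surj:
  assumes "openin (topol X) W" "m \<in> carrier (sec M W)"
  obtains \<sigma> where "\<sigma> \<in> carrier (sec Sh W)" "h W \<sigma> = m"
proof -
  obtain k where k: "smod_mor X M Sh k" "\<forall>V\<in>opens X. \<forall>t\<in>carrier (sec M V). h V (k V t) = t"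
    using h(2) unfolding smod_iso_def by blast
  have "linear_map (ring_at X W) (sec M W) (sec Sh W) (k W)"
    using k(1) assms(1) by (simp add: smod_mor_def)
  then show thesis
    using that[of "k W m"] assms k(2) by (simp add: linear_map_closed)
qed

text \<open>Adjointness prescribes \<open>h\<close> on values of the unit; linearity and
  compatibility with restriction extend this to pure tensors by \<open>sg_gen\<close>.\<close>

lemma h_sg_gen:
  assumes W: "openin (topol X) W" and V: "V \<in> FF W" and s: "s \<in> carrier (sec A V)" and a: "a \<in> carrier (ring_at X W)"
  shows "h W (sg W (frag_of (a, lg W V s))) = a \<odot>\<^bsub>sec M W\<^esub> sres M (pre X f V) W (\<alpha> V s)"
proof -
  note oV = FF_open[OF V]
  note oP = lrs_mor_openin_pre[OF f oV]
  have sub: "W \<subseteq> pre X f V" using V FF_iff[OF W] by simp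
  have u: "pullback_unit X Y f A V s \<in> carrier (sec Sh (pre X f V))"
    unfolding unit_sg by (rule sg_Sh[OF oP unit_carrier[OF oV s]])
  have u': "sres Sh (pre X f V) W (pullback_unit X Y f A V s) \<in> carrier (sec Sh W)"
    unfolding unit_sg sg_res[OF oP W sub unit_carrier[OF oV s]]
    by (rule sg_Sh[OF W rr_carrier[OF oP W sub unit_carrier[OF oV s]]])
  have "h (pre X f V) (pullback_unit X Y f A V s) = \<alpha> V s"
    using h(1) oV s by (simp add: adjoint_map_def)
  then show ?thesis
    unfolding sg_gen[OF W V s a, symmetric] linear_map_smult[OF h_linear[OF W] a u'] h_res[OF oP W sub u] by simp
qed

lemma h_sg_add:
  assumes W: "openin (topol X) W" and c: "c \<in> carrier (G W)" and d: "d \<in> carrier (G W)"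
  shows "h W (sg W (c + d)) = h W (sg W c) \<oplus>\<^bsub>sec M W\<^esub> h W (sg W d)"
  unfolding sg_add[OF assms, symmetric]
  by (rule linear_map_add[OF h_linear[OF W] sg_Sh[OF W c] sg_Sh[OF W d]])

lemma h_sg_hom: assumes W: "openin (topol X) W" shows "(\<lambda>c. h W (sg W c)) \<in> hom (G W) (add_monoid (sec M W))"
  by (rule homI) (use h_sg_add[OF W] linear_map_closed[OF h_linear[OF W] sg_Sh[OF W]] in simp_all)

lemma h_sg_zero: assumes W: "openin (topol X) W" shows "h W (sg W 0) = \<zero>\<^bsub>sec M W\<^esub>"
proof -
  interpret M: abelian_group "sec M W" by (rule M_group[OF W])
  have "h W (sg W (0 - 0)) = h W (sg W 0) \<ominus>\<^bsub>sec M W\<^esub> h W (sg W 0)"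
    by (rule hom_free_diff[OF M_group[OF W] h_sg_hom[OF W]]) simp_all
  moreover have "h W (sg W 0) \<in> carrier (sec M W)"
    using hom_in_carrier[OF h_sg_hom[OF W], of 0] by simp
  ultimately show ?thesis
    by (simp add: M.minus_eq M.r_neg)
qed

text \<open>Together with \<open>Q_pairs\<close> this identifies the inductively defined relation
  with the image of the formal sums. The inductive form is convenient for moving pairs between opens
  and arrows, the formal sums for analysing when a first entry vanishes.\<close>

lemma pairs_Q:
  assumes W: "openin (topol X) W" and sub: "W \<subseteq> pre X f W0" and c: "c \<in> carrier (G W)"
  shows "(h W (sg W c), E W c) \<in> Q W"
proof -
  have "Poly_Mapping.keys c \<subseteq> S W" using c by simp
  then show ?thesis
  proof (induction c rule: free_group_induct)
    case zero
    then show ?case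
      using graph_pairs.zero by (simp add: h_sg_zero[OF W] E_zero[OF W sub])
  next
    case (diff x y)
    then have x: "x \<in> carrier (G W)" and y: "y \<in> carrier (G W)" by simp_all
    show ?case
      using graph_pairs.diff[OF diff.IH]
      by (simp only: hom_free_diff[OF M_group[OF W] h_sg_hom[OF W] x y] hom_free_diff[OF N_group[OF W] E(1)[OF W sub] x y])
  next
    case (gen p)
    then obtain a l where p: "p = (a, l)" "a \<in> carrier (ring_at X W)" "l \<in> carrier (L W)"
      by (auto simp: S_def)
    obtain V s where V: "V \<in> FF W" "V \<subseteq> W0" "s \<in> carrier (sec A V)" "l = lg W V s"
      by (rule lg_small[OF W sub p(3)])
    have "W \<subseteq> pre X f V" using V(1) FF_iff[OF W] by simp
    then show ?case
      using graph_pairs.gen[OF FF_open[OF V(1)] V(2) _ V(3) p(2)]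
      by (simp add: p(1) V(4) h_sg_gen[OF W V(1,3) p(2)] E(2)[OF W sub p(2)] lg_closed[OF V(1,3)] ev_lg[OF W sub V(1-3)])
  qed
qed

lemma Q_pairs:
  assumes W: "openin (topol X) W" and sub: "W \<subseteq> pre X f W0" and mn: "(m, n) \<in> Q W"
  shows "\<exists>c\<in>carrier (G W). m = h W (sg W c) \<and> n = E W c"
  using mn
proof (induction rule: graph_pairs.induct)
  case (gen V s a)
  have V: "V \<in> FF W" using gen FF_iff[OF W] by simp
  have "frag_of (a, lg W V s) \<in> carrier (G W)"
    using gen lg_closed[OF V gen(4)] by (simp add: S_def keys_frag_of)
  then show ?case
    using gen by (intro bexI[of _ "frag_of (a, lg W V s)"])
      (simp_all add: h_sg_gen[OF W V] E(2)[OF W sub] lg_closed[OF V] ev_lg[OF W sub V])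
next
  case zero
  show ?case
    by (rule bexI[of _ 0]) (simp_all add: h_sg_zero[OF W] E_zero[OF W sub])
next
  case (diff m n m' n')
  then obtain c d where c: "c \<in> carrier (G W)" "m = h W (sg W c)" "n = E W c"
    and d: "d \<in> carrier (G W)" "m' = h W (sg W d)" "n' = E W d" by blast
  have "c - d \<in> carrier (G W)"
    using c(1) d(1) keys_diff_subset by simp
  then show ?case
    by (rule bexI[rotated]) (simp only: c(2,3) d(2,3) hom_free_diff[OF M_group[OF W] h_sg_hom[OF W] c(1) d(1)]
      hom_free_diff[OF N_group[OF W] E(1)[OF W sub] c(1) d(1)] simp_thms)
qed

text \<open>A section of \<open>M\<close> comes from the pullback because \<open>h\<close> is
  surjective, and a section of the pullback is locally given by a formal sum.\<close>

theorem Q_local_ex: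
  assumes W: "openin (topol X) W" and sub: "W \<subseteq> pre X f W0" and m: "m \<in> carrier (sec M W)" and x: "x \<in> W"
  obtains W' n where "openin (topol X) W'" "x \<in> W'" "W' \<subseteq> W" "(sres M W W' m, n) \<in> Q W'"
proof -
  obtain \<sigma> where s: "\<sigma> \<in> carrier (sec Sh W)" "h W \<sigma> = m"
    by (rule h_surj[OF W m])
  obtain W' c where W': "openin (topol X) W'" "x \<in> W'" "W' \<subseteq> W" and c: "c \<in> carrier (G W')"
      and e: "sres Sh W W' \<sigma> = sg W' c"
    by (rule sg_local[OF s(1) x])
  have "sres M W W' m = h W' (sg W' c)"
    using h_res[OF W W'(1,3) s(1)] s(2) e by simp
  moreover have "(h W' (sg W' c), E W' c) \<in> Q W'"
    by (rule pairs_Q[OF W'(1) _ c]) (use W' sub in simp)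
  ultimately show thesis
    using that W' by simp
qed

text \<open>This is where the relation is seen to be single-valued. Injectivity of \<open>h\<close>
  makes the formal sum behind the pair represent the zero section; locally it is then a consequence
  of tensor relations, which \<open>E\<close> kills, and \<open>N\<close> is separated.\<close>

theorem Q_zero:
  assumes W: "openin (topol X) W" and sub: "W \<subseteq> pre X f W0" and mn: "(\<zero>\<^bsub>sec M W\<^esub>, n) \<in> Q W"
  shows "n = \<zero>\<^bsub>sec N W\<^esub>"
proof -
  obtain c where c: "c \<in> carrier (G W)" "\<zero>\<^bsub>sec M W\<^esub> = h W (sg W c)" "n = E W c"
    using Q_pairs[OF W sub mn] by blast
  have z: "0 \<in> carrier (G W)" by simp
  have eq: "sg W c = sg W 0"
    by (rule h_inj[OF W sg_Sh[OF W c(1)] sg_Sh[OF W z]]) (simp add: h_sg_zero[OF W] c(2)[symmetric])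
  have n: "n \<in> carrier (sec N W)"
    unfolding c(3) using hom_in_carrier[OF E(1)[OF W sub] c(1)] by simp
  show ?thesis
  proof (rule smod_separated[OF N W n])
    show "\<zero>\<^bsub>sec N W\<^esub> \<in> carrier (sec N W)"
      using abelian_group.axioms(1)[OF N_group[OF W]] abelian_monoid.zero_closed by blast
    fix x assume "x \<in> W"
    then obtain W' where W': "openin (topol X) W'" "x \<in> W'" "W' \<subseteq> W" "rr W W' c \<in> K W'"
      using sg_eqD[OF W c(1) eq] by blast
    have "sres N W W' n = E W' (rr W W' c)"
      unfolding c(3) by (rule E_rr[OF W sub W'(1,3) c(1), symmetric])
    also have "\<dots> = \<zero>\<^bsub>sec N W'\<^esub>"
      by (rule E_K[OF W'(1) _ W'(4)]) (use W'(3) sub in simp)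
    finally show "\<exists>W'. openin (topol X) W' \<and> x \<in> W' \<and> W' \<subseteq> W \<and> sres N W W' n = sres N W W' \<zero>\<^bsub>sec N W\<^esub>"
      using W' sres_zero[OF N W W'(1,3)] by auto
  qed
qed

end

section \<open>Spectra of fields on one-point spaces\<close>

lemma field_maximalideal: assumes "field R" "maximalideal J R" shows "J = {\<zero>\<^bsub>R\<^esub>}"
proof -
  interpret field R by fact
  interpret J: maximalideal J R by fact
  have "J \<in> {I. ideal I R}" using J.ideal_axioms by simp
  then show ?thesis using J.I_notcarr all_ideals by auto
qed

lemma field_local_ring: assumes "field R" shows "local_ring R"
proof -
  interpret field R by fact
  show ?thesis
    unfolding local_ring_def using field_maximalideal[OF assms] zeromaximalideal cring_axioms by blast
qed

text \<open>\<open>ring_iso\<close> does not mention zero, and \<open>S\<close> is not yet known to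
  be a ring; so preservation of zero is a separate hypothesis.\<close>

lemma ring_iso_field:
  assumes "field K" "h \<in> ring_iso K S" "h \<zero>\<^bsub>K\<^esub> = \<zero>\<^bsub>S\<^esub>"
  shows "field S"
proof -
  have "field (S \<lparr>zero := h \<zero>\<^bsub>K\<^esub>\<rparr>)"
    by (rule field.ring_iso_imp_img_field[OF assms(1,2)])
  then show ?thesis by (simp add: assms(3))
qed

text \<open>For a family with one member, germs are singletons and the direct limit is the ring of
  sections itself. This computes the stalks of one-point spaces.\<close>

lemma stalk_single:
  assumes R: "ring (ring_at X W)" and id: "\<forall>r\<in>carrier (ring_at X W). rres X W W r = r"
  shows "rgerm X {W} W \<in> ring_iso (ring_at X W) (lim_ring X {W})"
    and "rgerm X {W} W \<zero>\<^bsub>ring_at X W\<^esub> = \<zero>\<^bsub>lim_ring X {W}\<^esub>"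
    and "\<And>r. r \<in> carrier (ring_at X W) \<Longrightarrow> rgerm X {W} W r = {(W, r)}"
proof -
  interpret ring "ring_at X W" by fact
  show g: "rgerm X {W} W r = {(W, r)}" if "r \<in> carrier (ring_at X W)" for r
    using that id by (auto simp: germ_def)
  show "rgerm X {W} W \<in> ring_iso (ring_at X W) (lim_ring X {W})"
  proof (rule ring_iso_memI)
    show "bij_betw (rgerm X {W} W) (carrier (ring_at X W)) (carrier (lim_ring X {W}))"
      unfolding bij_betw_def
    proof
      show "inj_on (rgerm X {W} W) (carrier (ring_at X W))"
        by (simp add: inj_on_def g)
    qed (auto simp: lim_ring_def)
    show "rgerm X {W} W r \<in> carrier (lim_ring X {W})" if "r \<in> carrier (ring_at X W)" for r
      using that by (auto simp: lim_ring_def)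
  qed (simp_all add: g lim_ring_def id)
  show "rgerm X {W} W \<zero>\<^bsub>ring_at X W\<^esub> = \<zero>\<^bsub>lim_ring X {W}\<^esub>"
    by (simp add: lim_ring_def)
qed

lemma lim_ring_germ:
  "z \<in> carrier (lim_ring X \<F>) \<Longrightarrow> \<exists>V s. V \<in> \<F> \<and> s \<in> carrier (ring_at X V) \<and> z = rgerm X \<F> V s"
  by (auto simp: lim_ring_def)

text \<open>The zero ring on the type of \<open>K\<close>, with the zero of \<open>K\<close> as its
  element. It serves as the ring of sections over the empty set.\<close>

definition zring :: "'r ring \<Rightarrow> 'r ring" where
  "zring K = \<lparr>carrier = {\<zero>\<^bsub>K\<^esub>}, monoid.mult = (\<lambda>a b. \<zero>\<^bsub>K\<^esub>), one = \<zero>\<^bsub>K\<^esub>, ring.zero = \<zero>\<^bsub>K\<^esub>, ring.add = (\<lambda>a b. \<zero>\<^bsub>K\<^esub>)\<rparr>"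

lemma zring_cring: "cring (zring K)"
proof (rule cringI)
  show "abelian_group (zring K)"
    by (rule abelian_groupI) (auto simp: zring_def)
  show "Group.comm_monoid (zring K)"
    by (rule comm_monoidI) (auto simp: zring_def)
qed (auto simp: zring_def)

text \<open>The spectrum of \<open>K\<close> placed on a prescribed point of type \<open>'p\<close>,
  with sections of type \<open>'r\<close>. \<open>Spec K\<close> itself has other types of points
  and sections, so it cannot be a test object for \<open>cartesian_square\<close>.\<close>

definition field_point :: "'p \<Rightarrow> 'r ring \<Rightarrow> ('p, 'r) ringed_space" where
  "field_point x K = \<lparr>topol = discrete_topology {x}, ring_at = (\<lambda>V. if x \<in> V then K else zring K),
     rres = (\<lambda>V W r. if x \<in> W then r else \<zero>\<^bsub>K\<^esub>)\<rparr>"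

locale one_point = field K for K :: "'r ring" (structure) + fixes x :: 'p
begin

abbreviation T where "T \<equiv> field_point x K"

lemma T_open: "openin (topol T) V \<longleftrightarrow> V = {} \<or> V = {x}"
  by (auto simp: field_point_def)

lemma T_points: "points T = {x}"
  by (simp add: field_point_def)

lemma T_ring: "ring_at T {x} = K" "ring_at T {} = zring K" "x \<in> V \<Longrightarrow> ring_at T V = K" "x \<notin> V \<Longrightarrow> ring_at T V = zring K"
  by (simp_all add: field_point_def)

lemma T_rres: "x \<in> W \<Longrightarrow> rres T V W r = r" "x \<notin> W \<Longrightarrow> rres T V W r = \<zero>"
  by (simp_all add: field_point_def)

lemma zring_simps: "carrier (zring K) = {\<zero>}" "\<one>\<^bsub>zring K\<^esub> = \<zero>" "\<zero>\<^bsub>zring K\<^esub> = \<zero>"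
  "a \<otimes>\<^bsub>zring K\<^esub> b = \<zero>" "a \<oplus>\<^bsub>zring K\<^esub> b = \<zero>"
  by (simp_all add: zring_def)

lemma T_ringed: "ringed T"
  unfolding ringed_def
proof (intro conjI ballI impI)
  have cl: "rres T U V \<in> carrier (ring_at T U) \<rightarrow> carrier (ring_at T V)" if "V \<subseteq> U" for U V
    using that by (auto simp: field_point_def zring_def)
  have psh: "presheaf_on (topol T) (\<lambda>V. carrier (ring_at T V)) (rres T)"
    unfolding presheaf_on_def
  proof (intro conjI allI impI ballI)
    fix U s assume "openin (topol T) U" "s \<in> carrier (ring_at T U)"
    then show "rres T U U s = s"
      by (cases "x \<in> U") (auto simp: T_ring T_rres zring_simps)
  next
    fix U V W s assume "openin (topol T) U \<and> openin (topol T) V \<and> openin (topol T) W \<and> W \<subseteq> V \<and> V \<subseteq> U"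
    then show "rres T V W (rres T U V s) = rres T U W s"
      by (cases "x \<in> W") (auto simp: T_rres subset_iff)
  qed (use cl in blast)
  show "sheaf_on (topol T) (\<lambda>V. carrier (ring_at T V)) (rres T)"
    unfolding sheaf_on_def
  proof (intro conjI allI impI psh)
    fix \<U> s
    assume "(\<forall>V\<in>\<U>. openin (topol T) V \<and> s V \<in> carrier (ring_at T V)) \<and>
      (\<forall>V\<in>\<U>. \<forall>W\<in>\<U>. rres T V (V \<inter> W) (s V) = rres T W (V \<inter> W) (s W))"
    then have s: "\<And>V. V \<in> \<U> \<Longrightarrow> s V \<in> carrier (ring_at T V)"
      and c: "\<And>V W. V \<in> \<U> \<Longrightarrow> W \<in> \<U> \<Longrightarrow> rres T V (V \<inter> W) (s V) = rres T W (V \<inter> W) (s W)"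
      by auto
    show "\<exists>!t. t \<in> carrier (ring_at T (\<Union>\<U>)) \<and> (\<forall>V\<in>\<U>. rres T (\<Union>\<U>) V t = s V)"
    proof (cases "x \<in> \<Union>\<U>")
      case True
      \<comment> \<open>A member containing \<open>x\<close> already determines the glued section,
        because restriction between opens containing \<open>x\<close> is the identity.\<close>
      then obtain V where V: "V \<in> \<U>" "x \<in> V" by blast
      have "rres T (\<Union>\<U>) W (s V) = s W" if W: "W \<in> \<U>" for W
      proof (cases "x \<in> W")
        case True
        then show ?thesis using c[OF V(1) W] V(2) by (simp add: T_rres)
      next
        case False
        then show ?thesis using s[OF W] by (simp add: T_rres T_ring zring_simps)
      qed
      moreover have "s V \<in> carrier (ring_at T (\<Union>\<U>))"
        using s[OF V(1)] V(2) True by (simp only: T_ring)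
      moreover have "t = s V" if "\<forall>W\<in>\<U>. rres T (\<Union>\<U>) W t = s W" for t
        using that V by (auto simp: T_rres)
      ultimately show ?thesis by blast
    next
      case False
      \<comment> \<open>Away from \<open>x\<close> all sections are zero, and this also covers the
        empty family.\<close>
      then have "s V = \<zero>" "x \<notin> V" if "V \<in> \<U>" for V
        using s[OF that] that by (auto simp: T_ring zring_simps)
      then show ?thesis
        using False by (intro ex1I[of _ \<zero>]) (auto simp: T_rres T_ring zring_simps)
    qed
  qed
next
  fix V :: "'p set"
  show "cring (ring_at T V)"
    by (cases "x \<in> V") (simp_all add: T_ring cring_axioms zring_cring)
next
  fix V W :: "'p set" assume "W \<subseteq> V"
  then show "rres T V W \<in> ring_hom (ring_at T V) (ring_at T W)"
    by (cases "x \<in> V"; cases "x \<in> W") (auto simp: T_ring T_rres zring_simps ring_hom_def)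
qed

lemma T_nbhds: "nbhds T x = {{x}}"
  unfolding nbhds_def by (auto simp: T_open)

lemma T_stalk: "field (stalk T x)" "\<zero>\<^bsub>stalk T x\<^esub> = {({x}, \<zero>)}"
  "r \<in> carrier K \<Longrightarrow> rgerm T (nbhds T x) {x} r = {({x}, r)}"
proof -
  have r: "ring (ring_at T {x})" by (simp add: T_ring ring_axioms)
  have i: "\<forall>r\<in>carrier (ring_at T {x}). rres T {x} {x} r = r" by (simp add: T_rres)
  note s = stalk_single[of T "{x}", OF r i]
  show "field (stalk T x)"
    unfolding T_nbhds by (rule ring_iso_field[OF _ s(1)]) (simp add: T_ring field_axioms, rule s(2))
  show "\<zero>\<^bsub>stalk T x\<^esub> = {({x}, \<zero>)}"
    unfolding T_nbhds using s(2) s(3)[of \<zero>] by (simp add: T_ring)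
  show "rgerm T (nbhds T x) {x} r = {({x}, r)}" if "r \<in> carrier K"
    unfolding T_nbhds using s(3)[of r] that by (simp add: T_ring)
qed

lemma T_locally_ringed: "locally_ringed T"
  by (simp add: locally_ringed_def T_ringed T_points field_local_ring T_stalk)

text \<open>The canonical map from \<open>K\<close> to its localization at the zero ideal. It is
  bijective because the denominators are already invertible, which is shown in
  \<open>frac_fr\<close> and \<open>fr_inj\<close>.\<close>

definition fr :: "'r \<Rightarrow> ('r \<times> 'r) set" where "fr r = frac K (carrier K - {\<zero>}) r \<one>"

lemma mult_nonzero: "a \<in> carrier K - {\<zero>} \<Longrightarrow> b \<in> carrier K - {\<zero>} \<Longrightarrow> a \<otimes> b \<in> carrier K - {\<zero>}"
  using integral by auto

lemma frac_iff:
  assumes "a \<in> carrier K" "s \<in> carrier K - {\<zero>}"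
  shows "frac K (carrier K - {\<zero>}) a s = {(b, t). b \<in> carrier K \<and> t \<in> carrier K - {\<zero>} \<and> a \<otimes> t = b \<otimes> s}"
proof -
  have "(\<exists>u\<in>carrier K - {\<zero>}. u \<otimes> (a \<otimes> t) = u \<otimes> (b \<otimes> s)) \<longleftrightarrow> a \<otimes> t = b \<otimes> s"
    if "b \<in> carrier K" "t \<in> carrier K - {\<zero>}" for b t
  proof
    assume "\<exists>u\<in>carrier K - {\<zero>}. u \<otimes> (a \<otimes> t) = u \<otimes> (b \<otimes> s)"
    then show "a \<otimes> t = b \<otimes> s"
      using that assms m_lcancel by auto
  next
    assume "a \<otimes> t = b \<otimes> s"
    then show "\<exists>u\<in>carrier K - {\<zero>}. u \<otimes> (a \<otimes> t) = u \<otimes> (b \<otimes> s)"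
      by (intro bexI[of _ \<one>]) auto
  qed
  then show ?thesis
    unfolding frac_def by auto
qed

lemma fr_iff: "r \<in> carrier K \<Longrightarrow> (b, t) \<in> fr r \<longleftrightarrow> b \<in> carrier K \<and> t \<in> carrier K - {\<zero>} \<and> b = r \<otimes> t"
  unfolding fr_def by (subst frac_iff) auto

lemma fr_eq: 
  assumes "a \<in> carrier K" "s \<in> carrier K - {\<zero>}" "r \<in> carrier K" "a = r \<otimes> s"
  shows "frac K (carrier K - {\<zero>}) a s = fr r"
proof -
  have "a \<otimes> t = b \<otimes> s \<longleftrightarrow> b = r \<otimes> t" if "b \<in> carrier K" "t \<in> carrier K - {\<zero>}" for b t
  proof -
    have "a \<otimes> t = (r \<otimes> t) \<otimes> s"
      using assms that by (simp add: m_ac)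
    then show ?thesis
      using m_rcancel[of s "r \<otimes> t" b] assms that by auto
  qed
  then show ?thesis
    using frac_iff[OF assms(1,2)] fr_iff[OF assms(3)] by auto
qed

lemma frac_fr:
  assumes "a \<in> carrier K" "s \<in> carrier K - {\<zero>}"
  obtains r where "r \<in> carrier K" "frac K (carrier K - {\<zero>}) a s = fr r"
proof -
  have s: "s \<in> Units K" using assms(2) field_Units by simp
  have "a = (a \<otimes> inv s) \<otimes> s"
    using assms s by (simp add: m_assoc)
  then show thesis
    using that[of "a \<otimes> inv s"] fr_eq[OF assms, of "a \<otimes> inv s"] assms s by simp
qed

lemma fr_inj: "r \<in> carrier K \<Longrightarrow> r' \<in> carrier K \<Longrightarrow> fr r = fr r' \<Longrightarrow> r = r'"
  using fr_iff[of r r \<one>] fr_iff[of r' r \<one>] by auto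

abbreviation Loc where "Loc \<equiv> localization K (carrier K - {\<zero>})"

lemma Loc_carrier: "carrier Loc = fr ` carrier K"
proof
  show "carrier Loc \<subseteq> fr ` carrier K"
  proof
    fix z assume "z \<in> carrier Loc"
    then obtain a s where "z = frac K (carrier K - {\<zero>}) a s" "a \<in> carrier K" "s \<in> carrier K - {\<zero>}"
      by (auto simp: localization_def)
    then show "z \<in> fr ` carrier K"
      using frac_fr[of a s] by blast
  qed
  show "fr ` carrier K \<subseteq> carrier Loc"
    unfolding localization_def fr_def using one_not_zero by (auto intro!: exI[of _ \<one>] exI)
qed

lemma fr_mem: "r \<in> carrier K \<Longrightarrow> (r, \<one>) \<in> fr r"
  by (simp add: fr_iff)

lemma Loc_mult: assumes "r \<in> carrier K" "r' \<in> carrier K" shows "fr r \<otimes>\<^bsub>Loc\<^esub> fr r' = fr (r \<otimes> r')"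
proof -
  have "fr r \<otimes>\<^bsub>Loc\<^esub> fr r' =
      (\<Union>(a, s)\<in>fr r. \<Union>(b, t)\<in>fr r'. frac K (carrier K - {\<zero>}) (a \<otimes> b) (s \<otimes> t))"
    by (simp add: localization_def)
  also have "\<dots> = fr (r \<otimes> r')"
  proof (rule Union_pairs_const)
    fix a s b t assume "(a, s) \<in> fr r" "(b, t) \<in> fr r'"
    then have "a \<in> carrier K" "s \<in> carrier K - {\<zero>}" "a = r \<otimes> s" "b \<in> carrier K" "t \<in> carrier K - {\<zero>}" "b = r' \<otimes> t"
      using assms by (simp_all add: fr_iff)
    then show "frac K (carrier K - {\<zero>}) (a \<otimes> b) (s \<otimes> t) = fr (r \<otimes> r')"
      using assms by (intro fr_eq mult_nonzero) (simp_all add: m_ac)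
  qed (use fr_mem assms in blast)+
  finally show ?thesis .
qed

lemma Loc_add: assumes "r \<in> carrier K" "r' \<in> carrier K" shows "fr r \<oplus>\<^bsub>Loc\<^esub> fr r' = fr (r \<oplus> r')"
proof -
  have "fr r \<oplus>\<^bsub>Loc\<^esub> fr r' =
      (\<Union>(a, s)\<in>fr r. \<Union>(b, t)\<in>fr r'. frac K (carrier K - {\<zero>}) (a \<otimes> t \<oplus> b \<otimes> s) (s \<otimes> t))"
    by (simp add: localization_def)
  also have "\<dots> = fr (r \<oplus> r')"
  proof (rule Union_pairs_const)
    fix a s b t assume "(a, s) \<in> fr r" "(b, t) \<in> fr r'"
    then have "a \<in> carrier K" "s \<in> carrier K - {\<zero>}" "a = r \<otimes> s" "b \<in> carrier K" "t \<in> carrier K - {\<zero>}" "b = r' \<otimes> t"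
      using assms by (simp_all add: fr_iff)
    then show "frac K (carrier K - {\<zero>}) (a \<otimes> t \<oplus> b \<otimes> s) (s \<otimes> t) = fr (r \<oplus> r')"
      using assms by (intro fr_eq mult_nonzero) (simp_all add: m_ac l_distr r_distr)
  qed (use fr_mem assms in blast)+
  finally show ?thesis .
qed

lemma Loc_one_zero: "\<one>\<^bsub>Loc\<^esub> = fr \<one>" "\<zero>\<^bsub>Loc\<^esub> = fr \<zero>"
  by (simp_all add: localization_def fr_def)

lemma prime_iff: "primeideal p K \<longleftrightarrow> p = {\<zero>}"
proof
  assume "primeideal p K"
  then interpret p: primeideal p K .
  have "p \<in> {I. ideal I K}" using p.ideal_axioms by simp
  then show "p = {\<zero>}" using p.I_notcarr all_ideals by auto
qed (simp add: zeroprimeideal)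

text \<open>A field has the zero ideal as its only prime, so its spectrum is a single point; the
  nonempty open is the basic open set of one.\<close>

lemma Spec_open: "openin (topol (Spec K)) U \<longleftrightarrow> U = {} \<or> U = {{\<zero>}}"
proof
  let ?B = "{{p. primeideal p K \<and> f \<notin> p} | f. f \<in> carrier K}"
  assume "openin (topol (Spec K)) U"
  then have "openin (topology_generated_by ?B) U"
    by (simp add: Spec_def zariski_def)
  then have "U \<subseteq> topspace (topology_generated_by ?B)"
    by (rule openin_subset)
  then have "U \<subseteq> {{\<zero>}}"
    unfolding topology_generated_by_topspace by (auto simp: prime_iff)
  then show "U = {} \<or> U = {{\<zero>}}" by auto
next
  assume U: "U = {} \<or> U = {{\<zero>}}"
  have "{{\<zero>}} = {p. primeideal p K \<and> \<one> \<notin> p}" by (auto simp: prime_iff)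
  then have "openin (topol (Spec K)) {{\<zero>}}"
    unfolding Spec_def zariski_def ringed_space.simps by (intro topology_generated_by_Basis) blast
  then show "openin (topol (Spec K)) U" using U by auto
qed

lemma Spec_points: "points (Spec K) = {{\<zero>}}"
proof
  show "points (Spec K) \<subseteq> {{\<zero>}}"
    using openin_topspace[of "topol (Spec K)"] unfolding Spec_open by auto
  show "{{\<zero>}} \<subseteq> points (Spec K)"
    using openin_subset[of "topol (Spec K)" "{{\<zero>}}"] by (simp add: Spec_open)
qed

text \<open>The global section of \<open>Spec K\<close> that corresponds to \<open>r\<close> under
  the isomorphism \<open>cs_iso\<close>.\<close>

definition cs :: "'r \<Rightarrow> 'r set \<Rightarrow> ('r \<times> 'r) set" where "cs r = (\<lambda>p\<in>{{\<zero>}}. fr r)"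

abbreviation SR where "SR \<equiv> ring_at (Spec K) {{\<zero>}}"

lemma SR_carrier: "carrier SR = cs ` carrier K"
proof
  show "carrier SR \<subseteq> cs ` carrier K"
  proof
    fix s assume "s \<in> carrier SR"
    then have s: "s \<in> (\<Pi>\<^sub>E p\<in>{{\<zero>}}. carrier (localization K (carrier K - p)))"
      by (simp add: Spec_def)
    then obtain r where r: "r \<in> carrier K" "s {\<zero>} = fr r"
      using Loc_carrier PiE_mem[OF s, of "{\<zero>}"] by auto
    then have "s = cs r"
      using s by (auto simp: cs_def PiE_def extensional_def fun_eq_iff)
    then show "s \<in> cs ` carrier K" using r by blast
  qed
  show "cs ` carrier K \<subseteq> carrier SR"
  proof
    fix s assume "s \<in> cs ` carrier K"
    then obtain r where r: "r \<in> carrier K" "s = cs r" by blast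
    have "\<exists>V. openin (zariski K) V \<and> {\<zero>} \<in> V \<and> V \<subseteq> {{\<zero>}} \<and>
             (\<exists>a\<in>carrier K. \<exists>b\<in>carrier K. \<forall>q\<in>V. b \<notin> q \<and> s q = frac K (carrier K - q) a b)"
      using r Spec_open[of "{{\<zero>}}"]
      by (intro exI[of _ "{{\<zero>}}"] conjI bexI[of _ r] bexI[of _ \<one>]) (auto simp: cs_def fr_def Spec_def)
    moreover have "s \<in> (\<Pi>\<^sub>E p\<in>{{\<zero>}}. carrier (localization K (carrier K - p)))"
      using r Loc_carrier by (auto simp: cs_def)
    ultimately show "s \<in> carrier SR"
      by (simp add: Spec_def)
  qed
qed

lemma cs_inj: "r \<in> carrier K \<Longrightarrow> r' \<in> carrier K \<Longrightarrow> cs r = cs r' \<Longrightarrow> r = r'"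
  by (rule fr_inj) (auto simp: cs_def dest: fun_cong[of _ _ "{\<zero>}"])

lemma SR_ops:
  "r \<in> carrier K \<Longrightarrow> r' \<in> carrier K \<Longrightarrow> cs r \<otimes>\<^bsub>SR\<^esub> cs r' = cs (r \<otimes> r')"
  "r \<in> carrier K \<Longrightarrow> r' \<in> carrier K \<Longrightarrow> cs r \<oplus>\<^bsub>SR\<^esub> cs r' = cs (r \<oplus> r')"
  "\<one>\<^bsub>SR\<^esub> = cs \<one>" "\<zero>\<^bsub>SR\<^esub> = cs \<zero>"
  unfolding cs_def by (auto simp: Spec_def Loc_mult Loc_add Loc_one_zero intro!: restrict_ext)

lemma cs_iso: "cs \<in> ring_iso K SR"
  by (rule ring_iso_memI) (auto simp: SR_carrier SR_ops bij_betw_def inj_on_def intro: cs_inj)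

lemma SR_field: "field SR"
  by (rule ring_iso_field[OF field_axioms cs_iso]) (simp add: SR_ops)

lemma Spec_empty: "carrier (ring_at (Spec K) {}) = {\<lambda>_. undefined}"
  by (auto simp: Spec_def)

lemma Spec_empty_ops: "\<one>\<^bsub>ring_at (Spec K) {}\<^esub> = (\<lambda>_. undefined)" "a \<otimes>\<^bsub>ring_at (Spec K) {}\<^esub> b = (\<lambda>_. undefined)"
  "a \<oplus>\<^bsub>ring_at (Spec K) {}\<^esub> b = (\<lambda>_. undefined)"
  by (auto simp: Spec_def)

lemma Spec_rres: "r \<in> carrier K \<Longrightarrow> rres (Spec K) {{\<zero>}} {{\<zero>}} (cs r) = cs r" "rres (Spec K) U {} s = (\<lambda>_. undefined)"
  by (auto simp: Spec_def cs_def fun_eq_iff)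

lemma Spec_nbhds: "nbhds (Spec K) {\<zero>} = {{{\<zero>}}}"
  unfolding nbhds_def by (auto simp: Spec_open)

lemma Spec_stalk: "field (stalk (Spec K) {\<zero>})" "\<zero>\<^bsub>stalk (Spec K) {\<zero>}\<^esub> = {({{\<zero>}}, cs \<zero>)}"
  "r \<in> carrier K \<Longrightarrow> rgerm (Spec K) (nbhds (Spec K) {\<zero>}) {{\<zero>}} (cs r) = {({{\<zero>}}, cs r)}"
proof -
  interpret SR: field SR by (rule SR_field)
  have i: "\<forall>r\<in>carrier SR. rres (Spec K) {{\<zero>}} {{\<zero>}} r = r"
    by (auto simp: SR_carrier Spec_rres)
  note s = stalk_single[of "Spec K" "{{\<zero>}}", OF SR.ring_axioms i]
  show "field (stalk (Spec K) {\<zero>})"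
    unfolding Spec_nbhds by (rule ring_iso_field) (rule SR_field, rule s(1), rule s(2))
  show "\<zero>\<^bsub>stalk (Spec K) {\<zero>}\<^esub> = {({{\<zero>}}, cs \<zero>)}"
    unfolding Spec_nbhds using s(2) s(3)[of "cs \<zero>"] by (simp add: SR_ops SR_carrier)
  show "rgerm (Spec K) (nbhds (Spec K) {\<zero>}) {{\<zero>}} (cs r) = {({{\<zero>}}, cs r)}" if "r \<in> carrier K"
    unfolding Spec_nbhds using s(3)[of "cs r"] that by (simp add: SR_carrier)
qed

section \<open>The one-point space as an affine scheme\<close>

definition toSpec :: "('p, 'r set, 'r, 'r set \<Rightarrow> ('r \<times> 'r) set) mor" where
  "toSpec = \<lparr>pt = (\<lambda>_. {\<zero>}), cm = (\<lambda>U \<sigma>. if {\<zero>} \<in> U then inv_into (carrier K) cs \<sigma> else \<zero>)\<rparr>"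

definition fromSpec :: "('r set, 'p, 'r set \<Rightarrow> ('r \<times> 'r) set, 'r) mor" where
  "fromSpec = \<lparr>pt = (\<lambda>_. x), cm = (\<lambda>V r. if x \<in> V then cs r else (\<lambda>_. undefined))\<rparr>"

lemma inv_cs: "r \<in> carrier K \<Longrightarrow> inv_into (carrier K) cs (cs r) = r"
  by (rule inv_into_f_f) (auto simp: inj_on_def intro: cs_inj)

lemma cm_toSpec: "cm toSpec {} \<sigma> = \<zero>" "r \<in> carrier K \<Longrightarrow> cm toSpec {{\<zero>}} (cs r) = r"
  by (simp_all add: toSpec_def inv_cs)

lemma cm_fromSpec: "cm fromSpec {} r = (\<lambda>_. undefined)" "cm fromSpec {x} r = cs r"
  by (simp_all add: fromSpec_def)

lemma pre_toSpec: "pre T toSpec {{\<zero>}} = {x}" "pre T toSpec {} = {}"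
  by (auto simp: pre_def toSpec_def T_points)

lemma pre_fromSpec: "pre (Spec K) fromSpec {x} = {{\<zero>}}" "pre (Spec K) fromSpec {} = {}"
  by (auto simp: pre_def fromSpec_def Spec_points)

text \<open>The maximal ideal of a field is zero, so locality amounts to sending the zero germ to
  the zero germ. The zero germ is assumed to have a single representative, which lets
  \<open>lim_map\<close> be evaluated directly.\<close>

lemma stalk_map_zero:
  assumes "cm f V \<zero>\<^bsub>ring_at Y V\<^esub> = z" "\<zero>\<^bsub>stalk Y (pt f y)\<^esub> = {(V, \<zero>\<^bsub>ring_at Y V\<^esub>)}"
    and "rgerm X (nbhds X y) (pre X f V) z = \<zero>\<^bsub>stalk X y\<^esub>"
    and "field (stalk X y)" "field (stalk Y (pt f y))"
    and "maximalideal \<mm> (stalk Y (pt f y))" "maximalideal \<nn> (stalk X y)"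
  shows "stalk_map X f y ` \<mm> \<subseteq> \<nn>"
  using field_maximalideal[OF assms(4,7)] field_maximalideal[OF assms(5,6)] assms(1-3)
  by (simp add: stalk_map_def lim_map_def)

lemma toSpec_mor: "lrs_mor T (Spec K) toSpec"
  unfolding lrs_mor_def
proof (intro conjI ballI impI allI)
  show "continuous_map (topol T) (topol (Spec K)) (pt toSpec)"
    by (simp add: toSpec_def Spec_points)
next
  fix V assume "V \<in> opens (Spec K)"
  then consider "V = {}" | "V = {{\<zero>}}" by (auto simp: Spec_open)
  then show "cm toSpec V \<in> ring_hom (ring_at (Spec K) V) (ring_at T (pre T toSpec V))"
  proof cases
    case 1
    then show ?thesis
      unfolding 1 pre_toSpec by (auto simp: ring_hom_def T_ring zring_simps toSpec_def Spec_empty Spec_empty_ops)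
  next
    case 2
    have "inv_into (carrier K) cs \<in> ring_hom SR K"
      by (rule ring_hom_memI) (auto simp: SR_carrier SR_ops inv_cs)
    then show ?thesis
      unfolding 2 pre_toSpec T_ring by (simp add: toSpec_def)
  qed
next
  fix V W s assume "V \<in> opens (Spec K)" "W \<in> opens (Spec K)" "W \<subseteq> V" "s \<in> carrier (ring_at (Spec K) V)"
  then consider "W = {}" | "V = {{\<zero>}}" "W = {{\<zero>}}" "s \<in> cs ` carrier K"
    using SR_carrier by (auto simp: Spec_open)
  then show "cm toSpec W (rres (Spec K) V W s) = rres T (pre T toSpec V) (pre T toSpec W) (cm toSpec V s)"
    by cases (auto simp: pre_toSpec T_rres cm_toSpec Spec_rres)
next
  fix y \<mm> \<nn> assume y: "y \<in> points T" and m: "maximalideal \<mm> (stalk (Spec K) (pt toSpec y)) \<and> maximalideal \<nn> (stalk T y)"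
  have yx: "y = x" and p: "pt toSpec x = {\<zero>}" using y by (auto simp: T_points toSpec_def)
  show "stalk_map T toSpec y ` \<mm> \<subseteq> \<nn>"
    by (rule stalk_map_zero[of toSpec "{{\<zero>}}" "Spec K" \<zero> y T])
      (use m in \<open>simp_all add: p SR_ops Spec_stalk T_stalk pre_toSpec cm_toSpec yx\<close>)
qed

lemma fromSpec_mor: "lrs_mor (Spec K) T fromSpec"
  unfolding lrs_mor_def
proof (intro conjI ballI impI allI)
  show "continuous_map (topol (Spec K)) (topol T) (pt fromSpec)"
    by (simp add: fromSpec_def T_points)
next
  fix V assume "V \<in> opens T"
  then consider "V = {}" | "V = {x}" by (auto simp: T_open)
  then show "cm fromSpec V \<in> ring_hom (ring_at T V) (ring_at (Spec K) (pre (Spec K) fromSpec V))"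
  proof cases
    case 1
    then show ?thesis
      unfolding 1 pre_fromSpec by (auto simp: ring_hom_def T_ring zring_simps fromSpec_def Spec_empty Spec_empty_ops)
  next
    case 2
    have "cs \<in> ring_hom K SR" using cs_iso by (simp add: ring_iso_def)
    then show ?thesis
      unfolding 2 pre_fromSpec T_ring by (simp add: fromSpec_def)
  qed
next
  fix V W s assume "V \<in> opens T" "W \<in> opens T" "W \<subseteq> V" "s \<in> carrier (ring_at T V)"
  then have VW: "V = {} \<or> V = {x}" "W = {} \<or> W = {x}" "W \<subseteq> V" and s: "s \<in> carrier (ring_at T V)"
    by (simp_all add: T_open)
  show "cm fromSpec W (rres T V W s) = rres (Spec K) (pre (Spec K) fromSpec V) (pre (Spec K) fromSpec W) (cm fromSpec V s)"
  proof (cases "W = {}")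
    case True
    show ?thesis
      unfolding True pre_fromSpec(2) Spec_rres(2) cm_fromSpec(1) by (rule refl)
  next
    case False
    then have "W = {x}" "V = {x}" using VW by auto
    then show ?thesis
      using s by (simp add: pre_fromSpec T_rres T_ring cm_fromSpec Spec_rres)
  qed
next
  fix y \<mm> \<nn> assume y: "y \<in> points (Spec K)" and m: "maximalideal \<mm> (stalk T (pt fromSpec y)) \<and> maximalideal \<nn> (stalk (Spec K) y)"
  have yx: "y = {\<zero>}" and p: "pt fromSpec {\<zero>} = x" using y by (auto simp: Spec_points fromSpec_def)
  show "stalk_map (Spec K) fromSpec y ` \<mm> \<subseteq> \<nn>"
    by (rule stalk_map_zero[of fromSpec "{x}" T "cs \<zero>" y "Spec K"])
      (use m in \<open>simp_all add: p T_ring Spec_stalk T_stalk pre_fromSpec cm_fromSpec yx\<close>)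
qed

lemma T_affine: "affine_scheme T"
  unfolding affine_scheme_def lrs_iso_def
proof (intro exI conjI)
  show "cring K" by (rule cring_axioms)
  show "lrs_mor T (Spec K) toSpec" by (rule toSpec_mor)
  show "lrs_mor (Spec K) T fromSpec" by (rule fromSpec_mor)
  show "mor_eq T T (mor_comp (Spec K) fromSpec toSpec) mor_id"
    by (auto simp: mor_eq_def mor_comp_def mor_id_def T_open T_points pre_fromSpec T_ring zring_simps cm_fromSpec cm_toSpec)
      (simp_all add: fromSpec_def)
  show "mor_eq (Spec K) (Spec K) (mor_comp T toSpec fromSpec) mor_id"
    unfolding mor_eq_def
  proof (intro conjI ballI)
    fix V s assume "V \<in> opens (Spec K)" "s \<in> carrier (ring_at (Spec K) V)"
    then consider "V = {}" "s = (\<lambda>_. undefined)" | "V = {{\<zero>}}" "s \<in> cs ` carrier K"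
      using SR_carrier by (auto simp: Spec_open Spec_empty)
    then show "cm (mor_comp T toSpec fromSpec) V s = cm mor_id V s"
      by cases (auto simp: mor_comp_def mor_id_def pre_toSpec cm_fromSpec cm_toSpec)
  qed (simp add: mor_comp_def mor_id_def toSpec_def Spec_points)
qed

lemma T_scheme: "is_scheme T"
proof -
  have "open_restrict T {x} = T"
    by (simp add: open_restrict_def field_point_def)
  then have "affine_scheme (open_restrict T {x})"
    using T_affine by simp
  then have "\<forall>y\<in>points T. \<exists>U\<in>opens T. y \<in> U \<and> affine_scheme (open_restrict T U)"
    unfolding T_points by (intro ballI bexI[of _ "{x}"]) (simp_all add: T_open)
  then show ?thesis
    unfolding is_scheme_def using T_locally_ringed by (rule conjI[rotated])
qed

end

section \<open>Stalks and residue fields\<close>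

lemma lrs_mor_points:
  assumes "lrs_mor X Y f" "x \<in> points X"
  shows "pt f x \<in> points Y"
proof -
  have "continuous_map (topol X) (topol Y) (pt f)"
    using assms(1) unfolding lrs_mor_def by (elim conjE)
  then show ?thesis
    using assms(2) continuous_map_image_subset_topspace by blast
qed

lemma nbhds_openin: "V \<in> nbhds X x \<Longrightarrow> openin (topol X) V"
  by (simp add: nbhds_def)

lemma nbhds_inter: "V \<in> nbhds X x \<Longrightarrow> W \<in> nbhds X x \<Longrightarrow> V \<inter> W \<in> nbhds X x"
  by (auto simp: nbhds_def)

lemma nbhds_iff: "V \<in> nbhds X x \<longleftrightarrow> openin (topol X) V \<and> x \<in> V"
  by (simp add: nbhds_def)

lemma direct_sys_nbhds: "ringed X \<Longrightarrow> direct_sys (topol X) (\<lambda>V. carrier (ring_at X V)) (rres X) (nbhds X x)"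
  by (rule direct_sys_ring[OF _ nbhds_openin nbhds_inter])

lemma stalk_hom:
  assumes X: "ringed X" and V: "V \<in> nbhds X x"
  shows "rgerm X (nbhds X x) V \<in> ring_hom (ring_at X V) (stalk X x)"
proof (rule ring_hom_memI)
  show "rgerm X (nbhds X x) V r \<in> carrier (stalk X x)" if "r \<in> carrier (ring_at X V)" for r
    using V that by (auto simp: lim_ring_def)
qed (simp_all add: lim_ring_mult[OF X nbhds_openin nbhds_inter V] lim_ring_add[OF X nbhds_openin nbhds_inter V]
    lim_ring_one[OF X nbhds_openin nbhds_inter V])

lemma germ_res:
  "ringed X \<Longrightarrow> V \<in> nbhds X x \<Longrightarrow> W \<in> nbhds X x \<Longrightarrow> W \<subseteq> V \<Longrightarrow> s \<in> carrier (ring_at X V) \<Longrightarrow>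
   rgerm X (nbhds X x) W (rres X V W s) = rgerm X (nbhds X x) V s"
  by (rule direct_sys.gm_res[OF direct_sys_nbhds])

text \<open>Naturality of \<open>cm\<close> makes the resulting germ independent of the
  representative, as \<open>lim_map_gm\<close> requires.\<close>

lemma stalk_map_germ:
  assumes X: "ringed X" and Y: "ringed Y" and f: "lrs_mor X Y f" and x: "x \<in> points X"
    and V: "V \<in> nbhds Y (pt f x)" and s: "s \<in> carrier (ring_at Y V)"
  shows "stalk_map X f x (rgerm Y (nbhds Y (pt f x)) V s) = rgerm X (nbhds X x) (pre X f V) (cm f V s)"
  unfolding stalk_map_def
proof (rule direct_sys.lim_map_gm[OF direct_sys_nbhds[OF Y] V s])
  fix V W t assume V: "V \<in> nbhds Y (pt f x)" and W: "W \<in> nbhds Y (pt f x)" and sub: "W \<subseteq> V" and t: "t \<in> carrier (ring_at Y V)"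
  have n: "pre X f Z \<in> nbhds X x" if "Z \<in> nbhds Y (pt f x)" for Z
    using that x lrs_mor_openin_pre[OF f] by (simp add: nbhds_iff pre_def)
  show "rgerm X (nbhds X x) (pre X f W) (cm f W (rres Y V W t)) = rgerm X (nbhds X x) (pre X f V) (cm f V t)"
    unfolding lrs_mor_cm_rres[OF f nbhds_openin[OF V] nbhds_openin[OF W] sub t]
    by (rule germ_res[OF X n[OF V] n[OF W] pre_mono[OF sub] lrs_mor_cm_closed[OF f nbhds_openin[OF V] t]])
qed

text \<open>Modulo a maximal ideal the element is nonzero, hence invertible in the quotient field,
  and any lift of the inverse will do.\<close>

lemma maximalideal_inverse:
  assumes R: "cring R" and J: "maximalideal J R" and s: "s \<in> carrier R" "s \<notin> J"
  obtains t where "t \<in> carrier R" "s \<otimes>\<^bsub>R\<^esub> t \<ominus>\<^bsub>R\<^esub> \<one>\<^bsub>R\<^esub> \<in> J"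
proof -
  interpret cring R by fact
  interpret J: maximalideal J R by fact
  interpret Q: field "R Quot J" by (rule J.quotient_is_field[OF R])
  have "J +>\<^bsub>R\<^esub> s \<noteq> J"
    using a_coset_join1[OF _ s(1) J.a_subgroup] s(2) by blast
  moreover have c: "J +>\<^bsub>R\<^esub> s \<in> carrier (R Quot J)"
    using ring_hom_closed[OF J.rcos_ring_hom s(1)] .
  ultimately have "J +>\<^bsub>R\<^esub> s \<in> Units (R Quot J)"
    using Q.field_Units by (simp add: FactRing_def)
  then obtain C where "C \<in> carrier (R Quot J)" "(J +>\<^bsub>R\<^esub> s) \<otimes>\<^bsub>R Quot J\<^esub> C = \<one>\<^bsub>R Quot J\<^esub>"
    unfolding Units_def by auto
  then obtain t where t: "t \<in> carrier R" "(J +>\<^bsub>R\<^esub> s) \<otimes>\<^bsub>R Quot J\<^esub> (J +>\<^bsub>R\<^esub> t) = \<one>\<^bsub>R Quot J\<^esub>"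
    by (auto simp: FactRing_def A_RCOSETS_def RCOSETS_def a_r_coset_def)
  have "J +>\<^bsub>R\<^esub> (s \<otimes>\<^bsub>R\<^esub> t) = J +>\<^bsub>R\<^esub> \<one>\<^bsub>R\<^esub>"
    using t(2) ring_hom_mult[OF J.rcos_ring_hom s(1) t(1)] ring_hom_one[OF J.rcos_ring_hom] by simp
  then have "s \<otimes>\<^bsub>R\<^esub> t \<ominus>\<^bsub>R\<^esub> \<one>\<^bsub>R\<^esub> \<in> J"
    using quotient_eq_iff_same_a_r_cos[OF J.ideal_axioms, of "s \<otimes>\<^bsub>R\<^esub> t" "\<one>\<^bsub>R\<^esub>"] s(1) t(1) by simp
  then show thesis
    using that t(1) by blast
qed

lemma stalk_cring: "locally_ringed X \<Longrightarrow> x \<in> points X \<Longrightarrow> cring (stalk X x)"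
  by (simp add: locally_ringed_def local_ring_def)

lemma stalk_max_unique:
  "locally_ringed X \<Longrightarrow> x \<in> points X \<Longrightarrow> maximalideal J (stalk X x) \<Longrightarrow> maximalideal J' (stalk X x) \<Longrightarrow> J = J'"
  by (auto simp: locally_ringed_def local_ring_def)

lemma lrs_mor_max:
  "lrs_mor X Y f \<Longrightarrow> x \<in> points X \<Longrightarrow> maximalideal \<mm> (stalk Y (pt f x)) \<Longrightarrow> maximalideal \<nn> (stalk X x) \<Longrightarrow>
   z \<in> \<mm> \<Longrightarrow> stalk_map X f x z \<in> \<nn>"
  unfolding lrs_mor_def by blast

text \<open>A germ outside the maximal ideal has an inverse modulo it, and locality of the open immersion
  transports this relation.\<close>

lemma open_immersion_reflects_max:
  assumes A: "locally_ringed A" and C: "locally_ringed C" and op: "openin (topol C) a"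
    and AC: "A = open_restrict C a" and f: "lrs_mor A C \<lparr>pt = (\<lambda>x. x), cm = (\<lambda>V. rres C V (a \<inter> V))\<rparr>"
    and y: "y \<in> a" and J: "maximalideal J (stalk C y)" and J': "maximalideal J' (stalk A y)"
    and V: "openin (topol C) V" "V \<subseteq> a" "y \<in> V" and s: "s \<in> carrier (ring_at C V)"
    and g: "rgerm A (nbhds A y) V s \<in> J'"
  shows "rgerm C (nbhds C y) V s \<in> J"
proof (rule ccontr)
  let ?f = "\<lparr>pt = (\<lambda>x. x), cm = (\<lambda>V. rres C V (a \<inter> V))\<rparr>"
  assume n: "rgerm C (nbhds C y) V s \<notin> J"
  have rC: "ringed C" and rA: "ringed A" using A C by (auto simp: locally_ringed_def)
  have aC: "a \<subseteq> points C" using op openin_subset by blast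
  have yC: "y \<in> points C" using aC y by blast
  have pA: "points A = a" using aC by (auto simp: AC open_restrict_def)
  have opA: "openin (topol A) W" if "openin (topol C) W" "W \<subseteq> a" for W
    using that by (auto simp: AC open_restrict_def openin_subtopology)
  have rAt: "ring_at A = ring_at C" "rres A = rres C" by (simp_all add: AC open_restrict_def)
  have yA: "y \<in> points A" by (simp add: pA y)
  interpret SC: cring "stalk C y" by (rule stalk_cring[OF C yC])
  interpret SA: cring "stalk A y" by (rule stalk_cring[OF A yA])
  interpret J': maximalideal J' "stalk A y" by fact
  have Vn: "V \<in> nbhds C y" using V by (simp add: nbhds_iff)
  have gs: "rgerm C (nbhds C y) V s \<in> carrier (stalk C y)"
    by (rule ring_hom_closed[OF stalk_hom[OF rC Vn] s])
  obtain z where z: "z \<in> carrier (stalk C y)"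
    "rgerm C (nbhds C y) V s \<otimes>\<^bsub>stalk C y\<^esub> z \<ominus>\<^bsub>stalk C y\<^esub> \<one>\<^bsub>stalk C y\<^esub> \<in> J"
    by (rule maximalideal_inverse[OF SC.cring_axioms J gs n])
  obtain W0 t0 where W0: "W0 \<in> nbhds C y" "t0 \<in> carrier (ring_at C W0)" "z = rgerm C (nbhds C y) W0 t0"
    using lim_ring_germ[OF z(1)] by blast
  \<comment> \<open>On \<open>W\<close> both germs have representatives, and \<open>W\<close> lies
    in \<open>a\<close>; so the element \<open>?u\<close> below has germs in the stalk of
    \<open>C\<close> and in that of \<open>A\<close>, which can be compared.\<close>
  define W where "W = V \<inter> W0"
  define t where "t = rres C W0 W t0"
  define s' where "s' = rres C V W s"
  have W: "W \<in> nbhds C y" "W \<subseteq> V" "W \<subseteq> W0" and oW: "openin (topol C) W" and Wa: "W \<subseteq> a"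
    using nbhds_inter[OF Vn W0(1)] V(2) by (auto simp: W_def nbhds_iff)
  have t: "t \<in> carrier (ring_at C W)" and s': "s' \<in> carrier (ring_at C W)"
    unfolding t_def s'_def using rres_closed[OF rC] W W0 s V oW by (auto simp: nbhds_iff)
  have zt: "z = rgerm C (nbhds C y) W t" and gs': "rgerm C (nbhds C y) V s = rgerm C (nbhds C y) W s'"
    unfolding t_def s'_def using germ_res[OF rC W0(1) W(1,3) W0(2)] germ_res[OF rC Vn W(1,2) s] W0(3) by simp_all
  interpret RW: cring "ring_at C W" by (rule ringed_cring[OF rC oW])
  let ?u = "s' \<otimes>\<^bsub>ring_at C W\<^esub> t \<ominus>\<^bsub>ring_at C W\<^esub> \<one>\<^bsub>ring_at C W\<^esub>"
  interpret gC: ring_hom_cring "ring_at C W" "stalk C y" "rgerm C (nbhds C y) W"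
    by unfold_locales (rule stalk_hom[OF rC W(1)])
  have WA: "W \<in> nbhds A y" using opA[OF oW Wa] W(1) by (simp add: nbhds_iff)
  interpret gA: ring_hom_cring "ring_at C W" "stalk A y" "rgerm A (nbhds A y) W"
    by unfold_locales (use stalk_hom[OF rA WA] in \<open>simp add: rAt\<close>)
  have "rgerm C (nbhds C y) W ?u \<in> J"
    using z(2) unfolding zt gs' by (simp add: s' t SC.minus_eq RW.minus_eq)
  then have "stalk_map A ?f y (rgerm C (nbhds C y) W ?u) \<in> J'"
    using lrs_mor_max[OF f yA, of J J'] J J' by simp
  moreover have "stalk_map A ?f y (rgerm C (nbhds C y) W ?u) = rgerm A (nbhds A y) W ?u"
  proof -
    have "pre A ?f W = W"
      using Wa pA by (auto simp: pre_def)
    moreover have "rres C W (a \<inter> W) ?u = ?u"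
      using Wa rres_id[OF rC oW] s' t by (simp add: Int_absorb1)
    ultimately show ?thesis
      using stalk_map_germ[OF rA rC f yA, of W ?u] W(1) s' t by simp
  qed
  ultimately have u: "rgerm A (nbhds A y) W ?u \<in> J'" by simp
  have sA: "rgerm A (nbhds A y) W s' \<in> J'"
    using g germ_res[OF rA, of V y W s] WA W(2) V opA[OF V(1,2)] s by (simp add: rAt s'_def nbhds_iff)
  let ?gs = "rgerm A (nbhds A y) W s'" and ?gt = "rgerm A (nbhds A y) W t"
  have "?gs \<otimes>\<^bsub>stalk A y\<^esub> ?gt \<in> J'"
    by (rule J'.I_r_closed[OF sA]) (simp add: t)
  moreover have "rgerm A (nbhds A y) W ?u = ?gs \<otimes>\<^bsub>stalk A y\<^esub> ?gt \<ominus>\<^bsub>stalk A y\<^esub> \<one>\<^bsub>stalk A y\<^esub>"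
    by (simp add: s' t SA.minus_eq RW.minus_eq)
  \<comment> \<open>The product and the product minus one both lie in \<open>J'\<close>, hence so
    does their difference, which is one.\<close>
  ultimately have "?gs \<otimes>\<^bsub>stalk A y\<^esub> ?gt \<ominus>\<^bsub>stalk A y\<^esub>
      (?gs \<otimes>\<^bsub>stalk A y\<^esub> ?gt \<ominus>\<^bsub>stalk A y\<^esub> \<one>\<^bsub>stalk A y\<^esub>) \<in> J'"
    using u J'.a_closed J'.a_inv_closed by (simp add: SA.minus_eq)
  moreover have "?gs \<otimes>\<^bsub>stalk A y\<^esub> ?gt \<ominus>\<^bsub>stalk A y\<^esub>
      (?gs \<otimes>\<^bsub>stalk A y\<^esub> ?gt \<ominus>\<^bsub>stalk A y\<^esub> \<one>\<^bsub>stalk A y\<^esub>) = \<one>\<^bsub>stalk A y\<^esub>"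
  proof -
    have "?gs \<otimes>\<^bsub>stalk A y\<^esub> ?gt \<in> carrier (stalk A y)" by (simp add: s' t)
    then show ?thesis
      by (simp add: SA.minus_eq SA.minus_add SA.r_neg1 SA.r_neg2 SA.a_assoc[symmetric] SA.r_neg)
  qed
  ultimately have "\<one>\<^bsub>stalk A y\<^esub> \<in> J'" by simp
  then show False
    using J'.one_imp_carrier J'.I_notcarr by simp
qed

text \<open>Finitely many germs have representatives on one common neighbourhood, where they are
  told apart by sections, that is, by elements of \<open>'r\<close>.\<close>

lemma stalk_finite_inj:
  assumes X: "ringed X" and x: "x \<in> points X" and fin: "finite (carrier (stalk X x))"
  shows "\<exists>j :: _ \<Rightarrow> 'r. inj_on j (carrier (stalk (X :: ('p, 'r) ringed_space) x))"
proof -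
  have "\<exists>V s. V \<in> nbhds X x \<and> s \<in> carrier (ring_at X V) \<and> z = rgerm X (nbhds X x) V s" if "z \<in> carrier (stalk X x)" for z
    using lim_ring_germ[OF that] .
  then obtain V s where Vs: "\<And>z. z \<in> carrier (stalk X x) \<Longrightarrow>
      V z \<in> nbhds X x \<and> s z \<in> carrier (ring_at X (V z)) \<and> z = rgerm X (nbhds X x) (V z) (s z)"
    by metis
  define W where "W = points X \<inter> (\<Inter>z\<in>carrier (stalk X x). V z)"
  have W: "W \<in> nbhds X x"
  proof -
    have "openin (topol X) (\<Inter> (insert (points X) (V ` carrier (stalk X x))))"
      by (rule openin_Inter) (use fin Vs in \<open>auto simp: nbhds_iff\<close>)
    moreover have "\<Inter> (insert (points X) (V ` carrier (stalk X x))) = W"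
      by (simp add: W_def)
    ultimately show ?thesis
      using Vs x by (simp add: nbhds_iff W_def)
  qed
  have "rgerm X (nbhds X x) W (rres X (V z) W (s z)) = z" if "z \<in> carrier (stalk X x)" for z
    using germ_res[OF X, of "V z" x W "s z"] Vs[OF that] W that by (auto simp: W_def)
  then have "inj_on (\<lambda>z. rres X (V z) W (s z)) (carrier (stalk X x))"
    by (rule inj_on_inverseI)
  then show ?thesis by blast
qed

section \<open>Embedding the stalks of a scheme into the type of sections\<close>

lemma Spec_section_iff:
  "s \<in> carrier (ring_at (Spec R) U) \<longleftrightarrow> s \<in> (\<Pi>\<^sub>E p\<in>U. carrier (localization R (carrier R - p))) \<and>
     (\<forall>p\<in>U. \<exists>V. openin (topol (Spec R)) V \<and> p \<in> V \<and> V \<subseteq> U \<and>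
       (\<exists>a\<in>carrier R. \<exists>b\<in>carrier R. \<forall>q\<in>V. b \<notin> q \<and> s q = frac R (carrier R - q) a b))"
  by (simp add: Spec_def)

lemma Spec_rres_restrict: "rres (Spec R) U V s = restrict s V"
  by (simp add: Spec_def)

text \<open>A germ on an affine scheme is given by a fraction, hence by a pair of ring elements.\<close>

lemma stalk_pairs_inj:
  fixes X :: "('p, 'r) ringed_space"
  assumes X: "ringed X" and x: "x \<in> U" and U: "openin (topol X) U" and aff: "affine_scheme (open_restrict X U)"
  shows "\<exists>p :: _ \<Rightarrow> 'r \<times> 'r. inj_on p (carrier (stalk X x))"
proof -
  let ?X = "open_restrict X U"
  from aff obtain A :: "'r ring" where "lrs_iso ?X (Spec A)"
    unfolding affine_scheme_def by (elim exE conjE)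
  then obtain f g where f: "lrs_mor ?X (Spec A) f" and g: "lrs_mor (Spec A) ?X g"
    and gf: "mor_eq ?X ?X (mor_comp (Spec A) g f) mor_id"
    unfolding lrs_iso_def by (elim exE conjE)
  have UX: "U \<subseteq> points X" using U openin_subset by blast
  have pU: "points ?X = U" using UX by (auto simp: open_restrict_def)
  have opU: "openin (topol ?X) W \<longleftrightarrow> openin (topol X) W \<and> W \<subseteq> U" for W
    using U by (auto simp: open_restrict_def openin_open_subtopology)
  have rAt: "ring_at ?X = ring_at X" "rres ?X = rres X" by (simp_all add: open_restrict_def)
  \<comment> \<open>The pair \<open>(a, b)\<close> defines a section on the neighbourhood
    \<open>D\<close> of the image of \<open>x\<close>, and transport along \<open>f\<close> gives
    the germ \<open>z\<close>. The open \<open>D\<close> need not be recorded, since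
    \<open>uniq\<close> shows that the pair alone determines the germ.\<close>
  define P where "P z D a b \<longleftrightarrow> openin (topol (Spec A)) D \<and> pt f x \<in> D \<and>
      (\<lambda>q\<in>D. frac A (carrier A - q) a b) \<in> carrier (ring_at (Spec A) D) \<and>
      z = rgerm X (nbhds X x) (pre ?X f D) (cm f D (\<lambda>q\<in>D. frac A (carrier A - q) a b))" for z D a b
  have nb: "pre ?X f D \<in> nbhds X x" if "openin (topol (Spec A)) D" "pt f x \<in> D" for D
    using lrs_mor_openin_pre[OF f that(1)] that(2) x by (simp add: opU nbhds_iff) (simp add: pre_def pU)
  have ex: "\<exists>D a b. P z D a b" if z: "z \<in> carrier (stalk X x)" for z
  proof -
    obtain V0 s0 where V0: "V0 \<in> nbhds X x" "s0 \<in> carrier (ring_at X V0)" "z = rgerm X (nbhds X x) V0 s0"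
      using lim_ring_germ[OF z] by blast
    define V where "V = V0 \<inter> U"
    define s where "s = rres X V0 V s0"
    have V: "V \<in> nbhds X x" "openin (topol ?X) V" "openin (topol X) V" "V \<subseteq> V0" "V \<subseteq> U" "x \<in> V"
      using V0(1) U x by (auto simp: V_def nbhds_iff opU)
    have s: "s \<in> carrier (ring_at X V)" and zs: "z = rgerm X (nbhds X x) V s"
      unfolding s_def using rres_closed[OF X _ V(3,4) V0(2)] V0 germ_res[OF X V0(1) V(1,4) V0(2)] by (auto simp: nbhds_iff)
    define \<sigma> where "\<sigma> = cm g V s"
    let ?E = "pre (Spec A) g V"
    have oE: "openin (topol (Spec A)) ?E" by (rule lrs_mor_openin_pre[OF g V(2)])
    have \<sigma>: "\<sigma> \<in> carrier (ring_at (Spec A) ?E)"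
      unfolding \<sigma>_def by (rule lrs_mor_cm_closed[OF g V(2)]) (simp add: rAt s)
    have ptgf: "pt g (pt f w) = w" if "w \<in> U" for w
      using gf that pU by (simp add: mor_eq_def mor_comp_def mor_id_def)
    have ptf: "pt f w \<in> points (Spec A)" if "w \<in> U" for w
      using lrs_mor_points[OF f] that pU by simp
    have pE: "pre ?X f ?E = V"
      using V(5) ptgf ptf by (auto simp: pre_def pU)
    have cmgf: "cm f ?E \<sigma> = s"
      using gf V(2) s by (simp add: mor_eq_def mor_comp_def mor_id_def \<sigma>_def rAt)
    have xE: "pt f x \<in> ?E"
      using V(5,6) ptgf ptf by (auto simp: pre_def)
    note \<sigma>' = \<sigma>[unfolded Spec_section_iff]
    obtain D a b where oD: "openin (topol (Spec A)) D" and D: "pt f x \<in> D" "D \<subseteq> ?E"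
      and ab: "\<forall>q\<in>D. b \<notin> q \<and> \<sigma> q = frac A (carrier A - q) a b"
      using bspec[OF \<sigma>'[THEN conjunct2] xE] by (elim exE conjE bexE) (rule that)
    have "rres (Spec A) ?E D \<sigma> = (\<lambda>q\<in>D. frac A (carrier A - q) a b)"
      unfolding Spec_rres_restrict by (rule restrict_ext) (use ab in simp)
    \<comment> \<open>Checked against the definition of sections of the spectrum: local fractions
      for \<open>\<sigma>\<close> remain local fractions after intersecting with
      \<open>D\<close>.\<close>
    moreover have "rres (Spec A) ?E D \<sigma> \<in> carrier (ring_at (Spec A) D)"
    proof -
      have "\<sigma> \<in> (\<Pi>\<^sub>E p\<in>?E. carrier (localization A (carrier A - p)))"
        and loc: "\<forall>p\<in>?E. \<exists>V. openin (topol (Spec A)) V \<and> p \<in> V \<and> V \<subseteq> ?E \<and>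
             (\<exists>a\<in>carrier A. \<exists>b\<in>carrier A. \<forall>q\<in>V. b \<notin> q \<and> \<sigma> q = frac A (carrier A - q) a b)"
        using \<sigma>' by (rule conjunct1, rule conjunct2)
      then have 1: "restrict \<sigma> D \<in> (\<Pi>\<^sub>E p\<in>D. carrier (localization A (carrier A - p)))"
        using D(2) by (auto simp: PiE_def Pi_def)
      have 2: "\<exists>V. openin (topol (Spec A)) V \<and> p \<in> V \<and> V \<subseteq> D \<and>
             (\<exists>a\<in>carrier A. \<exists>b\<in>carrier A. \<forall>q\<in>V. b \<notin> q \<and> restrict \<sigma> D q = frac A (carrier A - q) a b)" if p: "p \<in> D" for p
      proof -
        obtain V a b where V: "openin (topol (Spec A)) V" "p \<in> V" and "a \<in> carrier A" "b \<in> carrier A"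
            and q: "\<forall>q\<in>V. b \<notin> q \<and> \<sigma> q = frac A (carrier A - q) a b"
          using bspec[OF loc subsetD[OF D(2) p]] by (elim exE conjE bexE) (rule that)
        moreover have "\<forall>q\<in>V \<inter> D. b \<notin> q \<and> restrict \<sigma> D q = frac A (carrier A - q) a b"
          using q by simp
        ultimately have "\<exists>a\<in>carrier A. \<exists>b\<in>carrier A. \<forall>q\<in>V \<inter> D. b \<notin> q \<and> restrict \<sigma> D q = frac A (carrier A - q) a b"
          by (elim bexI[rotated])
        moreover have "openin (topol (Spec A)) (V \<inter> D)" "p \<in> V \<inter> D" "V \<inter> D \<subseteq> D"
          using V oD p by auto
        ultimately show ?thesis
          by (intro exI[of _ "V \<inter> D"] conjI)
      qed
      show ?thesis
        unfolding Spec_section_iff Spec_rres_restrict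
      proof (intro conjI ballI)
        show "restrict \<sigma> D \<in> (\<Pi>\<^sub>E p\<in>D. carrier (localization A (carrier A - p)))" by (fact 1)
      qed (fact 2)
    qed
    moreover have "z = rgerm X (nbhds X x) (pre ?X f D) (cm f D (rres (Spec A) ?E D \<sigma>))"
    proof -
      have "cm f D (rres (Spec A) ?E D \<sigma>) = rres X V (pre ?X f D) s"
        using lrs_mor_cm_rres[OF f oE oD D(2) \<sigma>] by (simp add: pE cmgf rAt)
      moreover have "pre ?X f D \<subseteq> V" using pre_mono[OF D(2), of ?X f] by (simp add: pE)
      ultimately show ?thesis
        using germ_res[OF X V(1) nb[OF oD D(1)] _ s] zs by simp
    qed
    ultimately show ?thesis
      unfolding P_def using oD D(1) by metis
  qed
  \<comment> \<open>Sections with the same numerator and denominator agree on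
    \<open>D \<inter> D'\<close>, so they have the same germ after transport along
    \<open>f\<close>.\<close>
  have uniq: "z = z'" if 1: "P z D a b" and 2: "P z' D' a b" for z z' D D' a b
  proof -
    let ?\<sigma> = "\<lambda>D. \<lambda>q\<in>D. frac A (carrier A - q) a b"
    have oD: "openin (topol (Spec A)) D" "openin (topol (Spec A)) D'" "openin (topol (Spec A)) (D \<inter> D')"
      and xD: "pt f x \<in> D" "pt f x \<in> D'" "pt f x \<in> D \<inter> D'"
      and \<sigma>: "?\<sigma> D \<in> carrier (ring_at (Spec A) D)" "?\<sigma> D' \<in> carrier (ring_at (Spec A) D')"
      using 1 2 by (auto simp: P_def)
    have r: "rres (Spec A) D (D \<inter> D') (?\<sigma> D) = ?\<sigma> (D \<inter> D')" "rres (Spec A) D' (D \<inter> D') (?\<sigma> D') = ?\<sigma> (D \<inter> D')"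
      by (auto simp: Spec_rres_restrict fun_eq_iff)
    have c: "cm f D (?\<sigma> D) \<in> carrier (ring_at X (pre ?X f D))" "cm f D' (?\<sigma> D') \<in> carrier (ring_at X (pre ?X f D'))"
      using lrs_mor_cm_closed[OF f oD(1) \<sigma>(1)] lrs_mor_cm_closed[OF f oD(2) \<sigma>(2)] by (simp_all add: rAt)
    have "z = rgerm X (nbhds X x) (pre ?X f (D \<inter> D')) (cm f (D \<inter> D') (?\<sigma> (D \<inter> D')))"
      using 1 lrs_mor_cm_rres[OF f oD(1,3) Int_lower1 \<sigma>(1)]
        germ_res[OF X nb[OF oD(1) xD(1)] nb[OF oD(3) xD(3)] pre_mono[OF Int_lower1] c(1)] by (simp add: P_def r rAt)
    moreover have "z' = rgerm X (nbhds X x) (pre ?X f (D \<inter> D')) (cm f (D \<inter> D') (?\<sigma> (D \<inter> D')))"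
      using 2 lrs_mor_cm_rres[OF f oD(2,3) Int_lower2 \<sigma>(2)]
        germ_res[OF X nb[OF oD(2) xD(2)] nb[OF oD(3) xD(3)] pre_mono[OF Int_lower2] c(2)] by (simp add: P_def r rAt)
    ultimately show ?thesis by simp
  qed
  define p where "p z = (SOME ab. \<exists>D. P z D (fst ab) (snd ab))" for z
  have p: "\<exists>D. P z D (fst (p z)) (snd (p z))" if z: "z \<in> carrier (stalk X x)" for z
  proof -
    obtain D a b where "P z D a b" using ex[OF z] by blast
    then have "\<exists>ab. \<exists>D. P z D (fst ab) (snd ab)" by (intro exI[of _ "(a, b)"] exI[of _ D]) simp
    from someI_ex[OF this] show ?thesis by (simp add: p_def)
  qed
  have "inj_on p (carrier (stalk X x))"
  proof (rule inj_onI)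
    fix z z' assume z: "z \<in> carrier (stalk X x)" "z' \<in> carrier (stalk X x)" "p z = p z'"
    obtain D where 1: "P z D (fst (p z)) (snd (p z))" using p[OF z(1)] by blast
    obtain D' where 2: "P z' D' (fst (p z')) (snd (p z'))" using p[OF z(2)] by blast
    show "z = z'" using uniq[OF 1 2[folded z(3)]] .
  qed
  then show ?thesis by blast
qed

text \<open>For infinite \<open>'r\<close> the pairs of \<open>stalk_pairs_inj\<close> are squeezed
  into \<open>'r\<close> by a bijection between \<open>'r \<times> 'r\<close> and \<open>'r\<close>.
  Such a bijection need not exist for finite \<open>'r\<close>, but then the stalk is finite and
  \<open>stalk_finite_inj\<close> applies.\<close>

lemma stalk_inj:
  fixes X :: "('p, 'r) ringed_space"
  assumes X: "is_scheme X" and x: "x \<in> points X"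
  shows "\<exists>j :: _ \<Rightarrow> 'r. inj_on j (carrier (stalk X x))"
proof -
  obtain U where U: "openin (topol X) U" "x \<in> U" "affine_scheme (open_restrict X U)"
    using X x by (auto simp: is_scheme_def)
  obtain p :: "_ \<Rightarrow> 'r \<times> 'r" where p: "inj_on p (carrier (stalk X x))"
    using stalk_pairs_inj[OF scheme_ringed[OF X] U(2,1,3)] by blast
  show ?thesis
  proof (cases "finite (UNIV :: 'r set)")
    case True
    then have "finite (UNIV :: ('r \<times> 'r) set)"
      by (simp add: finite_prod)
    then have "finite (carrier (stalk X x))"
      by (intro finite_imageD[OF _ p]) (rule finite_subset[OF subset_UNIV])
    then show ?thesis
      by (rule stalk_finite_inj[OF scheme_ringed[OF X] x])
  next
    case False
    obtain q :: "'r \<times> 'r \<Rightarrow> 'r" where "bij_betw q (UNIV \<times> UNIV) UNIV"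
      using card_of_Times_same_infinite[OF False] unfolding card_of_ordIso[symmetric] by (elim exE)
    then have "inj q"
      by (simp add: bij_betw_def)
    then have "inj_on (q \<circ> p) (carrier (stalk X x))"
      by (rule comp_inj_on[OF p inj_on_subset[OF _ subset_UNIV]])
    then show ?thesis by blast
  qed
qed

section \<open>Cartesian squares over open immersions\<close>

text \<open>A cartesian square is only tested against schemes over the types \<open>'p\<close> and \<open>'r\<close>, so the residue
  field is transported along an injection \<open>j\<close> into \<open>'r\<close>.\<close>

locale residue_point =
  fixes B :: "('p, 'r) ringed_space" and x :: 'p and J and j :: "('p set \<times> 'r) set set \<Rightarrow> 'r"
  assumes B: "locally_ringed B" and x: "x \<in> points B" and J: "maximalideal J (stalk B x)"
    and j: "inj_on j (carrier (stalk B x Quot J))"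
begin

definition K :: "'r ring" where "K = image_ring j (stalk B x Quot J)"

definition val :: "('p set \<times> 'r) set \<Rightarrow> 'r" where "val z = j (J +>\<^bsub>stalk B x\<^esub> z)"

lemma rB: "ringed B" using B by (simp add: locally_ringed_def)

sublocale S: cring "stalk B x" by (rule stalk_cring[OF B x])

sublocale J: maximalideal J "stalk B x" by (rule J)

lemma K_field: "field K"
  unfolding K_def by (rule field.inj_imp_image_ring_is_field[OF J.quotient_is_field[OF S.cring_axioms] j])

sublocale one_point K x
  by (intro one_point.intro K_field)

lemma val_hom: "val \<in> ring_hom (stalk B x) K"
proof -
  have "j \<in> ring_hom (stalk B x Quot J) K"
    using inj_imp_image_ring_iso[OF j] by (simp add: K_def ring_iso_def)
  from ring_hom_trans[OF J.rcos_ring_hom this] show ?thesis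
    by (simp add: val_def[abs_def] o_def)
qed

lemma val_zero: assumes "z \<in> J" shows "val z = \<zero>\<^bsub>K\<^esub>"
proof -
  have "J +>\<^bsub>stalk B x\<^esub> z = J"
    by (rule S.a_coset_join2[OF J.Icarr[OF assms] J.a_subgroup assms])
  moreover have "\<zero>\<^bsub>K\<^esub> = j J"
    by (simp add: K_def image_ring_def image_group_def monoid.defs FactRing_def)
  ultimately show ?thesis by (simp add: val_def)
qed

text \<open>A map \<open>g : B \<rightarrow> C\<close> that is only required to be defined on sections near \<open>pt g x\<close>, composed with
  the inclusion of the residue field.\<close>

definition at_point :: "('p, 'q, 'r, 's) mor \<Rightarrow> ('p, 'q, 'r, 's) mor" where
  "at_point g = \<lparr>pt = (\<lambda>_. pt g x),
     cm = (\<lambda>V r. if pt g x \<in> V then val (rgerm B (nbhds B x) (pre B g V) (cm g V r)) else \<zero>\<^bsub>K\<^esub>)\<rparr>"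

lemma pre_at_point: "pre T (at_point g) V = (if pt g x \<in> V then {x} else {})"
  by (auto simp: pre_def at_point_def T_points)

lemma zring_hom: "(\<lambda>r. \<zero>\<^bsub>K\<^esub>) \<in> ring_hom R (zring K)"
  by (auto simp: ring_hom_def zring_simps)

text \<open>All conditions on \<open>g\<close> concern opens around \<open>pt g x\<close>. Hence a
  map from \<open>B\<close> to \<open>C\<close> can be used with an open subscheme \<open>A\<close>
  of \<open>C\<close> as the target, although it need not map all of \<open>B\<close> into
  \<open>A\<close>. Over the remaining opens the preimage in \<open>T\<close> is empty and the ring
  is zero.\<close>

lemma at_point_mor:
  fixes A :: "('q, 's) ringed_space"
  assumes A: "ringed A" and y: "pt g x \<in> points A"
    and nb: "\<And>V. openin (topol A) V \<Longrightarrow> pt g x \<in> V \<Longrightarrow> pre B g V \<in> nbhds B x"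
    and hom: "\<And>V. openin (topol A) V \<Longrightarrow> pt g x \<in> V \<Longrightarrow> cm g V \<in> ring_hom (ring_at A V) (ring_at B (pre B g V))"
    and res: "\<And>V W s. openin (topol A) V \<Longrightarrow> openin (topol A) W \<Longrightarrow> W \<subseteq> V \<Longrightarrow> pt g x \<in> W \<Longrightarrow> s \<in> carrier (ring_at A V) \<Longrightarrow>
       cm g W (rres A V W s) = rres B (pre B g V) (pre B g W) (cm g V s)"
    and loc: "\<And>\<mm> V s. maximalideal \<mm> (stalk A (pt g x)) \<Longrightarrow> openin (topol A) V \<Longrightarrow> pt g x \<in> V \<Longrightarrow>
       s \<in> carrier (ring_at A V) \<Longrightarrow> rgerm A (nbhds A (pt g x)) V s \<in> \<mm> \<Longrightarrow>
       rgerm B (nbhds B x) (pre B g V) (cm g V s) \<in> J"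
  shows "lrs_mor T A (at_point g)"
proof -
  let ?u = "at_point g"
  have chom: "cm ?u V \<in> ring_hom (ring_at A V) (ring_at T (pre T ?u V))" if V: "openin (topol A) V" for V
  proof (cases "pt g x \<in> V")
    case True
    have "(val \<circ> rgerm B (nbhds B x) (pre B g V)) \<circ> cm g V \<in> ring_hom (ring_at A V) K"
      by (rule ring_hom_trans[OF hom[OF V True] ring_hom_trans[OF stalk_hom[OF rB nb[OF V True]] val_hom]])
    moreover have "cm ?u V = (val \<circ> rgerm B (nbhds B x) (pre B g V)) \<circ> cm g V"
      by (auto simp: at_point_def True)
    ultimately show ?thesis
      by (simp only: pre_at_point True if_True T_ring(1))
  next
    case False
    then have "cm ?u V = (\<lambda>r. \<zero>\<^bsub>K\<^esub>)" by (auto simp: at_point_def)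
    then show ?thesis
      using False by (simp only: pre_at_point if_False T_ring(2) zring_hom)
  qed
  have cres: "cm ?u W (rres A V W s) = rres T (pre T ?u V) (pre T ?u W) (cm ?u V s)"
    if V: "openin (topol A) V" and W: "openin (topol A) W" and sub: "W \<subseteq> V" and s: "s \<in> carrier (ring_at A V)" for V W s
  proof (cases "pt g x \<in> W")
    case True
    then have V': "pt g x \<in> V" using sub by blast
    have "rgerm B (nbhds B x) (pre B g W) (rres B (pre B g V) (pre B g W) (cm g V s)) =
        rgerm B (nbhds B x) (pre B g V) (cm g V s)"
      by (rule germ_res[OF rB nb[OF V V'] nb[OF W True] pre_mono[OF sub] ring_hom_closed[OF hom[OF V V'] s]])
    then show ?thesis
      using True V' by (simp add: pre_at_point T_rres res[OF V W sub True s]) (simp add: at_point_def res[OF V W sub True s])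
  next
    case False
    then show ?thesis
      by (simp add: pre_at_point T_rres) (simp add: at_point_def)
  qed
  have cloc: "stalk_map T ?u w ` \<mm> \<subseteq> \<nn>"
    if w: "w \<in> points T" and m: "maximalideal \<mm> (stalk A (pt ?u w))" and n: "maximalideal \<nn> (stalk T w)" for w \<mm> \<nn>
  proof
    fix v assume "v \<in> stalk_map T ?u w ` \<mm>"
    then obtain z where z: "z \<in> \<mm>" "v = stalk_map T ?u w z" by blast
    have wx: "w = x" using w T_points by simp
    have pw: "pt ?u w = pt g x" by (simp add: at_point_def)
    interpret m: maximalideal \<mm> "stalk A (pt g x)" using m pw by simp
    obtain V s where Vs: "V \<in> nbhds A (pt g x)" "s \<in> carrier (ring_at A V)" "z = rgerm A (nbhds A (pt g x)) V s"
      using lim_ring_germ[OF m.Icarr[OF z(1)]] by blast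
    have V: "openin (topol A) V" "pt g x \<in> V" using Vs(1) by (auto simp: nbhds_iff)
    have c0: "cm ?u V s = \<zero>\<^bsub>K\<^esub>"
      using val_zero[OF loc[OF m.is_maximalideal V Vs(2)]] z(1) Vs(3) V(2) by (simp add: at_point_def)
    have "v = lim_map (\<lambda>V s. rgerm T (nbhds T x) (pre T ?u V) (cm ?u V s)) (rgerm A (nbhds A (pt g x)) V s)"
      using z(2) Vs(3) by (simp add: stalk_map_def wx)
    also have "\<dots> = rgerm T (nbhds T x) (pre T ?u V) (cm ?u V s)"
    proof (rule direct_sys.lim_map_gm[OF direct_sys_nbhds[OF A] Vs(1,2)])
      fix V W t assume h: "V \<in> nbhds A (pt g x)" "W \<in> nbhds A (pt g x)" "W \<subseteq> V" "t \<in> carrier (ring_at A V)"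
      then have "cm ?u W (rres A V W t) = cm ?u V t"
        using cres[of V W t] by (simp add: nbhds_iff pre_at_point T_rres)
      then show "rgerm T (nbhds T x) (pre T ?u W) (cm ?u W (rres A V W t)) = rgerm T (nbhds T x) (pre T ?u V) (cm ?u V t)"
        using h by (simp add: nbhds_iff pre_at_point)
    qed
    also have "\<dots> = \<zero>\<^bsub>stalk T x\<^esub>"
      using V(2) by (simp add: c0 pre_at_point T_stalk)
    finally have "v = \<zero>\<^bsub>stalk T x\<^esub>" .
    moreover have "\<nn> = {\<zero>\<^bsub>stalk T x\<^esub>}"
      using field_maximalideal[OF T_stalk(1)] n wx by simp
    ultimately show "v \<in> \<nn>" by simp
  qed
  have "continuous_map (topol T) (topol A) (pt ?u)"
    using y by (simp add: at_point_def)
  then show ?thesis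
    unfolding lrs_mor_def using chom cres cloc by (intro conjI ballI allI impI) (simp_all only: mem_Collect_eq)
qed

end

text \<open>The spectrum of the residue field at \<open>x\<close> maps to \<open>B\<close>, and also
  to \<open>A\<close> because \<open>pt g x\<close> lies in \<open>a\<close>. The two maps agree in
  \<open>C\<close>, so the square produces a map to \<open>P\<close>; as \<open>q\<close> is the
  identity on points, the image of the only point is \<open>x\<close>.\<close>

theorem cartesian_square_open:
  fixes A B C P :: "('p, 'r) ringed_space"
  assumes A: "is_scheme A" and B: "is_scheme B" and C: "is_scheme C" and P: "ringed P"
    and a: "openin (topol C) a" and AC: "A = open_restrict C a"
    and f: "lrs_mor A C \<lparr>pt = (\<lambda>x. x), cm = (\<lambda>V. rres C V (a \<inter> V))\<rparr>" and g: "lrs_mor B C g"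
    and q: "pt q = (\<lambda>x. x)"
    and sq: "cartesian_square P A B C p q \<lparr>pt = (\<lambda>x. x), cm = (\<lambda>V. rres C V (a \<inter> V))\<rparr> g"
    and px: "x \<in> points B" "pt g x \<in> a"
  shows "x \<in> points P"
proof -
  let ?f = "\<lparr>pt = (\<lambda>x. x), cm = (\<lambda>V. rres C V (a \<inter> V))\<rparr>"
  have lB: "locally_ringed B" and lA: "locally_ringed A" and lC: "locally_ringed C"
    using A B C by (simp_all add: is_scheme_def)
  have rA: "ringed A" and rB: "ringed B" and rC: "ringed C"
    using A B C by (simp_all add: scheme_ringed)
  have aC: "a \<subseteq> points C" using a openin_subset by blast
  have pA: "points A = a" using aC by (auto simp: AC open_restrict_def)
  have opA: "openin (topol A) W \<longleftrightarrow> openin (topol C) W \<and> W \<subseteq> a" for W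
    using a by (auto simp: AC open_restrict_def openin_open_subtopology)
  have rAt: "ring_at A = ring_at C" "rres A = rres C" by (simp_all add: AC open_restrict_def)
  obtain J where J: "maximalideal J (stalk B x)"
    using lB px(1) by (auto simp: locally_ringed_def local_ring_def)
  obtain i :: "_ \<Rightarrow> 'r" where i: "inj_on i (carrier (stalk B x))"
    using stalk_inj[OF B px(1)] by blast
  interpret S: cring "stalk B x" by (rule stalk_cring[OF lB px(1)])
  interpret J: maximalideal J "stalk B x" by fact
  \<comment> \<open>The stalk is embedded in \<open>'r\<close>, but the residue field is a quotient
    of it. A choice of coset representatives turns the one embedding into the other.\<close>
  let ?rep = "\<lambda>D. SOME z. z \<in> carrier (stalk B x) \<and> D = J +>\<^bsub>stalk B x\<^esub> z"
  have rep: "?rep D \<in> carrier (stalk B x) \<and> D = J +>\<^bsub>stalk B x\<^esub> ?rep D" if "D \<in> carrier (stalk B x Quot J)" for D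
  proof -
    have "\<exists>z. z \<in> carrier (stalk B x) \<and> D = J +>\<^bsub>stalk B x\<^esub> z"
      using that by (auto simp: FactRing_def A_RCOSETS_def RCOSETS_def a_r_coset_def)
    from someI_ex[OF this] show ?thesis .
  qed
  have "inj_on (\<lambda>D. i (?rep D)) (carrier (stalk B x Quot J))"
  proof (rule inj_onI)
    fix D D' assume D: "D \<in> carrier (stalk B x Quot J)" "D' \<in> carrier (stalk B x Quot J)" "i (?rep D) = i (?rep D')"
    then have "?rep D = ?rep D'"
      using inj_onD[OF i] rep by blast
    then show "D = D'" using rep[OF D(1)] rep[OF D(2)] by metis
  qed
  then interpret residue_point B x J "\<lambda>D. i (?rep D)"
    by (intro residue_point.intro lB px(1) J)
  let ?idB = "mor_id :: ('p, 'p, 'r, 'r) mor"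
  have pid: "pre B ?idB V = V" if "openin (topol B) V" for V
    using openin_subset[OF that] by (auto simp: pre_def mor_id_def)
  have yC: "pt g x \<in> points C" using px(2) aC by blast
  have v: "lrs_mor T B (at_point ?idB)"
  proof (rule at_point_mor[OF rB])
    fix V assume V: "openin (topol B) V" "pt ?idB x \<in> V"
    show "pre B ?idB V \<in> nbhds B x"
      using V by (simp add: pid nbhds_iff) (simp add: mor_id_def)
    show "cm ?idB V \<in> ring_hom (ring_at B V) (ring_at B (pre B ?idB V))"
      using V by (simp add: pid) (simp add: mor_id_def ring_hom_def)
  next
    \<comment> \<open>For the identity, locality is the uniqueness of the maximal ideal of
      \<open>stalk B x\<close>.\<close>
    fix \<mm> V s assume h: "maximalideal \<mm> (stalk B (pt ?idB x))" "openin (topol B) V" "rgerm B (nbhds B (pt ?idB x)) V s \<in> \<mm>"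
    have "\<mm> = J"
      using stalk_max_unique[OF lB px(1) _ J] h(1) by (simp add: mor_id_def)
    then show "rgerm B (nbhds B x) (pre B ?idB V) (cm ?idB V s) \<in> J"
      using h(2,3) by (simp add: pid) (simp add: mor_id_def)
  next
    fix V W s assume h: "openin (topol B) V" "openin (topol B) W" "W \<subseteq> V"
    then show "cm ?idB W (rres B V W s) = rres B (pre B ?idB V) (pre B ?idB W) (cm ?idB V s)"
      by (simp add: pid) (simp add: mor_id_def)
  qed (simp add: mor_id_def px)
  have u: "lrs_mor T A (at_point g)"
  proof (rule at_point_mor[OF rA])
    fix V assume "openin (topol A) V" "pt g x \<in> V"
    then have V: "openin (topol C) V" "pt g x \<in> V" by (simp_all add: opA)
    show "pre B g V \<in> nbhds B x"
      using lrs_mor_openin_pre[OF g V(1)] V px(1) by (simp add: nbhds_iff pre_def)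
    show "cm g V \<in> ring_hom (ring_at A V) (ring_at B (pre B g V))"
      using lrs_mor_cm_hom[OF g V(1)] by (simp add: rAt)
  next
    fix V W s assume "openin (topol A) V" "openin (topol A) W" "W \<subseteq> V" "s \<in> carrier (ring_at A V)"
    then show "cm g W (rres A V W s) = rres B (pre B g V) (pre B g W) (cm g V s)"
      using lrs_mor_cm_rres[OF g] by (simp add: opA rAt)
  next
    fix \<mm> V s assume m: "maximalideal \<mm> (stalk A (pt g x))" and "openin (topol A) V" and V: "pt g x \<in> V"
      and "s \<in> carrier (ring_at A V)" and gm: "rgerm A (nbhds A (pt g x)) V s \<in> \<mm>"
    then have oV: "openin (topol C) V" "V \<subseteq> a" and s: "s \<in> carrier (ring_at C V)"
      by (simp_all add: opA rAt)
    obtain J' where J': "maximalideal J' (stalk C (pt g x))"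
      using lC yC by (auto simp: locally_ringed_def local_ring_def)
    \<comment> \<open>\<open>g\<close> is local as a map to \<open>C\<close>, while the germ at hand
      lies in the maximal ideal of the stalk of \<open>A\<close>. Reflecting it through the open
      immersion bridges the two.\<close>
    have "rgerm C (nbhds C (pt g x)) V s \<in> J'"
      by (rule open_immersion_reflects_max[OF lA lC a AC f px(2) J' m oV V s gm])
    then have "stalk_map B g x (rgerm C (nbhds C (pt g x)) V s) \<in> J"
      by (rule lrs_mor_max[OF g px(1) J' J])
    then show "rgerm B (nbhds B x) (pre B g V) (cm g V s) \<in> J"
      using stalk_map_germ[OF rB rC g px(1) _ s] V oV by (simp add: nbhds_iff)
  qed (simp add: pA px)
  have "mor_eq T C (mor_comp A ?f (at_point g)) (mor_comp B g (at_point ?idB))"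
    unfolding mor_eq_def
  proof (intro conjI ballI)
    show "pt (mor_comp A ?f (at_point g)) w = pt (mor_comp B g (at_point ?idB)) w" for w
      by (simp add: mor_comp_def at_point_def mor_id_def)
    fix V s assume "V \<in> opens C" and s: "s \<in> carrier (ring_at C V)"
    then have V: "openin (topol C) V" by simp
    have oV: "openin (topol C) (a \<inter> V)" using a V by blast
    have pf: "pre A ?f V = a \<inter> V" by (auto simp: pre_def pA)
    have og: "openin (topol B) (pre B g V)" by (rule lrs_mor_openin_pre[OF g V])
    show "cm (mor_comp A ?f (at_point g)) V s = cm (mor_comp B g (at_point ?idB)) V s"
    proof (cases "pt g x \<in> V")
      case True
      have n: "pre B g V \<in> nbhds B x" "pre B g (a \<inter> V) \<in> nbhds B x"
        using lrs_mor_openin_pre[OF g V] lrs_mor_openin_pre[OF g oV] True px by (auto simp: nbhds_iff pre_def)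
      \<comment> \<open>One composite restricts to \<open>a \<inter> V\<close> first and the other
        does not. The germs at \<open>x\<close> agree because \<open>pt g x\<close> lies in
        \<open>a\<close>.\<close>
      have "rgerm B (nbhds B x) (pre B g (a \<inter> V)) (cm g (a \<inter> V) (rres C V (a \<inter> V) s)) =
          rgerm B (nbhds B x) (pre B g V) (cm g V s)"
        unfolding lrs_mor_cm_rres[OF g V oV Int_lower2 s]
        by (rule germ_res[OF rB n pre_mono[OF Int_lower2] lrs_mor_cm_closed[OF g V s]])
      moreover have "x \<in> pre B g V" using True px by (simp add: pre_def)
      ultimately show ?thesis
        using True px(2) og by (simp add: mor_comp_def at_point_def pf pid) (simp add: mor_id_def)
    next
      case False
      then have "x \<notin> pre B g V" by (simp add: pre_def)
      then show ?thesis
        using False by (simp add: mor_comp_def at_point_def pf) (simp add: mor_id_def)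
    qed
  qed
  then obtain w where w: "lrs_mor T P w" "mor_eq T B (mor_comp P q w) (at_point ?idB)"
    using sq T_scheme u v unfolding cartesian_square_def by blast
  have xT: "x \<in> points T" by (simp add: T_points)
  have "pt w x = x"
    using w(2) xT by (simp add: mor_eq_def mor_comp_def at_point_def q mor_id_def)
  then show ?thesis
    using lrs_mor_points[OF w(1) xT] by simp
qed

section \<open>The canonical map made explicit\<close>

locale hom_gamma = two_open I X U V + hom_modules I X M N
  for I :: "('i, 'f) cat" and X :: "('i, 'f, 'p, 'r) diagram" and U V :: "('i, 'f, 'p, 'r) diagram"
    and M :: "('i, 'f, 'p, 'r, 'm) dmod" and N :: "('i, 'f, 'p, 'r, 'n) dmod"
begin

abbreviation S where "S \<equiv> \<Gamma> (sheaf_Hom I X M N)"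

abbreviation T where "T \<equiv> sheaf_Hom I X M (\<Gamma> N)"

sublocale GN: dia_module I X "\<Gamma> N"
  by unfold_locales (rule Gamma_Modules[OF N.mod])

sublocale HG: hom_modules I X M "\<Gamma> N" ..

definition Hx :: "'i \<Rightarrow> 'p set \<Rightarrow> ('f \<Rightarrow> 'p set \<Rightarrow> 'm \<Rightarrow> 'n) \<Rightarrow> 'f \<Rightarrow> 'p set \<Rightarrow> 'm \<Rightarrow> 'n" where
  "Hx i W \<eta> = hom_of M i W (\<lambda>\<phi> W' s. \<eta> \<phi> (P (tgt I \<phi>) \<inter> W') (sres (fib M (tgt I \<phi>)) W' (P (tgt I \<phi>) \<inter> W') s))"

lemma PW: "i \<in> Ob I \<Longrightarrow> op i W \<Longrightarrow> op i (P i \<inter> W)" and QW: "i \<in> Ob I \<Longrightarrow> op i W \<Longrightarrow> op i (Q i \<inter> (P i \<inter> W))"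
  using P_op Q_op by (simp_all add: openin_Int)

lemma GN_carrier:
  "i \<in> Ob I \<Longrightarrow> op i W \<Longrightarrow> n \<in> carrier (dsec (\<Gamma> N) i W) \<longleftrightarrow> n \<in> carrier (dsec N i (P i \<inter> W)) \<and>
     sres (fib N i) (P i \<inter> W) (Q i \<inter> (P i \<inter> W)) n = \<zero>\<^bsub>dsec N i (Q i \<inter> (P i \<inter> W))\<^esub>"
  by (simp add: Gamma_carrier)

lemma sr_GN:
  "\<psi> \<in> out I j \<Longrightarrow> op j W \<Longrightarrow> W' \<in> below I X \<psi> W \<Longrightarrow> s \<in> carrier (dsec N j (P j \<inter> W)) \<Longrightarrow>
   site_res I X (\<Gamma> N) \<psi> W W' s = N.sr \<psi> (P j \<inter> W) (P (tgt I \<psi>) \<inter> W') s"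
  unfolding Gamma_simps by (rule site_res_push_restr[OF N.mod])

text \<open>\<open>Gamma_carrier\<close> for the sheaf Hom asks that a restricted family be equal to
  the zero family. Both are in normal form, so the equality can be read off value by value.\<close>

lemma S_iff:
  assumes i: "i \<in> Ob I" and W: "op i W"
  shows "\<eta> \<in> carrier (dsec S i W) \<longleftrightarrow> \<eta> \<in> hom_sections I X M N i (P i \<inter> W) \<and>
     (\<forall>\<phi>\<in>out I i. \<forall>W'\<in>below I X \<phi> (Q i \<inter> (P i \<inter> W)). \<forall>s\<in>carrier (dsec M (tgt I \<phi>) W').
        \<eta> \<phi> W' s = \<zero>\<^bsub>dsec N (tgt I \<phi>) W'\<^esub>)"
proof -
  have eq: "hom_of M i W1 \<eta> = hom_of M i W1 \<theta> \<longleftrightarrow>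
     (\<forall>\<phi>\<in>out I i. \<forall>W'\<in>below I X \<phi> W1. \<forall>s\<in>carrier (dsec M (tgt I \<phi>) W'). \<eta> \<phi> W' s = \<theta> \<phi> W' s)"
    for W1 and \<eta> \<theta> :: "'f \<Rightarrow> 'p set \<Rightarrow> 'm \<Rightarrow> 'n"
  proof
    assume e: "hom_of M i W1 \<eta> = hom_of M i W1 \<theta>"
    show "\<forall>\<phi>\<in>out I i. \<forall>W'\<in>below I X \<phi> W1. \<forall>s\<in>carrier (dsec M (tgt I \<phi>) W'). \<eta> \<phi> W' s = \<theta> \<phi> W' s"
    proof (intro ballI)
      fix \<phi> W' s assume a: "\<phi> \<in> out I i" "W' \<in> below I X \<phi> W1" "s \<in> carrier (dsec M (tgt I \<phi>) W')"
      show "\<eta> \<phi> W' s = \<theta> \<phi> W' s"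
        using fun_cong[OF fun_cong[OF fun_cong[OF e]], of \<phi> W' s] by (simp only: hom_of_app[OF a])
    qed
  qed (rule hom_of_cong, blast)
  show ?thesis
    unfolding Gamma_carrier[OF i W] mem_Collect_eq sheaf_Hom_simps
    by (rule conj_cong[OF refl]) (simp only: hom_restrict[OF _ Int_lower2] eq)
qed

lemma below_PW: "\<phi> \<in> out I i \<Longrightarrow> W' \<in> below I X \<phi> W \<Longrightarrow> op (tgt I \<phi>) (P (tgt I \<phi>) \<inter> W')"
  by (rule below_op[OF below_P])

lemma below_QW:
  assumes "\<phi> \<in> out I i" "W' \<in> below I X \<phi> W"
  shows "Q (tgt I \<phi>) \<inter> (P (tgt I \<phi>) \<inter> W') \<in> below I X \<phi> (Q i \<inter> (P i \<inter> W))"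
  using below_P[OF assms] Q_pb[OF assms(1)] Q_op[OF out_tgt[OF assms(1)]] by (auto simp: below_iff pb_Int)

lemma M_res: "\<phi> \<in> out I i \<Longrightarrow> W' \<in> below I X \<phi> W \<Longrightarrow> s \<in> carrier (dsec M (tgt I \<phi>) W') \<Longrightarrow>
    sres (fib M (tgt I \<phi>)) W' (P (tgt I \<phi>) \<inter> W') s \<in> carrier (dsec M (tgt I \<phi>) (P (tgt I \<phi>) \<inter> W'))"
  by (rule sres_closed[OF M.fib_smod]) (simp_all add: out_tgt below_op below_PW)

lemma shifted_linear:
  assumes \<eta>: "\<eta> \<in> hom_sections I X M N i (P i \<inter> W)" and \<phi>: "\<phi> \<in> out I i" and W': "W' \<in> below I X \<phi> W"
    and s: "s \<in> carrier (dsec M (tgt I \<phi>) W')"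
  defines "h \<equiv> \<lambda>s. \<eta> \<phi> (P (tgt I \<phi>) \<inter> W') (sres (fib M (tgt I \<phi>)) W' (P (tgt I \<phi>) \<inter> W') s)"
  shows "h s \<in> carrier (dsec N (tgt I \<phi>) (P (tgt I \<phi>) \<inter> W'))"
    and "t \<in> carrier (dsec M (tgt I \<phi>) W') \<Longrightarrow> h (s \<oplus>\<^bsub>dsec M (tgt I \<phi>) W'\<^esub> t) = h s \<oplus>\<^bsub>dsec N (tgt I \<phi>) (P (tgt I \<phi>) \<inter> W')\<^esub> h t"
    and "r \<in> carrier (ring_at (sp X (tgt I \<phi>)) W') \<Longrightarrow>
      h (r \<odot>\<^bsub>dsec M (tgt I \<phi>) W'\<^esub> s) = rres (sp X (tgt I \<phi>)) W' (P (tgt I \<phi>) \<inter> W') r \<odot>\<^bsub>dsec N (tgt I \<phi>) (P (tgt I \<phi>) \<inter> W')\<^esub> h s"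
proof -
  note j = out_tgt[OF \<phi>] and oW' = below_op[OF W'] and oPW' = below_PW[OF \<phi> W']
  note l = hom_sectionsD(2)[OF \<eta> \<phi> below_P[OF \<phi> W']]
  note f = M.fib_smod[OF j]
  show "h s \<in> carrier (dsec N (tgt I \<phi>) (P (tgt I \<phi>) \<inter> W'))"
    unfolding h_def by (rule linear_map_closed[OF l M_res[OF \<phi> W' s]])
  show "t \<in> carrier (dsec M (tgt I \<phi>) W') \<Longrightarrow> h (s \<oplus>\<^bsub>dsec M (tgt I \<phi>) W'\<^esub> t) = h s \<oplus>\<^bsub>dsec N (tgt I \<phi>) (P (tgt I \<phi>) \<inter> W')\<^esub> h t"
    unfolding h_def by (simp only: sres_add[OF f oW' oPW' Int_lower2 s] linear_map_add[OF l M_res[OF \<phi> W' s] M_res[OF \<phi> W']])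
  show "r \<in> carrier (ring_at (sp X (tgt I \<phi>)) W') \<Longrightarrow>
      h (r \<odot>\<^bsub>dsec M (tgt I \<phi>) W'\<^esub> s) = rres (sp X (tgt I \<phi>)) W' (P (tgt I \<phi>) \<inter> W') r \<odot>\<^bsub>dsec N (tgt I \<phi>) (P (tgt I \<phi>) \<inter> W')\<^esub> h s"
    unfolding h_def
    by (simp only: sres_smult[OF f oW' oPW' Int_lower2 _ s] linear_map_smult[OF l _ M_res[OF \<phi> W' s]]
        rres_closed[OF sp_ringed[OF j] oW' oPW' Int_lower2])
qed

text \<open>The trace of \<open>U\<close> at the target of \<open>\<psi>\<close> lies over the trace
  at the target of \<open>\<phi>\<close>. Hence a section may be cut down to \<open>P\<close> before
  or after it is moved along \<open>\<psi>\<close>, and the compatibility of \<open>\<eta>\<close>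
  applies to the section cut down first.\<close>

lemma shifted_compat:
  assumes \<eta>: "\<eta> \<in> hom_sections I X M N i (P i \<inter> W)" and \<phi>: "\<phi> \<in> out I i" and W': "W' \<in> below I X \<phi> W"
    and \<psi>: "\<psi> \<in> out I (tgt I \<phi>)" and W'': "W'' \<in> below I X \<psi> W'" and s: "s \<in> carrier (dsec M (tgt I \<phi>) W')"
  shows "\<eta> (cmp I \<psi> \<phi>) (P (tgt I \<psi>) \<inter> W'') (sres (fib M (tgt I \<psi>)) W'' (P (tgt I \<psi>) \<inter> W'') (M.sr \<psi> W' W'' s)) =
    N.sr \<psi> (P (tgt I \<phi>) \<inter> W') (P (tgt I \<psi>) \<inter> W'') (\<eta> \<phi> (P (tgt I \<phi>) \<inter> W') (sres (fib M (tgt I \<phi>)) W' (P (tgt I \<phi>) \<inter> W') s))"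
proof -
  note oW' = below_op[OF W'] and oPW' = below_PW[OF \<phi> W']
  note bP = below_P[OF \<psi> W'']
  have "sres (fib M (tgt I \<psi>)) W'' (P (tgt I \<psi>) \<inter> W'') (M.sr \<psi> W' W'' s) = M.sr \<psi> W' (P (tgt I \<psi>) \<inter> W'') s"
    by (rule M.sres_sr[OF \<psi> oW' W'' below_op[OF bP] Int_lower2 s])
  also have "\<dots> = M.sr \<psi> (P (tgt I \<phi>) \<inter> W') (P (tgt I \<psi>) \<inter> W'') (sres (fib M (tgt I \<phi>)) W' (P (tgt I \<phi>) \<inter> W') s)"
    by (rule M.sr_sres[OF \<psi> oW' oPW' Int_lower2 bP s, symmetric])
  finally show ?thesis
    by (simp only: hom_sectionsD(3)[OF \<eta> \<phi> below_P[OF \<phi> W'] \<psi> bP M_res[OF \<phi> W' s]])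
qed

lemma Hx_mem:
  assumes i: "i \<in> Ob I" and W: "op i W" and \<eta>: "\<eta> \<in> carrier (dsec S i W)"
  shows "Hx i W \<eta> \<in> hom_sections I X M (\<Gamma> N) i W"
  unfolding Hx_def
proof (rule M.hom_sectionsI')
  have \<eta>1: "\<eta> \<in> hom_sections I X M N i (P i \<inter> W)" and \<eta>2: "\<And>\<phi> W' s. \<phi> \<in> out I i \<Longrightarrow> W' \<in> below I X \<phi> (Q i \<inter> (P i \<inter> W)) \<Longrightarrow>
      s \<in> carrier (dsec M (tgt I \<phi>) W') \<Longrightarrow> \<eta> \<phi> W' s = \<zero>\<^bsub>dsec N (tgt I \<phi>) W'\<^esub>"
    using \<eta> S_iff[OF i W] by blast+
  fix \<phi> W' assume \<phi>: "\<phi> \<in> out I i" and W': "W' \<in> below I X \<phi> W"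
  note j = out_tgt[OF \<phi>] and oW' = below_op[OF W'] and oPW' = below_PW[OF \<phi> W']
  note lin = shifted_linear[OF \<eta>1 \<phi> W']
  show "linear_map (ring_at (sp X (tgt I \<phi>)) W') (dsec M (tgt I \<phi>) W') (dsec (\<Gamma> N) (tgt I \<phi>) W')
      (\<lambda>s. \<eta> \<phi> (P (tgt I \<phi>) \<inter> W') (sres (fib M (tgt I \<phi>)) W' (P (tgt I \<phi>) \<inter> W') s))"
  proof (rule linear_mapI)
    fix s assume s: "s \<in> carrier (dsec M (tgt I \<phi>) W')"
    have oQ: "op (tgt I \<phi>) (Q (tgt I \<phi>) \<inter> (P (tgt I \<phi>) \<inter> W'))" by (rule QW[OF j oW'])
    \<comment> \<open>The restriction to \<open>Q\<close> is moved inside \<open>\<eta>\<close>,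
      whose components over opens above \<open>Q i\<close> vanish by \<open>\<eta>2\<close>.\<close>
    have "sres (fib N (tgt I \<phi>)) (P (tgt I \<phi>) \<inter> W') (Q (tgt I \<phi>) \<inter> (P (tgt I \<phi>) \<inter> W'))
        (\<eta> \<phi> (P (tgt I \<phi>) \<inter> W') (sres (fib M (tgt I \<phi>)) W' (P (tgt I \<phi>) \<inter> W') s)) = \<zero>\<^bsub>dsec N (tgt I \<phi>) (Q (tgt I \<phi>) \<inter> (P (tgt I \<phi>) \<inter> W'))\<^esub>"
      unfolding hom_sres[OF \<eta>1 \<phi> below_P[OF \<phi> W'] oQ Int_lower2 M_res[OF \<phi> W' s], symmetric]
      by (rule \<eta>2[OF \<phi> below_QW[OF \<phi> W'] sres_closed[OF M.fib_smod[OF j] oPW' oQ Int_lower2 M_res[OF \<phi> W' s]]])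
    then show "\<eta> \<phi> (P (tgt I \<phi>) \<inter> W') (sres (fib M (tgt I \<phi>)) W' (P (tgt I \<phi>) \<inter> W') s) \<in> carrier (dsec (\<Gamma> N) (tgt I \<phi>) W')"
      using lin(1)[OF s] by (simp add: GN_carrier[OF j oW'])
  qed (simp_all only: Gamma_simps lin(2,3))
  fix \<psi> W'' s assume \<psi>: "\<psi> \<in> out I (tgt I \<phi>)" and W'': "W'' \<in> below I X \<psi> W'" and s: "s \<in> carrier (dsec M (tgt I \<phi>) W')"
  show "\<eta> (cmp I \<psi> \<phi>) (P (tgt I (cmp I \<psi> \<phi>)) \<inter> W'') (sres (fib M (tgt I (cmp I \<psi> \<phi>))) W'' (P (tgt I (cmp I \<psi> \<phi>)) \<inter> W'') (M.sr \<psi> W' W'' s)) =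
      site_res I X (\<Gamma> N) \<psi> W' W'' (\<eta> \<phi> (P (tgt I \<phi>) \<inter> W') (sres (fib M (tgt I \<phi>)) W' (P (tgt I \<phi>) \<inter> W') s))"
    unfolding sr_GN[OF \<psi> oW' W'' lin(1)[OF s]] tgt_cmp[OF \<phi> \<psi>] by (rule shifted_compat[OF \<eta>1 \<phi> W' \<psi> W'' s])
qed

section \<open>The operations of the source of the canonical map\<close>

lemma S_simps:
  "\<eta> \<oplus>\<^bsub>dsec S i W\<^esub> \<theta> = hom_of M i (P i \<inter> W) (\<lambda>\<phi> W' s. \<eta> \<phi> W' s \<oplus>\<^bsub>dsec N (tgt I \<phi>) W'\<^esub> \<theta> \<phi> W' s)"
  "r \<odot>\<^bsub>dsec S i W\<^esub> \<eta> = hom_of M i (P i \<inter> W) (\<lambda>\<phi> W' s. rsr \<phi> (P i \<inter> W) W' (rres (sp X i) W (P i \<inter> W) r) \<odot>\<^bsub>dsec N (tgt I \<phi>) W'\<^esub> \<eta> \<phi> W' s)"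
  by (simp_all add: Gamma_simps sheaf_Hom_simps)

lemma S_sres:
  assumes "\<eta> \<in> hom_sections I X M N i (P i \<inter> W)" "W1 \<subseteq> W"
  shows "sres (fib S i) W W1 \<eta> = hom_of M i (P i \<inter> W1) \<eta>"
  unfolding Gamma_simps sheaf_Hom_simps by (rule hom_restrict[OF assms(1)]) (use assms(2) in blast)

lemma S_trn:
  assumes \<eta>: "\<eta> \<in> hom_sections I X M N i (P i \<inter> W)" and \<phi>: "\<phi> \<in> out I i"
  shows "trn S \<phi> W \<eta> = hom_of M (tgt I \<phi>) (P (tgt I \<phi>) \<inter> pb \<phi> W) (\<lambda>\<psi>. \<eta> (cmp I \<psi> \<phi>))"
proof -
  have "trn S \<phi> W \<eta> = sres (fib (sheaf_Hom I X M N) (tgt I \<phi>)) (pb \<phi> (P i \<inter> W)) (P (tgt I \<phi>) \<inter> pb \<phi> W)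
      (hom_of M (tgt I \<phi>) (pb \<phi> (P i \<inter> W)) (\<lambda>\<psi>. \<eta> (cmp I \<psi> \<phi>)))"
    unfolding Gamma_simps push_restr_trn[OF \<phi>] sheaf_Hom_simps(6) hom_trn[OF \<eta> \<phi>] by (rule refl)
  also have "\<dots> = hom_of M (tgt I \<phi>) (P (tgt I \<phi>) \<inter> pb \<phi> W) (hom_of M (tgt I \<phi>) (pb \<phi> (P i \<inter> W)) (\<lambda>\<psi>. \<eta> (cmp I \<psi> \<phi>)))"
    unfolding sheaf_Hom_simps(5)
    by (rule hom_restrict[OF hom_trn_mem[OF \<eta> \<phi>]]) (use P_pb[OF \<phi>] in \<open>auto simp: pb_Int\<close>)
  also have "\<dots> = hom_of M (tgt I \<phi>) (P (tgt I \<phi>) \<inter> pb \<phi> W) (\<lambda>\<psi>. \<eta> (cmp I \<psi> \<phi>))"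
  proof (rule hom_of_cong)
    fix \<psi> W' s assume a: "\<psi> \<in> out I (tgt I \<phi>)" "W' \<in> below I X \<psi> (P (tgt I \<phi>) \<inter> pb \<phi> W)" "s \<in> carrier (dsec M (tgt I \<psi>) W')"
    have "W' \<in> below I X \<psi> (pb \<phi> (P i \<inter> W))"
      by (rule below_mono[OF _ a(2)]) (use P_pb[OF \<phi>] in \<open>auto simp: pb_Int\<close>)
    then show "hom_of M (tgt I \<phi>) (pb \<phi> (P i \<inter> W)) (\<lambda>\<psi>. \<eta> (cmp I \<psi> \<phi>)) \<psi> W' s = \<eta> (cmp I \<psi> \<phi>) W' s"
      by (rule hom_of_app[OF a(1) _ a(3)])
  qed
  finally show ?thesis .
qed

text \<open>This and the three closure lemmas that follow for multiples, restrictions and transition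
  maps provide what \<open>bij_Mod_iso\<close> asks of the source.\<close>

lemma S_add_closed:
  assumes i: "i \<in> Ob I" and W: "op i W" and \<eta>: "\<eta> \<in> carrier (dsec S i W)" and \<theta>: "\<theta> \<in> carrier (dsec S i W)"
  shows "\<eta> \<oplus>\<^bsub>dsec S i W\<^esub> \<theta> \<in> carrier (dsec S i W)"
proof -
  have \<eta>': "\<eta> \<in> hom_sections I X M N i (P i \<inter> W)" "\<theta> \<in> hom_sections I X M N i (P i \<inter> W)"
    using \<eta> \<theta> S_iff[OF i W] by blast+
  have "(\<eta> \<oplus>\<^bsub>dsec S i W\<^esub> \<theta>) \<phi> W' s = \<zero>\<^bsub>dsec N (tgt I \<phi>) W'\<^esub>"
    if a: "\<phi> \<in> out I i" "W' \<in> below I X \<phi> (Q i \<inter> (P i \<inter> W))" "s \<in> carrier (dsec M (tgt I \<phi>) W')" for \<phi> W' s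
  proof -
    interpret G: abelian_group "dsec N (tgt I \<phi>) W'" by (rule N.sec_group[OF out_tgt[OF a(1)] below_op[OF a(2)]])
    have b: "W' \<in> below I X \<phi> (P i \<inter> W)" by (rule below_mono[OF Int_lower2 a(2)])
    have "\<eta> \<phi> W' s = \<zero>\<^bsub>dsec N (tgt I \<phi>) W'\<^esub>" "\<theta> \<phi> W' s = \<zero>\<^bsub>dsec N (tgt I \<phi>) W'\<^esub>"
      using \<eta> \<theta> S_iff[OF i W] a by blast+
    then show ?thesis
      unfolding S_simps hom_of_app[OF a(1) b a(3)] by simp
  qed
  then show ?thesis
    using hom_add_mem[OF \<eta>'] unfolding S_iff[OF i W] S_simps by blast
qed

lemma S_smult_closed:
  assumes i: "i \<in> Ob I" and W: "op i W" and r: "r \<in> carrier (ring_at (sp X i) W)" and \<eta>: "\<eta> \<in> carrier (dsec S i W)"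
  shows "r \<odot>\<^bsub>dsec S i W\<^esub> \<eta> \<in> carrier (dsec S i W)"
proof -
  have \<eta>': "\<eta> \<in> hom_sections I X M N i (P i \<inter> W)"
    using \<eta> S_iff[OF i W] by blast
  have r': "rres (sp X i) W (P i \<inter> W) r \<in> carrier (ring_at (sp X i) (P i \<inter> W))"
    by (rule rres_closed[OF sp_ringed[OF i] W PW[OF i W] Int_lower2 r])
  have "(r \<odot>\<^bsub>dsec S i W\<^esub> \<eta>) \<phi> W' s = \<zero>\<^bsub>dsec N (tgt I \<phi>) W'\<^esub>"
    if a: "\<phi> \<in> out I i" "W' \<in> below I X \<phi> (Q i \<inter> (P i \<inter> W))" "s \<in> carrier (dsec M (tgt I \<phi>) W')" for \<phi> W' s
  proof -
    interpret G: module "ring_at (sp X (tgt I \<phi>)) W'" "dsec N (tgt I \<phi>) W'" by (rule N.sec_module[OF out_tgt[OF a(1)] below_op[OF a(2)]])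
    have b: "W' \<in> below I X \<phi> (P i \<inter> W)" by (rule below_mono[OF Int_lower2 a(2)])
    have "\<eta> \<phi> W' s = \<zero>\<^bsub>dsec N (tgt I \<phi>) W'\<^esub>"
      using \<eta> S_iff[OF i W] a by blast
    then show ?thesis
      unfolding S_simps hom_of_app[OF a(1) b a(3)] using rsr_closed[OF a(1) PW[OF i W] b r'] by simp
  qed
  then show ?thesis
    using hom_smult_mem[OF \<eta>' PW[OF i W] r'] unfolding S_iff[OF i W] S_simps by blast
qed

lemma S_sres_closed:
  assumes i: "i \<in> Ob I" and W: "op i W" and W1: "op i W1" "W1 \<subseteq> W" and \<eta>: "\<eta> \<in> carrier (dsec S i W)"
  shows "sres (fib S i) W W1 \<eta> \<in> carrier (dsec S i W1)"
proof -
  have \<eta>': "\<eta> \<in> hom_sections I X M N i (P i \<inter> W)"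
    using \<eta> S_iff[OF i W] by blast
  have PP: "P i \<inter> W1 \<subseteq> P i \<inter> W" and QQ: "Q i \<inter> (P i \<inter> W1) \<subseteq> Q i \<inter> (P i \<inter> W)" using W1 by auto
  have "hom_of M i (P i \<inter> W1) \<eta> \<phi> W' s = \<zero>\<^bsub>dsec N (tgt I \<phi>) W'\<^esub>"
    if a: "\<phi> \<in> out I i" "W' \<in> below I X \<phi> (Q i \<inter> (P i \<inter> W1))" "s \<in> carrier (dsec M (tgt I \<phi>) W')" for \<phi> W' s
    unfolding hom_of_app[OF a(1) below_mono[OF Int_lower2 a(2)] a(3)]
    using \<eta> S_iff[OF i W] a(1,3) below_mono[OF QQ a(2)] by blast
  then show ?thesis
    using hom_restrict_mem[OF \<eta>' PP] unfolding S_iff[OF i W1(1)] S_sres[OF \<eta>' W1(2)] by blast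
qed

lemma S_trn_closed:
  assumes \<phi>: "\<phi> \<in> out I i" and W: "op i W" and \<eta>: "\<eta> \<in> carrier (dsec S i W)"
  shows "trn S \<phi> W \<eta> \<in> carrier (dsec S (tgt I \<phi>) (pb \<phi> W))"
proof -
  note i = out_Ob[OF \<phi>] and j = out_tgt[OF \<phi>] and opb = pb_op[OF \<phi> W]
  have \<eta>': "\<eta> \<in> hom_sections I X M N i (P i \<inter> W)"
    using \<eta> S_iff[OF i W] by blast
  have PP: "P (tgt I \<phi>) \<inter> pb \<phi> W \<subseteq> pb \<phi> (P i \<inter> W)" and QQ: "Q (tgt I \<phi>) \<inter> (P (tgt I \<phi>) \<inter> pb \<phi> W) \<subseteq> pb \<phi> (Q i \<inter> (P i \<inter> W))"
    using P_pb[OF \<phi>] Q_pb[OF \<phi>] by (auto simp: pb_Int)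
  let ?\<theta> = "hom_of M (tgt I \<phi>) (P (tgt I \<phi>) \<inter> pb \<phi> W) (\<lambda>\<psi>. \<eta> (cmp I \<psi> \<phi>))"
  have "?\<theta> = hom_of M (tgt I \<phi>) (P (tgt I \<phi>) \<inter> pb \<phi> W) (hom_of M (tgt I \<phi>) (pb \<phi> (P i \<inter> W)) (\<lambda>\<psi>. \<eta> (cmp I \<psi> \<phi>)))"
    by (rule hom_of_cong) (simp add: hom_of_app below_mono[OF PP])
  then have mem: "?\<theta> \<in> hom_sections I X M N (tgt I \<phi>) (P (tgt I \<phi>) \<inter> pb \<phi> W)"
    using hom_restrict_mem[OF hom_trn_mem[OF \<eta>' \<phi>] PP] by simp
  have "?\<theta> \<psi> W' s = \<zero>\<^bsub>dsec N (tgt I \<psi>) W'\<^esub>"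
    if a: "\<psi> \<in> out I (tgt I \<phi>)" "W' \<in> below I X \<psi> (Q (tgt I \<phi>) \<inter> (P (tgt I \<phi>) \<inter> pb \<phi> W))" "s \<in> carrier (dsec M (tgt I \<psi>) W')" for \<psi> W' s
  proof -
    have "W' \<in> below I X (cmp I \<psi> \<phi>) (Q i \<inter> (P i \<inter> W))"
      by (rule below_trn[OF \<phi> a(1) below_mono[OF QQ a(2)]])
    then have "\<eta> (cmp I \<psi> \<phi>) W' s = \<zero>\<^bsub>dsec N (tgt I (cmp I \<psi> \<phi>)) W'\<^esub>"
      using \<eta> S_iff[OF i W] cmp_out[OF \<phi> a(1)] a(3) tgt_cmp[OF \<phi> a(1)] by force
    then show ?thesis
      unfolding hom_of_app[OF a(1) below_mono[OF Int_lower2 a(2)] a(3)] tgt_cmp[OF \<phi> a(1)] .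
  qed
  then show ?thesis
    using mem unfolding S_iff[OF j opb] S_trn[OF \<eta>' \<phi>] by blast
qed

lemma Hx_app:
  "\<phi> \<in> out I i \<Longrightarrow> W' \<in> below I X \<phi> W \<Longrightarrow> s \<in> carrier (dsec M (tgt I \<phi>) W') \<Longrightarrow>
   Hx i W \<eta> \<phi> W' s = \<eta> \<phi> (P (tgt I \<phi>) \<inter> W') (sres (fib M (tgt I \<phi>)) W' (P (tgt I \<phi>) \<inter> W') s)"
  unfolding Hx_def by (rule hom_of_app)

lemma hom_of_eqI:
  assumes "\<And>\<phi> W' s. \<phi> \<in> out I i \<Longrightarrow> W' \<in> below I X \<phi> W \<Longrightarrow> s \<in> carrier (dsec M (tgt I \<phi>) W') \<Longrightarrow> h \<phi> W' s = h' \<phi> W' s"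
    and "k = hom_of M i W h" "k' = hom_of M i W h'"
  shows "k = k'"
  unfolding assms(2,3) by (rule hom_of_cong[OF assms(1)])

lemma Hx_Mod_hom: "dmap I X S Hx \<in> Mod_hom I X S T"
proof (rule Mod_homI)
  note app = dmap_app[where h = Hx]
  have \<eta>': "\<eta> \<in> hom_sections I X M N i (P i \<inter> W)" if "i \<in> Ob I" "op i W" "\<eta> \<in> carrier (dsec S i W)" for i W \<eta>
    using that S_iff[OF that(1,2)] by blast
  show "dmap I X S Hx = dmap I X S (dmap I X S Hx)" by (simp add: dmap_idem)
  show "dmap I X S Hx i W \<eta> \<in> carrier (dsec T i W)" if "i \<in> Ob I" "op i W" "\<eta> \<in> carrier (dsec S i W)" for i W \<eta>
    unfolding app[OF that] sheaf_Hom_simps by (rule Hx_mem[OF that])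
  show "dmap I X S Hx i W (\<eta> \<oplus>\<^bsub>dsec S i W\<^esub> \<theta>) = dmap I X S Hx i W \<eta> \<oplus>\<^bsub>dsec T i W\<^esub> dmap I X S Hx i W \<theta>"
    if a: "i \<in> Ob I" "op i W" "\<eta> \<in> carrier (dsec S i W)" "\<theta> \<in> carrier (dsec S i W)" for i W \<eta> \<theta>
    unfolding app[OF a(1-3)] app[OF a(1,2,4)] app[OF a(1,2) S_add_closed[OF a]]
  proof (rule hom_of_eqI[OF _ Hx_def sheaf_Hom_simps(3)])
    fix \<phi> W' s assume b: "\<phi> \<in> out I i" "W' \<in> below I X \<phi> W" "s \<in> carrier (dsec M (tgt I \<phi>) W')"
    show "(\<eta> \<oplus>\<^bsub>dsec S i W\<^esub> \<theta>) \<phi> (P (tgt I \<phi>) \<inter> W') (sres (fib M (tgt I \<phi>)) W' (P (tgt I \<phi>) \<inter> W') s) =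
        Hx i W \<eta> \<phi> W' s \<oplus>\<^bsub>dsec (\<Gamma> N) (tgt I \<phi>) W'\<^esub> Hx i W \<theta> \<phi> W' s"
      unfolding S_simps unfolding hom_of_app[OF b(1) below_P[OF b(1,2)] M_res[OF b]] Hx_app[OF b] Gamma_simps by (rule refl)
  qed
  show "dmap I X S Hx i W (r \<odot>\<^bsub>dsec S i W\<^esub> \<eta>) = r \<odot>\<^bsub>dsec T i W\<^esub> dmap I X S Hx i W \<eta>"
    if a: "i \<in> Ob I" "op i W" "r \<in> carrier (ring_at (sp X i) W)" "\<eta> \<in> carrier (dsec S i W)" for i W r \<eta>
    unfolding app[OF a(1,2,4)] app[OF a(1,2) S_smult_closed[OF a]]
  proof (rule hom_of_eqI[OF _ Hx_def sheaf_Hom_simps(4)])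
    fix \<phi> W' s assume b: "\<phi> \<in> out I i" "W' \<in> below I X \<phi> W" "s \<in> carrier (dsec M (tgt I \<phi>) W')"
    \<comment> \<open>A scalar on \<open>W\<close> reaches the trace of \<open>W'\<close> either
      through \<open>P i \<inter> W\<close> or through \<open>W'\<close>, with the same
      result.\<close>
    have "rsr \<phi> (P i \<inter> W) (P (tgt I \<phi>) \<inter> W') (rres (sp X i) W (P i \<inter> W) r) = rres (sp X (tgt I \<phi>)) W' (P (tgt I \<phi>) \<inter> W') (rsr \<phi> W W' r)"
      unfolding rsr_rres[OF b(1) a(2) PW[OF a(1,2)] Int_lower2 below_P[OF b(1,2)] a(3)]
      by (rule rres_rsr[OF b(1) a(2) b(2) below_PW[OF b(1,2)] Int_lower2 a(3), symmetric])
    then show "(r \<odot>\<^bsub>dsec S i W\<^esub> \<eta>) \<phi> (P (tgt I \<phi>) \<inter> W') (sres (fib M (tgt I \<phi>)) W' (P (tgt I \<phi>) \<inter> W') s) =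
        rsr \<phi> W W' r \<odot>\<^bsub>dsec (\<Gamma> N) (tgt I \<phi>) W'\<^esub> Hx i W \<eta> \<phi> W' s"
      unfolding S_simps unfolding hom_of_app[OF b(1) below_P[OF b(1,2)] M_res[OF b]] Hx_app[OF b] Gamma_simps by simp
  qed
  show "dmap I X S Hx i W1 (sres (fib S i) W W1 \<eta>) = sres (fib T i) W W1 (dmap I X S Hx i W \<eta>)"
    if a: "i \<in> Ob I" "op i W" "op i W1" "W1 \<subseteq> W" "\<eta> \<in> carrier (dsec S i W)" for i W W1 \<eta>
    unfolding app[OF a(1,2,5)] app[OF a(1,3) S_sres_closed[OF a]]
  proof (rule hom_of_eqI[OF _ Hx_def])
    show "sres (fib T i) W W1 (Hx i W \<eta>) = hom_of M i W1 (Hx i W \<eta>)"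
      unfolding sheaf_Hom_simps by (rule hom_restrict[OF Hx_mem[OF a(1,2,5)] a(4)])
    fix \<phi> W' s assume b: "\<phi> \<in> out I i" "W' \<in> below I X \<phi> W1" "s \<in> carrier (dsec M (tgt I \<phi>) W')"
    show "(sres (fib S i) W W1 \<eta>) \<phi> (P (tgt I \<phi>) \<inter> W') (sres (fib M (tgt I \<phi>)) W' (P (tgt I \<phi>) \<inter> W') s) = Hx i W \<eta> \<phi> W' s"
      unfolding S_sres[OF \<eta>'[OF a(1,2,5)] a(4)] hom_of_app[OF b(1) below_P[OF b(1,2)] M_res[OF b]]
        Hx_app[OF b(1) below_mono[OF a(4) b(2)] b(3)] by (rule refl)
  qed
  show "dmap I X S Hx (tgt I \<phi>) (pb \<phi> W) (trn S \<phi> W \<eta>) = trn T \<phi> W (dmap I X S Hx i W \<eta>)"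
    if a: "\<phi> \<in> out I i" "op i W" "\<eta> \<in> carrier (dsec S i W)" for i \<phi> W \<eta>
    unfolding app[OF out_Ob[OF a(1)] a(2,3)] app[OF out_tgt[OF a(1)] pb_op[OF a(1,2)] S_trn_closed[OF a]]
  proof (rule hom_of_eqI[OF _ Hx_def])
    show "trn T \<phi> W (Hx i W \<eta>) = hom_of M (tgt I \<phi>) (pb \<phi> W) (\<lambda>\<psi>. Hx i W \<eta> (cmp I \<psi> \<phi>))"
      unfolding sheaf_Hom_simps by (rule hom_trn[OF Hx_mem[OF out_Ob[OF a(1)] a(2,3)] a(1)])
    fix \<psi> W' s assume b: "\<psi> \<in> out I (tgt I \<phi>)" "W' \<in> below I X \<psi> (pb \<phi> W)" "s \<in> carrier (dsec M (tgt I \<psi>) W')"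
    have "Hx i W \<eta> (cmp I \<psi> \<phi>) W' s = \<eta> (cmp I \<psi> \<phi>) (P (tgt I \<psi>) \<inter> W') (sres (fib M (tgt I \<psi>)) W' (P (tgt I \<psi>) \<inter> W') s)"
      using Hx_app[OF cmp_out[OF a(1) b(1)] below_trn[OF a(1) b(1,2)]] b(3) by (simp add: tgt_cmp[OF a(1) b(1)])
    then show "trn S \<phi> W \<eta> \<psi> (P (tgt I \<psi>) \<inter> W') (sres (fib M (tgt I \<psi>)) W' (P (tgt I \<psi>) \<inter> W') s) = Hx i W \<eta> (cmp I \<psi> \<phi>) W' s"
      unfolding S_trn[OF \<eta>'[OF out_Ob[OF a(1)] a(2,3)] a(1)] hom_of_app[OF b(1) below_P[OF b(1,2)] M_res[OF b]] by simp
  qed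
qed

text \<open>The maps composed in \<open>frakG\<close> are made extensional by \<open>dmap\<close>,
  so their formulas hold on the carriers only. This membership, and \<open>push_hom_mem\<close> for
  the next stage, is what allows the composite to be evaluated.\<close>

lemma sub_restr_mem:
  assumes i: "i \<in> Ob I" and W: "op i W" and \<eta>: "\<eta> \<in> hom_sections I X M N i (P i \<inter> W)"
  shows "(\<lambda>\<phi>\<in>out I i. \<lambda>W'\<in>below I U \<phi> (P i \<inter> W). \<eta> \<phi> W')
    \<in> hom_sections I U (restr I U X M) (restr I U X N) i (P i \<inter> W)" (is "?h \<in> _")
proof -
  have b: "W' \<in> below I X \<phi> (P i \<inter> W)" if "\<phi> \<in> out I i" "W' \<in> below I U \<phi> (P i \<inter> W)" for \<phi> W'
    using that by (simp add: below_sub_iff below_iff)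
  have r: "dsec (restr I U X A) j W = dsec A j W" for A :: "('i, 'f, 'p, 'r, 'k) dmod" and j W
    by (simp add: restr_def)
  have e: "?h = sub.hom_of (restr I U X M) i (P i \<inter> W) \<eta>"
    unfolding sub.hom_of_def r
  proof (intro restrict_ext ext)
    fix \<phi> W' s assume "\<phi> \<in> out I i" "W' \<in> below I U \<phi> (P i \<inter> W)"
    then show "\<eta> \<phi> W' s = (\<lambda>s\<in>carrier (dsec M (tgt I \<phi>) W'). \<eta> \<phi> W' s) s"
      using hom_undefined[OF \<eta> _ b, of \<phi> W' s] by (simp add: restrict_def)
  qed
  show ?thesis
    unfolding e
  proof (rule sub.hom_sectionsI, unfold r)
    fix \<phi> W' assume a: "\<phi> \<in> out I i" "W' \<in> below I U \<phi> (P i \<inter> W)"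
    note j = out_tgt[OF a(1)] and ba = b[OF a] and oW' = below_op[OF b[OF a]]
    have WP: "W' \<subseteq> P (tgt I \<phi>)" using a below_sub_iff[OF a(1)] by blast
    show "linear_map (ring_at (sp U (tgt I \<phi>)) W') (dsec M (tgt I \<phi>) W') (dsec N (tgt I \<phi>) W') (\<eta> \<phi> W')"
      using hom_sectionsD(2)[OF \<eta> a(1) ba] by (simp add: sub_ring[OF j])
    show "s \<oplus>\<^bsub>dsec M (tgt I \<phi>) W'\<^esub> t \<in> carrier (dsec M (tgt I \<phi>) W')"
      if "s \<in> carrier (dsec M (tgt I \<phi>) W')" "t \<in> carrier (dsec M (tgt I \<phi>) W')" for s t
      by (rule M.sec_add_closed[OF j oW' that])
    show "q \<odot>\<^bsub>dsec M (tgt I \<phi>) W'\<^esub> t \<in> carrier (dsec M (tgt I \<phi>) W')"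
      if "q \<in> carrier (ring_at (sp U (tgt I \<phi>)) W')" "t \<in> carrier (dsec M (tgt I \<phi>) W')" for q t
      by (rule M.sec_smult_closed[OF j oW' _ that(2)]) (use that(1) in \<open>simp add: sub_ring[OF j]\<close>)
    fix \<psi> W'' s assume c: "\<psi> \<in> out I (tgt I \<phi>)" "W'' \<in> below I U \<psi> W'" "s \<in> carrier (dsec M (tgt I \<phi>) W')"
    have W'': "W'' \<in> below I X \<psi> W'" using c by (simp add: below_sub_iff[OF c(1)] below_iff)
    note sM = site_res_restr[OF M.mod c(1) oW' c(2,3)]
    note sN = site_res_restr[OF N.mod c(1) oW' c(2) hom_closed[OF \<eta> a(1) ba c(3)]]
    show "site_res I U (restr I U X M) \<psi> W' W'' s \<in> carrier (dsec M (tgt I \<psi>) W'')"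
      unfolding sM by (rule M.sr_closed[OF c(1) oW' W'' c(3)])
    show "\<eta> (cmp I \<psi> \<phi>) W'' (site_res I U (restr I U X M) \<psi> W' W'' s) = site_res I U (restr I U X N) \<psi> W' W'' (\<eta> \<phi> W' s)"
      unfolding sM sN by (rule hom_sectionsD(3)[OF \<eta> a(1) ba c(1) W'' c(3)])
  qed
qed

lemma push_hom_mem:
  assumes i: "i \<in> Ob I" and W: "op i W" and \<eta>: "\<eta> \<in> hom_sections I X M N i (P i \<inter> W)"
  shows "(\<lambda>\<phi>\<in>out I i. \<lambda>W'\<in>below I X \<phi> W. \<eta> \<phi> (P (tgt I \<phi>) \<inter> W'))
    \<in> hom_sections I X (push_restr I U X M) (push_restr I U X N) i W" (is "?h \<in> _")
proof -
  have e: "?h = hom_of (push_restr I U X M) i W (\<lambda>\<phi> W'. \<eta> \<phi> (P (tgt I \<phi>) \<inter> W'))"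
    unfolding hom_of_def push_restr_simps
  proof (intro restrict_ext ext)
    fix \<phi> W' s assume "\<phi> \<in> out I i" "W' \<in> below I X \<phi> W"
    then show "\<eta> \<phi> (P (tgt I \<phi>) \<inter> W') s = (\<lambda>s\<in>carrier (dsec M (tgt I \<phi>) (P (tgt I \<phi>) \<inter> W')). \<eta> \<phi> (P (tgt I \<phi>) \<inter> W') s) s"
      using hom_undefined[OF \<eta> _ below_P, of \<phi> W' s] by (simp add: restrict_def)
  qed
  show ?thesis
    unfolding e
  proof (rule hom_sectionsI, unfold push_restr_simps)
    fix \<phi> W' assume a: "\<phi> \<in> out I i" "W' \<in> below I X \<phi> W"
    note j = out_tgt[OF a(1)] and ba = below_P[OF a] and oW' = below_op[OF a(2)] and oP = below_PW[OF a]
    note l = hom_sectionsD(2)[OF \<eta> a(1) ba]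
    note rc = rres_closed[OF sp_ringed[OF j] oW' oP Int_lower2]
    show "linear_map (ring_at (sp X (tgt I \<phi>)) W') (dsec (push_restr I U X M) (tgt I \<phi>) W') (dsec (push_restr I U X N) (tgt I \<phi>) W')
        (\<eta> \<phi> (P (tgt I \<phi>) \<inter> W'))"
      by (rule linear_mapI) (simp_all only: push_restr_simps linear_map_closed[OF l] linear_map_add[OF l] linear_map_smult[OF l rc])
    show "s \<oplus>\<^bsub>dsec M (tgt I \<phi>) (P (tgt I \<phi>) \<inter> W')\<^esub> t \<in> carrier (dsec M (tgt I \<phi>) (P (tgt I \<phi>) \<inter> W'))"
      if "s \<in> carrier (dsec M (tgt I \<phi>) (P (tgt I \<phi>) \<inter> W'))" "t \<in> carrier (dsec M (tgt I \<phi>) (P (tgt I \<phi>) \<inter> W'))" for s t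
      by (rule M.sec_add_closed[OF j oP that])
    show "rres (sp X (tgt I \<phi>)) W' (P (tgt I \<phi>) \<inter> W') q \<odot>\<^bsub>dsec M (tgt I \<phi>) (P (tgt I \<phi>) \<inter> W')\<^esub> t \<in> carrier (dsec M (tgt I \<phi>) (P (tgt I \<phi>) \<inter> W'))"
      if "q \<in> carrier (ring_at (sp X (tgt I \<phi>)) W')" "t \<in> carrier (dsec M (tgt I \<phi>) (P (tgt I \<phi>) \<inter> W'))" for q t
      by (rule M.sec_smult_closed[OF j oP rc[OF that(1)] that(2)])
    fix \<psi> W'' s assume c: "\<psi> \<in> out I (tgt I \<phi>)" "W'' \<in> below I X \<psi> W'" "s \<in> carrier (dsec M (tgt I \<phi>) (P (tgt I \<phi>) \<inter> W'))"
    note bP = below_P[OF c(1,2)]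
    note sM = site_res_push_restr[OF M.mod c(1) oW' c(2,3)]
    note sN = site_res_push_restr[OF N.mod c(1) oW' c(2) hom_closed[OF \<eta> a(1) ba c(3)]]
    show "site_res I X (push_restr I U X M) \<psi> W' W'' s \<in> carrier (dsec M (tgt I \<psi>) (P (tgt I \<psi>) \<inter> W''))"
      unfolding sM by (rule M.sr_closed[OF c(1) oP bP c(3)])
    show "\<eta> (cmp I \<psi> \<phi>) (P (tgt I (cmp I \<psi> \<phi>)) \<inter> W'') (site_res I X (push_restr I U X M) \<psi> W' W'' s) =
        site_res I X (push_restr I U X N) \<psi> W' W'' (\<eta> \<phi> (P (tgt I \<phi>) \<inter> W') s)"
      unfolding sM sN tgt_cmp[OF a(1) c(1)] by (rule hom_sectionsD(3)[OF \<eta> a(1) ba c(1) bP c(3)])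
  qed
qed

text \<open>The intermediate families are \<open>?\<eta>1\<close> on the opens of \<open>U\<close>
  and \<open>?\<eta>2\<close> after the direct image. Precomposition with the unit then inserts the
  restriction of the argument to \<open>P\<close>.\<close>

lemma frakG_eq:
  assumes i: "i \<in> Ob I" and W: "op i W" and \<eta>: "\<eta> \<in> hom_sections I X M N i (P i \<inter> W)"
  shows "frakG I X U M N i W \<eta> = Hx i W \<eta>"
proof -
  let ?f = "incl U X" and ?D = "push_restr I U X (sheaf_Hom I X M N)"
  have D: "\<eta> \<in> carrier (dsec ?D i W)"
    using \<eta> by (simp only: push_restr_simps sheaf_Hom_simps)
  let ?\<eta>1 = "\<lambda>\<phi>\<in>out I i. \<lambda>W'\<in>below I U \<phi> (P i \<inter> W). \<eta> \<phi> W'"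
  let ?\<eta>2 = "\<lambda>\<phi>\<in>out I i. \<lambda>W'\<in>below I X \<phi> W. \<eta> \<phi> (P (tgt I \<phi>) \<inter> W')"
  have oU: "sub.op i (P i \<inter> W)"
    using PW[OF i W] by (simp add: sub_open[OF i])
  have 1: "push_map I U X ?f (restr I U X (sheaf_Hom I X M N)) (restr_Hom I U X M N) i W \<eta> = ?\<eta>1"
  proof -
    have "push_map I U X ?f (restr I U X (sheaf_Hom I X M N)) (restr_Hom I U X M N) i W \<eta> = restr_Hom I U X M N i (P i \<inter> W) \<eta>"
      unfolding push_map_def using D by (simp add: dmap_app[OF i W] push_restr_def pre_incl)
    also have "\<dots> = ?\<eta>1"
      unfolding restr_Hom_def
      by (rule sub.dmap_app[OF i oU]) (use \<eta> in \<open>simp add: restr_def sheaf_Hom_simps\<close>)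
    finally show ?thesis .
  qed
  have 2: "push_Hom I U X ?f (restr I U X M) (restr I U X N) i W ?\<eta>1 = ?\<eta>2"
  proof -
    have "?\<eta>1 \<in> carrier (dsec (push I U ?f (sheaf_Hom I U (restr I U X M) (restr I U X N))) i W)"
      using sub_restr_mem[OF i W \<eta>] by (simp add: push_def smod_push_def pre_incl sub.sheaf_Hom_simps)
    then have "push_Hom I U X ?f (restr I U X M) (restr I U X N) i W ?\<eta>1 =
        (\<lambda>\<phi>\<in>out I i. \<lambda>W'\<in>below I X \<phi> W. ?\<eta>1 \<phi> (pre (sp U (tgt I \<phi>)) (?f (tgt I \<phi>)) W'))"
      unfolding push_Hom_def by (rule dmap_app[OF i W])
    also have "\<dots> = ?\<eta>2"
    proof (intro restrict_ext)
      fix \<phi> W' assume a: "\<phi> \<in> out I i" "W' \<in> below I X \<phi> W"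
      have "P (tgt I \<phi>) \<inter> W' \<in> below I U \<phi> (P i \<inter> W)"
        using below_P[OF a] by (simp add: below_sub_iff[OF a(1)] below_iff)
      then show "?\<eta>1 \<phi> (pre (sp U (tgt I \<phi>)) (?f (tgt I \<phi>)) W') = \<eta> \<phi> (P (tgt I \<phi>) \<inter> W')"
        using a(1) by (simp add: pre_incl)
    qed
    finally show ?thesis .
  qed
  have 3: "Hom_pre I X M (push_restr I U X M) (push_restr I U X N) (adj_unit I U X M) i W ?\<eta>2 = Hx i W \<eta>"
  proof -
    have "?\<eta>2 \<in> carrier (dsec (sheaf_Hom I X (push_restr I U X M) (push_restr I U X N)) i W)"
      using push_hom_mem[OF i W \<eta>] by (simp only: sheaf_Hom_simps)
    then have "Hom_pre I X M (push_restr I U X M) (push_restr I U X N) (adj_unit I U X M) i W ?\<eta>2 =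
        hom_of M i W (\<lambda>\<phi> W' s. ?\<eta>2 \<phi> W' (adj_unit I U X M (tgt I \<phi>) W' s))"
      unfolding Hom_pre_def hom_of_def by (rule dmap_app[OF i W])
    also have "\<dots> = Hx i W \<eta>"
      unfolding Hx_def
    proof (rule hom_of_cong)
      fix \<phi> W' s assume a: "\<phi> \<in> out I i" "W' \<in> below I X \<phi> W" "s \<in> carrier (dsec M (tgt I \<phi>) W')"
      have "adj_unit I U X M (tgt I \<phi>) W' s = sres (fib M (tgt I \<phi>)) W' (P (tgt I \<phi>) \<inter> W') s"
        unfolding adj_unit_def dmap_app[OF out_tgt[OF a(1)] below_op[OF a(2)] a(3)] pre_incl by (rule refl)
      then show "?\<eta>2 \<phi> W' (adj_unit I U X M (tgt I \<phi>) W' s) = \<eta> \<phi> (P (tgt I \<phi>) \<inter> W') (sres (fib M (tgt I \<phi>)) W' (P (tgt I \<phi>) \<inter> W') s)"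
        using a by simp
    qed
    finally show ?thesis .
  qed
  show ?thesis
    unfolding frakG_def Let_def Mod_comp_def by (simp only: dmap_app[OF i W D] 1 2 3)
qed

text \<open>Since \<open>iota\<close> returns its argument, composing with it on the target leaves
  \<open>H\<close> unchanged, and the defining equation becomes \<open>H = dmap I X S Hx\<close>.
  Uniqueness is immediate, and existence is \<open>Hx_Mod_hom\<close>.\<close>

theorem frakH_eq: "frakH I X U V M N = dmap I X S Hx"
proof -
  have G: "Mod_comp I X S (frakG I X U M N) (iota I X U V (sheaf_Hom I X M N)) = dmap I X S Hx"
    unfolding Mod_comp_def
  proof (rule dmap_eqI)
    fix i W \<eta> assume a: "i \<in> Ob I" "op i W" "\<eta> \<in> carrier (dsec S i W)"
    have "iota I X U V (sheaf_Hom I X M N) i W \<eta> = \<eta>"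
      unfolding iota_def by (rule dmap_app[OF a])
    then show "frakG I X U M N i W (iota I X U V (sheaf_Hom I X M N) i W \<eta>) = Hx i W \<eta>"
      using frakG_eq[OF a(1,2)] a(3) S_iff[OF a(1,2)] by simp
  qed
  have P: "Mod_comp I X S (Hom_post I X M (\<Gamma> N) (iota I X U V N)) H = H" if H: "H \<in> Mod_hom I X S T" for H
  proof -
    have "Mod_comp I X S (Hom_post I X M (\<Gamma> N) (iota I X U V N)) H = dmap I X S H"
      unfolding Mod_comp_def
    proof (rule dmap_eqI)
      fix i W \<eta> assume a: "i \<in> Ob I" "op i W" "\<eta> \<in> carrier (dsec S i W)"
      have t: "H i W \<eta> \<in> carrier (dsec T i W)" by (rule Mod_homD(2)[OF H a])
      then have \<theta>: "H i W \<eta> \<in> hom_sections I X M (\<Gamma> N) i W" by (simp only: sheaf_Hom_simps)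
      have "Hom_post I X M (\<Gamma> N) (iota I X U V N) i W (H i W \<eta>) =
          hom_of M i W (\<lambda>\<phi> W' s. iota I X U V N (tgt I \<phi>) W' (H i W \<eta> \<phi> W' s))"
        unfolding Hom_post_def hom_of_def by (rule dmap_app[OF a(1,2) t])
      also have "\<dots> = hom_of M i W (H i W \<eta>)"
        by (rule hom_of_cong) (simp add: iota_def dmap_app out_tgt below_op hom_closed[OF \<theta>])
      also have "\<dots> = H i W \<eta>" by (rule hom_sectionsD(1)[OF \<theta>, symmetric])
      finally show "Hom_post I X M (\<Gamma> N) (iota I X U V N) i W (H i W \<eta>) = H i W \<eta>" .
    qed
    also have "\<dots> = H" by (rule Mod_homD(1)[OF H, symmetric])
    finally show ?thesis .
  qed
  show ?thesis
    unfolding frakH_def Let_def G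
    by (rule the_equality) (use Hx_Mod_hom P in auto)
qed

lemma Mod_iso_frakH:
  assumes "\<And>i W. i \<in> Ob I \<Longrightarrow> op i W \<Longrightarrow> bij_betw (Hx i W) (carrier (dsec S i W)) (hom_sections I X M (\<Gamma> N) i W)"
  shows "Mod_iso I X S T (frakH I X U V M N)"
  unfolding frakH_eq
proof (rule bij_Mod_iso[OF Hx_Mod_hom])
  fix i W assume a: "i \<in> Ob I" "op i W"
  have "bij_betw (dmap I X S Hx i W) (carrier (dsec S i W)) (hom_sections I X M (\<Gamma> N) i W) \<longleftrightarrow>
      bij_betw (Hx i W) (carrier (dsec S i W)) (hom_sections I X M (\<Gamma> N) i W)"
    by (rule bij_betw_cong) (rule dmap_app[OF a])
  then show "bij_betw (dmap I X S Hx i W) (carrier (dsec S i W)) (carrier (dsec T i W))"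
    using assms[OF a] by (simp add: sheaf_Hom_simps)
qed (rule S_add_closed S_smult_closed S_sres_closed S_trn_closed; assumption)+

end

section \<open>Sections of the sheaf Hom out of an equivariant module\<close>

text \<open>\<open>e\<close> is a candidate for the identity component of a Hom section over
  \<open>(i, W0)\<close>, given on the opens inside \<open>W0\<close>. Equivariance of
  \<open>M\<close> makes it extend to every arrow out of \<open>i\<close>.\<close>

locale equiv_ext = hom_modules I X M N
  for I :: "('i, 'f) cat" and X :: "('i, 'f, 'p, 'r) diagram"
    and M :: "('i, 'f, 'p, 'r, 'm) dmod" and N :: "('i, 'f, 'p, 'r, 'n) dmod" +
  fixes i :: 'i and W0 :: "'p set" and e :: "'p set \<Rightarrow> 'm \<Rightarrow> 'n"
  assumes eqv: "equivariant I X M" and i: "i \<in> Ob I" and W0: "openin (topol (sp X i)) W0"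
    and e_linear: "\<And>V. openin (topol (sp X i)) V \<Longrightarrow> V \<subseteq> W0 \<Longrightarrow> linear_map (ring_at (sp X i) V) (dsec M i V) (dsec N i V) (e V)"
    and e_sres: "\<And>V V' s. openin (topol (sp X i)) V \<Longrightarrow> V \<subseteq> W0 \<Longrightarrow> openin (topol (sp X i)) V' \<Longrightarrow> V' \<subseteq> V \<Longrightarrow>
      s \<in> carrier (dsec M i V) \<Longrightarrow> e V' (sres (fib M i) V V' s) = sres (fib N i) V V' (e V s)"
begin

text \<open>The graph of the component at \<open>\<phi>\<close>, generated by sections moved along
  \<open>\<phi>\<close> and the images that \<open>e\<close> prescribes. Neither the pullback nor
  its comparison map occurs in it, which keeps \<open>GP_site\<close> a direct computation.\<close>

definition GP :: "'f \<Rightarrow> 'p set \<Rightarrow> ('m \<times> 'n) set" where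
  "GP \<phi> = graph_pairs (sp X (tgt I \<phi>)) (sp X i) (tr X \<phi>) (fib M i) (fib M (tgt I \<phi>)) (fib N (tgt I \<phi>))
     (trn M \<phi>) (\<lambda>V s. trn N \<phi> V (e V s)) W0"

text \<open>Equivariance supplies the isomorphism \<open>h\<close>, and \<open>trn N \<phi>\<close>
  after \<open>e\<close> is the morphism into the direct image whose adjoint is wanted.\<close>

lemma pullback_ext:
  assumes \<phi>: "\<phi> \<in> out I i"
  shows "\<exists>h. pullback_ext (sp X (tgt I \<phi>)) (sp X i) (tr X \<phi>) (fib M i) (fib M (tgt I \<phi>)) (fib N (tgt I \<phi>))
     (trn M \<phi>) (\<lambda>V s. trn N \<phi> V (e V s)) W0 h"
proof -
  note j = M.out_tgt[OF \<phi>]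
  obtain h where "adjoint_map (sp X (tgt I \<phi>)) (sp X i) (tr X \<phi>) (fib M i) (fib M (tgt I \<phi>)) (trn M \<phi>) h"
    "smod_iso (sp X (tgt I \<phi>)) (pullback (sp X (tgt I \<phi>)) (sp X i) (tr X \<phi>) (fib M i)) (fib M (tgt I \<phi>)) h"
    using eqv \<phi> unfolding equivariant_def Let_def M.out_iff by blast
  then have "pullback_ext (sp X (tgt I \<phi>)) (sp X i) (tr X \<phi>) (fib M i) (fib M (tgt I \<phi>)) (fib N (tgt I \<phi>))
     (trn M \<phi>) (\<lambda>V s. trn N \<phi> V (e V s)) W0 h"
    by unfold_locales
      (simp_all add: M.sp_ringed[OF j] M.sp_ringed[OF i] M.tr_lrs[OF \<phi>] M.fib_smod[OF i] M.fib_smod[OF j] N.fib_smod[OF j] W0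
        N.trn_closed[OF \<phi>] N.trn_add[OF \<phi>] N.trn_smult[OF \<phi>] N.trn_sres[OF \<phi>] linear_map_closed[OF e_linear]
        linear_map_add[OF e_linear] linear_map_smult[OF e_linear] e_sres M.pb_def[symmetric])
  then show ?thesis by blast
qed

lemma GP_local_ex:
  assumes \<phi>: "\<phi> \<in> out I i" and W: "W \<in> below I X \<phi> W0" and m: "m \<in> carrier (dsec M (tgt I \<phi>) W)" and x: "x \<in> W"
  obtains W' n where "M.op (tgt I \<phi>) W'" "x \<in> W'" "W' \<subseteq> W" "(sres (fib M (tgt I \<phi>)) W W' m, n) \<in> GP \<phi> W'"
proof -
  obtain h where "pullback_ext (sp X (tgt I \<phi>)) (sp X i) (tr X \<phi>) (fib M i) (fib M (tgt I \<phi>)) (fib N (tgt I \<phi>))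
     (trn M \<phi>) (\<lambda>V s. trn N \<phi> V (e V s)) W0 h" using pullback_ext[OF \<phi>] by blast
  then show thesis
    using pullback_ext.Q_local_ex[OF _ M.below_op[OF W] M.below_sub[OF W, unfolded M.pb_def] m x] that
    unfolding GP_def by blast
qed

lemma GP_zero:
  assumes \<phi>: "\<phi> \<in> out I i" and W: "W \<in> below I X \<phi> W0" and n: "(\<zero>\<^bsub>dsec M (tgt I \<phi>) W\<^esub>, n) \<in> GP \<phi> W"
  shows "n = \<zero>\<^bsub>dsec N (tgt I \<phi>) W\<^esub>"
proof -
  obtain h where "pullback_ext (sp X (tgt I \<phi>)) (sp X i) (tr X \<phi>) (fib M i) (fib M (tgt I \<phi>)) (fib N (tgt I \<phi>))
     (trn M \<phi>) (\<lambda>V s. trn N \<phi> V (e V s)) W0 h" using pullback_ext[OF \<phi>] by blast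
  then show ?thesis
    by (rule pullback_ext.Q_zero[OF _ M.below_op[OF W] M.below_sub[OF W, unfolded M.pb_def]]) (use n in \<open>simp only: GP_def\<close>)
qed

lemma e_closed: "M.op i V \<Longrightarrow> V \<subseteq> W0 \<Longrightarrow> s \<in> carrier (dsec M i V) \<Longrightarrow> e V s \<in> carrier (dsec N i V)"
  by (rule linear_map_closed[OF e_linear])

lemma GP_gen:
  assumes "M.op i V" "V \<subseteq> W0" "W \<in> below I X \<phi> V" "s \<in> carrier (dsec M i V)" "a \<in> carrier (ring_at (sp X (tgt I \<phi>)) W)"
  shows "(a \<odot>\<^bsub>dsec M (tgt I \<phi>) W\<^esub> M.sr \<phi> V W s, a \<odot>\<^bsub>dsec N (tgt I \<phi>) W\<^esub> N.sr \<phi> V W (e V s)) \<in> GP \<phi> W"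
  unfolding GP_def site_res_def
  by (rule graph_pairs.gen) (use assms in \<open>simp_all add: M.below_iff M.pb_def\<close>)

lemma GP_induct [consumes 2, case_names gen zero diff]:
  assumes "(m, n) \<in> GP \<phi> W" and W: "M.op (tgt I \<phi>) W"
    and "\<And>V s a. M.op i V \<Longrightarrow> V \<subseteq> W0 \<Longrightarrow> W \<in> below I X \<phi> V \<Longrightarrow> s \<in> carrier (dsec M i V) \<Longrightarrow>
       a \<in> carrier (ring_at (sp X (tgt I \<phi>)) W) \<Longrightarrow>
       R (a \<odot>\<^bsub>dsec M (tgt I \<phi>) W\<^esub> M.sr \<phi> V W s) (a \<odot>\<^bsub>dsec N (tgt I \<phi>) W\<^esub> N.sr \<phi> V W (e V s))"
    and "R \<zero>\<^bsub>dsec M (tgt I \<phi>) W\<^esub> \<zero>\<^bsub>dsec N (tgt I \<phi>) W\<^esub>"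
    and "\<And>m n m' n'. (m, n) \<in> GP \<phi> W \<Longrightarrow> (m', n') \<in> GP \<phi> W \<Longrightarrow> R m n \<Longrightarrow> R m' n' \<Longrightarrow>
       R (m \<ominus>\<^bsub>dsec M (tgt I \<phi>) W\<^esub> m') (n \<ominus>\<^bsub>dsec N (tgt I \<phi>) W\<^esub> n')"
  shows "R m n"
  using assms(1) unfolding GP_def
proof (induction rule: graph_pairs.induct)
  case (gen V s a)
  then show ?case
    using assms(3)[of V s a] W by (simp add: M.below_iff M.pb_def site_res_def)
qed (use assms(4,5) in \<open>simp_all add: GP_def\<close>)

lemma GP_zero_mem: "(\<zero>\<^bsub>dsec M (tgt I \<phi>) W\<^esub>, \<zero>\<^bsub>dsec N (tgt I \<phi>) W\<^esub>) \<in> GP \<phi> W"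
  unfolding GP_def by (rule graph_pairs.zero)

lemma GP_diff: "(m, n) \<in> GP \<phi> W \<Longrightarrow> (m', n') \<in> GP \<phi> W \<Longrightarrow>
    (m \<ominus>\<^bsub>dsec M (tgt I \<phi>) W\<^esub> m', n \<ominus>\<^bsub>dsec N (tgt I \<phi>) W\<^esub> n') \<in> GP \<phi> W"
  unfolding GP_def by (rule graph_pairs.diff)

lemma GP_carrier:
  assumes \<phi>: "\<phi> \<in> out I i" and W: "M.op (tgt I \<phi>) W" and mn: "(m, n) \<in> GP \<phi> W"
  shows "m \<in> carrier (dsec M (tgt I \<phi>) W) \<and> n \<in> carrier (dsec N (tgt I \<phi>) W)"
  using mn W
proof (induction rule: GP_induct)
  case (gen V s a)
  then show ?case
    using M.sec_smult_closed[OF M.out_tgt[OF \<phi>] W] N.sec_smult_closed[OF M.out_tgt[OF \<phi>] W]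
      M.sr_closed[OF \<phi>] N.sr_closed[OF \<phi>] e_closed by simp
next
  case zero
  then show ?case
    using M.sec_zero_closed[OF M.out_tgt[OF \<phi>] W] N.sec_zero_closed[OF M.out_tgt[OF \<phi>] W] by simp
next
  case (diff m n m' n')
  interpret A: abelian_group "dsec M (tgt I \<phi>) W" by (rule M.sec_group[OF M.out_tgt[OF \<phi>] W])
  interpret B: abelian_group "dsec N (tgt I \<phi>) W" by (rule N.sec_group[OF M.out_tgt[OF \<phi>] W])
  show ?case using diff by simp
qed

lemma GP_add:
  assumes \<phi>: "\<phi> \<in> out I i" and W: "M.op (tgt I \<phi>) W" and mn: "(m, n) \<in> GP \<phi> W" and mn': "(m', n') \<in> GP \<phi> W"
  shows "(m \<oplus>\<^bsub>dsec M (tgt I \<phi>) W\<^esub> m', n \<oplus>\<^bsub>dsec N (tgt I \<phi>) W\<^esub> n') \<in> GP \<phi> W"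
proof -
  interpret A: abelian_group "dsec M (tgt I \<phi>) W" by (rule M.sec_group[OF M.out_tgt[OF \<phi>] W])
  interpret B: abelian_group "dsec N (tgt I \<phi>) W" by (rule N.sec_group[OF M.out_tgt[OF \<phi>] W])
  \<comment> \<open>\<open>graph_pairs\<close> is closed under differences by definition, so the sum
    is formed as \<open>m - (0 - m')\<close>.\<close>
  show ?thesis
    using GP_diff[OF mn GP_diff[OF GP_zero_mem mn']] GP_carrier[OF \<phi> W mn] GP_carrier[OF \<phi> W mn']
    by (simp add: A.minus_eq B.minus_eq)
qed

text \<open>A generator goes to a generator by functoriality of restriction, with its scalar
  restricted along \<open>\<psi>\<close>. This takes the place of the isomorphism between the
  pullback along a composite and the iterated pullback.\<close>

lemma GP_site:
  assumes \<phi>: "\<phi> \<in> out I i" and W: "M.op (tgt I \<phi>) W" and mn: "(m, n) \<in> GP \<phi> W"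
    and \<psi>: "\<psi> \<in> out I (tgt I \<phi>)" and W': "W' \<in> below I X \<psi> W"
  shows "(M.sr \<psi> W W' m, N.sr \<psi> W W' n) \<in> GP (cmp I \<psi> \<phi>) W'"
  using mn W
proof (induction rule: GP_induct)
  case (gen V s a)
  have b: "W' \<in> below I X (cmp I \<psi> \<phi>) V" by (rule M.below_cmp[OF \<phi> \<psi> gen(3) W'])
  show ?case
    using GP_gen[OF gen(1,2) b gen(4)] M.rsr_closed[OF \<psi> W W' gen(5)]
    by (simp add: M.sr_smult[OF \<psi> W W' gen(5) M.sr_closed[OF \<phi> gen(1,3,4)]] M.sr_cmp[OF \<phi> \<psi> gen(1,3) W' gen(4)]
      N.sr_smult[OF \<psi> W W' gen(5) N.sr_closed[OF \<phi> gen(1,3) e_closed[OF gen(1,2,4)]]]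
      N.sr_cmp[OF \<phi> \<psi> gen(1,3) W' e_closed[OF gen(1,2,4)]] M.tgt_cmp[OF \<phi> \<psi>])
next
  case zero
  then show ?case
    using GP_zero_mem[of "cmp I \<psi> \<phi>" W'] by (simp add: M.sr_linear_zero[OF \<psi> W W'] N.sr_linear_zero[OF \<psi> W W'] M.tgt_cmp[OF \<phi> \<psi>])
next
  case (diff m n m' n')
  show ?case
    using GP_diff[OF diff(3,4)] GP_carrier[OF \<phi> W diff(1)] GP_carrier[OF \<phi> W diff(2)]
    by (simp add: M.sr_minus[OF \<psi> W W'] N.sr_minus[OF \<psi> W W'] M.tgt_cmp[OF \<phi> \<psi>])
qed

lemma GP_res:
  assumes \<phi>: "\<phi> \<in> out I i" and W: "M.op (tgt I \<phi>) W" and mn: "(m, n) \<in> GP \<phi> W" and W': "M.op (tgt I \<phi>) W'" "W' \<subseteq> W"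
  shows "(sres (fib M (tgt I \<phi>)) W W' m, sres (fib N (tgt I \<phi>)) W W' n) \<in> GP \<phi> W'"
proof -
  note j = M.out_tgt[OF \<phi>]
  have "W' \<in> below I X (idt I (tgt I \<phi>)) W" using W' by (simp add: M.below_idt[OF j W])
  from GP_site[OF \<phi> W mn M.idt_out[OF j] this] show ?thesis
    using GP_carrier[OF \<phi> W mn] by (simp add: M.idt_cmp[OF \<phi>] M.sr_idt[OF j W] N.sr_idt[OF j W])
qed

lemma GP_smult:
  assumes \<phi>: "\<phi> \<in> out I i" and W: "M.op (tgt I \<phi>) W" and mn: "(m, n) \<in> GP \<phi> W" and r: "r \<in> carrier (ring_at (sp X (tgt I \<phi>)) W)"
  shows "(r \<odot>\<^bsub>dsec M (tgt I \<phi>) W\<^esub> m, r \<odot>\<^bsub>dsec N (tgt I \<phi>) W\<^esub> n) \<in> GP \<phi> W"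
proof -
  interpret A: module "ring_at (sp X (tgt I \<phi>)) W" "dsec M (tgt I \<phi>) W" by (rule M.sec_module[OF M.out_tgt[OF \<phi>] W])
  interpret B: module "ring_at (sp X (tgt I \<phi>)) W" "dsec N (tgt I \<phi>) W" by (rule N.sec_module[OF M.out_tgt[OF \<phi>] W])
  show ?thesis
    using mn W
  proof (induction rule: GP_induct)
    case (gen V s a)
    show ?case
      using GP_gen[OF gen(1-4), of "r \<otimes>\<^bsub>ring_at (sp X (tgt I \<phi>)) W\<^esub> a"] r gen(5)
      by (simp add: A.smult_assoc1 B.smult_assoc1 M.sr_closed[OF \<phi> gen(1,3,4)] N.sr_closed[OF \<phi> gen(1,3) e_closed[OF gen(1,2,4)]])
  next
    case zero
    then show ?case using GP_zero_mem r by simp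
  next
    case (diff m n m' n')
    have "r \<odot>\<^bsub>dsec M (tgt I \<phi>) W\<^esub> (m \<ominus>\<^bsub>dsec M (tgt I \<phi>) W\<^esub> m') = r \<odot>\<^bsub>dsec M (tgt I \<phi>) W\<^esub> m \<ominus>\<^bsub>dsec M (tgt I \<phi>) W\<^esub> r \<odot>\<^bsub>dsec M (tgt I \<phi>) W\<^esub> m'"
      "r \<odot>\<^bsub>dsec N (tgt I \<phi>) W\<^esub> (n \<ominus>\<^bsub>dsec N (tgt I \<phi>) W\<^esub> n') = r \<odot>\<^bsub>dsec N (tgt I \<phi>) W\<^esub> n \<ominus>\<^bsub>dsec N (tgt I \<phi>) W\<^esub> r \<odot>\<^bsub>dsec N (tgt I \<phi>) W\<^esub> n'"
      using GP_carrier[OF \<phi> W diff(1)] GP_carrier[OF \<phi> W diff(2)] r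
      by (simp_all add: A.minus_eq B.minus_eq A.smult_r_distr B.smult_r_distr A.smult_r_minus B.smult_r_minus)
    then show ?case
      using GP_diff[OF diff(3,4)] by simp
  qed
qed

text \<open>Subtracting the two pairs gives a pair with first entry zero, to which
  \<open>GP_zero\<close> applies.\<close>

lemma GP_uniq:
  assumes \<phi>: "\<phi> \<in> out I i" and W: "W \<in> below I X \<phi> W0" and mn: "(m, n) \<in> GP \<phi> W" and mn': "(m, n') \<in> GP \<phi> W"
  shows "n = n'"
proof -
  note oW = M.below_op[OF W]
  interpret A: abelian_group "dsec M (tgt I \<phi>) W" by (rule M.sec_group[OF M.out_tgt[OF \<phi>] oW])
  interpret B: abelian_group "dsec N (tgt I \<phi>) W" by (rule N.sec_group[OF M.out_tgt[OF \<phi>] oW])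
  have c: "m \<in> carrier (dsec M (tgt I \<phi>) W)" "n \<in> carrier (dsec N (tgt I \<phi>) W)" "n' \<in> carrier (dsec N (tgt I \<phi>) W)"
    using GP_carrier[OF \<phi> oW mn] GP_carrier[OF \<phi> oW mn'] by simp_all
  have "(\<zero>\<^bsub>dsec M (tgt I \<phi>) W\<^esub>, n \<ominus>\<^bsub>dsec N (tgt I \<phi>) W\<^esub> n') \<in> GP \<phi> W"
    using GP_diff[OF mn mn'] c(1) by (simp add: A.minus_eq A.r_neg)
  then have "n \<ominus>\<^bsub>dsec N (tgt I \<phi>) W\<^esub> n' = \<zero>\<^bsub>dsec N (tgt I \<phi>) W\<^esub>"
    by (rule GP_zero[OF \<phi> W])
  moreover have "n = (n \<ominus>\<^bsub>dsec N (tgt I \<phi>) W\<^esub> n') \<oplus>\<^bsub>dsec N (tgt I \<phi>) W\<^esub> n'"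
    using c by (simp add: B.minus_eq B.a_assoc B.l_neg)
  ultimately show ?thesis
    using c by simp
qed

text \<open>A pair that lies in \<open>GP\<close> locally need not be known to lie in it globally,
  so membership is required only around each point. The relation obtained in this way can be
  glued.\<close>

definition Rl :: "'f \<Rightarrow> 'p set \<Rightarrow> 'm \<Rightarrow> 'n \<Rightarrow> bool" where
  "Rl \<phi> W m n \<longleftrightarrow> n \<in> carrier (dsec N (tgt I \<phi>) W) \<and>
     (\<forall>x\<in>W. \<exists>W'. M.op (tgt I \<phi>) W' \<and> x \<in> W' \<and> W' \<subseteq> W \<and>
        (sres (fib M (tgt I \<phi>)) W W' m, sres (fib N (tgt I \<phi>)) W W' n) \<in> GP \<phi> W')"

lemma Rl_common:
  assumes \<phi>: "\<phi> \<in> out I i" and W: "W \<in> below I X \<phi> W0" and m: "m \<in> carrier (dsec M (tgt I \<phi>) W)" "m' \<in> carrier (dsec M (tgt I \<phi>) W)"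
    and R: "Rl \<phi> W m n" and R': "Rl \<phi> W m' n'" and x: "x \<in> W"
  obtains Z where "M.op (tgt I \<phi>) Z" "x \<in> Z" "Z \<subseteq> W"
    "(sres (fib M (tgt I \<phi>)) W Z m, sres (fib N (tgt I \<phi>)) W Z n) \<in> GP \<phi> Z"
    "(sres (fib M (tgt I \<phi>)) W Z m', sres (fib N (tgt I \<phi>)) W Z n') \<in> GP \<phi> Z"
proof -
  note j = M.out_tgt[OF \<phi>] and oW = M.below_op[OF W]
  obtain A where A: "M.op (tgt I \<phi>) A" "x \<in> A" "A \<subseteq> W" "(sres (fib M (tgt I \<phi>)) W A m, sres (fib N (tgt I \<phi>)) W A n) \<in> GP \<phi> A"
    using R x unfolding Rl_def by blast
  obtain B where B: "M.op (tgt I \<phi>) B" "x \<in> B" "B \<subseteq> W" "(sres (fib M (tgt I \<phi>)) W B m', sres (fib N (tgt I \<phi>)) W B n') \<in> GP \<phi> B"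
    using R' x unfolding Rl_def by blast
  have n: "n \<in> carrier (dsec N (tgt I \<phi>) W)" "n' \<in> carrier (dsec N (tgt I \<phi>) W)"
    using R R' by (simp_all add: Rl_def)
  have oZ: "M.op (tgt I \<phi>) (A \<inter> B)" by (rule openin_Int[OF A(1) B(1)])
  show thesis
  proof (rule that[OF oZ])
    show "(sres (fib M (tgt I \<phi>)) W (A \<inter> B) m, sres (fib N (tgt I \<phi>)) W (A \<inter> B) n) \<in> GP \<phi> (A \<inter> B)"
      using GP_res[OF \<phi> A(1,4) oZ Int_lower1]
      by (simp only: sres_comp[OF M.fib_smod[OF j] oW A(1) oZ Int_lower1 A(3) m(1)] sres_comp[OF N.fib_smod[OF j] oW A(1) oZ Int_lower1 A(3) n(1)])
    show "(sres (fib M (tgt I \<phi>)) W (A \<inter> B) m', sres (fib N (tgt I \<phi>)) W (A \<inter> B) n') \<in> GP \<phi> (A \<inter> B)"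
      using GP_res[OF \<phi> B(1,4) oZ Int_lower2]
      by (simp only: sres_comp[OF M.fib_smod[OF j] oW B(1) oZ Int_lower2 B(3) m(2)] sres_comp[OF N.fib_smod[OF j] oW B(1) oZ Int_lower2 B(3) n(2)])
  qed (use A B in auto)
qed

lemma Rl_uniq:
  assumes \<phi>: "\<phi> \<in> out I i" and W: "W \<in> below I X \<phi> W0" and m: "m \<in> carrier (dsec M (tgt I \<phi>) W)"
    and R: "Rl \<phi> W m n" and R': "Rl \<phi> W m n'"
  shows "n = n'"
proof (rule smod_separated[OF N.fib_smod[OF M.out_tgt[OF \<phi>]] M.below_op[OF W]])
  show "n \<in> carrier (dsec N (tgt I \<phi>) W)" "n' \<in> carrier (dsec N (tgt I \<phi>) W)"
    using R R' by (simp_all add: Rl_def)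
  fix x assume x: "x \<in> W"
  obtain Z where Z: "M.op (tgt I \<phi>) Z" "x \<in> Z" "Z \<subseteq> W"
    "(sres (fib M (tgt I \<phi>)) W Z m, sres (fib N (tgt I \<phi>)) W Z n) \<in> GP \<phi> Z"
    "(sres (fib M (tgt I \<phi>)) W Z m, sres (fib N (tgt I \<phi>)) W Z n') \<in> GP \<phi> Z"
    by (rule Rl_common[OF \<phi> W m m R R' x])
  have "sres (fib N (tgt I \<phi>)) W Z n = sres (fib N (tgt I \<phi>)) W Z n'"
    by (rule GP_uniq[OF \<phi> M.below_sub_trans[OF W Z(1,3)] Z(4,5)])
  then show "\<exists>Z. M.op (tgt I \<phi>) Z \<and> x \<in> Z \<and> Z \<subseteq> W \<and> sres (fib N (tgt I \<phi>)) W Z n = sres (fib N (tgt I \<phi>)) W Z n'"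
    using Z by blast
qed

text \<open>Related sections exist locally by \<open>GP_local_ex\<close>. By \<open>GP_uniq\<close>
  they agree on overlaps, so they glue.\<close>

lemma Rl_ex:
  assumes \<phi>: "\<phi> \<in> out I i" and W: "W \<in> below I X \<phi> W0" and m: "m \<in> carrier (dsec M (tgt I \<phi>) W)"
  shows "\<exists>n. Rl \<phi> W m n"
proof -
  note j = M.out_tgt[OF \<phi>] and oW = M.below_op[OF W]
  obtain t where "t \<in> carrier (dsec N (tgt I \<phi>) W)" "\<And>x. x \<in> W \<Longrightarrow> \<exists>Z. M.op (tgt I \<phi>) Z \<and> x \<in> Z \<and> Z \<subseteq> W \<and>
      (sres (fib M (tgt I \<phi>)) W Z m, sres (fib N (tgt I \<phi>)) W Z t) \<in> GP \<phi> Z"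
  proof (rule smod_glue_rel[OF N.fib_smod[OF j] oW, of "\<lambda>Z n. (sres (fib M (tgt I \<phi>)) W Z m, n) \<in> GP \<phi> Z"])
    fix x assume "x \<in> W"
    then obtain Z n where Z: "M.op (tgt I \<phi>) Z" "x \<in> Z" "Z \<subseteq> W" "(sres (fib M (tgt I \<phi>)) W Z m, n) \<in> GP \<phi> Z"
      by (rule GP_local_ex[OF \<phi> W m])
    then show "\<exists>Z n. M.op (tgt I \<phi>) Z \<and> x \<in> Z \<and> Z \<subseteq> W \<and> n \<in> carrier (dsec N (tgt I \<phi>) Z) \<and> (sres (fib M (tgt I \<phi>)) W Z m, n) \<in> GP \<phi> Z"
      using GP_carrier[OF \<phi> Z(1,4)] by blast
  next
    fix Z Z' n assume a: "M.op (tgt I \<phi>) Z" "Z \<subseteq> W" "(sres (fib M (tgt I \<phi>)) W Z m, n) \<in> GP \<phi> Z" "M.op (tgt I \<phi>) Z'" "Z' \<subseteq> Z"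
    show "(sres (fib M (tgt I \<phi>)) W Z' m, sres (fib N (tgt I \<phi>)) Z Z' n) \<in> GP \<phi> Z'"
      using GP_res[OF \<phi> a(1,3,4,5)] by (simp only: sres_comp[OF M.fib_smod[OF j] oW a(1,4,5,2) m])
  next
    fix Z n n' assume a: "M.op (tgt I \<phi>) Z" "Z \<subseteq> W" "(sres (fib M (tgt I \<phi>)) W Z m, n) \<in> GP \<phi> Z" "(sres (fib M (tgt I \<phi>)) W Z m, n') \<in> GP \<phi> Z"
    show "n = n'" by (rule GP_uniq[OF \<phi> M.below_sub_trans[OF W a(1,2)] a(3,4)])
  qed (rule that)
  then show ?thesis unfolding Rl_def by blast
qed

definition ext :: "'f \<Rightarrow> 'p set \<Rightarrow> 'm \<Rightarrow> 'n" where "ext \<phi> W m = (THE n. Rl \<phi> W m n)"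

lemma ext_Rl:
  assumes "\<phi> \<in> out I i" "W \<in> below I X \<phi> W0" "m \<in> carrier (dsec M (tgt I \<phi>) W)"
  shows "Rl \<phi> W m (ext \<phi> W m)"
  unfolding ext_def using Rl_ex[OF assms] Rl_uniq[OF assms] by (rule_tac theI') blast

lemma ext_eqI:
  "\<phi> \<in> out I i \<Longrightarrow> W \<in> below I X \<phi> W0 \<Longrightarrow> m \<in> carrier (dsec M (tgt I \<phi>) W) \<Longrightarrow> Rl \<phi> W m n \<Longrightarrow> ext \<phi> W m = n"
  by (rule Rl_uniq[OF _ _ _ ext_Rl])

lemma ext_closed:
  "\<phi> \<in> out I i \<Longrightarrow> W \<in> below I X \<phi> W0 \<Longrightarrow> m \<in> carrier (dsec M (tgt I \<phi>) W) \<Longrightarrow> ext \<phi> W m \<in> carrier (dsec N (tgt I \<phi>) W)"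
  using ext_Rl by (simp add: Rl_def)

lemma ext_linear:
  assumes \<phi>: "\<phi> \<in> out I i" and W: "W \<in> below I X \<phi> W0"
  shows "linear_map (ring_at (sp X (tgt I \<phi>)) W) (dsec M (tgt I \<phi>) W) (dsec N (tgt I \<phi>) W) (ext \<phi> W)"
proof -
  note j = M.out_tgt[OF \<phi>] and oW = M.below_op[OF W]
  note fM = M.fib_smod[OF j] and fN = N.fib_smod[OF j]
  show ?thesis
  proof (rule linear_mapI)
    fix s t assume s: "s \<in> carrier (dsec M (tgt I \<phi>) W)" and t: "t \<in> carrier (dsec M (tgt I \<phi>) W)"
    note es = ext_closed[OF \<phi> W s] and et = ext_closed[OF \<phi> W t]
    show "ext \<phi> W (s \<oplus>\<^bsub>dsec M (tgt I \<phi>) W\<^esub> t) = ext \<phi> W s \<oplus>\<^bsub>dsec N (tgt I \<phi>) W\<^esub> ext \<phi> W t"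
    proof (rule ext_eqI[OF \<phi> W M.sec_add_closed[OF j oW s t]], unfold Rl_def, intro conjI ballI)
      show "ext \<phi> W s \<oplus>\<^bsub>dsec N (tgt I \<phi>) W\<^esub> ext \<phi> W t \<in> carrier (dsec N (tgt I \<phi>) W)"
        by (rule N.sec_add_closed[OF j oW es et])
      fix x assume x: "x \<in> W"
      obtain Z where Z: "M.op (tgt I \<phi>) Z" "x \<in> Z" "Z \<subseteq> W"
        "(sres (fib M (tgt I \<phi>)) W Z s, sres (fib N (tgt I \<phi>)) W Z (ext \<phi> W s)) \<in> GP \<phi> Z"
        "(sres (fib M (tgt I \<phi>)) W Z t, sres (fib N (tgt I \<phi>)) W Z (ext \<phi> W t)) \<in> GP \<phi> Z"
        by (rule Rl_common[OF \<phi> W s t ext_Rl[OF \<phi> W s] ext_Rl[OF \<phi> W t] x])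
      show "\<exists>Z. M.op (tgt I \<phi>) Z \<and> x \<in> Z \<and> Z \<subseteq> W \<and> (sres (fib M (tgt I \<phi>)) W Z (s \<oplus>\<^bsub>dsec M (tgt I \<phi>) W\<^esub> t),
          sres (fib N (tgt I \<phi>)) W Z (ext \<phi> W s \<oplus>\<^bsub>dsec N (tgt I \<phi>) W\<^esub> ext \<phi> W t)) \<in> GP \<phi> Z"
        using GP_add[OF \<phi> Z(1,4,5)] Z(1-3)
        by (intro exI[of _ Z]) (simp add: sres_add[OF fM oW Z(1,3) s t] sres_add[OF fN oW Z(1,3) es et])
    qed
  next
    fix r s assume r: "r \<in> carrier (ring_at (sp X (tgt I \<phi>)) W)" and s: "s \<in> carrier (dsec M (tgt I \<phi>) W)"
    note es = ext_closed[OF \<phi> W s]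
    show "ext \<phi> W (r \<odot>\<^bsub>dsec M (tgt I \<phi>) W\<^esub> s) = r \<odot>\<^bsub>dsec N (tgt I \<phi>) W\<^esub> ext \<phi> W s"
    proof (rule ext_eqI[OF \<phi> W M.sec_smult_closed[OF j oW r s]], unfold Rl_def, intro conjI ballI)
      show "r \<odot>\<^bsub>dsec N (tgt I \<phi>) W\<^esub> ext \<phi> W s \<in> carrier (dsec N (tgt I \<phi>) W)"
        by (rule N.sec_smult_closed[OF j oW r es])
      fix x assume x: "x \<in> W"
      obtain Z where Z: "M.op (tgt I \<phi>) Z" "x \<in> Z" "Z \<subseteq> W"
        "(sres (fib M (tgt I \<phi>)) W Z s, sres (fib N (tgt I \<phi>)) W Z (ext \<phi> W s)) \<in> GP \<phi> Z"
        by (rule Rl_common[OF \<phi> W s s ext_Rl[OF \<phi> W s] ext_Rl[OF \<phi> W s] x])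
      show "\<exists>Z. M.op (tgt I \<phi>) Z \<and> x \<in> Z \<and> Z \<subseteq> W \<and> (sres (fib M (tgt I \<phi>)) W Z (r \<odot>\<^bsub>dsec M (tgt I \<phi>) W\<^esub> s),
          sres (fib N (tgt I \<phi>)) W Z (r \<odot>\<^bsub>dsec N (tgt I \<phi>) W\<^esub> ext \<phi> W s)) \<in> GP \<phi> Z"
        using GP_smult[OF \<phi> Z(1,4) rres_closed[OF M.sp_ringed[OF j] oW Z(1,3) r]] Z(1-3)
        by (intro exI[of _ Z]) (simp add: sres_smult[OF fM oW Z(1,3) r s] sres_smult[OF fN oW Z(1,3) r es])
    qed
  qed (rule ext_closed[OF \<phi> W])
qed

lemma ext_compat:
  assumes \<phi>: "\<phi> \<in> out I i" and W: "W \<in> below I X \<phi> W0" and \<psi>: "\<psi> \<in> out I (tgt I \<phi>)" and W': "W' \<in> below I X \<psi> W"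
    and s: "s \<in> carrier (dsec M (tgt I \<phi>) W)"
  shows "ext (cmp I \<psi> \<phi>) W' (M.sr \<psi> W W' s) = N.sr \<psi> W W' (ext \<phi> W s)"
proof (rule ext_eqI[OF M.cmp_out[OF \<phi> \<psi>] M.below_cmp[OF \<phi> \<psi> W W']], unfold Rl_def M.tgt_cmp[OF \<phi> \<psi>])
  note oW = M.below_op[OF W] and oW' = M.below_op[OF W'] and es = ext_closed[OF \<phi> W s]
  show "M.sr \<psi> W W' s \<in> carrier (dsec M (tgt I \<psi>) W')" by (rule M.sr_closed[OF \<psi> oW W' s])
  show "N.sr \<psi> W W' (ext \<phi> W s) \<in> carrier (dsec N (tgt I \<psi>) W') \<and>
     (\<forall>x\<in>W'. \<exists>Z. M.op (tgt I \<psi>) Z \<and> x \<in> Z \<and> Z \<subseteq> W' \<and>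
        (sres (fib M (tgt I \<psi>)) W' Z (M.sr \<psi> W W' s), sres (fib N (tgt I \<psi>)) W' Z (N.sr \<psi> W W' (ext \<phi> W s))) \<in> GP (cmp I \<psi> \<phi>) Z)"
  proof (intro conjI ballI)
    show "N.sr \<psi> W W' (ext \<phi> W s) \<in> carrier (dsec N (tgt I \<psi>) W')" by (rule N.sr_closed[OF \<psi> oW W' es])
    fix x assume x: "x \<in> W'"
    then have "x \<in> M.pb \<psi> W" using M.below_sub[OF W'] by blast
    then have px: "x \<in> points (sp X (tgt I \<psi>))" "pt (tr X \<psi>) x \<in> W" by (simp_all add: M.pb_def pre_def)
    \<comment> \<open>The neighbourhood is found at the image of \<open>x\<close> under
      \<open>tr X \<psi>\<close>, where \<open>ext \<phi> W s\<close> is related to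
      \<open>s\<close>. Its preimage, cut down to \<open>W'\<close>, is the neighbourhood of
      \<open>x\<close> that is sought.\<close>
    obtain A where A: "M.op (tgt I \<phi>) A" "pt (tr X \<psi>) x \<in> A" "A \<subseteq> W"
      "(sres (fib M (tgt I \<phi>)) W A s, sres (fib N (tgt I \<phi>)) W A (ext \<phi> W s)) \<in> GP \<phi> A"
      by (rule Rl_common[OF \<phi> W s s ext_Rl[OF \<phi> W s] ext_Rl[OF \<phi> W s] px(2)])
    let ?Z = "W' \<inter> M.pb \<psi> A"
    have oZ: "M.op (tgt I \<psi>) ?Z" by (rule openin_Int[OF oW' M.pb_op[OF \<psi> A(1)]])
    have Z: "?Z \<in> below I X \<psi> A" using oZ by (simp add: M.below_iff)
    have "sres (fib M (tgt I \<psi>)) W' ?Z (M.sr \<psi> W W' s) = M.sr \<psi> A ?Z (sres (fib M (tgt I \<phi>)) W A s)"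
      by (simp only: M.sres_sr[OF \<psi> oW W' oZ Int_lower1 s] M.sr_sres[OF \<psi> oW A(1,3) Z s])
    moreover have "sres (fib N (tgt I \<psi>)) W' ?Z (N.sr \<psi> W W' (ext \<phi> W s)) = N.sr \<psi> A ?Z (sres (fib N (tgt I \<phi>)) W A (ext \<phi> W s))"
      by (simp only: N.sres_sr[OF \<psi> oW W' oZ Int_lower1 es] N.sr_sres[OF \<psi> oW A(1,3) Z es])
    moreover have "x \<in> ?Z" using x px A(2) by (simp add: M.pb_def pre_def)
    ultimately show "\<exists>Z. M.op (tgt I \<psi>) Z \<and> x \<in> Z \<and> Z \<subseteq> W' \<and>
        (sres (fib M (tgt I \<psi>)) W' Z (M.sr \<psi> W W' s), sres (fib N (tgt I \<psi>)) W' Z (N.sr \<psi> W W' (ext \<phi> W s))) \<in> GP (cmp I \<psi> \<phi>) Z"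
      using GP_site[OF \<phi> A(1,4) \<psi> Z] oZ by (intro exI[of _ ?Z]) simp
  qed
qed

lemma hom_ext: "M.hom_of M i W0 ext \<in> hom_sections I X M N i W0"
  by (rule M.hom_sectionsI') (rule ext_linear ext_compat; assumption)+

text \<open>Among the generators, take the scalar one and the identity arrow. This makes
  \<open>e\<close> the identity component of the extension.\<close>

lemma GP_idt:
  assumes V: "M.op i V" "V \<subseteq> W0" and s: "s \<in> carrier (dsec M i V)"
  shows "(s, e V s) \<in> GP (idt I i) V"
proof -
  interpret A: module "ring_at (sp X i) V" "dsec M i V" by (rule M.sec_module[OF i V(1)])
  interpret B: module "ring_at (sp X i) V" "dsec N i V" by (rule N.sec_module[OF i V(1)])
  note es = e_closed[OF V s]
  have "V \<in> below I X (idt I i) V" using V by (simp add: M.below_idt[OF i])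
  from GP_gen[OF V this s, of "\<one>\<^bsub>ring_at (sp X i) V\<^esub>"] show ?thesis
    by (simp add: M.tgt_idt[OF i] M.sr_idt[OF i V(1) s] N.sr_idt[OF i V(1) es] sres_id[OF M.fib_smod[OF i] V(1) s]
        sres_id[OF N.fib_smod[OF i] V(1) es] s es)
qed

lemma ext_idt:
  assumes V: "M.op i V" "V \<subseteq> W0" and s: "s \<in> carrier (dsec M i V)"
  shows "ext (idt I i) V s = e V s"
proof (rule ext_eqI[OF M.idt_out[OF i]])
  note es = e_closed[OF V s]
  show "V \<in> below I X (idt I i) W0" using V by (simp add: M.below_idt[OF i W0])
  show "s \<in> carrier (dsec M (tgt I (idt I i)) V)" using s by (simp add: M.tgt_idt[OF i])
  show "Rl (idt I i) V s (e V s)"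
    unfolding Rl_def M.tgt_idt[OF i]
    using GP_idt[OF V s] V es by (auto simp: sres_id[OF M.fib_smod[OF i] V(1) s] sres_id[OF N.fib_smod[OF i] V(1) es] intro!: exI[of _ V])
qed

end

section \<open>Uniqueness and existence of a Hom section with a given identity component\<close>

context hom_modules
begin

lemma hom_idt:
  assumes i: "i \<in> Ob I" and W: "M.op i W" and \<eta>: "\<eta> \<in> hom_sections I X M N i W"
  shows "\<And>V. M.op i V \<Longrightarrow> V \<subseteq> W \<Longrightarrow> linear_map (ring_at (sp X i) V) (dsec M i V) (dsec N i V) (\<eta> (idt I i) V)"
    and "\<And>V V' s. M.op i V \<Longrightarrow> V \<subseteq> W \<Longrightarrow> M.op i V' \<Longrightarrow> V' \<subseteq> V \<Longrightarrow> s \<in> carrier (dsec M i V) \<Longrightarrow>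
      \<eta> (idt I i) V' (sres (fib M i) V V' s) = sres (fib N i) V V' (\<eta> (idt I i) V s)"
  using M.hom_sectionsD(2)[OF \<eta> M.idt_out[OF i]] hom_sres[OF \<eta> M.idt_out[OF i]]
  by (simp_all add: M.tgt_idt[OF i] M.below_idt[OF i W])

text \<open>The graph built from the identity component of \<open>\<eta>\<close> serves both
  families: each of them maps the first entry of a pair to the second. Every section of
  \<open>M\<close> is locally such a first entry, and \<open>N\<close> is separated.\<close>

lemma equivariant_hom_eqI:
  assumes eqv: "equivariant I X M" and i: "i \<in> Ob I" and W: "M.op i W"
    and \<eta>: "\<eta> \<in> hom_sections I X M N i W" and \<theta>: "\<theta> \<in> hom_sections I X M N i W"
    and eq: "\<And>V s. M.op i V \<Longrightarrow> V \<subseteq> W \<Longrightarrow> s \<in> carrier (dsec M i V) \<Longrightarrow> \<eta> (idt I i) V s = \<theta> (idt I i) V s"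
  shows "\<eta> = \<theta>"
proof -
  interpret E: equiv_ext I X M N i W "\<eta> (idt I i)"
    by unfold_locales (use eqv i W hom_idt[OF i W \<eta>] in simp_all)
  \<comment> \<open>Induction on the pairs. On a generator, linearity and compatibility starting
    from the identity arrow reduce the claim to identity components.\<close>
  have G: "\<kappa> \<phi> W' m = n"
    if \<kappa>: "\<kappa> \<in> hom_sections I X M N i W" and e: "\<And>V s. M.op i V \<Longrightarrow> V \<subseteq> W \<Longrightarrow> s \<in> carrier (dsec M i V) \<Longrightarrow> \<kappa> (idt I i) V s = \<eta> (idt I i) V s"
      and \<phi>: "\<phi> \<in> out I i" and W': "W' \<in> below I X \<phi> W" and mn: "(m, n) \<in> E.GP \<phi> W'" for \<kappa> \<phi> W' m n
    using mn M.below_op[OF W']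
  proof (induction rule: E.GP_induct)
    case (gen V s a)
    have Vb: "V \<in> below I X (idt I i) W" using gen by (simp add: M.below_idt[OF i W])
    have s: "s \<in> carrier (dsec M (tgt I (idt I i)) V)" using gen by (simp add: M.tgt_idt[OF i])
    have "\<kappa> \<phi> W' (M.sr \<phi> V W' s) = N.sr \<phi> V W' (\<kappa> (idt I i) V s)"
      using M.hom_sectionsD(3)[OF \<kappa> M.idt_out[OF i] Vb, of \<phi> W' s] \<phi> gen(3) s by (simp add: M.tgt_idt[OF i] M.cmp_idt[OF \<phi>])
    then show ?case
      using linear_map_smult[OF M.hom_sectionsD(2)[OF \<kappa> \<phi> W'] gen(5) M.sr_closed[OF \<phi> gen(1,3,4)]] e[OF gen(1,2,4)] by simp
  next
    case zero
    show ?case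
      by (rule linear_map_zero[OF M.hom_sectionsD(2)[OF \<kappa> \<phi> W'] M.sec_group N.sec_group]) (simp_all add: M.out_tgt[OF \<phi>] M.below_op[OF W'])
  next
    case (diff m n m' n')
    show ?case
      using linear_map_minus[OF M.hom_sectionsD(2)[OF \<kappa> \<phi> W'] M.sec_group[OF M.out_tgt[OF \<phi>] M.below_op[OF W']] N.sec_group[OF M.out_tgt[OF \<phi>] M.below_op[OF W']],
          of m m'] E.GP_carrier[OF \<phi> M.below_op[OF W'] diff(1)] E.GP_carrier[OF \<phi> M.below_op[OF W'] diff(2)] diff(3,4) by simp
  qed
  show ?thesis
  proof (rule M.hom_sections_eqI[OF \<eta> \<theta>])
    fix \<phi> W' s assume a: "\<phi> \<in> out I i" "W' \<in> below I X \<phi> W" "s \<in> carrier (dsec M (tgt I \<phi>) W')"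
    show "\<eta> \<phi> W' s = \<theta> \<phi> W' s"
    proof (rule smod_separated[OF N.fib_smod[OF M.out_tgt[OF a(1)]] M.below_op[OF a(2)] M.hom_closed[OF \<eta> a] M.hom_closed[OF \<theta> a]])
      fix x assume "x \<in> W'"
      then obtain Z n where Z: "M.op (tgt I \<phi>) Z" "x \<in> Z" "Z \<subseteq> W'" "(sres (fib M (tgt I \<phi>)) W' Z s, n) \<in> E.GP \<phi> Z"
        by (rule E.GP_local_ex[OF a])
      note Zb = M.below_sub_trans[OF a(2) Z(1,3)]
      have "sres (fib N (tgt I \<phi>)) W' Z (\<eta> \<phi> W' s) = sres (fib N (tgt I \<phi>)) W' Z (\<theta> \<phi> W' s)"
        unfolding hom_sres[OF \<eta> a(1,2) Z(1,3) a(3), symmetric] hom_sres[OF \<theta> a(1,2) Z(1,3) a(3), symmetric]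
        using G[OF \<eta> _ a(1) Zb Z(4)] G[OF \<theta> _ a(1) Zb Z(4)] eq by simp
      then show "\<exists>Z. M.op (tgt I \<phi>) Z \<and> x \<in> Z \<and> Z \<subseteq> W' \<and> sres (fib N (tgt I \<phi>)) W' Z (\<eta> \<phi> W' s) = sres (fib N (tgt I \<phi>)) W' Z (\<theta> \<phi> W' s)"
        using Z by blast
    qed
  qed
qed

lemma equivariant_hom_ex:
  assumes "equivariant I X M" "i \<in> Ob I" "M.op i W"
    and "\<And>V. M.op i V \<Longrightarrow> V \<subseteq> W \<Longrightarrow> linear_map (ring_at (sp X i) V) (dsec M i V) (dsec N i V) (e V)"
    and "\<And>V V' s. M.op i V \<Longrightarrow> V \<subseteq> W \<Longrightarrow> M.op i V' \<Longrightarrow> V' \<subseteq> V \<Longrightarrow> s \<in> carrier (dsec M i V) \<Longrightarrow>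
      e V' (sres (fib M i) V V' s) = sres (fib N i) V V' (e V s)"
  obtains \<eta> where "\<eta> \<in> hom_sections I X M N i W" "\<And>V s. M.op i V \<Longrightarrow> V \<subseteq> W \<Longrightarrow> s \<in> carrier (dsec M i V) \<Longrightarrow> \<eta> (idt I i) V s = e V s"
proof -
  interpret E: equiv_ext I X M N i W e
    by unfold_locales (use assms in simp_all)
  show thesis
  proof (rule that[OF E.hom_ext])
    fix V s assume V: "M.op i V" "V \<subseteq> W" and s: "s \<in> carrier (dsec M i V)"
    have "V \<in> below I X (idt I i) W" using V by (simp add: M.below_idt[OF assms(2,3)])
    then have "M.hom_of M i W E.ext (idt I i) V s = E.ext (idt I i) V s"
      using s by (intro M.hom_of_app M.idt_out assms(2)) (simp_all add: M.tgt_idt[OF assms(2)])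
    then show "M.hom_of M i W E.ext (idt I i) V s = e V s"
      using E.ext_idt[OF V s] by simp
  qed
qed

end

section \<open>The isomorphism\<close>

context open_sub
begin

text \<open>The converse of \<open>P_pb\<close>: every arrow gives a cartesian square over the open
  immersion of \<open>sp U i\<close> into \<open>sp X i\<close>, and
  \<open>cartesian_square_open\<close> reads off the points.\<close>

lemma cartesian_pb:
  assumes cart: "cartesian_mor I U X (incl U X)" and \<phi>: "\<phi> \<in> out I i"
  shows "pb \<phi> (P i) \<subseteq> P (tgt I \<phi>)"
proof
  fix x assume "x \<in> pb \<phi> (P i)"
  then have x: "x \<in> points (sp X (tgt I \<phi>))" "pt (tr X \<phi>) x \<in> P i"
    by (simp_all add: pb_def pre_def)
  note i = out_Ob[OF \<phi>] and j = out_tgt[OF \<phi>]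
  have f: "lrs_mor (sp U i) (sp X i) (incl U X i)"
    using sub i unfolding open_subdiagram_def diagram_mor_def by blast
  have sq: "cartesian_square (sp U (tgt I \<phi>)) (sp U i) (sp X (tgt I \<phi>)) (sp X i) (tr U \<phi>) (incl U X (tgt I \<phi>)) (incl U X i) (tr X \<phi>)"
    using cart \<phi> unfolding cartesian_mor_def out_iff by blast
  show "x \<in> P (tgt I \<phi>)"
    by (rule cartesian_square_open[OF sub.sp_scheme[OF i] sp_scheme[OF j] sp_scheme[OF i] sub.sp_ringed[OF j] P_op[OF i]
          sp_sub[OF i] f[unfolded incl_def] tr_lrs[OF \<phi>] _ sq[unfolded incl_def[of U X i]] x])
      (simp add: incl_def)
qed

end

context hom_gamma
begin

lemma S_sections: "i \<in> Ob I \<Longrightarrow> op i W \<Longrightarrow> \<eta> \<in> carrier (dsec S i W) \<Longrightarrow> \<eta> \<in> hom_sections I X M N i (P i \<inter> W)"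
  by (simp add: S_iff)

lemma Hx_below_P:
  assumes "\<phi> \<in> out I i" "W' \<in> below I X \<phi> W" "W' \<subseteq> P (tgt I \<phi>)" "s \<in> carrier (dsec M (tgt I \<phi>) W')"
  shows "Hx i W \<eta> \<phi> W' s = \<eta> \<phi> W' s"
proof -
  have "P (tgt I \<phi>) \<inter> W' = W'" using assms(3) by blast
  then show ?thesis
    using assms by (simp add: Hx_app sres_id[OF M.fib_smod[OF out_tgt] below_op])
qed

text \<open>Inside \<open>P i\<close> passing to the trace cuts nothing off, and inside
  \<open>Q i\<close> the vanishing condition concerns the whole section.\<close>

lemma GN_small:
  assumes i: "i \<in> Ob I" and W: "op i W" "W \<subseteq> P i" and n: "n \<in> carrier (dsec (\<Gamma> N) i W)"
  shows "n \<in> carrier (dsec N i W)" and "W \<subseteq> Q i \<Longrightarrow> n = \<zero>\<^bsub>dsec N i W\<^esub>"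
proof -
  have PW: "P i \<inter> W = W" using W by blast
  show c: "n \<in> carrier (dsec N i W)"
    using n by (simp add: GN_carrier[OF i W(1)] PW)
  assume "W \<subseteq> Q i"
  then have "Q i \<inter> W = W" by blast
  then show "n = \<zero>\<^bsub>dsec N i W\<^esub>"
    using n by (simp add: GN_carrier[OF i W(1)] PW sres_id[OF N.fib_smod[OF i] W(1) c])
qed

lemma GN_linear_small:
  assumes i: "i \<in> Ob I" and W: "op i W" "W \<subseteq> P i" and h: "linear_map (ring_at (sp X i) W) A (dsec (\<Gamma> N) i W) h"
  shows "linear_map (ring_at (sp X i) W) A (dsec N i W) h"
proof -
  have PW: "P i \<inter> W = W" using W by blast
  show ?thesis
    by (rule linear_mapI)
      (use linear_map_closed[OF h] linear_map_add[OF h] linear_map_smult[OF h] in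
        \<open>simp_all add: GN_small(1)[OF i W] Gamma_simps PW rres_id[OF sp_ringed[OF i] W(1)]\<close>)
qed

text \<open>A value of \<open>\<theta>\<close> over \<open>W'\<close> is already a section of
  \<open>N\<close> over the trace of \<open>W'\<close> on \<open>P\<close>, so for
  \<open>\<Gamma> N\<close> the restriction from \<open>W'\<close> to that trace does
  nothing.\<close>

lemma theta_P:
  assumes \<theta>: "\<theta> \<in> hom_sections I X M (\<Gamma> N) i W" and \<phi>: "\<phi> \<in> out I i" and W': "W' \<in> below I X \<phi> W"
    and s: "s \<in> carrier (dsec M (tgt I \<phi>) W')"
  shows "\<theta> \<phi> (P (tgt I \<phi>) \<inter> W') (sres (fib M (tgt I \<phi>)) W' (P (tgt I \<phi>) \<inter> W') s) = \<theta> \<phi> W' s"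
proof -
  note j = out_tgt[OF \<phi>]
  have "\<theta> \<phi> W' s \<in> carrier (dsec N (tgt I \<phi>) (P (tgt I \<phi>) \<inter> W'))"
    using hom_closed[OF \<theta> \<phi> W' s] by (simp add: GN_carrier[OF j below_op[OF W']])
  then show ?thesis
    unfolding HG.hom_sres[OF \<theta> \<phi> W' below_PW[OF \<phi> W'] Int_lower2 s] Gamma_simps Int_left_absorb
    by (rule sres_id[OF N.fib_smod[OF j] below_PW[OF \<phi> W']])
qed

text \<open>In the cartesian case a section of \<open>Hom(M, \<Gamma> N)\<close> is inverted by restricting it to the opens lying over \<open>U\<close>.\<close>

lemma Hx_bij_cartesian:
  assumes cP: "\<And>i \<phi>. \<phi> \<in> out I i \<Longrightarrow> pb \<phi> (P i) \<subseteq> P (tgt I \<phi>)"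
    and cQ: "\<And>i \<phi>. \<phi> \<in> out I i \<Longrightarrow> P (tgt I \<phi>) \<inter> pb \<phi> (Q i) \<subseteq> Q (tgt I \<phi>)"
    and i: "i \<in> Ob I" and W: "op i W"
  shows "bij_betw (Hx i W) (carrier (dsec S i W)) (hom_sections I X M (\<Gamma> N) i W)"
  unfolding bij_betw_def
proof
  \<comment> \<open>By \<open>cP\<close>, opens above \<open>P i \<inter> W\<close> are contained in
    \<open>P\<close> at the target, so \<open>Hx\<close> leaves the components over them
    unchanged.\<close>
  have small: "W' \<subseteq> P (tgt I \<phi>)" "W' \<in> below I X \<phi> W" if "\<phi> \<in> out I i" "W' \<in> below I X \<phi> (P i \<inter> W)" for \<phi> W'
    using that cP[OF that(1)] below_sub[OF that(2)] below_mono[OF Int_lower2 that(2)] by (auto simp: pb_Int)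
  show "inj_on (Hx i W) (carrier (dsec S i W))"
  proof (rule inj_onI)
    fix \<eta> \<theta> assume a: "\<eta> \<in> carrier (dsec S i W)" "\<theta> \<in> carrier (dsec S i W)" "Hx i W \<eta> = Hx i W \<theta>"
    show "\<eta> = \<theta>"
    proof (rule hom_sections_eqI[OF S_sections[OF i W a(1)] S_sections[OF i W a(2)]])
      fix \<phi> W' s assume b: "\<phi> \<in> out I i" "W' \<in> below I X \<phi> (P i \<inter> W)" "s \<in> carrier (dsec M (tgt I \<phi>) W')"
      have "Hx i W \<eta> \<phi> W' s = Hx i W \<theta> \<phi> W' s" by (simp only: a(3))
      then show "\<eta> \<phi> W' s = \<theta> \<phi> W' s"
        by (simp only: Hx_below_P[OF b(1) small(2,1)[OF b(1,2)] b(3)])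
    qed
  qed
  show "Hx i W ` carrier (dsec S i W) = hom_sections I X M (\<Gamma> N) i W"
  proof
    show "Hx i W ` carrier (dsec S i W) \<subseteq> hom_sections I X M (\<Gamma> N) i W"
      using Hx_mem[OF i W] by blast
    show "hom_sections I X M (\<Gamma> N) i W \<subseteq> Hx i W ` carrier (dsec S i W)"
    proof
      fix \<theta> assume \<theta>: "\<theta> \<in> hom_sections I X M (\<Gamma> N) i W"
      let ?\<eta> = "hom_of M i (P i \<inter> W) \<theta>"
      have \<eta>1: "?\<eta> \<in> hom_sections I X M N i (P i \<inter> W)"
      proof (rule M.hom_sectionsI')
        fix \<phi> W' assume a: "\<phi> \<in> out I i" "W' \<in> below I X \<phi> (P i \<inter> W)"
        note sm = small[OF a] and oW' = below_op[OF a(2)] and j = out_tgt[OF a(1)]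
        show "linear_map (ring_at (sp X (tgt I \<phi>)) W') (dsec M (tgt I \<phi>) W') (dsec N (tgt I \<phi>) W') (\<theta> \<phi> W')"
          by (rule GN_linear_small[OF j oW' sm(1) hom_sectionsD(2)[OF \<theta> a(1) sm(2)]])
        fix \<psi> W'' s assume b: "\<psi> \<in> out I (tgt I \<phi>)" "W'' \<in> below I X \<psi> W'" "s \<in> carrier (dsec M (tgt I \<phi>) W')"
        have PW: "P (tgt I \<phi>) \<inter> W' = W'" "P (tgt I \<psi>) \<inter> W'' = W''"
          using sm(1) cP[OF b(1)] pb_mono[OF sm(1), of \<psi>] below_sub[OF b(2)] by auto
        have n: "\<theta> \<phi> W' s \<in> carrier (dsec N (tgt I \<phi>) (P (tgt I \<phi>) \<inter> W'))"
          using GN_small(1)[OF j oW' sm(1) hom_closed[OF \<theta> a(1) sm(2) b(3)]] by (simp add: PW)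
        show "\<theta> (cmp I \<psi> \<phi>) W'' (M.sr \<psi> W' W'' s) = N.sr \<psi> W' W'' (\<theta> \<phi> W' s)"
          using hom_sectionsD(3)[OF \<theta> a(1) sm(2) b] sr_GN[OF b(1) oW' b(2) n] by (simp add: PW)
      qed
      \<comment> \<open>The containment \<open>cQ\<close> enters here: an open that lies in
        \<open>P\<close> and above \<open>Q i\<close> is contained in \<open>Q\<close> at the
        target, where values of \<open>\<Gamma> N\<close> vanish.\<close>
      have \<eta>2: "?\<eta> \<phi> W' s = \<zero>\<^bsub>dsec N (tgt I \<phi>) W'\<^esub>"
        if a: "\<phi> \<in> out I i" "W' \<in> below I X \<phi> (Q i \<inter> (P i \<inter> W))" "s \<in> carrier (dsec M (tgt I \<phi>) W')" for \<phi> W' s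
      proof -
        have b: "W' \<in> below I X \<phi> (P i \<inter> W)" by (rule below_mono[OF Int_lower2 a(2)])
        note sm = small[OF a(1) b]
        have "W' \<subseteq> Q (tgt I \<phi>)"
          using cQ[OF a(1)] sm(1) below_sub[OF a(2)] by (auto simp: pb_Int)
        then show ?thesis
          unfolding hom_of_app[OF a(1) b a(3)]
          by (rule GN_small(2)[OF out_tgt[OF a(1)] below_op[OF b] sm(1) hom_closed[OF \<theta> a(1) sm(2) a(3)]])
      qed
      have \<eta>: "?\<eta> \<in> carrier (dsec S i W)"
        using \<eta>1 \<eta>2 S_iff[OF i W] by blast
      have "Hx i W ?\<eta> = \<theta>"
      proof (rule hom_sections_eqI[OF Hx_mem[OF i W \<eta>] \<theta>])
        fix \<phi> W' s assume a: "\<phi> \<in> out I i" "W' \<in> below I X \<phi> W" "s \<in> carrier (dsec M (tgt I \<phi>) W')"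
        show "Hx i W ?\<eta> \<phi> W' s = \<theta> \<phi> W' s"
          unfolding Hx_app[OF a] hom_of_app[OF a(1) below_P[OF a(1,2)] M_res[OF a]] by (rule theta_P[OF \<theta> a])
      qed
      then show "\<theta> \<in> Hx i W ` carrier (dsec S i W)"
        by (rule image_eqI[OF sym \<eta>])
    qed
  qed
qed

text \<open>Families are compared through their identity components throughout. Equivariance thus
  gives injectivity, the construction of \<open>\<eta>\<close> from \<open>\<theta>\<close>, the
  vanishing of \<open>\<eta>\<close> above \<open>Q i\<close>, and the equality of
  \<open>Hx i W \<eta>\<close> with \<open>\<theta>\<close>.\<close>

lemma Hx_bij_equivariant:
  assumes eqv: "equivariant I X M" and i: "i \<in> Ob I" and W: "op i W"
  shows "bij_betw (Hx i W) (carrier (dsec S i W)) (hom_sections I X M (\<Gamma> N) i W)"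
  unfolding bij_betw_def
proof
  note id = idt_out[OF i] and td = tgt_idt[OF i]
  have Hid: "Hx i W \<eta> (idt I i) V s = \<eta> (idt I i) V s"
    if "op i V" "V \<subseteq> P i \<inter> W" "s \<in> carrier (dsec M i V)" for \<eta> V s
    by (rule Hx_below_P[OF id]) (use that in \<open>simp_all add: td below_idt[OF i W]\<close>)
  show "inj_on (Hx i W) (carrier (dsec S i W))"
  proof (rule inj_onI)
    fix \<eta> \<theta> assume a: "\<eta> \<in> carrier (dsec S i W)" "\<theta> \<in> carrier (dsec S i W)" "Hx i W \<eta> = Hx i W \<theta>"
    show "\<eta> = \<theta>"
    proof (rule equivariant_hom_eqI[OF eqv i PW[OF i W] S_sections[OF i W a(1)] S_sections[OF i W a(2)]])
      fix V s assume b: "op i V" "V \<subseteq> P i \<inter> W" "s \<in> carrier (dsec M i V)"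
      show "\<eta> (idt I i) V s = \<theta> (idt I i) V s"
        using Hid[OF b, of \<eta>] Hid[OF b, of \<theta>] a(3) by simp
    qed
  qed
  show "Hx i W ` carrier (dsec S i W) = hom_sections I X M (\<Gamma> N) i W"
  proof
    show "Hx i W ` carrier (dsec S i W) \<subseteq> hom_sections I X M (\<Gamma> N) i W"
      using Hx_mem[OF i W] by blast
    show "hom_sections I X M (\<Gamma> N) i W \<subseteq> Hx i W ` carrier (dsec S i W)"
    proof
      fix \<theta> assume \<theta>: "\<theta> \<in> hom_sections I X M (\<Gamma> N) i W"
      note \<theta>id = HG.hom_idt[OF i W \<theta>]
      let ?e = "\<theta> (idt I i)"
      \<comment> \<open>Over opens inside \<open>P i \<inter> W\<close> the identity component of
        \<open>\<theta>\<close> takes values in \<open>N\<close> itself, so it can be extended to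
        all arrows.\<close>
      obtain \<eta> where \<eta>1: "\<eta> \<in> hom_sections I X M N i (P i \<inter> W)"
        and \<eta>id: "\<And>V s. op i V \<Longrightarrow> V \<subseteq> P i \<inter> W \<Longrightarrow> s \<in> carrier (dsec M i V) \<Longrightarrow> \<eta> (idt I i) V s = ?e V s"
      proof (rule equivariant_hom_ex[OF eqv i PW[OF i W], of ?e])
        fix V assume "op i V" "V \<subseteq> P i \<inter> W"
        then show "linear_map (ring_at (sp X i) V) (dsec M i V) (dsec N i V) (?e V)"
          by (intro GN_linear_small[OF i _ _ \<theta>id(1)]) auto
      next
        fix V V' s assume a: "op i V" "V \<subseteq> P i \<inter> W" "op i V'" "V' \<subseteq> V" "s \<in> carrier (dsec M i V)"
        have "P i \<inter> V = V" "P i \<inter> V' = V'" using a by auto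
        then show "?e V' (sres (fib M i) V V' s) = sres (fib N i) V V' (?e V s)"
          using \<theta>id(2)[of V V' s] a by (simp add: Gamma_simps)
      qed (rule that)
      have \<eta>2: "\<eta> \<phi> W' s = \<zero>\<^bsub>dsec N (tgt I \<phi>) W'\<^esub>"
        if a: "\<phi> \<in> out I i" "W' \<in> below I X \<phi> (Q i \<inter> (P i \<inter> W))" "s \<in> carrier (dsec M (tgt I \<phi>) W')" for \<phi> W' s
      proof -
        \<comment> \<open>\<open>\<eta>\<close> is compared with the zero family over
          \<open>?W\<close>. The identity components agree because sections of
          \<open>\<Gamma> N\<close> vanish over opens inside \<open>Q i\<close>, and uniqueness
          carries this to the other arrows.\<close>
        let ?W = "Q i \<inter> (P i \<inter> W)" and ?z = "\<lambda>\<phi> W' s. \<zero>\<^bsub>dsec N (tgt I \<phi>) W'\<^esub>"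
        have z: "hom_of M i ?W ?z \<in> hom_sections I X M N i ?W"
        proof (rule M.hom_sectionsI')
          fix \<phi> W' assume a: "\<phi> \<in> out I i" "W' \<in> below I X \<phi> ?W"
          interpret B: module "ring_at (sp X (tgt I \<phi>)) W'" "dsec N (tgt I \<phi>) W'"
            by (rule N.sec_module[OF out_tgt[OF a(1)] below_op[OF a(2)]])
          show "linear_map (ring_at (sp X (tgt I \<phi>)) W') (dsec M (tgt I \<phi>) W') (dsec N (tgt I \<phi>) W') (\<lambda>s. \<zero>\<^bsub>dsec N (tgt I \<phi>) W'\<^esub>)"
            by (rule linear_mapI) simp_all
          fix \<psi> W'' s assume b: "\<psi> \<in> out I (tgt I \<phi>)" "W'' \<in> below I X \<psi> W'"
          show "\<zero>\<^bsub>dsec N (tgt I (cmp I \<psi> \<phi>)) W''\<^esub> = N.sr \<psi> W' W'' \<zero>\<^bsub>dsec N (tgt I \<phi>) W'\<^esub>"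
            by (simp only: N.sr_linear_zero[OF b(1) below_op[OF a(2)] b(2)] tgt_cmp[OF a(1) b(1)])
        qed
        have "hom_of M i ?W \<eta> = hom_of M i ?W ?z"
        proof (rule equivariant_hom_eqI[OF eqv i QW[OF i W] hom_restrict_mem[OF \<eta>1 Int_lower2] z])
          fix V s assume b: "op i V" "V \<subseteq> ?W" "s \<in> carrier (dsec M i V)"
          have Vb: "V \<in> below I X (idt I i) ?W" using b by (simp add: below_idt[OF i QW[OF i W]])
          have s': "s \<in> carrier (dsec M (tgt I (idt I i)) V)" using b(3) by (simp add: td)
          have t: "?e V s \<in> carrier (dsec (\<Gamma> N) i V)"
            by (rule linear_map_closed[OF \<theta>id(1) b(3)]) (use b in auto)
          have "?e V s = \<zero>\<^bsub>dsec N i V\<^esub>"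
            by (rule GN_small(2)[OF i b(1) _ t]) (use b in auto)
          then have "\<eta> (idt I i) V s = \<zero>\<^bsub>dsec N i V\<^esub>"
            using \<eta>id[OF b(1) _ b(3)] b(2) by auto
          then show "hom_of M i ?W \<eta> (idt I i) V s = hom_of M i ?W ?z (idt I i) V s"
            by (simp only: hom_of_app[OF id Vb s'] td)
        qed
        then have "hom_of M i ?W \<eta> \<phi> W' s = hom_of M i ?W ?z \<phi> W' s" by simp
        then show ?thesis by (simp only: hom_of_app[OF a])
      qed
      have \<eta>: "\<eta> \<in> carrier (dsec S i W)"
        using \<eta>1 \<eta>2 S_iff[OF i W] by blast
      \<comment> \<open>Uniqueness is applied once more, now with target \<open>\<Gamma> N\<close>;
        this relies on \<open>Gamma_Modules\<close>.\<close>
      have "Hx i W \<eta> = \<theta>"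
      proof (rule HG.equivariant_hom_eqI[OF eqv i W Hx_mem[OF i W \<eta>] \<theta>])
        fix V s assume b: "op i V" "V \<subseteq> W" "s \<in> carrier (dsec M i V)"
        have Vb: "V \<in> below I X (idt I i) W" using b by (simp add: below_idt[OF i W])
        have s': "s \<in> carrier (dsec M (tgt I (idt I i)) V)" using b(3) by (simp add: td)
        have PV: "op i (P i \<inter> V)" "P i \<inter> V \<subseteq> P i \<inter> W" using PW[OF i b(1)] b(2) by auto
        have "sres (fib M i) V (P i \<inter> V) s \<in> carrier (dsec M i (P i \<inter> V))"
          by (rule sres_closed[OF M.fib_smod[OF i] b(1) PV(1) Int_lower2 b(3)])
        then show "Hx i W \<eta> (idt I i) V s = \<theta> (idt I i) V s"
          using theta_P[OF \<theta> id Vb s'] \<eta>id[OF PV] Hx_app[OF id Vb s', of \<eta>] by (simp add: td)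
      qed
      then show "\<theta> \<in> Hx i W ` carrier (dsec S i W)"
        by (rule image_eqI[OF sym \<eta>])
    qed
  qed
qed

end

theorem lemma3p16:
  fixes I :: "('i, 'f) cat"
    and X U V :: "('i, 'f, 'p, 'r) diagram"
    and M :: "('i, 'f, 'p, 'r, 'm) dmod"
    and N :: "('i, 'f, 'p, 'r, 'n) dmod"
  assumes "category I"
    and "scheme_diagram I X"
    and "open_subdiagram I U X"
    and "open_subdiagram I V U"
    and "M \<in> Modules I X"
    and "N \<in> Modules I X"
    and "(cartesian_mor I U X (incl U X) \<and> cartesian_mor I V U (incl V U)) \<or> equivariant I X M"
  shows "Mod_iso I X (Gamma I X U V (sheaf_Hom I X M N)) (sheaf_Hom I X M (Gamma I X U V N))
           (frakH I X U V M N)"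
proof -
  have "scheme_diagram I U"
    using assms(3) by (simp add: open_subdiagram_def)
  then interpret hom_gamma I X U V M N
    by unfold_locales (use assms in simp_all)
  show ?thesis
    using assms(7)
  proof (elim disjE conjE)
    assume cU: "cartesian_mor I U X (incl U X)" and cV: "cartesian_mor I V U (incl V U)"
    \<comment> \<open>Preimages in the diagram \<open>U\<close> are preimages in \<open>X\<close>
      cut down to \<open>P\<close>, so the cartesian property of the inner inclusion yields the
      containment inside \<open>P\<close>, which is the form of \<open>cQ\<close>.\<close>
    have "P (tgt I \<phi>) \<inter> pb \<phi> (Q i) \<subseteq> Q (tgt I \<phi>)" if "\<phi> \<in> out I i" for i \<phi>
      using VU.cartesian_pb[OF cV that] by (simp add: sub.pb_def pre_tr[OF that])
    then show ?thesis
      by (intro Mod_iso_frakH Hx_bij_cartesian cartesian_pb[OF cU])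
  next
    assume "equivariant I X M"
    then show ?thesis
      by (intro Mod_iso_frakH Hx_bij_equivariant)
  qed
qed

end
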